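(* Let $n\ge1$ and $m\ge 0$ be integers. Let $B_m$ be the unique $q$-difference operator of the form $B_m=\sum_{\gamma\in\mathbb N^n,\,|\gamma|\le m}b^{(m)}_\gamma(x)T_{q,x}^\gamma$, with coefficients rational functions in $x=(x_1,\ldots,x_n)$ over $\mathbb Q(q,t)$, such that for every partition $\lambda$ with $\ell(\lambda)\le n$ and $\lambda_1\le m$ one has $B_mJ_\lambda(x;q,t)=J_{(m,\lambda)}(x;q,t)$ if $\ell(\lambda)<n$ and $B_mJ_\lambda(x;q,t)=0$ if $\ell(\lambda)=n$. Then $B_m$ can be expressed in the form $$B_m=\sum_{|\alpha|=m}\tilde b^{(m)}_\alpha(x)\,\phi^{(m)}_\alpha(x;T_{q,x}),$$ where, for each $\alpha\in\mathbb N^n$ with $|\alpha|=m$, $$\tilde b^{(m)}_\alpha(x)=(-1)^{|\alpha|}q^{\sum_i\binom{\alpha_i}{2}}x^\alpha\sum_{\beta\le\alpha}(-1)^{|\beta|}q^{\binom{|\beta|}{2}}C_{\alpha,\beta}(x;q)\prod_{i,j=1}^n\frac{(tq^{-\beta_j+1}x_i/x_j)_{\beta_j}\,(q^{-\alpha_j+1}x_i/x_j)_{\alpha_j-\beta_j}}{(q^{\alpha_i-\alpha_j+1}x_i/x_j)_{\alpha_j}}$$ and $$\phi^{(m)}_\alpha(x;T_{q,x})=\sum_{\beta\le\alpha}(-1)^{|\alpha|-|\beta|}q^{\binom{|\alpha|-|\beta|+1}{2}}C_{\alpha,\beta}(x;q)\,T_{q,x}^\beta .$$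
   Context: $q,t$ are indeterminates, $\mathbb K=\mathbb Q(q,t)$, $x=(x_1,\ldots,x_n)$, $\mathbb N=\{0,1,2,\ldots\}$. For $\gamma\in\mathbb N^n$: $|\gamma|=\gamma_1+\cdots+\gamma_n$, $x^\gamma=x_1^{\gamma_1}\cdots x_n^{\gamma_n}$, $T_{q,x}^\gamma=T_{q,x_1}^{\gamma_1}\cdots T_{q,x_n}^{\gamma_n}$, where $T_{q,x_i}f(x_1,\ldots,x_i,\ldots,x_n)=f(x_1,\ldots,qx_i,\ldots,x_n)$. For multi-indices, $\beta\le\alpha$ means $\beta_i\le\alpha_i$ for all $i$; sums over $\beta\le\alpha$ are over $\beta\in\mathbb N^n$. $(a)_k=(a;q)_k=(1-a)(1-aq)\cdots(1-aq^{k-1})$. For $\beta\le\alpha$ in $\mathbb N^n$, $$C_{\alpha,\beta}(x;q)=\prod_{1\le i,j\le n}\frac{(q^{\alpha_i-\beta_j+1}x_i/x_j)_{\beta_j}}{(q^{\beta_i-\beta_j+1}x_i/x_j)_{\beta_j}}.$$ Macdonald polynomials: let $$D_x(u;q,t)=\sum_{K\subset\{1,\ldots,n\}}(-u)^{|K|}t^{\binom{|K|}{2}}\prod_{i\in K,\,j\notin K}\frac{1-t x_i/x_j}{1-x_i/x_j}\prod_{i\in K}T_{q,x_i}.$$ For a partition $\lambda$ with length $\ell(\lambda)\le n$, $P_\lambda(x;q,t)\in\mathbb K[x]^{\mathfrak S_n}$ is the symmetric polynomial satisfying $D_x(u;q,t)P_\lambda=P_\lambda\prod_{i=1}^n(1-uq^{\lambda_i}t^{n-i})$,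 normalized so that the coefficient of $x^\lambda$ is $1$. Its integral form is $J_\lambda(x;q,t)=c_\lambda P_\lambda(x;q,t)$ with $c_\lambda=\prod_{s\in\lambda}(1-q^{a(s)}t^{l(s)+1})$, where $a(s),l(s)$ are the arm-length and leg-length of the box $s$ in the Young diagram of $\lambda$. For $\lambda_1\le m$, $(m,\lambda)=(m,\lambda_1,\lambda_2,\ldots)$. (The existence and uniqueness of the operator $B_m$ described in the claim is a result of the paper.) *)

theory Defs
  imports
    "HOL-Library.Poly_Mapping"
    "HOL-Computational_Algebra.Polynomial"
    "HOL-Computational_Algebra.Fraction_Field"
    "HOL-Combinatorics.Permutations"
begin

section \<open>The field $\mathbb K = \mathbb Q(q,t)$ and rational functions over it\<close>

text \<open>
  $\mathbb K$ is the fraction field of $\mathbb Q[q][t]$: the inner polynomial variable is $q$,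
  the outer one is $t$.
\<close>

type_synonym K = "rat poly poly fract"

definition q_K :: K where "q_K = Fraction_Field.Fract [:[:0, 1:]:] 1"

definition t_K :: K where "t_K = Fraction_Field.Fract [:0, 1:] 1"

text \<open>
  Polynomials in $x_0, x_1, x_2, \ldots$ and their fraction field. Indices start at $0$, so the
  variables $x_1,\ldots,x_n$ of the informal text are those with index $i < n$ here;
  $\mathbb K[x_1,\ldots,x_n]$ and $\mathbb K(x_1,\ldots,x_n)$ are the subsets \<open>polys n\<close> and
  \<open>ratfuns n\<close>.
\<close>

type_synonym mpol = "(nat \<Rightarrow>\<^sub>0 nat) \<Rightarrow>\<^sub>0 K"

type_synonym ratfun = "mpol fract"

definition polys :: "nat \<Rightarrow> mpol set" where
  "polys n = {p. \<forall>\<mu>\<in>Poly_Mapping.keys p. Poly_Mapping.keys \<mu> \<subseteq> {..<n}}"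

definition ratfuns :: "nat \<Rightarrow> ratfun set" where
  "ratfuns n = {Fraction_Field.Fract a b | a b. a \<in> polys n \<and> b \<in> polys n \<and> b \<noteq> 0}"

definition of_mpol :: "mpol \<Rightarrow> ratfun" where
  "of_mpol p = Fraction_Field.Fract p 1"

definition of_K :: "K \<Rightarrow> ratfun" where
  "of_K c = of_mpol (Poly_Mapping.single 0 c)"

definition xvar :: "nat \<Rightarrow> ratfun" where
  "xvar i = of_mpol (Poly_Mapping.single (Poly_Mapping.single i 1) 1)"

definition qF :: ratfun where "qF = of_K q_K"

definition tF :: ratfun where "tF = of_K t_K"


section \<open>The $q$-shift operators\<close>

text \<open>$f(x_0,\ldots,x_i,\ldots) \mapsto f(x_0,\ldots,q x_i,\ldots)$ on polynomials: the monomial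
  $x^\mu$ is multiplied by $q^{\mu_i}$.\<close>

definition qshift_pol :: "nat \<Rightarrow> mpol \<Rightarrow> mpol" where
  "qshift_pol i p = Poly_Mapping.mapp (\<lambda>\<mu> c. q_K ^ Poly_Mapping.lookup \<mu> i * c) p"

lemma q_K_nonzero: "q_K \<noteq> 0"
  by (simp add: q_K_def Zero_fract_def eq_fract)

lemma lookup_qshift_pol:
  "Poly_Mapping.lookup (qshift_pol i p) \<mu> =
     q_K ^ Poly_Mapping.lookup \<mu> i * Poly_Mapping.lookup p \<mu>"
  by (simp add: qshift_pol_def lookup_mapp in_keys_iff when_def)

lemma qshift_pol_eq_0_iff: "qshift_pol i p = 0 \<longleftrightarrow> p = 0"
  by (simp add: poly_mapping_eq_iff fun_eq_iff lookup_qshift_pol q_K_nonzero)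

lemma qshift_pol_mult: "qshift_pol i (f * g) = qshift_pol i f * qshift_pol i g"
proof (rule poly_mapping_eqI)
  fix \<mu> :: "nat \<Rightarrow>\<^sub>0 nat"
  have fin: "finite {l. Poly_Mapping.lookup f l * (\<Sum>r. Poly_Mapping.lookup g r when \<mu> = l + r) \<noteq> 0}" for \<mu>
    by (rule finite_subset[OF _ finite_keys[of f]]) (auto simp: in_keys_iff)
  have fin': "finite {r. (Poly_Mapping.lookup g r when \<mu> = l + r) \<noteq> 0}" for \<mu> l
    by (rule finite_subset[OF _ finite_keys[of g]]) (auto simp: in_keys_iff when_def)
  have inner: "q_K ^ Poly_Mapping.lookup l i * (\<Sum>r. Poly_Mapping.lookup (qshift_pol i g) r when \<mu> = l + r) =
      q_K ^ Poly_Mapping.lookup \<mu> i * (\<Sum>r. Poly_Mapping.lookup g r when \<mu> = l + r)" for l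
  proof -
    have "finite {r. (Poly_Mapping.lookup (qshift_pol i g) r when \<mu> = l + r) \<noteq> 0}"
      by (rule finite_subset[OF _ finite_keys[of g]])
        (auto simp: in_keys_iff when_def lookup_qshift_pol)
    then show ?thesis
      unfolding Sum_any_right_distrib[OF fin']
      by (auto simp: Sum_any_right_distrib when_def lookup_qshift_pol lookup_add power_add
          intro!: Sum_any.cong)
  qed
  have "Poly_Mapping.lookup (qshift_pol i f * qshift_pol i g) \<mu> =
      (\<Sum>l. Poly_Mapping.lookup f l * (q_K ^ Poly_Mapping.lookup l i *
        (\<Sum>r. Poly_Mapping.lookup (qshift_pol i g) r when \<mu> = l + r)))"
    by (simp add: times_poly_mapping.rep_eq prod_fun_def lookup_qshift_pol[of i f] mult_ac)
  also have "\<dots> = (\<Sum>l. q_K ^ Poly_Mapping.lookup \<mu> i * (Poly_Mapping.lookup f l * (\<Sum>r. Poly_Mapping.lookup g r when \<mu> = l + r)))"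
    by (simp only: inner mult.left_commute)
  also have "\<dots> = q_K ^ Poly_Mapping.lookup \<mu> i * Poly_Mapping.lookup (f * g) \<mu>"
    by (simp add: Sum_any_right_distrib[OF fin] times_poly_mapping.rep_eq prod_fun_def)
  finally show "Poly_Mapping.lookup (qshift_pol i (f * g)) \<mu> = Poly_Mapping.lookup (qshift_pol i f * qshift_pol i g) \<mu>"
    by (simp add: lookup_qshift_pol)
qed

lift_definition qshift :: "nat \<Rightarrow> ratfun \<Rightarrow> ratfun"
  is "\<lambda>i (a, b). (qshift_pol i a, qshift_pol i b)"
  by (auto simp: qshift_pol_eq_0_iff simp flip: qshift_pol_mult)

lemma qshift_pol_0: "qshift_pol i 0 = 0"
  by (simp add: qshift_pol_eq_0_iff)

lemma qshift_pol_1: "qshift_pol i 1 = 1"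
  by (rule poly_mapping_eqI) (simp add: lookup_qshift_pol lookup_one when_def)

lemma qshift_Fract:
  "qshift i (Fraction_Field.Fract a b) = Fraction_Field.Fract (qshift_pol i a) (qshift_pol i b)"
  by transfer (simp add: qshift_pol_eq_0_iff qshift_pol_0 qshift_pol_1)

text \<open>
  Elements of $\mathbb N^n$ are functions vanishing from index \<open>n\<close> on; \<open>\<beta> \<le> \<alpha>\<close> is then
  the pointwise order on functions.
\<close>

definition multi :: "nat \<Rightarrow> (nat \<Rightarrow> nat) set" where
  "multi n = {\<gamma>. \<forall>i\<ge>n. \<gamma> i = 0}"

definition msize :: "nat \<Rightarrow> (nat \<Rightarrow> nat) \<Rightarrow> nat" where
  "msize n \<gamma> = (\<Sum>i<n. \<gamma> i)"

definition qshifts :: "nat \<Rightarrow> (nat \<Rightarrow> nat) \<Rightarrow> ratfun \<Rightarrow> ratfun" where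
  "qshifts n \<gamma> = foldr (\<lambda>i g. (qshift i ^^ \<gamma> i) \<circ> g) [0..<n] id"


section \<open>Macdonald polynomials\<close>

text \<open>
  $D_x(u;q,t) f$ as a polynomial in the indeterminate $u$ over the field of rational functions;
  \<open>[:0, 1:]\<close> is $u$.
\<close>

definition D_op :: "nat \<Rightarrow> ratfun \<Rightarrow> ratfun poly" where
  "D_op n f = (\<Sum>I\<in>Pow {..<n}.
     (- [:0, 1:]) ^ card I *
     [: tF ^ (card I choose 2) *
        (\<Prod>i\<in>I. \<Prod>j\<in>{..<n} - I. (1 - tF * xvar i / xvar j) / (1 - xvar i / xvar j)) *
        qshifts n (\<lambda>i. if i \<in> I then 1 else 0) f :])"

text \<open>Partitions are weakly decreasing, eventually zero sequences, with first part \<open>\<nu> 0\<close>.\<close>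

definition is_partition :: "(nat \<Rightarrow> nat) \<Rightarrow> bool" where
  "is_partition \<nu> \<longleftrightarrow> antimono \<nu> \<and> finite {i. \<nu> i \<noteq> 0}"

definition len :: "(nat \<Rightarrow> nat) \<Rightarrow> nat" where
  "len \<nu> = card {i. \<nu> i \<noteq> 0}"

definition symmetric_pol :: "nat \<Rightarrow> mpol \<Rightarrow> bool" where
  "symmetric_pol n p \<longleftrightarrow> p \<in> polys n \<and>
     (\<forall>\<pi>. \<pi> permutes {..<n} \<longrightarrow>
       (\<forall>\<mu>. Poly_Mapping.lookup p (Poly_Mapping.map_key \<pi> \<mu>) = Poly_Mapping.lookup p \<mu>))"

text \<open>
  In the eigenvalue, $t^{n-i}$ for $1 \le i \le n$ becomes $t^{n-1-i}$ because indices start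
  at $0$.
\<close>

definition is_macdonald :: "nat \<Rightarrow> (nat \<Rightarrow> nat) \<Rightarrow> mpol \<Rightarrow> bool" where
  "is_macdonald n \<nu> p \<longleftrightarrow> symmetric_pol n p \<and>
     D_op n (of_mpol p) =
       [:of_mpol p:] * (\<Prod>i<n. 1 - [:0, 1:] * [:qF ^ \<nu> i * tF ^ (n - 1 - i):]) \<and>
     Poly_Mapping.lookup p (Abs_poly_mapping \<nu>) = 1"

definition macdonald_P :: "nat \<Rightarrow> (nat \<Rightarrow> nat) \<Rightarrow> mpol" where
  "macdonald_P n \<nu> = (THE p. is_macdonald n \<nu> p)"

text \<open>Boxes are pairs (row, column), both counted from \<open>0\<close>.\<close>

definition boxes :: "(nat \<Rightarrow> nat) \<Rightarrow> (nat \<times> nat) set" where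
  "boxes \<nu> = {(i, j). j < \<nu> i}"

definition arm :: "(nat \<Rightarrow> nat) \<Rightarrow> nat \<times> nat \<Rightarrow> nat" where
  "arm \<nu> = (\<lambda>(i, j). card {j'. j < j' \<and> (i, j') \<in> boxes \<nu>})"

definition leg :: "(nat \<Rightarrow> nat) \<Rightarrow> nat \<times> nat \<Rightarrow> nat" where
  "leg \<nu> = (\<lambda>(i, j). card {i'. i < i' \<and> (i', j) \<in> boxes \<nu>})"

definition c_norm :: "(nat \<Rightarrow> nat) \<Rightarrow> ratfun" where
  "c_norm \<nu> = (\<Prod>s\<in>boxes \<nu>. 1 - qF ^ arm \<nu> s * tF ^ (leg \<nu> s + 1))"

definition macdonald_J :: "nat \<Rightarrow> (nat \<Rightarrow> nat) \<Rightarrow> ratfun" where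
  "macdonald_J n \<nu> = c_norm \<nu> * of_mpol (macdonald_P n \<nu>)"


section \<open>The raising operator\<close>

text \<open>
  An operator is identified with the map it induces on rational functions. This loses nothing:
  the $T_{q,x}^\gamma$ with $\gamma \in \mathbb N^n$ are linearly independent over the rational
  functions, already as maps on \<open>ratfuns n\<close>, so the map determines the coefficients.
\<close>

definition qdiff_op :: "nat \<Rightarrow> nat \<Rightarrow> (ratfun \<Rightarrow> ratfun) \<Rightarrow> bool" where
  "qdiff_op n m B \<longleftrightarrow> (\<exists>b. (\<forall>\<gamma>. b \<gamma> \<in> ratfuns n) \<and>
     B = (\<lambda>f. \<Sum>\<gamma> | \<gamma> \<in> multi n \<and> msize n \<gamma> \<le> m. b \<gamma> * qshifts n \<gamma> f))"

text \<open>\<open>case_nat m \<nu>\<close> is the sequence $(m, \nu_1, \nu_2, \ldots)$.\<close>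

definition is_raising_op :: "nat \<Rightarrow> nat \<Rightarrow> (ratfun \<Rightarrow> ratfun) \<Rightarrow> bool" where
  "is_raising_op n m B \<longleftrightarrow> qdiff_op n m B \<and>
     (\<forall>\<nu>. is_partition \<nu> \<and> len \<nu> \<le> n \<and> \<nu> 0 \<le> m \<longrightarrow>
        B (macdonald_J n \<nu>) =
          (if len \<nu> < n then macdonald_J n (case_nat m \<nu>) else 0))"

definition raising_op :: "nat \<Rightarrow> nat \<Rightarrow> ratfun \<Rightarrow> ratfun" where
  "raising_op n m = (THE B. is_raising_op n m B)"


section \<open>The explicit expression\<close>

definition qpoch :: "ratfun \<Rightarrow> nat \<Rightarrow> ratfun" where
  "qpoch a k = (\<Prod>r<k. 1 - a * qF ^ r)"

definition C_coef :: "nat \<Rightarrow> (nat \<Rightarrow> nat) \<Rightarrow> (nat \<Rightarrow> nat) \<Rightarrow> ratfun" where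
  "C_coef n \<alpha> \<beta> = (\<Prod>i<n. \<Prod>j<n.
     qpoch (qF powi (int (\<alpha> i) - int (\<beta> j) + 1) * xvar i / xvar j) (\<beta> j) /
     qpoch (qF powi (int (\<beta> i) - int (\<beta> j) + 1) * xvar i / xvar j) (\<beta> j))"

definition b_tilde :: "nat \<Rightarrow> (nat \<Rightarrow> nat) \<Rightarrow> ratfun" where
  "b_tilde n \<alpha> =
     (-1) ^ msize n \<alpha> * qF ^ (\<Sum>i<n. \<alpha> i choose 2) * (\<Prod>i<n. xvar i ^ \<alpha> i) *
     (\<Sum>\<beta> | \<beta> \<in> multi n \<and> \<beta> \<le> \<alpha>.
        (-1) ^ msize n \<beta> * qF ^ (msize n \<beta> choose 2) * C_coef n \<alpha> \<beta> *
        (\<Prod>i<n. \<Prod>j<n.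
           qpoch (tF * qF powi (- int (\<beta> j) + 1) * xvar i / xvar j) (\<beta> j) *
           qpoch (qF powi (- int (\<alpha> j) + 1) * xvar i / xvar j) (\<alpha> j - \<beta> j) /
           qpoch (qF powi (int (\<alpha> i) - int (\<alpha> j) + 1) * xvar i / xvar j) (\<alpha> j)))"

definition phi :: "nat \<Rightarrow> (nat \<Rightarrow> nat) \<Rightarrow> ratfun \<Rightarrow> ratfun" where
  "phi n \<alpha> f =
     (\<Sum>\<beta> | \<beta> \<in> multi n \<and> \<beta> \<le> \<alpha>.
        (-1) ^ (msize n \<alpha> - msize n \<beta>) *
        qF ^ ((msize n \<alpha> - msize n \<beta> + 1) choose 2) *
        C_coef n \<alpha> \<beta> * qshifts n \<beta> f)"

end

theory Submission
  imports Defs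
begin

text \<open>Besides $x_1,\ldots,x_n$ take further variables $y_1,\ldots,y_m$, realised as \<open>xvar n\<close>, \dots,
\<open>xvar (n + m - 1)\<close>, and the kernel $\Pi = \prod_{i,k}(1 + x_i y_k)$ (\<open>kernelF\<close>). It expands as
$\Pi = \sum_\mu P_\mu(x)\, Q_\mu(y)$ over the partitions $\mu$ in the $n \times m$ box, where the $Q_\mu$
are linearly independent, even over the rational functions in $x$. Two operators that act on $x$
alone therefore agree on all the $P_\mu$ as soon as they agree on the single function $\Pi$, and the whole
proof is a computation with $\Pi$.

The $Q_\mu$ are eigenfunctions of the Macdonald operators in $y$ with $q$ and $t$ exchanged, with
exponents the conjugate partition $\mu'$ (\<open>Dr_polyQ\<close>). Hence the alternating sum
$\sum_r (-1)^r D_r^y$ multiplies $Q_\mu$ by $\prod_k (1 - t^{\mu'_k} q^{m-k})$, which vanishes unless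
$\mu'_m \neq 0$, that is unless $\mu = (m,\lambda)$; and $Q_{(m,\lambda)} = y_1\cdots y_m\, Q_\lambda$
(\<open>polyQ_part_cons\<close>). Dividing by $y_1\cdots y_m$ gives a function \<open>raised_kernel\<close> whose coefficient
of $Q_\lambda$ is a multiple of $P_{(m,\lambda)}$ if $\ell(\lambda) < n$ and zero otherwise, and the
multiple is $c_{(m,\lambda)}/c_\lambda$ (\<open>c_normK_cons\<close>). So an operator in $x$ has the required action
on the $J_\lambda$ once it maps $\Pi$ to \<open>raised_kernel\<close> (\<open>raising_from_kernel\<close>).

It remains to see that the explicit operator does so. In the points $z_k = -1/y_k$ the function
\<open>raised_kernel\<close> becomes, up to a monomial, a sum over the subsets of $Z = \{z_1,\ldots,z_m\}$ which is
symmetric and in each single $z_k$ a polynomial of degree less than $n$: the poles cancel in pairs, and so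
do the top coefficients (\<open>cross_sum_poly\<close>). Such a function is determined by its values at the node
sets $N_\alpha = \{q^j x_i : j < \alpha_i\}$ with $|\alpha| = m$ (\<open>interpolation_zero\<close>). Up to the same
monomial the functions $\phi_\alpha \Pi$ are the interpolation basis: $\phi_\alpha\Pi$ vanishes at
$N_\delta$ for every $\delta \neq \alpha$ of the same size. So the coefficient of $\phi_\alpha$ is a value at
$N_\alpha$, where only the subsets $N_\beta$ with $\beta \le \alpha$ contribute, with weight
$C_{\alpha,\beta}$; this value is $\tilde b_\alpha$ (\<open>interpolation_formula\<close>, \<open>b_tilde_eq\<close>).

The operator is unique because an operator $\sum_\gamma d_\gamma T^\gamma$ that kills all $P_\lambda$
kills $\Pi$ for every value of $y$, and the specialization at a node set $N_\delta$ kills all terms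
except those with $\gamma \ge \delta$ (\<open>qcomb_zero\<close>).

The Macdonald polynomials are constructed along the way. A residue computation relates the first
operator in $x$ and the first one in $y$, with exchanged and inverted parameters, on $\Pi$
(\<open>kernel_eq\<close>). Since $\Pi$ generates the products of elementary symmetric polynomials, their span is stable under the first operator in $x$
(\<open>D1_elem_span\<close>), and triangularity with respect to the lexicographic order gives eigenvectors
$P_\mu$; the same kernel equation then shows that the $Q_\mu$ are eigenfunctions. An eigenfunction of one first-order
operator is determined up to a scalar by its eigenvalue (\<open>eigen_unique\<close>); as the operators
with parameters $(p,s)$ commute with the first-order one with parameters $(1/p,1/s)$
(\<open>Dr_commute\<close>), eigenfunctions of one are eigenfunctions of all.\<close>

section \<open>Residue sums for rational functions of one variable\<close>

text \<open>The sum is the coefficient of the Lagrange interpolation polynomial of \<open>g\<close> in degree \<open>card I - 1\<close>.\<close>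

lemma lagrange_top_coeff:
  fixes a :: "'i \<Rightarrow> 'a::field" and g :: "'a poly"
  assumes fin: "finite I" and inj: "inj_on a I" and deg: "degree g < card I"
  shows "(\<Sum>i\<in>I. poly g (a i) / (\<Prod>j\<in>I - {i}. a i - a j)) = coeff g (card I - 1)"
proof -
  define B where "B i = (\<Prod>j\<in>I - {i}. [:- a j, 1:])" for i
  define L where "L = (\<Sum>i\<in>I. smult (poly g (a i) / (\<Prod>j\<in>I - {i}. a i - a j)) (B i))"
  have degB: "degree (B i) = card I - 1" if "i \<in> I" for i
    using that fin unfolding B_def by (subst degree_prod_eq_sum_degree) auto
  have lcB: "coeff (B i) (card I - 1) = 1" if "i \<in> I" for i
    using that degB[OF that] lead_coeff_prod[of "\<lambda>j. [:- a j, 1:]" "I - {i}"]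
    by (simp add: B_def)
  have polyB: "poly (B i) (a k) = (\<Prod>j\<in>I - {i}. a k - a j)" for i k
    by (simp add: B_def poly_prod)
  have "poly L (a k) = poly g (a k)" if k: "k \<in> I" for k
  proof -
    have nz: "(\<Prod>j\<in>I - {k}. a k - a j) \<noteq> 0"
      using fin inj k by (auto simp: inj_on_def)
    have "poly L (a k) = (\<Sum>i\<in>I. if i = k then poly g (a k) else 0)"
      unfolding L_def poly_sum
    proof (intro sum.cong refl)
      fix i assume i: "i \<in> I"
      show "poly (smult (poly g (a i) / (\<Prod>j\<in>I - {i}. a i - a j)) (B i)) (a k) =
          (if i = k then poly g (a k) else 0)"
        using nz fin k by (auto simp: polyB)
    qed
    also have "\<dots> = poly g (a k)" using k fin by simp
    finally show ?thesis .
  qed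
  moreover have "degree L < card I"
  proof -
    have "degree L \<le> card I - 1"
      unfolding L_def by (intro degree_sum_le fin) (metis degB degree_smult_le)
    then show ?thesis using deg by linarith
  qed
  ultimately have "L = g"
    using inj deg by (intro poly_eqI_degree[of "a ` I"]) (auto simp: card_image)
  then have "coeff g (card I - 1) = coeff L (card I - 1)" by simp
  also have "\<dots> = (\<Sum>i\<in>I. poly g (a i) / (\<Prod>j\<in>I - {i}. a i - a j))"
    unfolding L_def coeff_sum by (intro sum.cong refl) (simp add: lcB[simplified])
  finally show ?thesis by simp
qed

text \<open>The residue theorem for $g(z)/(z\prod_i (z - a_i))$, whose residue at infinity is, up to
sign, the top coefficient of \<open>g\<close>. Algebraically it is Lagrange interpolation at the \<open>a i\<close> together with the extra node \<open>0\<close>.\<close>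

lemma sum_residues:
  fixes a :: "'i \<Rightarrow> 'a::field" and g :: "'a poly"
  assumes fin: "finite I" and inj: "inj_on a I" and nz: "\<And>i. i \<in> I \<Longrightarrow> a i \<noteq> 0"
    and deg: "degree g \<le> card I"
  shows "(\<Sum>i\<in>I. poly g (a i) / (a i * (\<Prod>j\<in>I - {i}. a i - a j))) =
    coeff g (card I) - poly g 0 / (\<Prod>j\<in>I. - a j)"
proof -
  define J where "J = insert None (Some ` I)"
  define b where "b = (\<lambda>j. case j of None \<Rightarrow> 0 | Some i \<Rightarrow> a i)"
  have cardJ: "card J = Suc (card I)"
    using fin by (simp add: J_def card_image)
  have "inj_on b J"
    using inj nz by (auto simp: J_def b_def inj_on_def split: option.splits)
  then have "(\<Sum>i\<in>J. poly g (b i) / (\<Prod>j\<in>J - {i}. b i - b j)) = coeff g (card I)"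
    using lagrange_top_coeff[of J b g] fin deg cardJ by (simp add: J_def)
  moreover have "(\<Sum>i\<in>J. poly g (b i) / (\<Prod>j\<in>J - {i}. b i - b j)) =
     poly g 0 / (\<Prod>j\<in>I. - a j) + (\<Sum>i\<in>I. poly g (a i) / (a i * (\<Prod>j\<in>I - {i}. a i - a j)))"
  proof -
    have 1: "J - {None} = Some ` I" by (auto simp: J_def)
    have 2: "J - {Some i} = insert None (Some ` (I - {i}))" for i by (auto simp: J_def)
    have "(\<Sum>i\<in>J. poly g (b i) / (\<Prod>j\<in>J - {i}. b i - b j)) =
      poly g (b None) / (\<Prod>j\<in>J - {None}. b None - b j) +
      (\<Sum>i\<in>Some ` I. poly g (b i) / (\<Prod>j\<in>J - {i}. b i - b j))"
      using fin unfolding J_def by (subst sum.insert) auto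
    then show ?thesis using fin
      by (simp add: 1 2 sum.reindex prod.reindex b_def)
  qed
  ultimately show ?thesis by (simp add: algebra_simps)
qed

lemma frac_regroup: "(A * P) / (y * (B * Q)) = (A / (y * B)) * (P / (Q::'a::field))"
  by simp

text \<open>The residues of one rational function with simple poles at the $x_i$, at the $-1/y_k$ and at
\<open>0\<close>. This is the identity behind the kernel equation for the Macdonald operators.\<close>

lemma kernel_identity:
  fixes x :: "'i \<Rightarrow> 'a::field" and y :: "'j \<Rightarrow> 'a"
  assumes fin: "finite I" "finite J" and inj: "inj_on x I" "inj_on y J"
    and x0: "\<And>i. i \<in> I \<Longrightarrow> x i \<noteq> 0" and y0: "\<And>k. k \<in> J \<Longrightarrow> y k \<noteq> 0"
    and xy: "\<And>i k. i \<in> I \<Longrightarrow> k \<in> J \<Longrightarrow> 1 + x i * y k \<noteq> 0"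
    and q: "q \<noteq> 0" and t: "t \<noteq> 0"
  shows "(t - 1) * (\<Sum>i\<in>I. (\<Prod>j\<in>I - {i}. (1 - t * x i / x j) / (1 - x i / x j)) *
        (\<Prod>k\<in>J. (1 + q * x i * y k) / (1 + x i * y k))) +
    (q - 1) * t ^ card I * q ^ (card J - 1) *
      (\<Sum>k\<in>J. (\<Prod>l\<in>J - {k}. (1 - inverse q * y k / y l) / (1 - y k / y l)) *
        (\<Prod>i\<in>I. (1 + inverse t * x i * y k) / (1 + x i * y k))) =
    t ^ card I * q ^ card J - 1"
proof -
  define N where "N = Inl ` I \<union> Inr ` J"
  define a where "a = (\<lambda>s. case s of Inl i \<Rightarrow> x i | Inr k \<Rightarrow> - inverse (y k))"
  \<comment> \<open>The numerator. Since its zeros are proportional to the poles, at each pole one factor degenerates to a multiple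
    of \<open>t - 1\<close> or \<open>q - 1\<close>.\<close>
  define g where "g = (\<Prod>i\<in>I. [:- x i, t:]) * (\<Prod>k\<in>J. [:inverse (y k), q:])"
  have finN: "finite N" using fin by (simp add: N_def)
  have cardN: "card N = card I + card J"
    using fin unfolding N_def by (subst card_Un_disjoint) (auto simp: card_image)
  have neq: "x i \<noteq> - inverse (y k)" if "i \<in> I" "k \<in> J" for i k
    using xy[OF that] y0[OF that(2)] by (metis add.right_inverse left_inverse minus_mult_left)
  have injN: "inj_on a N"
  proof -
    have "- inverse (y k) \<noteq> x i" if "i \<in> I" "k \<in> J" for i k
      using neq[OF that] by metis
    then show ?thesis
      using neq by (intro inj_onI) (auto simp: N_def a_def dest: inj_onD[OF inj(1)] inj_onD[OF inj(2)])
  qed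
  have dg1: "degree (\<Prod>i\<in>I. [:- x i, t:]) = card I"
    using t fin by (subst degree_prod_eq_sum_degree) auto
  have dg2: "degree (\<Prod>k\<in>J. [:inverse (y k), q:]) = card J"
    using q fin by (subst degree_prod_eq_sum_degree) auto
  have nz: "(\<Prod>i\<in>I. [:- x i, t:]) \<noteq> 0" "(\<Prod>k\<in>J. [:inverse (y k), q:]) \<noteq> 0"
    using t q fin by auto
  have dg: "degree g = card N"
    using nz by (simp add: g_def degree_mult_eq dg1 dg2 cardN)
  have "lead_coeff g = t ^ card I * q ^ card J"
    using t q fin by (simp add: g_def lead_coeff_mult lead_coeff_prod)
  then have lc: "coeff g (card N) = t ^ card I * q ^ card J" by (simp add: dg)
  have pg: "poly g z = (\<Prod>i\<in>I. t * z - x i) * (\<Prod>k\<in>J. inverse (y k) + q * z)" for z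
    by (simp add: g_def poly_prod mult.commute)
  have g0: "poly g 0 / (\<Prod>j\<in>N. - a j) = 1"
  proof -
    have "(\<Prod>j\<in>N. - a j) = (\<Prod>j\<in>Inl ` I. - a j) * (\<Prod>j\<in>Inr ` J. - a j)"
      unfolding N_def using fin by (intro prod.union_disjoint) auto
    also have "\<dots> = poly g 0"
      by (simp add: pg a_def prod.reindex)
    finally show ?thesis using x0 y0 fin by (auto simp: pg)
  qed
  have tx: "poly g (a (Inl i)) / (a (Inl i) * (\<Prod>j\<in>N - {Inl i}. a (Inl i) - a j)) =
    (t - 1) * ((\<Prod>j\<in>I - {i}. (1 - t * x i / x j) / (1 - x i / x j)) *
        (\<Prod>k\<in>J. (1 + q * x i * y k) / (1 + x i * y k)))" if i: "i \<in> I" for i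
  proof -
    have e: "N - {Inl i} = Inl ` (I - {i}) \<union> Inr ` J" by (auto simp: N_def)
    have d: "(\<Prod>j\<in>N - {Inl i}. a (Inl i) - a j) =
        (\<Prod>j\<in>I - {i}. x i - x j) * (\<Prod>k\<in>J. x i + inverse (y k))"
      unfolding e using fin by (subst prod.union_disjoint) (auto simp: prod.reindex a_def)
    have n: "poly g (a (Inl i)) = (t * x i - x i) * (\<Prod>j\<in>I - {i}. t * x i - x j) *
        (\<Prod>k\<in>J. inverse (y k) + q * x i)"
      using prod.remove[OF fin(1) i, of "\<lambda>j. t * x i - x j"] by (simp add: pg a_def)
    have p1: "(\<Prod>j\<in>I - {i}. (1 - t * x i / x j) / (1 - x i / x j)) =
       (\<Prod>j\<in>I - {i}. t * x i - x j) / (\<Prod>j\<in>I - {i}. x i - x j)"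
      unfolding prod_dividef[symmetric]
    proof (intro prod.cong refl)
      fix j assume j: "j \<in> I - {i}"
      then have "x j \<noteq> 0" "x i \<noteq> x j" using x0 inj i by (auto simp: inj_on_def)
      then show "(1 - t * x i / x j) / (1 - x i / x j) = (t * x i - x j) / (x i - x j)"
        by (simp add: divide_simps) (simp add: algebra_simps)
    qed
    have p2: "(\<Prod>k\<in>J. (1 + q * x i * y k) / (1 + x i * y k)) =
       (\<Prod>k\<in>J. inverse (y k) + q * x i) / (\<Prod>k\<in>J. x i + inverse (y k))"
      unfolding prod_dividef[symmetric]
    proof (intro prod.cong refl)
      fix k assume k: "k \<in> J"
      have "x i + inverse (y k) \<noteq> 0" using neq[OF i k] by (metis eq_neg_iff_add_eq_0)
      moreover have "1 + x i * y k = y k * (x i + inverse (y k))"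
        "1 + q * x i * y k = y k * (inverse (y k) + q * x i)"
        using y0[OF k] by (simp_all add: algebra_simps)
      ultimately show "(1 + q * x i * y k) / (1 + x i * y k) =
          (inverse (y k) + q * x i) / (x i + inverse (y k))"
        using y0[OF k] by simp
    qed
    have "t * x i - x i = (t - 1) * x i" by (simp add: algebra_simps)
    then show ?thesis unfolding d n p1 p2 using x0[OF i] by (simp add: a_def)
  qed
  have ty: "poly g (a (Inr k)) / (a (Inr k) * (\<Prod>j\<in>N - {Inr k}. a (Inr k) - a j)) =
    (q - 1) * t ^ card I * q ^ (card J - 1) *
      ((\<Prod>l\<in>J - {k}. (1 - inverse q * y k / y l) / (1 - y k / y l)) *
        (\<Prod>i\<in>I. (1 + inverse t * x i * y k) / (1 + x i * y k)))" if k: "k \<in> J" for k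
  proof -
    have e: "N - {Inr k} = Inl ` I \<union> Inr ` (J - {k})" by (auto simp: N_def)
    have d: "(\<Prod>j\<in>N - {Inr k}. a (Inr k) - a j) =
        (\<Prod>i\<in>I. - inverse (y k) - x i) * (\<Prod>l\<in>J - {k}. inverse (y l) - inverse (y k))"
      unfolding e using fin
      by (subst prod.union_disjoint) (auto simp: prod.reindex a_def)
    have n: "poly g (a (Inr k)) = (\<Prod>i\<in>I. t * - inverse (y k) - x i) *
       ((inverse (y k) - q * inverse (y k)) * (\<Prod>l\<in>J - {k}. inverse (y l) - q * inverse (y k)))"
      using prod.remove[OF fin(2) k, of "\<lambda>l. inverse (y l) - q * inverse (y k)"]
      by (simp add: pg a_def)
    have p1: "q ^ (card J - 1) * (\<Prod>l\<in>J - {k}. (1 - inverse q * y k / y l) / (1 - y k / y l)) =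
       (\<Prod>l\<in>J - {k}. inverse (y l) - q * inverse (y k)) / (\<Prod>l\<in>J - {k}. inverse (y l) - inverse (y k))"
    proof -
      have "q ^ (card J - 1) = (\<Prod>l\<in>J - {k}. q)" using fin k by simp
      then show ?thesis
        unfolding prod_dividef[symmetric] prod.distrib[symmetric]
      proof (simp only: prod.distrib[symmetric], intro prod.cong refl)
        fix l assume l: "l \<in> J - {k}"
        then have h: "y l \<noteq> 0" "y k \<noteq> y l" "y k \<noteq> 0" using y0 inj k by (auto simp: inj_on_def)
        then have h': "inverse (y l) - inverse (y k) \<noteq> 0" by auto
        have "1 - y k / y l = - y k * (inverse (y l) - inverse (y k))"
          "q * (1 - inverse q * y k / y l) = - y k * (inverse (y l) - q * inverse (y k))"
          using h q by (simp_all add: field_simps)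
        then show "q * ((1 - inverse q * y k / y l) / (1 - y k / y l)) =
            (inverse (y l) - q * inverse (y k)) / (inverse (y l) - inverse (y k))"
          using h h' by simp
      qed
    qed
    have p2: "t ^ card I * (\<Prod>i\<in>I. (1 + inverse t * x i * y k) / (1 + x i * y k)) =
       (\<Prod>i\<in>I. t * - inverse (y k) - x i) / (\<Prod>i\<in>I. - inverse (y k) - x i)"
    proof -
      have "t ^ card I = (\<Prod>i\<in>I. t)" by simp
      then show ?thesis
        unfolding prod_dividef[symmetric]
      proof (simp only: prod.distrib[symmetric], intro prod.cong refl)
        fix i assume i: "i \<in> I"
        have h: "- inverse (y k) - x i \<noteq> 0" using neq[OF i k] by auto
        have "1 + x i * y k = - y k * (- inverse (y k) - x i)"
          "t * (1 + inverse t * x i * y k) = - y k * (t * - inverse (y k) - x i)"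
          using y0[OF k] t by (simp_all add: field_simps)
        then show "t * ((1 + inverse t * x i * y k) / (1 + x i * y k)) =
            (t * - inverse (y k) - x i) / (- inverse (y k) - x i)"
          using y0[OF k] h by simp
      qed
    qed
    have "(q - 1) * t ^ card I * q ^ (card J - 1) *
      ((\<Prod>l\<in>J - {k}. (1 - inverse q * y k / y l) / (1 - y k / y l)) *
        (\<Prod>i\<in>I. (1 + inverse t * x i * y k) / (1 + x i * y k))) = (q - 1) *
      (q ^ (card J - 1) * (\<Prod>l\<in>J - {k}. (1 - inverse q * y k / y l) / (1 - y k / y l))) *
      (t ^ card I * (\<Prod>i\<in>I. (1 + inverse t * x i * y k) / (1 + x i * y k)))"
      by (simp add: mult_ac)
    moreover have "inverse (y k) - q * inverse (y k) = (q - 1) * a (Inr k)"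
      by (simp add: a_def algebra_simps)
    moreover have "a (Inr k) \<noteq> 0" using y0[OF k] by (simp add: a_def)
    ultimately show ?thesis unfolding d n p1 p2 by (simp add: mult_ac)
  qed
  have "(\<Sum>s\<in>N. poly g (a s) / (a s * (\<Prod>j\<in>N - {s}. a s - a j))) = t ^ card I * q ^ card J - 1"
  proof -
    have "a s \<noteq> 0" if "s \<in> N" for s using that x0 y0 by (auto simp: N_def a_def)
    then show ?thesis using sum_residues[OF finN injN, of g] dg lc g0 by simp
  qed
  moreover have "(\<Sum>s\<in>N. poly g (a s) / (a s * (\<Prod>j\<in>N - {s}. a s - a j))) =
    (\<Sum>s\<in>Inl ` I. poly g (a s) / (a s * (\<Prod>j\<in>N - {s}. a s - a j))) +
    (\<Sum>s\<in>Inr ` J. poly g (a s) / (a s * (\<Prod>j\<in>N - {s}. a s - a j)))"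
    by (subst N_def, rule sum.union_disjoint) (use fin in auto)
  ultimately show ?thesis
    by (simp add: sum.reindex tx ty sum_distrib_left)
qed

text \<open>The residues of one rational function with simple poles at \<open>0\<close>, at the $y_k$ and at the
$q y_k$: the residues at $y_k$ give the left-hand side, those at $q y_k$ the right-hand side, and
\<open>0\<close> cancels against infinity. It is needed for the commutation of Macdonald operators.\<close>

lemma shift_exchange_identity:
  fixes y :: "'i \<Rightarrow> 'a::field"
  assumes fin: "finite M" and inj: "inj_on y M"
    and y0: "\<And>k. k \<in> M \<Longrightarrow> y k \<noteq> 0"
    and yq: "\<And>k l. k \<in> M \<Longrightarrow> l \<in> M \<Longrightarrow> y k \<noteq> q * y l"
    and q: "q \<noteq> 0" and t: "t \<noteq> 0" "t \<noteq> 1" "t \<noteq> q"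
  shows "(\<Sum>k\<in>M. \<Prod>j\<in>M - {k}. (1 - inverse t * y k / y j) / (1 - y k / y j) *
        ((1 - t * inverse q * y k / y j) / (1 - inverse q * y k / y j))) =
    (\<Sum>k\<in>M. \<Prod>j\<in>M - {k}. (1 - t * y k / y j) / (1 - y k / y j) *
        ((1 - inverse t * q * y k / y j) / (1 - q * y k / y j)))"
    (is "sum ?L M = sum ?R M")
proof (cases "M = {}")
  case False
  have q1: "q \<noteq> 1" using yq False by fastforce
  define N where "N = (\<lambda>k. (k, False)) ` M \<union> (\<lambda>k. (k, True)) ` M"
  define a where "a = (\<lambda>(k, b). if b then q * y k else y k)"
  \<comment> \<open>Of degree twice \<open>card M\<close> with top coefficient \<open>1\<close>, so that infinity and \<open>0\<close> cancel.\<close>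
  define g where "g = (\<Prod>k\<in>M. [:y k, - inverse t:] * [:q * y k, - t:])"
  define c where "c = (t - 1) * (q - t) / (t * (1 - q))"
  have finN: "finite N" using fin by (simp add: N_def)
  have cardN: "card N = 2 * card M"
    using fin unfolding N_def
    by (subst card_Un_disjoint) (auto simp: card_image inj_on_def)
  have injN: "inj_on a N"
  proof -
    have "q * y l \<noteq> y k" if "k \<in> M" "l \<in> M" for k l
      using yq[OF that] by metis
    then show ?thesis
      using yq q by (intro inj_onI) (auto simp: N_def a_def dest: inj_onD[OF inj])
  qed
  have "degree g = (\<Sum>k\<in>M. degree ([:y k, - inverse t:] * [:q * y k, - t:]))"
    unfolding g_def using t fin by (subst degree_prod_eq_sum_degree) auto
  also have "\<dots> = (\<Sum>k\<in>M. 2)"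
    using t by (intro sum.cong refl) (subst degree_mult_eq; simp)
  finally have dg: "degree g = card N" by (simp add: cardN)
  have "lead_coeff g = 1"
    using t by (simp add: g_def lead_coeff_mult lead_coeff_prod del: mult_pCons_left mult_pCons_right)
  then have lc: "coeff g (card N) = 1" by (simp add: dg)
  have pg: "poly g z = (\<Prod>k\<in>M. (y k - inverse t * z) * (q * y k - t * z))" for z
    by (simp add: g_def poly_prod mult.commute[of z] del: mult_pCons_left mult_pCons_right)
  have g0: "poly g 0 / (\<Prod>s\<in>N. - a s) = 1"
  proof -
    have "(\<Prod>s\<in>N. - a s) = (\<Prod>s\<in>(\<lambda>k. (k, False)) ` M. - a s) * (\<Prod>s\<in>(\<lambda>k. (k, True)) ` M. - a s)"
      unfolding N_def using fin by (intro prod.union_disjoint) auto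
    also have "\<dots> = (\<Prod>k\<in>M. - y k) * (\<Prod>k\<in>M. - (q * y k))"
      by (simp add: prod.reindex inj_on_def a_def)
    also have "\<dots> = poly g 0"
      unfolding pg prod.distrib[symmetric] by (intro prod.cong) auto
    finally show ?thesis using y0 q fin by (auto simp: pg)
  qed
  have split: "prod f (N - {s}) = f (k, \<not> b) * (\<Prod>j\<in>M - {k}. f (j, False) * f (j, True))"
    if k: "k \<in> M" and s: "s = (k, b)" for f :: "'i \<times> bool \<Rightarrow> 'a" and k b s
  proof -
    have "N - {s} = insert (k, \<not> b) ((\<lambda>j. (j, False)) ` (M - {k}) \<union> (\<lambda>j. (j, True)) ` (M - {k}))"
      using k s by (auto simp: N_def)
    then have "prod f (N - {s}) = f (k, \<not> b) * prod f ((\<lambda>j. (j, False)) ` (M - {k}) \<union> (\<lambda>j. (j, True)) ` (M - {k}))"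
      using fin by (auto intro: prod.insert)
    also have "prod f ((\<lambda>j. (j, False)) ` (M - {k}) \<union> (\<lambda>j. (j, True)) ` (M - {k})) =
       prod f ((\<lambda>j. (j, False)) ` (M - {k})) * prod f ((\<lambda>j. (j, True)) ` (M - {k}))"
      using fin by (intro prod.union_disjoint) auto
    also have "\<dots> = (\<Prod>j\<in>M - {k}. f (j, False) * f (j, True))"
      by (simp add: prod.reindex inj_on_def prod.distrib)
    finally show ?thesis .
  qed
  have tF: "poly g (a (k, False)) / (a (k, False) * (\<Prod>j\<in>N - {(k, False)}. a (k, False) - a j)) =
      c * ?L k" if k: "k \<in> M" for k
  proof -
    have d: "(\<Prod>j\<in>N - {(k, False)}. a (k, False) - a j) =
       (y k - q * y k) * (\<Prod>j\<in>M - {k}. (y k - y j) * (y k - q * y j))"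
      using split[OF k refl, where b = False and f = "\<lambda>j. a (k, False) - a j"] by (simp add: a_def)
    have n: "poly g (a (k, False)) = ((y k - inverse t * y k) * (q * y k - t * y k)) *
       (\<Prod>j\<in>M - {k}. (y j - inverse t * y k) * (q * y j - t * y k))"
      using prod.remove[OF fin k] by (simp add: pg a_def)
    have p: "?L k = (\<Prod>j\<in>M - {k}. (y j - inverse t * y k) * (q * y j - t * y k)) /
        (\<Prod>j\<in>M - {k}. (y k - y j) * (y k - q * y j))"
      unfolding prod_dividef[symmetric]
    proof (intro prod.cong refl)
      fix j assume j: "j \<in> M - {k}"
      have h: "y j \<noteq> 0" "y k \<noteq> y j" "y k \<noteq> q * y j"
        using j y0 inj k yq by (auto simp: inj_on_def)
      have e: "1 - inverse t * y k / y j = (y j - inverse t * y k) / y j"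
        "1 - y k / y j = - (y k - y j) / y j"
        "1 - t * inverse q * y k / y j = (q * y j - t * y k) / (q * y j)"
        "1 - inverse q * y k / y j = - (y k - q * y j) / (q * y j)"
        using h q by (simp_all add: field_simps)
      show "(1 - inverse t * y k / y j) / (1 - y k / y j) *
        ((1 - t * inverse q * y k / y j) / (1 - inverse q * y k / y j)) =
        (y j - inverse t * y k) * (q * y j - t * y k) / ((y k - y j) * (y k - q * y j))"
        unfolding e using h q by (simp, simp add: algebra_simps)
    qed
    have aF: "a (k, False) = y k" by (simp add: a_def)
    have const: "(y k - inverse t * y k) * (q * y k - t * y k) / (y k * (y k - q * y k)) = c"
    proof -
      have e: "(y k - inverse t * y k) * (q * y k - t * y k) = y k * y k * ((1 - inverse t) * (q - t))"
        "y k * (y k - q * y k) = y k * y k * (1 - q)" by (simp_all add: algebra_simps)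
      show ?thesis unfolding e c_def using y0[OF k] t q1 by (simp add: field_simps)
    qed
    show ?thesis unfolding d n p unfolding aF frac_regroup const by (rule refl)
  qed
  have tT: "poly g (a (k, True)) / (a (k, True) * (\<Prod>j\<in>N - {(k, True)}. a (k, True) - a j)) =
      - c * ?R k" if k: "k \<in> M" for k
  proof -
    have d: "(\<Prod>j\<in>N - {(k, True)}. a (k, True) - a j) =
       (q * y k - y k) * (\<Prod>j\<in>M - {k}. (q * y k - y j) * (q * y k - q * y j))"
      using split[OF k refl, where b = True and f = "\<lambda>j. a (k, True) - a j"] by (simp add: a_def)
    have n: "poly g (a (k, True)) = ((y k - inverse t * (q * y k)) * (q * y k - t * (q * y k))) *
       (\<Prod>j\<in>M - {k}. (y j - inverse t * (q * y k)) * (q * y j - t * (q * y k)))"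
      using prod.remove[OF fin k] by (simp add: pg a_def)
    have p: "?R k = (\<Prod>j\<in>M - {k}. (y j - inverse t * (q * y k)) * (q * y j - t * (q * y k))) /
        (\<Prod>j\<in>M - {k}. (q * y k - y j) * (q * y k - q * y j))"
      unfolding prod_dividef[symmetric]
    proof (intro prod.cong refl)
      fix j assume j: "j \<in> M - {k}"
      have h: "y j \<noteq> 0" "y k \<noteq> y j" "q * y k \<noteq> y j"
        using j y0 inj k yq by (auto simp: inj_on_def) metis
      have e: "1 - inverse t * q * y k / y j = (y j - inverse t * (q * y k)) / y j"
        "1 - y k / y j = - (q * y k - q * y j) / (q * y j)"
        "1 - t * y k / y j = (q * y j - t * (q * y k)) / (q * y j)"
        "1 - q * y k / y j = - (q * y k - y j) / y j"
        using h q by (simp_all add: field_simps)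
      show "(1 - t * y k / y j) / (1 - y k / y j) *
        ((1 - inverse t * q * y k / y j) / (1 - q * y k / y j)) =
        (y j - inverse t * (q * y k)) * (q * y j - t * (q * y k)) / ((q * y k - y j) * (q * y k - q * y j))"
        unfolding e using h q by (simp, simp add: algebra_simps)
    qed
    have aF: "a (k, True) = q * y k" by (simp add: a_def)
    have const: "(y k - inverse t * (q * y k)) * (q * y k - t * (q * y k)) / (q * y k * (q * y k - y k)) = - c"
    proof -
      have e: "(y k - inverse t * (q * y k)) * (q * y k - t * (q * y k)) = q * y k * y k * ((1 - inverse t * q) * (1 - t))"
        "q * y k * (q * y k - y k) = q * y k * y k * (q - 1)" by (simp_all add: algebra_simps)
      show ?thesis unfolding e c_def using y0[OF k] t q1 q by (simp add: field_simps)
    qed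
    show ?thesis unfolding d n p unfolding aF frac_regroup const by (rule refl)
  qed
  have "(\<Sum>s\<in>N. poly g (a s) / (a s * (\<Prod>j\<in>N - {s}. a s - a j))) = 0"
  proof -
    have "a s \<noteq> 0" if "s \<in> N" for s using that y0 q by (auto simp: N_def a_def)
    then show ?thesis using sum_residues[OF finN injN, of g] dg lc g0 by simp
  qed
  moreover have "(\<Sum>s\<in>N. poly g (a s) / (a s * (\<Prod>j\<in>N - {s}. a s - a j))) =
    (\<Sum>s\<in>(\<lambda>k. (k, False)) ` M. poly g (a s) / (a s * (\<Prod>j\<in>N - {s}. a s - a j))) +
    (\<Sum>s\<in>(\<lambda>k. (k, True)) ` M. poly g (a s) / (a s * (\<Prod>j\<in>N - {s}. a s - a j)))"
    by (subst N_def, rule sum.union_disjoint) (use fin in auto)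
  ultimately have "(\<Sum>k\<in>M. c * ?L k) + (\<Sum>k\<in>M. - c * ?R k) = 0"
    by (simp add: sum.reindex inj_on_def tF tT)
  then have "c * sum ?L M = c * sum ?R M" by (simp add: sum_distrib_left sum_negf)
  moreover have "c \<noteq> 0" using t q1 by (simp add: c_def)
  ultimately show ?thesis by simp
qed simp

section \<open>Symmetric sums over the subsets of a finite set\<close>

lemma coeff_mult_top:
  fixes p q :: "'a::comm_semiring_0 poly"
  assumes "degree p \<le> m" "degree q \<le> n"
  shows "coeff (p * q) (m + n) = coeff p m * coeff q n"
proof -
  have "coeff (p * q) (m + n) = (\<Sum>i\<le>m + n. if i = m then coeff p m * coeff q n else 0)"
    unfolding coeff_mult
  proof (intro sum.cong refl)
    fix i assume "i \<in> {..m + n}"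
    then show "coeff p i * coeff q (m + n - i) = (if i = m then coeff p m * coeff q n else 0)"
      using assms by (cases i m rule: linorder_cases) (auto simp: coeff_eq_0)
  qed
  then show ?thesis by simp
qed

lemma roots_factor:
  fixes N :: "'a::field poly"
  assumes "finite Z" "\<And>w. w \<in> Z \<Longrightarrow> poly N w = 0"
  shows "\<exists>p. N = p * (\<Prod>w\<in>Z. [:- w, 1:])"
  using assms
proof (induction Z rule: finite_induct)
  case (insert w Z)
  then obtain p where p: "N = p * (\<Prod>w\<in>Z. [:- w, 1:])" by auto
  have "poly p w * (\<Prod>v\<in>Z. w - v) = 0"
    using insert.prems[of w] by (simp add: p poly_prod)
  then have "poly p w = 0" using insert.hyps by auto
  then obtain r where "p = [:- w, 1:] * r" by (metis poly_eq_0_iff_dvd dvdE)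
  then show ?case using insert.hyps by (intro exI[of _ r]) (simp add: p mult_ac del: mult_pCons_left mult_pCons_right)
qed auto

definition cross :: "'a::field \<Rightarrow> 'a set \<Rightarrow> 'a set \<Rightarrow> 'a" where
  "cross q K L = (\<Prod>z\<in>K. \<Prod>w\<in>L. (z - q * w) / (z - w))"

lemma cross_insert_left:
  "finite K \<Longrightarrow> z \<notin> K \<Longrightarrow> cross q (insert z K) L = (\<Prod>w\<in>L. (z - q * w) / (z - w)) * cross q K L"
  by (simp add: cross_def)

lemma cross_insert_right:
  "finite L \<Longrightarrow> w \<notin> L \<Longrightarrow> cross q K (insert w L) = (\<Prod>z\<in>K. (z - q * w) / (z - w)) * cross q K L"
  unfolding cross_def prod.distrib[symmetric] by (intro prod.cong refl) simp

text \<open>With \<open>c k = (-1) ^ k * q ^ (k choose 2)\<close>, this is the shape that the generating function of the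
Macdonald operators takes on a product kernel, in variables inverse to the original ones.\<close>

definition cross_sum :: "'a::field \<Rightarrow> (nat \<Rightarrow> 'a) \<Rightarrow> 'a poly \<Rightarrow> 'a poly \<Rightarrow> 'a set \<Rightarrow> 'a" where
  "cross_sum q c a b Z =
     (\<Sum>K\<in>Pow Z. c (card K) * cross q K (Z - K) * (\<Prod>z\<in>K. poly a z) * (\<Prod>w\<in>Z - K. poly b w))"

lemma sum_Pow_insert:
  assumes "finite Z" "z \<notin> Z"
  shows "(\<Sum>K\<in>Pow (insert z Z). f K) = (\<Sum>K\<in>Pow Z. f K + f (insert z K))"
proof -
  have "(\<Sum>K\<in>Pow (insert z Z). f K) = (\<Sum>K\<in>Pow Z. f K) + (\<Sum>K\<in>insert z ` Pow Z. f K)"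
    unfolding Pow_insert using assms by (intro sum.union_disjoint) auto
  also have "(\<Sum>K\<in>insert z ` Pow Z. f K) = (\<Sum>K\<in>Pow Z. f (insert z K))"
    using assms by (subst sum.reindex) (auto intro!: inj_onI)
  finally show ?thesis by (simp add: sum.distrib)
qed

lemma cross_sum_insert:
  assumes "finite Z" "z \<notin> Z"
  shows "cross_sum q c a b (insert z Z) =
    (\<Sum>K\<in>Pow Z. cross q K (Z - K) * (\<Prod>v\<in>K. poly a v) * (\<Prod>w\<in>Z - K. poly b w) *
       (c (Suc (card K)) * poly a z * (\<Prod>w\<in>Z - K. (z - q * w) / (z - w)) +
        c (card K) * poly b z * (\<Prod>v\<in>K. (v - q * z) / (v - z))))"
  unfolding cross_sum_def sum_Pow_insert[OF assms]
proof (intro sum.cong refl)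
  fix K assume "K \<in> Pow Z"
  then have K: "finite K" "z \<notin> K" "K \<subseteq> Z" using assms finite_subset by auto
  have e: "insert z Z - K = insert z (Z - K)" "insert z Z - insert z K = Z - K"
    using K assms by auto
  show "c (card K) * cross q K (insert z Z - K) * (\<Prod>v\<in>K. poly a v) * (\<Prod>w\<in>insert z Z - K. poly b w) +
    c (card (insert z K)) * cross q (insert z K) (insert z Z - insert z K) *
      (\<Prod>v\<in>insert z K. poly a v) * (\<Prod>w\<in>insert z Z - insert z K. poly b w) =
    cross q K (Z - K) * (\<Prod>v\<in>K. poly a v) * (\<Prod>w\<in>Z - K. poly b w) *
       (c (Suc (card K)) * poly a z * (\<Prod>w\<in>Z - K. (z - q * w) / (z - w)) +
        c (card K) * poly b z * (\<Prod>v\<in>K. (v - q * z) / (v - z)))"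
    unfolding e using K assms
    by (simp add: cross_insert_left cross_insert_right algebra_simps)
qed

text \<open>As a function of one point \<open>z\<close> the sum has at most simple poles at the other points. The subsets
\<open>K\<close> and \<open>insert w K\<close> have opposite residues at \<open>w\<close>, so nothing of the poles remains. At infinity the cross
factors tend to constants, whence the recursion on \<open>c\<close> that makes the top coefficient vanish.\<close>

lemma cross_sum_poly:
  fixes q :: "'a::field"
  assumes fin: "finite Z" and q: "q \<noteq> 0" and da: "degree a \<le> d" and db: "degree b \<le> d"
  shows "\<exists>p. degree p \<le> d \<and> (\<forall>z. z \<notin> Z \<longrightarrow> cross_sum q c a b (insert z Z) = poly p z) \<and>
    ((\<forall>k. c (Suc k) * coeff a d + q ^ k * c k * coeff b d = 0) \<longrightarrow> coeff p d = 0)"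
proof -
  define X where "X K = cross q K (Z - K) * (\<Prod>v\<in>K. poly a v) * (\<Prod>w\<in>Z - K. poly b w)" for K
  define A where "A K = a * ((\<Prod>w\<in>Z - K. [:- (q * w), 1:]) * (\<Prod>w\<in>K. [:- w, 1:]))" for K
  define B where "B K = b * ((\<Prod>v\<in>K. [:- v, q:]) * (\<Prod>w\<in>Z - K. [:- w, 1:]))" for K
  \<comment> \<open>The sum times the product of all \<open>z - w\<close>, as a polynomial in \<open>z\<close>.\<close>
  define N where "N = (\<Sum>K\<in>Pow Z. smult (X K) (smult (c (Suc (card K))) (A K) + smult (c (card K)) (B K)))"
  have pA: "poly (A K) z = poly a z * ((\<Prod>w\<in>Z - K. z - q * w) * (\<Prod>w\<in>K. z - w))" for K z
    by (simp add: A_def poly_prod)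
  have pB: "poly (B K) z = poly b z * ((\<Prod>v\<in>K. q * z - v) * (\<Prod>w\<in>Z - K. z - w))" for K z
    by (simp add: B_def poly_prod mult.commute[of z])
  have N_generic: "poly N z = cross_sum q c a b (insert z Z) * (\<Prod>w\<in>Z. z - w)" if z: "z \<notin> Z" for z
    unfolding N_def poly_sum cross_sum_insert[OF fin z] sum_distrib_right
  proof (intro sum.cong refl)
    fix K assume "K \<in> Pow Z"
    then have K: "finite K" "z \<notin> K" "K \<subseteq> Z" using fin z finite_subset by auto
    have s: "(\<Prod>w\<in>Z. z - w) = (\<Prod>w\<in>Z - K. z - w) * (\<Prod>w\<in>K. z - w)"
      using K fin by (metis prod.subset_diff)
    have n: "(\<Prod>w\<in>Z - K. z - w) \<noteq> 0" "(\<Prod>w\<in>K. z - w) \<noteq> 0" using K fin z by auto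
    have r: "(\<Prod>v\<in>K. (v - q * z) / (v - z)) = (\<Prod>v\<in>K. q * z - v) / (\<Prod>w\<in>K. z - w)"
      unfolding prod_dividef[symmetric]
    proof (intro prod.cong refl)
      fix v assume "v \<in> K"
      then have "v - z \<noteq> 0" "z - v \<noteq> 0" using K by auto
      then show "(v - q * z) / (v - z) = (q * z - v) / (z - v)"
        by (simp add: divide_simps) (simp add: algebra_simps)
    qed
    show "poly (smult (X K) (smult (c (Suc (card K))) (A K) + smult (c (card K)) (B K))) z =
      cross q K (Z - K) * (\<Prod>v\<in>K. poly a v) * (\<Prod>w\<in>Z - K. poly b w) *
       (c (Suc (card K)) * poly a z * (\<Prod>w\<in>Z - K. (z - q * w) / (z - w)) +
        c (card K) * poly b z * (\<Prod>v\<in>K. (v - q * z) / (v - z))) * (\<Prod>w\<in>Z. z - w)"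
    proof -
      have g: "X K * (u * A * (P / R) + v * B * (Q / S)) * (R * S) = X K * (u * (A * (P * S)) + v * (B * (Q * R)))"
        if "R \<noteq> 0" "S \<noteq> 0" for u v A B P Q R S using that by (simp add: field_simps)
      show ?thesis
        unfolding r s prod_dividef[of _ _ "Z - K"] X_def[symmetric] g[OF n]
        by (simp add: pA pB)
    qed
  qed
  \<comment> \<open>Only the terms with a pole at \<open>w0\<close> survive there, and the sets with and without \<open>w0\<close> cancel.\<close>
  have N_root: "poly N w0 = 0" if w0: "w0 \<in> Z" for w0
  proof -
    define Y where "Y = Z - {w0}"
    have Y: "finite Y" "w0 \<notin> Y" "Z = insert w0 Y" using fin w0 by (auto simp: Y_def)
    have "poly N w0 = (\<Sum>K\<in>Pow (insert w0 Y). X K * (c (Suc (card K)) * poly (A K) w0 + c (card K) * poly (B K) w0))"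
      by (simp add: N_def poly_sum Y(3))
    also have "\<dots> = (\<Sum>K\<in>Pow Y. 0)"
      unfolding sum_Pow_insert[OF Y(1,2)]
    proof (intro sum.cong refl)
      fix K assume "K \<in> Pow Y"
      then have K: "finite K" "w0 \<notin> K" "K \<subseteq> Y" using Y finite_subset by auto
      define L where "L = Y - K"
      have L: "finite L" "w0 \<notin> L" using Y by (auto simp: L_def)
      have e: "Z - K = insert w0 L" "Z - insert w0 K = L" using K Y by (auto simp: L_def)
      have n: "(\<Prod>v\<in>K. v - w0) \<noteq> 0" "(\<Prod>w\<in>L. w0 - w) \<noteq> 0" using K L by auto
      have m1: "(\<Prod>v\<in>K. q * w0 - v) = (- 1) ^ card K * (\<Prod>v\<in>K. v - q * w0)"
        using prod_uminus[of "\<lambda>v. v - q * w0" K] by simp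
      have m2: "(\<Prod>v\<in>K. w0 - v) = (- 1) ^ card K * (\<Prod>v\<in>K. v - w0)"
        using prod_uminus[of "\<lambda>v. v - w0" K] by simp
      have X1: "X K = (\<Prod>v\<in>K. v - q * w0) / (\<Prod>v\<in>K. v - w0) * cross q K L *
          (\<Prod>v\<in>K. poly a v) * (poly b w0 * (\<Prod>w\<in>L. poly b w))"
        unfolding X_def e using L by (simp add: cross_insert_right prod_dividef)
      have X2: "X (insert w0 K) = (\<Prod>w\<in>L. w0 - q * w) / (\<Prod>w\<in>L. w0 - w) * cross q K L *
          (poly a w0 * (\<Prod>v\<in>K. poly a v)) * (\<Prod>w\<in>L. poly b w)"
        unfolding X_def e using K by (simp add: cross_insert_left prod_dividef)
      have A1: "poly (A K) w0 = poly a w0 * ((w0 - q * w0) * (\<Prod>w\<in>L. w0 - q * w) *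
          ((- 1) ^ card K * (\<Prod>v\<in>K. v - w0)))"
        unfolding pA e m2 using L by simp
      have A2: "poly (A (insert w0 K)) w0 = 0" unfolding pA using K by simp
      have B1: "poly (B K) w0 = 0" unfolding pB e using L by simp
      have B2: "poly (B (insert w0 K)) w0 = poly b w0 * ((q * w0 - w0) *
          ((- 1) ^ card K * (\<Prod>v\<in>K. v - q * w0)) * (\<Prod>w\<in>L. w0 - w))"
        unfolding pB e using K by (simp add: m1)
      have cc: "card (insert w0 K) = Suc (card K)" using K by simp
      show "X K * (c (Suc (card K)) * poly (A K) w0 + c (card K) * poly (B K) w0) +
        X (insert w0 K) * (c (Suc (card (insert w0 K))) * poly (A (insert w0 K)) w0 +
          c (card (insert w0 K)) * poly (B (insert w0 K)) w0) = 0"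
      proof -
        have g: "(P / P' * C * A * (b * B)) * (k * (a * ((w0 - q * w0) * Q * (s * P'))) + k' * 0) +
          (Q / Q' * C * (a * A) * B) * (k'' * 0 + k * (b * ((q * w0 - w0) * (s * P) * Q'))) = 0"
          if "P' \<noteq> 0" "Q' \<noteq> 0" for P P' C A a b B k k' k'' Q Q' s
        proof -
          have "(P / P' * C * A * (b * B)) * (k * (a * ((w0 - q * w0) * Q * (s * P')))) =
            C * A * b * B * k * a * (w0 - q * w0) * Q * s * P"
            using that by simp
          moreover have "(Q / Q' * C * (a * A) * B) * (k * (b * ((q * w0 - w0) * (s * P) * Q'))) =
            - (C * A * b * B * k * a * (w0 - q * w0) * Q * s * P)"
          proof -
            have "(Q / Q' * C * (a * A) * B) * (k * (b * ((q * w0 - w0) * (s * P) * Q'))) =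
              Q * C * a * A * B * k * b * (q * w0 - w0) * s * P" using that by simp
            then show ?thesis by (simp add: algebra_simps)
          qed
          ultimately show ?thesis by simp
        qed
        show ?thesis unfolding A2 B1 A1 B2 X1 X2 cc by (rule g[OF n])
      qed
    qed
    finally show ?thesis by simp
  qed
  obtain p where p: "N = p * (\<Prod>w\<in>Z. [:- w, 1:])"
    using roots_factor[OF fin, of N] N_root by blast
  have lin: "degree (\<Prod>w\<in>K. [:- h w, r:]) = card K" "coeff (\<Prod>w\<in>K. [:- h w, r:]) (card K) = r ^ card K"
    if "finite K" "r \<noteq> 0" for K and h :: "'a \<Rightarrow> 'a" and r
  proof -
    show d: "degree (\<Prod>w\<in>K. [:- h w, r:]) = card K"
      using that by (subst degree_prod_eq_sum_degree) auto
    show "coeff (\<Prod>w\<in>K. [:- h w, r:]) (card K) = r ^ card K"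
      using that lead_coeff_prod[of "\<lambda>w. [:- h w, r:]" K] by (simp add: d)
  qed
  note lin1 = lin(1)[where h = "\<lambda>w. w"] lin(2)[where h = "\<lambda>w. w"]
    lin(1)[where h = "\<lambda>w. q * w"] lin(2)[where h = "\<lambda>w. q * w"]
  have dZ: "degree (\<Prod>w\<in>Z. [:- w, 1:]) = card Z" "coeff (\<Prod>w\<in>Z. [:- w, 1:]) (card Z) = 1"
    using lin1(1,2)[of Z 1] fin by simp_all
  have AB: "degree (A K) \<le> d + card Z" "coeff (A K) (d + card Z) = coeff a d"
    "degree (B K) \<le> d + card Z" "coeff (B K) (d + card Z) = coeff b d * q ^ card K"
    if "K \<in> Pow Z" for K
  proof -
    have K: "finite K" "finite (Z - K)" "K \<subseteq> Z" using that fin finite_subset by auto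
    have cz: "card Z = card (Z - K) + card K" "card Z = card K + card (Z - K)"
      using K fin card_mono[of Z K] by (simp_all add: card_Diff_subset)
    have d1: "degree ((\<Prod>w\<in>Z - K. [:- (q * w), 1:]) * (\<Prod>w\<in>K. [:- w, 1:])) \<le> card Z"
      unfolding cz(1) by (rule order.trans[OF degree_mult_le]) (use lin1 K in simp)
    have c1: "coeff ((\<Prod>w\<in>Z - K. [:- (q * w), 1:]) * (\<Prod>w\<in>K. [:- w, 1:])) (card Z) = 1"
      unfolding cz(1) by (subst coeff_mult_top) (use lin1 K in simp_all)
    have d2: "degree ((\<Prod>v\<in>K. [:- v, q:]) * (\<Prod>w\<in>Z - K. [:- w, 1:])) \<le> card Z"
      unfolding cz(2) by (rule order.trans[OF degree_mult_le]) (use lin1 K q in simp)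
    have c2: "coeff ((\<Prod>v\<in>K. [:- v, q:]) * (\<Prod>w\<in>Z - K. [:- w, 1:])) (card Z) = q ^ card K"
      unfolding cz(2) by (subst coeff_mult_top) (use lin1 K q in simp_all)
    show "degree (A K) \<le> d + card Z" unfolding A_def
      by (rule order.trans[OF degree_mult_le]) (use da d1 in simp)
    show "degree (B K) \<le> d + card Z" unfolding B_def
      by (rule order.trans[OF degree_mult_le]) (use db d2 in simp)
    show "coeff (A K) (d + card Z) = coeff a d" unfolding A_def
      by (subst coeff_mult_top[OF da d1]) (simp add: c1)
    show "coeff (B K) (d + card Z) = coeff b d * q ^ card K" unfolding B_def
      by (subst coeff_mult_top[OF db d2]) (simp add: c2)
  qed
  have dN: "degree N \<le> d + card Z"
    unfolding N_def using fin AB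
    by (intro degree_sum_le order.trans[OF degree_smult_le] degree_add_le) auto
  have dp: "degree p \<le> d"
  proof (cases "p = 0")
    case False
    have "(\<Prod>w\<in>Z. [:- w, 1:]) \<noteq> (0 :: 'a poly)" using fin by auto
    then show ?thesis using dN False by (simp add: p degree_mult_eq dZ)
  qed simp
  show ?thesis
  proof (intro exI[of _ p] conjI allI impI dp)
    fix z assume z: "z \<notin> Z"
    have "(\<Prod>w\<in>Z. z - w) \<noteq> 0" using z fin by auto
    then show "cross_sum q c a b (insert z Z) = poly p z"
      using N_generic[OF z] by (simp add: p poly_prod)
  next
    assume *: "\<forall>k. c (Suc k) * coeff a d + q ^ k * c k * coeff b d = 0"
    have "coeff p d = coeff N (d + card Z)"
      unfolding p using dZ dp by (subst coeff_mult_top) auto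
    also have "\<dots> = (\<Sum>K\<in>Pow Z. 0)"
      unfolding N_def coeff_sum
    proof (intro sum.cong refl)
      fix K assume K: "K \<in> Pow Z"
      show "coeff (smult (X K) (smult (c (Suc (card K))) (A K) + smult (c (card K)) (B K))) (d + card Z) = 0"
        using spec[OF *, of "card K"] by (simp add: AB[OF K] mult_ac)
    qed
    finally show "coeff p d = 0" by simp
  qed
qed

section \<open>Interpolation at geometric progressions\<close>

text \<open>For a vector \<open>\<delta>\<close> the union of the progressions $x_i, q x_i, \ldots, q^{\delta_i - 1}x_i$. The
product $\prod_i (z - q^{\gamma_i}x_i)$ vanishes at one of these points unless $\delta \le \gamma$.\<close>

definition nodes :: "'a::field \<Rightarrow> (nat \<Rightarrow> 'a) \<Rightarrow> nat \<Rightarrow> (nat \<Rightarrow> nat) \<Rightarrow> 'a set" where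
  "nodes q x n \<delta> = {q ^ j * x i | i j. i < n \<and> j < \<delta> i}"

definition generic_nodes :: "'a::field \<Rightarrow> (nat \<Rightarrow> 'a) \<Rightarrow> nat \<Rightarrow> bool" where
  "generic_nodes q x n \<longleftrightarrow>
     (\<forall>i j i' j'. i < n \<longrightarrow> i' < n \<longrightarrow> q ^ j * x i = q ^ j' * x i' \<longrightarrow> i = i' \<and> j = j')"

lemma generic_nodesD:
  "generic_nodes q x n \<Longrightarrow> i < n \<Longrightarrow> i' < n \<Longrightarrow> q ^ j * x i = q ^ j' * x i' \<Longrightarrow> i = i' \<and> j = j'"
  unfolding generic_nodes_def by blast

lemma nodes_eq_image: "nodes q x n \<delta> = (\<lambda>(i, j). q ^ j * x i) ` (SIGMA i:{..<n}. {..<\<delta> i})"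
  unfolding nodes_def by force

lemma finite_nodes [simp]: "finite (nodes q x n \<delta>)"
  by (simp add: nodes_eq_image)

lemma inj_on_nodes:
  assumes "generic_nodes q x n"
  shows "inj_on (\<lambda>(i, j). q ^ j * x i) (SIGMA i:{..<n}. A i)"
  by (rule inj_onI) (auto dest: generic_nodesD[OF assms])

lemma card_nodes:
  assumes "generic_nodes q x n"
  shows "card (nodes q x n \<delta>) = (\<Sum>i<n. \<delta> i)"
  unfolding nodes_eq_image by (subst card_image[OF inj_on_nodes[OF assms]]) simp

lemma prod_nodes:
  assumes "generic_nodes q x n"
  shows "prod f (nodes q x n \<delta>) = (\<Prod>i<n. \<Prod>j<\<delta> i. f (q ^ j * x i))"
  unfolding nodes_eq_image
  by (subst prod.reindex[OF inj_on_nodes[OF assms]]) (simp add: prod.Sigma o_def split_def)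

lemma node_in_nodes_iff:
  assumes "generic_nodes q x n" "i < n"
  shows "q ^ j * x i \<in> nodes q x n \<delta> \<longleftrightarrow> j < \<delta> i"
  using assms generic_nodesD[OF assms(1)] unfolding nodes_def by blast

lemma nodes_shift_base:
  assumes "i < n"
  shows "insert (x i) (nodes q (x(i := q * x i)) n \<delta>) = nodes q x n (\<delta>(i := Suc (\<delta> i)))"
proof -
  have "nodes q (x(i := q * x i)) n \<delta> =
      {q ^ j * x l | l j. l < n \<and> l \<noteq> i \<and> j < \<delta> l} \<union> {q ^ Suc j * x i | j. j < \<delta> i}"
    unfolding nodes_def using assms by (auto simp: mult_ac split: if_splits) (metis+)?
  moreover have "nodes q x n (\<delta>(i := Suc (\<delta> i))) =
      {q ^ j * x l | l j. l < n \<and> l \<noteq> i \<and> j < \<delta> l} \<union> {q ^ j * x i | j. j < Suc (\<delta> i)}"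
    unfolding nodes_def using assms by (auto split: if_splits) (metis+)?
  moreover have "{q ^ j * x i | j. j < Suc (\<delta> i)} = insert (x i) {q ^ Suc j * x i | j. j < \<delta> i}"
  proof -
    have "{q ^ j * x i | j. j < Suc (\<delta> i)} = (\<lambda>j. q ^ j * x i) ` {..<Suc (\<delta> i)}" by auto
    also have "\<dots> = insert (x i) ((\<lambda>j. q ^ Suc j * x i) ` {..<\<delta> i})"
      by (subst lessThan_Suc_eq_insert_0) (simp add: image_image)
    also have "(\<lambda>j. q ^ Suc j * x i) ` {..<\<delta> i} = {q ^ Suc j * x i | j. j < \<delta> i}" by auto
    finally show ?thesis .
  qed
  ultimately show ?thesis by auto
qed

lemma orbit_shift_base:
  fixes q :: "'a::field"
  assumes "i < n" "l < n"
  shows "\<exists>j'. q ^ j * (x(i := q * x i)) l = q ^ j' * x l \<and> (l = i \<longrightarrow> j' = Suc j) \<and> (l \<noteq> i \<longrightarrow> j' = j)"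
  by (cases "l = i") (auto simp: mult.assoc mult.left_commute intro!: exI[of _ "Suc j"])

lemma generic_nodes_shift_base:
  assumes g: "generic_nodes q x n" and i: "i < n"
  shows "generic_nodes q (x(i := q * x i)) n"
  unfolding generic_nodes_def
proof (intro allI impI)
  fix l j l' j' assume h: "l < n" "l' < n" "q ^ j * (x(i := q * x i)) l = q ^ j' * (x(i := q * x i)) l'"
  obtain k k' where k: "q ^ j * (x(i := q * x i)) l = q ^ k * x l" "l = i \<longrightarrow> k = Suc j" "l \<noteq> i \<longrightarrow> k = j"
    "q ^ j' * (x(i := q * x i)) l' = q ^ k' * x l'" "l' = i \<longrightarrow> k' = Suc j'" "l' \<noteq> i \<longrightarrow> k' = j'"
    using orbit_shift_base[OF i h(1), of q j x] orbit_shift_base[OF i h(2), of q j' x] by blast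
  then have "l = l' \<and> k = k'" using generic_nodesD[OF g h(1,2), of k k'] h(3) by simp
  then show "l = l' \<and> j = j'" using k by (cases "l = i") auto
qed

text \<open>A function on \<open>m\<close>-element sets that has degree less than \<open>n\<close> in each element is determined by its
values at the node sets of size \<open>m\<close>. The set \<open>S\<close> collects points that are to be avoided.
The proof fixes one element \<open>x i\<close> of the argument: what remains is a function on \<open>(m - 1)\<close>-element sets of
the same kind, with \<open>x i\<close> replaced by \<open>q * x i\<close>.\<close>

lemma interpolation_zero:
  fixes H :: "'a::field set \<Rightarrow> 'a"
  assumes "generic_nodes q x n"
    and "\<And>i j. i < n \<Longrightarrow> q ^ j * x i \<notin> S"
    and "\<And>Z. finite Z \<Longrightarrow> Suc (card Z) = m \<Longrightarrow> Z \<inter> S = {} \<Longrightarrow>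
       \<exists>p. degree p < n \<and> (\<forall>z. z \<notin> Z \<union> S \<longrightarrow> H (insert z Z) = poly p z)"
    and "\<And>\<delta>. \<forall>i\<ge>n. \<delta> i = 0 \<Longrightarrow> (\<Sum>i<n. \<delta> i) = m \<Longrightarrow> H (nodes q x n \<delta>) = 0"
    and "finite Z" "card Z = m" "Z \<inter> S = {}" "\<And>i j. i < n \<Longrightarrow> q ^ j * x i \<notin> Z"
  shows "H Z = 0"
  using assms
proof (induction m arbitrary: x S H Z)
  case 0
  have "nodes q x n (\<lambda>_. 0) = {}" by (simp add: nodes_def)
  then show ?case using 0(4)[of "\<lambda>_. 0"] 0(5,6) by simp
next
  case (Suc m)
  note gen = Suc.prems(1) and orb = Suc.prems(2) and pol = Suc.prems(3) and van = Suc.prems(4)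
  obtain z Z' where Z: "Z = insert z Z'" "z \<notin> Z'" "finite Z'" "card Z' = m"
    using Suc.prems(5,6) by (metis card_Suc_eq finite_insert)
  have Z': "Z' \<inter> S = {}" using Suc.prems(7) Z by auto
  obtain p where p: "degree p < n" "\<And>z. z \<notin> Z' \<union> S \<Longrightarrow> H (insert z Z') = poly p z"
    using pol[of Z'] Z Z' by auto
  \<comment> \<open>One element of the argument is put equal to \<open>x i\<close>; the progression at \<open>i\<close> then starts one step later.\<close>
  have root: "poly p (x i) = 0" if i: "i < n" for i
  proof -
    define x' where "x' = x(i := q * x i)"
    have gen': "generic_nodes q x' n" unfolding x'_def by (rule generic_nodes_shift_base[OF gen i])
    have orbi: "\<exists>k. q ^ j * x' l = q ^ k * x l \<and> (l = i \<longrightarrow> k = Suc j)" if "l < n" for l j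
      using orbit_shift_base[OF i that, of q j x] unfolding x'_def by blast
    have xi: "q ^ j * x' l \<noteq> x i" if l: "l < n" for l j
    proof
      assume eq: "q ^ j * x' l = x i"
      obtain k where k: "q ^ j * x' l = q ^ k * x l" "l = i \<longrightarrow> k = Suc j"
        using orbi[OF l, of j] by blast
      have "l = i \<and> k = 0" using generic_nodesD[OF gen l i, of k 0] k(1) eq by simp
      then show False using k(2) by simp
    qed
    have "H (insert (x i) Z') = 0"
    proof (rule Suc.IH[of x' "insert (x i) S" "\<lambda>Y. H (insert (x i) Y)" Z'])
      show "generic_nodes q x' n" by (rule gen')
      show "q ^ j * x' l \<notin> insert (x i) S" if "l < n" for l j
        using orbi[OF that, of j] xi[OF that, of j] orb[OF that] by force
      show "\<exists>p. degree p < n \<and> (\<forall>z. z \<notin> Y \<union> insert (x i) S \<longrightarrow> H (insert (x i) (insert z Y)) = poly p z)"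
        if Y: "finite Y" "Suc (card Y) = m" "Y \<inter> insert (x i) S = {}" for Y
      proof -
        have "x i \<notin> S" using orb[OF i, of 0] by simp
        then obtain p where p: "degree p < n"
          "\<And>z. z \<notin> insert (x i) Y \<union> S \<Longrightarrow> H (insert z (insert (x i) Y)) = poly p z"
          using pol[of "insert (x i) Y"] Y by auto
        then show ?thesis by (intro exI[of _ p]) (auto simp: insert_commute)
      qed
      show "H (insert (x i) (nodes q x' n \<delta>)) = 0"
        if "\<forall>i\<ge>n. \<delta> i = 0" "(\<Sum>i<n. \<delta> i) = m" for \<delta>
      proof -
        have "(\<Sum>l<n. (\<delta>(i := Suc (\<delta> i))) l) = Suc m"
          using i that(2) by (simp add: sum.remove[of _ i] fun_upd_def)
        moreover have "\<forall>l\<ge>n. (\<delta>(i := Suc (\<delta> i))) l = 0" using i that(1) by auto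
        ultimately show ?thesis
          unfolding x'_def nodes_shift_base[OF i] by (intro van)
      qed
      show "finite Z'" "card Z' = m" by fact+
      show "Z' \<inter> insert (x i) S = {}" using Suc.prems(8)[OF i, of 0] Z' Z by auto
      show "q ^ j * x' l \<notin> Z'" if "l < n" for l j
        using orbi[OF that, of j] Suc.prems(8)[OF that] Z by force
    qed
    moreover have "x i \<notin> Z' \<union> S" using Suc.prems(8)[OF i, of 0] orb[OF i, of 0] Z by auto
    ultimately show ?thesis using p(2)[of "x i"] by simp
  qed
  have inj: "inj_on x {..<n}"
    using generic_nodesD[OF gen, of _ _ 0 0] by (intro inj_onI) auto
  have "p = 0"
  proof (rule ccontr)
    assume "p \<noteq> 0"
    then have "card (x ` {..<n}) \<le> degree p"
      using root by (intro order.trans[OF card_mono card_poly_roots_bound]) (auto intro: poly_roots_finite)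
    then show False using p(1) by (simp add: card_image[OF inj])
  qed
  moreover have "z \<notin> Z' \<union> S" using Z Suc.prems(7) by auto
  ultimately show ?case using p(2)[of z] by (simp add: Z)
qed

lemma choose_two_Suc: "Suc k choose 2 = (k choose 2) + k"
  by (simp add: numeral_2_eq_2)

text \<open>The sign and power of \<open>q\<close> in \<open>phi\<close>, up to the common sign $(-1)^m$, times the factor $q^k$ that the
value at \<open>0\<close> of $\prod_i (z - q^{\beta_i}x_i)$ contributes when $|\beta| = k$.\<close>

definition phi_weight :: "'a::field \<Rightarrow> nat \<Rightarrow> nat \<Rightarrow> 'a" where
  "phi_weight q m k = (- 1) ^ k * q ^ ((Suc (m - k) choose 2) + k)"

text \<open>By \<open>cross_sum_poly\<close> the sum does not depend on any one of its points, and at a point \<open>0\<close> the subsets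
with and without \<open>0\<close> cancel.\<close>

lemma cross_sum_phi_const:
  fixes q :: "'a::field"
  assumes fin: "finite M" and M0: "0 \<notin> M" and m: "card M = Suc m" and q: "q \<noteq> 0"
  shows "(\<Sum>K\<in>Pow M. phi_weight q (Suc m) (card K) * cross q K (M - K)) = 0"
proof -
  obtain z Z where Z: "M = insert z Z" "z \<notin> Z" "finite Z" "card Z = m"
    using fin m by (metis card_Suc_eq finite_insert)
  have Z0: "0 \<notin> Z" using M0 Z by auto
  define c where "c = phi_weight q (Suc m)"
  obtain p where p: "degree p \<le> 0" "\<And>z. z \<notin> Z \<Longrightarrow> cross_sum q c 1 1 (insert z Z) = poly p z"
    using cross_sum_poly[OF Z(3) q, of 1 0 1 c] by auto
  obtain a where a: "p = [:a:]" using p(1) by (metis degree_eq_zeroE le_zero_eq)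
  have "(\<Sum>K\<in>Pow M. c (card K) * cross q K (M - K)) = cross_sum q c 1 1 (insert z Z)"
    by (simp add: cross_sum_def Z)
  \<comment> \<open>The sum is constant in the point \<open>z\<close>, which may be moved to \<open>0\<close>.\<close>
  also have "\<dots> = cross_sum q c 1 1 (insert 0 Z)"
    using p(2)[OF Z(2)] p(2)[OF Z0] a by simp
  also have "\<dots> = (\<Sum>K\<in>Pow Z. 0)"
    unfolding cross_sum_insert[OF Z(3) Z0]
  proof (intro sum.cong refl)
    fix K assume "K \<in> Pow Z"
    then have K: "finite K" "K \<subseteq> Z" using Z finite_subset by auto
    have 1: "(\<Prod>w\<in>Z - K. (0 - q * w) / (0 - w)) = q ^ card (Z - K)"
      using Z0 by (subst prod_constant[symmetric], intro prod.cong refl) auto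
    have 2: "(\<Prod>v\<in>K. (v - q * 0) / (v - 0)) = 1"
      using Z0 K by (intro prod.neutral) auto
    have le: "card K \<le> m" using K Z card_mono by blast
    have 3: "card (Z - K) = m - card K" using K Z by (simp add: card_Diff_subset)
    have e: "(Suc (m - card K) choose 2) + Suc (card K) + (m - card K) =
        (Suc (Suc m - card K) choose 2) + card K"
      using le by (simp add: choose_two_Suc Suc_diff_le)
    have "q ^ ((Suc (m - card K) choose 2) + Suc (card K)) * q ^ (m - card K) =
        q ^ ((Suc (Suc m - card K) choose 2) + card K)"
      unfolding power_add[symmetric] e ..
    then have "c (Suc (card K)) * q ^ (m - card K) = - c (card K)"
      unfolding c_def phi_weight_def diff_Suc_Suc by (simp only: mult.assoc) simp
    then show "cross q K (Z - K) * (\<Prod>v\<in>K. poly 1 v) * (\<Prod>w\<in>Z - K. poly 1 w) *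
       (c (Suc (card K)) * poly 1 0 * (\<Prod>w\<in>Z - K. (0 - q * w) / (0 - w)) +
        c (card K) * poly 1 0 * (\<Prod>v\<in>K. (v - q * 0) / (v - 0))) = 0"
      unfolding 1 2 3 by simp
  qed
  finally show ?thesis by (simp add: c_def)
qed

text \<open>Induction on the number of auxiliary points \<open>w r\<close>. As a polynomial in the last one, the sum has degree
less than \<open>card M\<close> by the case of fewer points, and at each of the \<open>card M\<close> points of \<open>M\<close> it reduces to a
multiple of the sum for the set without that point and without the last auxiliary point.\<close>

lemma cross_sum_phi_zero:
  fixes q :: "'a::field" and w :: "nat \<Rightarrow> 'a"
  assumes "finite M" "0 \<notin> M" "N < card M" "q \<noteq> 0"
  shows "(\<Sum>K\<in>Pow M. phi_weight q (card M) (card K) * cross q K (M - K) *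
      (\<Prod>r<N. (\<Prod>z\<in>K. w r - q * z) * (\<Prod>z\<in>M - K. w r - z))) = 0"
  using assms
proof (induction N arbitrary: M)
  case 0
  then obtain m where "card M = Suc m" using gr0_implies_Suc by auto
  then show ?case using cross_sum_phi_const[OF 0(1,2) _ 0(4)] by simp
next
  case (Suc N)
  define R where "R M K = (\<Prod>r<N. (\<Prod>z\<in>K. w r - q * z) * (\<Prod>z\<in>M - K. w r - z))" for M K
  define Q where "Q K = (\<Prod>z\<in>K. [:- (q * z), 1:]) * (\<Prod>z\<in>M - K. [:- z, 1:])" for K
  define c where "c K = phi_weight q (card M) (card K) * cross q K (M - K) * R M K" for K
  define P where "P = (\<Sum>K\<in>Pow M. smult (c K) (Q K))"
  note fin = Suc.prems(1)
  have lin: "degree (\<Prod>z\<in>K. [:- h z, 1:]) = card K" "coeff (\<Prod>z\<in>K. [:- h z, 1:]) (card K) = 1"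
    if "finite K" for K and h :: "'a \<Rightarrow> 'a"
  proof -
    show d: "degree (\<Prod>w\<in>K. [:- h w, 1:]) = card K"
      using that by (subst degree_prod_eq_sum_degree) auto
    show "coeff (\<Prod>w\<in>K. [:- h w, 1:]) (card K) = 1"
      using that lead_coeff_prod[of "\<lambda>w. [:- h w, 1:]" K] by (simp add: d)
  qed
  have Q: "degree (Q K) \<le> card M" "coeff (Q K) (card M) = 1" if "K \<in> Pow M" for K
  proof -
    have K: "finite K" "finite (M - K)" "K \<subseteq> M" using that fin finite_subset by auto
    have cz: "card M = card K + card (M - K)"
      using K fin card_mono[of M K] by (simp add: card_Diff_subset)
    show "degree (Q K) \<le> card M" unfolding Q_def cz
      by (rule order.trans[OF degree_mult_le])
         (use lin(1)[OF K(1), of "\<lambda>z. q * z"] lin(1)[OF K(2), of "\<lambda>z. z"] in simp)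
    show "coeff (Q K) (card M) = 1" unfolding Q_def cz
      using lin[OF K(1), of "\<lambda>z. q * z"] lin[OF K(2), of "\<lambda>z. z"] by (subst coeff_mult_top) auto
  qed
  have "degree P \<le> card M"
    unfolding P_def using fin Q by (intro degree_sum_le order.trans[OF degree_smult_le]) auto
  moreover have "coeff P (card M) = (\<Sum>K\<in>Pow M. c K)"
    unfolding P_def coeff_sum using Q by (intro sum.cong refl) simp
  moreover have "(\<Sum>K\<in>Pow M. c K) = 0"
    using Suc.IH[OF fin Suc.prems(2)] Suc.prems(3,4) by (simp add: c_def R_def)
  ultimately have dP: "degree P < card M"
    using Suc.prems(3) by (metis le_neq_implies_less leading_coeff_0_iff degree_0 gr_implies_not0 not_gr_zero)
  have pQ: "poly (Q K) v = (\<Prod>z\<in>K. v - q * z) * (\<Prod>z\<in>M - K. v - z)" for K v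
    by (simp add: Q_def poly_prod)
  \<comment> \<open>At \<open>w = z0\<close> only the sets containing \<open>z0\<close> contribute, and they give the sum for \<open>M - {z0}\<close>.\<close>
  have root: "poly P z0 = 0" if z0: "z0 \<in> M" for z0
  proof -
    define Y where "Y = M - {z0}"
    have Y: "finite Y" "z0 \<notin> Y" "M = insert z0 Y" using fin z0 by (auto simp: Y_def)
    have cM: "card M = Suc (card Y)" using Y by simp
    have "poly P z0 = (\<Sum>K\<in>Pow (insert z0 Y). c K * poly (Q K) z0)"
      by (simp add: P_def poly_sum Y(3))
    also have "\<dots> = (\<Sum>K\<in>Pow Y. - q * (z0 - q * z0) * (\<Prod>z\<in>Y. z0 - q * z) * (\<Prod>r<N. w r - q * z0) *
        (phi_weight q (card Y) (card K) * cross q K (Y - K) * R Y K))"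
      unfolding sum_Pow_insert[OF Y(1,2)]
    proof (intro sum.cong refl)
      fix K assume "K \<in> Pow Y"
      then have K: "finite K" "z0 \<notin> K" "K \<subseteq> Y" using Y finite_subset by auto
      define L where "L = Y - K"
      have L: "finite L" "z0 \<notin> L" using Y by (auto simp: L_def)
      have e: "M - K = insert z0 L" "M - insert z0 K = L" using K Y by (auto simp: L_def)
      have n: "(\<Prod>w\<in>L. z0 - w) \<noteq> 0" using L by auto
      have Q0: "poly (Q K) z0 = 0" unfolding pQ e using L by simp
      have Q1: "poly (Q (insert z0 K)) z0 = (z0 - q * z0) * (\<Prod>z\<in>K. z0 - q * z) * (\<Prod>z\<in>L. z0 - z)"
        unfolding pQ e using K by simp
      have R1: "R M (insert z0 K) = (\<Prod>r<N. w r - q * z0) * R Y K"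
        unfolding R_def e L_def[symmetric] using K by (simp add: mult.assoc flip: prod.distrib)
      have C1: "cross q (insert z0 K) L = (\<Prod>w\<in>L. z0 - q * w) / (\<Prod>w\<in>L. z0 - w) * cross q K L"
        using K by (simp add: cross_insert_left prod_dividef)
      have ph: "phi_weight q (card M) (card (insert z0 K)) = - q * phi_weight q (card Y) (card K)"
        unfolding phi_weight_def cM using K by simp
      have s: "(\<Prod>z\<in>Y. z0 - q * z) = (\<Prod>z\<in>L. z0 - q * z) * (\<Prod>z\<in>K. z0 - q * z)"
        using K Y unfolding L_def by (metis prod.subset_diff)
      have g: "(A * (B / D * E) * (F * G)) * (H * I * D) = A * H * (B * I) * F * (E * G)"
        if "D \<noteq> 0" for A B D E F G H I :: 'a using that by simp
      show "c K * poly (Q K) z0 + c (insert z0 K) * poly (Q (insert z0 K)) z0 =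
        - q * (z0 - q * z0) * (\<Prod>z\<in>Y. z0 - q * z) * (\<Prod>r<N. w r - q * z0) *
        (phi_weight q (card Y) (card K) * cross q K (Y - K) * R Y K)"
        unfolding Q0 Q1 c_def R1 e C1 ph g[OF n] unfolding s L_def[symmetric] by simp
    qed
    also have "\<dots> = - q * (z0 - q * z0) * (\<Prod>z\<in>Y. z0 - q * z) * (\<Prod>r<N. w r - q * z0) *
       (\<Sum>K\<in>Pow Y. phi_weight q (card Y) (card K) * cross q K (Y - K) * R Y K)"
      by (simp add: sum_distrib_left)
    also have "\<dots> = 0"
      using Suc.IH[of Y] Y Suc.prems by (simp add: R_def)
    finally show ?thesis .
  qed
  have "P = 0"
  proof (rule ccontr)
    assume "P \<noteq> 0"
    then have "card M \<le> degree P"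
      using root by (intro order.trans[OF card_mono card_poly_roots_bound]) (auto intro: poly_roots_finite)
    then show False using dP by simp
  qed
  then have "poly P (w N) = 0" by simp
  then show ?case
    by (simp add: P_def poly_sum c_def R_def pQ mult_ac)
qed

section \<open>Multi-indices and their node sets\<close>

lemma finite_multi_bounded: "finite {\<beta>. \<beta> \<in> multi n \<and> (\<forall>i<n. \<beta> i \<le> N i)}"
proof (rule finite_subset)
  show "{\<beta>. \<beta> \<in> multi n \<and> (\<forall>i<n. \<beta> i \<le> N i)} \<subseteq>
      (\<lambda>g i. if i < n then g i else 0) ` (PiE {..<n} (\<lambda>i. {..N i}))"
  proof
    fix \<beta> assume b: "\<beta> \<in> {\<beta>. \<beta> \<in> multi n \<and> (\<forall>i<n. \<beta> i \<le> N i)}"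
    have "\<beta> = (\<lambda>i. if i < n then restrict \<beta> {..<n} i else 0)"
      using b by (auto simp: multi_def fun_eq_iff)
    moreover have "restrict \<beta> {..<n} \<in> PiE {..<n} (\<lambda>i. {..N i})" using b by auto
    ultimately show "\<beta> \<in> (\<lambda>g i. if i < n then g i else 0) ` (PiE {..<n} (\<lambda>i. {..N i}))"
      by (rule image_eqI)
  qed
qed (intro finite_imageI finite_PiE, auto)

lemma finite_multi_le: "finite {\<beta>. \<beta> \<in> multi n \<and> \<beta> \<le> \<alpha>}"
  by (rule finite_subset[OF _ finite_multi_bounded[of n \<alpha>]]) (auto simp: le_fun_def)

lemma component_le_msize: "i < n \<Longrightarrow> \<gamma> i \<le> msize n \<gamma>"
  unfolding msize_def by (rule member_le_sum) auto

lemma finite_multi_msize_le: "finite {\<gamma>. \<gamma> \<in> multi n \<and> msize n \<gamma> \<le> m}"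
  by (rule finite_subset[OF _ finite_multi_bounded[of n "\<lambda>_. m"]])
     (auto intro: order.trans[OF component_le_msize])

lemma finite_multi_msize_eq: "finite {\<gamma>. \<gamma> \<in> multi n \<and> msize n \<gamma> = m}"
  by (rule finite_subset[OF _ finite_multi_msize_le[of n m]]) auto

lemma msize_mono: "\<beta> \<le> \<alpha> \<Longrightarrow> msize n \<beta> \<le> msize n \<alpha>"
  unfolding msize_def le_fun_def by (intro sum_mono) auto

lemma multi_le_msize_eq:
  assumes "\<beta> \<in> multi n" "\<alpha> \<in> multi n" "\<beta> \<le> \<alpha>" "msize n \<beta> = msize n \<alpha>"
  shows "\<beta> = \<alpha>"
proof
  fix i
  have "\<beta> i = \<alpha> i" if "i < n"
  proof (rule ccontr)
    assume "\<beta> i \<noteq> \<alpha> i"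
    then have "\<beta> i < \<alpha> i" using assms(3) by (simp add: le_fun_def order_less_le)
    then have "msize n \<beta> < msize n \<alpha>"
      unfolding msize_def using that assms(3) by (intro sum_strict_mono_ex1) (auto simp: le_fun_def)
    then show False using assms(4) by simp
  qed
  then show "\<beta> i = \<alpha> i" using assms(1,2) by (cases "i < n") (auto simp: multi_def)
qed

lemma nodes_mono: "\<beta> \<le> \<alpha> \<Longrightarrow> nodes q x n \<beta> \<subseteq> nodes q x n \<alpha>"
  unfolding nodes_def le_fun_def by (blast intro: order.strict_trans2)

lemma inj_on_nodes_multi:
  assumes "generic_nodes q x n"
  shows "inj_on (nodes q x n) (multi n)"
proof (rule inj_onI)
  fix \<beta> \<gamma> assume h: "\<beta> \<in> multi n" "\<gamma> \<in> multi n" "nodes q x n \<beta> = nodes q x n \<gamma>"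
  show "\<beta> = \<gamma>"
  proof
    fix i
    have "(j < \<beta> i) = (j < \<gamma> i)" if "i < n" for j
      using node_in_nodes_iff[OF assms that, of j \<beta>] node_in_nodes_iff[OF assms that, of j \<gamma>] h(3) by simp
    then have "\<beta> i = \<gamma> i" if "i < n" using that by (metis nat_neq_iff)
    then show "\<beta> i = \<gamma> i" using h by (cases "i < n") (auto simp: multi_def)
  qed
qed

text \<open>If \<open>K\<close> is not an initial segment of each progression, some \<open>q * w\<close> lies in \<open>K\<close> with \<open>w\<close> outside \<open>K\<close>,
and the corresponding factor is zero.\<close>

lemma cross_not_nodes:
  assumes gen: "generic_nodes q x n" and K: "K \<subseteq> nodes q x n \<alpha>"
    and not: "\<And>\<beta>. \<beta> \<in> multi n \<Longrightarrow> \<beta> \<le> \<alpha> \<Longrightarrow> K \<noteq> nodes q x n \<beta>"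
  shows "cross q K (nodes q x n \<alpha> - K) = 0"
proof -
  have "\<exists>i j. i < n \<and> q ^ Suc j * x i \<in> K \<and> q ^ j * x i \<notin> K"
  proof (rule ccontr)
    assume "\<not> ?thesis"
    then have down: "q ^ j * x i \<in> K" if "i < n" "q ^ Suc j * x i \<in> K" for i j using that by blast
    have down': "q ^ j * x i \<in> K" if "i < n" "q ^ (j + l) * x i \<in> K" for i j l
      using that by (induction l) (auto intro: down simp del: power_Suc)
    define \<beta> where "\<beta> i = (if i < n then LEAST j. q ^ j * x i \<notin> K else 0)" for i
    have out: "q ^ \<alpha> i * x i \<notin> K" if "i < n" for i
      using K node_in_nodes_iff[OF gen that, of "\<alpha> i" \<alpha>] by auto
    have b1: "q ^ \<beta> i * x i \<notin> K" if "i < n" for i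
      unfolding \<beta>_def using LeastI[of "\<lambda>j. q ^ j * x i \<notin> K", OF out[OF that]] that by simp
    have b2: "q ^ j * x i \<in> K" if "i < n" "j < \<beta> i" for i j
      using not_less_Least[of j "\<lambda>j. q ^ j * x i \<notin> K"] that by (auto simp: \<beta>_def)
    have iff: "q ^ j * x i \<in> K \<longleftrightarrow> j < \<beta> i" if "i < n" for i j
      using b1[OF that] b2[OF that] down'[OF that, of "\<beta> i" "j - \<beta> i"] by (cases "j < \<beta> i") auto
    have "\<beta> \<le> \<alpha>"
    proof (rule le_funI)
      show "\<beta> i \<le> \<alpha> i" for i
        using out[of i] b2[of i "\<alpha> i"] by (cases "i < n") (auto simp: \<beta>_def not_less[symmetric])
    qed
    moreover have "\<beta> \<in> multi n" by (simp add: \<beta>_def multi_def)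
    moreover have "K = nodes q x n \<beta>"
    proof (intro equalityI subsetI)
      fix z assume z: "z \<in> K"
      then have "z \<in> nodes q x n \<alpha>" using K by blast
      then obtain i j where "i < n" "z = q ^ j * x i" by (auto simp: nodes_def)
      then show "z \<in> nodes q x n \<beta>" using iff z by (auto simp: nodes_def)
    qed (auto simp: nodes_def iff)
    ultimately show False using not by blast
  qed
  then obtain i j where ij: "i < n" "q ^ Suc j * x i \<in> K" "q ^ j * x i \<notin> K" by blast
  have "q ^ Suc j * x i \<in> nodes q x n \<alpha>" using ij(2) K by blast
  then have "q ^ j * x i \<in> nodes q x n \<alpha> - K"
    using ij node_in_nodes_iff[OF gen ij(1), of "Suc j" \<alpha>] node_in_nodes_iff[OF gen ij(1), of j \<alpha>]
    by (simp del: power_Suc)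
  moreover have "finite (nodes q x n \<alpha> - K)" and "finite K" using finite_subset[OF K finite_nodes] by simp_all
  ultimately have "(\<Prod>w\<in>nodes q x n \<alpha> - K. (q ^ Suc j * x i - q * w) / (q ^ Suc j * x i - w)) = 0"
    by (intro prod_zero bexI[of _ "q ^ j * x i"]) (simp_all add: mult.assoc)
  then show ?thesis
    unfolding cross_def by (intro prod_zero[OF \<open>finite K\<close>] bexI[OF _ ij(2)])
qed

lemma sum_Pow_nodes:
  assumes gen: "generic_nodes q x n"
  shows "(\<Sum>K\<in>Pow (nodes q x n \<alpha>). f K * cross q K (nodes q x n \<alpha> - K)) =
    (\<Sum>\<beta> | \<beta> \<in> multi n \<and> \<beta> \<le> \<alpha>. f (nodes q x n \<beta>) * cross q (nodes q x n \<beta>) (nodes q x n \<alpha> - nodes q x n \<beta>))"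
proof -
  let ?A = "{\<beta>. \<beta> \<in> multi n \<and> \<beta> \<le> \<alpha>}"
  have "(\<Sum>K\<in>nodes q x n ` ?A. f K * cross q K (nodes q x n \<alpha> - K)) =
    (\<Sum>K\<in>Pow (nodes q x n \<alpha>). f K * cross q K (nodes q x n \<alpha> - K))"
  proof (rule sum.mono_neutral_left)
    show "nodes q x n ` ?A \<subseteq> Pow (nodes q x n \<alpha>)" using nodes_mono by blast
    show "\<forall>K\<in>Pow (nodes q x n \<alpha>) - nodes q x n ` ?A. f K * cross q K (nodes q x n \<alpha> - K) = 0"
    proof
      fix K assume K: "K \<in> Pow (nodes q x n \<alpha>) - nodes q x n ` ?A"
      have "cross q K (nodes q x n \<alpha> - K) = 0"
        by (rule cross_not_nodes[OF gen]) (use K in auto)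
      then show "f K * cross q K (nodes q x n \<alpha> - K) = 0" by simp
    qed
  qed simp
  moreover have "inj_on (nodes q x n) ?A"
    by (rule inj_on_subset[OF inj_on_nodes_multi[OF gen]]) auto
  ultimately show ?thesis by (simp add: sum.reindex)
qed

lemma prod_telescope_ratio:
  fixes f :: "nat \<Rightarrow> 'a::field"
  assumes "b \<le> a" "\<And>s. b \<le> s \<Longrightarrow> f s \<noteq> 0"
  shows "(\<Prod>s\<in>{b..<a}. f (Suc s) / f s) = f a / f b"
  using assms(1)
proof (induction rule: dec_induct)
  case base
  show ?case using assms(2)[of b] by simp
next
  case (step m)
  then show ?case using assms(2)[of m] by (simp add: prod.atLeastLessThan_Suc)
qed

lemma nodes_diff:
  assumes gen: "generic_nodes q x n"
  shows "nodes q x n \<alpha> - nodes q x n \<beta> = (\<lambda>(i, j). q ^ j * x i) ` (SIGMA i:{..<n}. {\<beta> i..<\<alpha> i})"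
proof (intro equalityI subsetI)
  fix z assume z: "z \<in> nodes q x n \<alpha> - nodes q x n \<beta>"
  then obtain i j where ij: "i < n" "j < \<alpha> i" "z = q ^ j * x i" by (auto simp: nodes_def)
  then show "z \<in> (\<lambda>(i, j). q ^ j * x i) ` (SIGMA i:{..<n}. {\<beta> i..<\<alpha> i})"
    using z node_in_nodes_iff[OF gen ij(1), of j \<beta>] by (intro image_eqI[of _ _ "(i, j)"]) auto
next
  fix z assume "z \<in> (\<lambda>(i, j). q ^ j * x i) ` (SIGMA i:{..<n}. {\<beta> i..<\<alpha> i})"
  then show "z \<in> nodes q x n \<alpha> - nodes q x n \<beta>" by (auto simp: node_in_nodes_iff[OF gen])
qed

text \<open>Within each progression the factors telescope; the result is the coefficient $C_{\alpha,\beta}$ in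
additive form.\<close>

lemma cross_nodes:
  assumes gen: "generic_nodes q x n" and le: "\<beta> \<le> \<alpha>"
  shows "cross q (nodes q x n \<beta>) (nodes q x n \<alpha> - nodes q x n \<beta>) =
    (\<Prod>i<n. \<Prod>j<n. \<Prod>s<\<beta> j. (q ^ s * x j - q ^ \<alpha> i * x i) / (q ^ s * x j - q ^ \<beta> i * x i))"
proof -
  have inner: "(\<Prod>w\<in>nodes q x n \<alpha> - nodes q x n \<beta>. (q ^ s * x j - q * w) / (q ^ s * x j - w)) =
      (\<Prod>i<n. (q ^ s * x j - q ^ \<alpha> i * x i) / (q ^ s * x j - q ^ \<beta> i * x i))"
    if j: "j < n" "s < \<beta> j" for j s
  proof -
    have "(\<Prod>w\<in>nodes q x n \<alpha> - nodes q x n \<beta>. (q ^ s * x j - q * w) / (q ^ s * x j - w)) =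
       (\<Prod>i<n. \<Prod>r\<in>{\<beta> i..<\<alpha> i}. (q ^ s * x j - q ^ Suc r * x i) / (q ^ s * x j - q ^ r * x i))"
      unfolding nodes_diff[OF gen]
      by (subst prod.reindex[OF inj_on_nodes[OF gen]]) (simp add: prod.Sigma o_def split_def mult.assoc)
    also have "\<dots> = (\<Prod>i<n. (q ^ s * x j - q ^ \<alpha> i * x i) / (q ^ s * x j - q ^ \<beta> i * x i))"
    proof (intro prod.cong refl)
      fix i assume i: "i \<in> {..<n}"
      have "q ^ s * x j - q ^ r * x i \<noteq> 0" if "\<beta> i \<le> r" for r
        using generic_nodesD[OF gen j(1), of i s r] i j(2) that by auto
      then show "(\<Prod>r\<in>{\<beta> i..<\<alpha> i}. (q ^ s * x j - q ^ Suc r * x i) / (q ^ s * x j - q ^ r * x i)) =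
         (q ^ s * x j - q ^ \<alpha> i * x i) / (q ^ s * x j - q ^ \<beta> i * x i)"
        using le by (intro prod_telescope_ratio) (auto simp: le_fun_def)
    qed
    finally show ?thesis .
  qed
  have "cross q (nodes q x n \<beta>) (nodes q x n \<alpha> - nodes q x n \<beta>) =
    (\<Prod>j<n. \<Prod>s<\<beta> j. \<Prod>i<n. (q ^ s * x j - q ^ \<alpha> i * x i) / (q ^ s * x j - q ^ \<beta> i * x i))"
    unfolding cross_def prod_nodes[OF gen] by (intro prod.cong refl inner) auto
  also have "\<dots> = (\<Prod>j<n. \<Prod>i<n. \<Prod>s<\<beta> j. (q ^ s * x j - q ^ \<alpha> i * x i) / (q ^ s * x j - q ^ \<beta> i * x i))"
    by (intro prod.cong refl prod.swap)
  also have "\<dots> = (\<Prod>i<n. \<Prod>j<n. \<Prod>s<\<beta> j. (q ^ s * x j - q ^ \<alpha> i * x i) / (q ^ s * x j - q ^ \<beta> i * x i))"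
    by (rule prod.swap)
  finally show ?thesis .
qed

text \<open>The image of the factor \<open>\<Prod>i<n. w - x i\<close> of the kernel under \<open>x i \<mapsto> q ^ \<gamma> i * x i\<close>.\<close>

definition shifted_prod :: "'a::field \<Rightarrow> (nat \<Rightarrow> 'a) \<Rightarrow> nat \<Rightarrow> (nat \<Rightarrow> nat) \<Rightarrow> 'a \<Rightarrow> 'a" where
  "shifted_prod q x n \<gamma> w = (\<Prod>i<n. w - q ^ \<gamma> i * x i)"

lemma shifted_prod_zero_at_nodes:
  assumes gen: "generic_nodes q x n" and "\<delta> \<in> multi n" "\<gamma> \<in> multi n" "\<not> \<delta> \<le> \<gamma>"
  shows "(\<Prod>z\<in>nodes q x n \<delta>. shifted_prod q x n \<gamma> z) = 0"
proof -
  obtain i where i: "\<gamma> i < \<delta> i" using assms(4) by (auto simp: le_fun_def not_le)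
  then have "i < n" using assms(2) by (auto simp: multi_def not_less[symmetric])
  then have "q ^ \<gamma> i * x i \<in> nodes q x n \<delta>" using node_in_nodes_iff[OF gen] i by blast
  moreover have "shifted_prod q x n \<gamma> (q ^ \<gamma> i * x i) = 0"
    unfolding shifted_prod_def using \<open>i < n\<close> by auto
  ultimately show ?thesis by (intro prod_zero) auto
qed

lemma shifted_prod_nonzero:
  assumes gen: "generic_nodes q x n" and "\<delta> \<le> \<gamma>"
  shows "(\<Prod>z\<in>nodes q x n \<delta>. shifted_prod q x n \<gamma> z) \<noteq> 0"
  unfolding shifted_prod_def prod_nodes[OF gen]
proof (simp, intro ballI)
  fix i j l assume h: "i \<in> {..<n}" "j \<in> {..<\<delta> i}" "l \<in> {..<n}"
  have "\<delta> i \<le> \<gamma> i" using assms(2) by (simp add: le_fun_def)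
  then show "q ^ j * x i \<noteq> q ^ \<gamma> l * x l"
    using h generic_nodesD[OF gen, of i l j "\<gamma> l"] by auto
qed

text \<open>Telescoping along the progressions turns the shifted product at \<open>\<beta>\<close> into the products over the nodes
that occur in \<open>cross_sum_phi_zero\<close>.\<close>

lemma shifted_prod_nodes:
  assumes gen: "generic_nodes q x n" and le: "\<beta> \<le> \<alpha>"
  shows "shifted_prod q x n (\<lambda>_. 0) w * ((\<Prod>z\<in>nodes q x n \<beta>. w - q * z) *
      (\<Prod>z\<in>nodes q x n \<alpha> - nodes q x n \<beta>. w - z)) =
    (\<Prod>z\<in>nodes q x n \<alpha>. w - z) * shifted_prod q x n \<beta> w"
proof -
  have tele: "(w - v) * (\<Prod>s<b. w - q * (q ^ s * v)) = (\<Prod>s<b. w - q ^ s * v) * (w - q ^ b * v)" for b :: nat and v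
    by (induction b) (simp_all add: mult_ac)
  have "shifted_prod q x n (\<lambda>_. 0) w * (\<Prod>z\<in>nodes q x n \<beta>. w - q * z) =
      (\<Prod>z\<in>nodes q x n \<beta>. w - z) * shifted_prod q x n \<beta> w"
    unfolding shifted_prod_def prod_nodes[OF gen] prod.distrib[symmetric]
    using tele by (intro prod.cong refl) simp
  moreover have "(\<Prod>z\<in>nodes q x n \<alpha>. w - z) =
    (\<Prod>z\<in>nodes q x n \<alpha> - nodes q x n \<beta>. w - z) * (\<Prod>z\<in>nodes q x n \<beta>. w - z)"
    using nodes_mono[OF le] by (intro prod.subset_diff) auto
  ultimately show ?thesis by (simp add: mult_ac)
qed

text \<open>The translation of \<open>cross_sum_phi_zero\<close> to multi-indices. It says that the
sums \<open>phi_kernel\<close> vanish when one of their points is \<open>0\<close>.\<close>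

lemma phi_sum_vanishes:
  fixes q :: "'a::field" and w :: "nat \<Rightarrow> 'a"
  assumes gen: "generic_nodes q x n" and n: "n \<ge> 1" and q: "q \<noteq> 0"
    and x0: "\<And>i. i < n \<Longrightarrow> x i \<noteq> 0" and N: "N < msize n \<alpha>"
  shows "(\<Sum>\<beta> | \<beta> \<in> multi n \<and> \<beta> \<le> \<alpha>. phi_weight q (msize n \<alpha>) (msize n \<beta>) *
      cross q (nodes q x n \<beta>) (nodes q x n \<alpha> - nodes q x n \<beta>) * (\<Prod>r<N. shifted_prod q x n \<beta> (w r))) = 0"
    (is "?S w = 0")
proof -
  let ?M = "nodes q x n \<alpha>"
  let ?A = "{\<beta>. \<beta> \<in> multi n \<and> \<beta> \<le> \<alpha>}"
  define c where "c \<beta> = phi_weight q (msize n \<alpha>) (msize n \<beta>) * cross q (nodes q x n \<beta>) (?M - nodes q x n \<beta>)" for \<beta>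
  have S: "?S w = (\<Sum>\<beta>\<in>?A. c \<beta> * (\<Prod>r<N. shifted_prod q x n \<beta> (w r)))" for w
    by (simp add: c_def)
  have M0: "0 \<notin> ?M" using x0 q by (auto simp: nodes_def)
  \<comment> \<open>Away from the nodes, \<open>shifted_prod_nodes\<close> may be divided by the product over all nodes.\<close>
  have generic: "?S w = 0" if w: "\<And>r. r < N \<Longrightarrow> w r \<notin> ?M" for w
  proof -
    have "(\<Prod>r<N. \<Prod>z\<in>?M. w r - z) * ?S w =
      (\<Sum>\<beta>\<in>?A. (\<Prod>r<N. shifted_prod q x n (\<lambda>_. 0) (w r)) *
        (phi_weight q (card ?M) (card (nodes q x n \<beta>)) *
         (\<Prod>r<N. (\<Prod>z\<in>nodes q x n \<beta>. w r - q * z) * (\<Prod>z\<in>?M - nodes q x n \<beta>. w r - z)) *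
          cross q (nodes q x n \<beta>) (?M - nodes q x n \<beta>)))"
      unfolding sum_distrib_left
    proof (intro sum.cong refl)
      fix \<beta> assume "\<beta> \<in> ?A"
      then have le: "\<beta> \<le> \<alpha>" by simp
      have "(\<Prod>r<N. shifted_prod q x n (\<lambda>_. 0) (w r)) *
         (\<Prod>r<N. (\<Prod>z\<in>nodes q x n \<beta>. w r - q * z) * (\<Prod>z\<in>?M - nodes q x n \<beta>. w r - z)) =
        (\<Prod>r<N. \<Prod>z\<in>?M. w r - z) * (\<Prod>r<N. shifted_prod q x n \<beta> (w r))"
        unfolding prod.distrib[where A = "{..<N}", symmetric] shifted_prod_nodes[OF gen le] ..
      then show "(\<Prod>r<N. \<Prod>z\<in>?M. w r - z) * (phi_weight q (msize n \<alpha>) (msize n \<beta>) *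
          cross q (nodes q x n \<beta>) (?M - nodes q x n \<beta>) * (\<Prod>r<N. shifted_prod q x n \<beta> (w r))) =
        (\<Prod>r<N. shifted_prod q x n (\<lambda>_. 0) (w r)) *
        (phi_weight q (card ?M) (card (nodes q x n \<beta>)) *
         (\<Prod>r<N. (\<Prod>z\<in>nodes q x n \<beta>. w r - q * z) * (\<Prod>z\<in>?M - nodes q x n \<beta>. w r - z)) *
          cross q (nodes q x n \<beta>) (?M - nodes q x n \<beta>))"
        unfolding card_nodes[OF gen] msize_def[symmetric] by (simp add: mult_ac)
    qed
    also have "\<dots> = (\<Prod>r<N. shifted_prod q x n (\<lambda>_. 0) (w r)) * (\<Sum>K\<in>Pow ?M.
        phi_weight q (card ?M) (card K) * (\<Prod>r<N. (\<Prod>z\<in>K. w r - q * z) * (\<Prod>z\<in>?M - K. w r - z)) *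
          cross q K (?M - K))"
      unfolding sum_Pow_nodes[OF gen, of "\<lambda>K. phi_weight q (card ?M) (card K) *
         (\<Prod>r<N. (\<Prod>z\<in>K. w r - q * z) * (\<Prod>z\<in>?M - K. w r - z))"] by (simp add: sum_distrib_left)
    also have "(\<Sum>K\<in>Pow ?M.
        phi_weight q (card ?M) (card K) * (\<Prod>r<N. (\<Prod>z\<in>K. w r - q * z) * (\<Prod>z\<in>?M - K. w r - z)) *
          cross q K (?M - K)) = 0"
    proof -
      have "N < card ?M" using N by (simp add: card_nodes[OF gen] msize_def)
      then show ?thesis
        using cross_sum_phi_zero[OF finite_nodes M0 _ q, of N w] by (simp add: mult_ac)
    qed
    finally have "(\<Prod>r<N. \<Prod>z\<in>?M. w r - z) * ?S w = 0" by simp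
    moreover have "(\<Prod>r<N. \<Prod>z\<in>?M. w r - z) \<noteq> 0" using w by auto
    ultimately show ?thesis by simp
  qed
  \<comment> \<open>A polynomial identity in each \<open>w r\<close> extends from the complement of the nodes, since the field is infinite.\<close>
  have inf: "infinite (UNIV :: 'a set)"
  proof
    assume "finite (UNIV :: 'a set)"
    then have "finite (range (\<lambda>j. q ^ j * x 0))" by (rule finite_subset[OF subset_UNIV])
    moreover have "inj (\<lambda>j. q ^ j * x 0)"
      using generic_nodesD[OF gen, of 0 0] n by (intro injI) auto
    ultimately show False using finite_imageD by blast
  qed
  have "?S w = 0" if "k \<le> N" "\<And>r. k \<le> r \<Longrightarrow> r < N \<Longrightarrow> w r \<notin> ?M" for k w
    using that
  proof (induction k arbitrary: w)
    case 0
    then show ?case using generic by simp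
  next
    case (Suc k)
    have k: "k < N" using Suc.prems by simp
    define P where "P = (\<Sum>\<beta>\<in>?A. smult (c \<beta> * (\<Prod>r\<in>{..<N} - {k}. shifted_prod q x n \<beta> (w r)))
       (\<Prod>i<n. [:- (q ^ \<beta> i * x i), 1:]))"
    have P: "poly P u = ?S (w(k := u))" for u
      unfolding P_def S poly_sum
    proof (intro sum.cong refl)
      fix \<beta>
      have "(\<Prod>r<N. shifted_prod q x n \<beta> ((w(k := u)) r)) =
        shifted_prod q x n \<beta> u * (\<Prod>r\<in>{..<N} - {k}. shifted_prod q x n \<beta> (w r))"
        using k by (subst prod.remove[of _ k]) auto
      then show "poly (smult (c \<beta> * (\<Prod>r\<in>{..<N} - {k}. shifted_prod q x n \<beta> (w r)))
       (\<Prod>i<n. [:- (q ^ \<beta> i * x i), 1:])) u = c \<beta> * (\<Prod>r<N. shifted_prod q x n \<beta> ((w(k := u)) r))"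
        by (simp add: poly_prod shifted_prod_def)
    qed
    have "poly P u = 0" if "u \<notin> ?M" for u
      unfolding P using k that Suc.prems(2) by (intro Suc.IH) auto
    then have "- ?M \<subseteq> {u. poly P u = 0}" by auto
    moreover have "infinite (- ?M)" using inf by (metis finite_nodes finite_compl)
    ultimately have "P = 0" using poly_roots_finite finite_subset by blast
    then show ?case using P[of "w k"] by simp
  qed
  from this[of N w] show ?thesis by simp
qed

section \<open>The interpolation formula\<close>

definition signed_q :: "'a::field \<Rightarrow> nat \<Rightarrow> 'a" where
  "signed_q q k = (- 1) ^ k * q ^ (k choose 2)"

definition monic_scaled :: "'a::field \<Rightarrow> (nat \<Rightarrow> 'a) \<Rightarrow> nat \<Rightarrow> 'a poly" where
  "monic_scaled t x n = (\<Prod>i<n. [:- (t * x i), 1:])"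

lemma monic_scaled: "degree (monic_scaled t x n) = n" "coeff (monic_scaled t x n) n = 1"
  "poly (monic_scaled t x n) z = (\<Prod>i<n. z - t * x i)"
proof -
  show d: "degree (monic_scaled t x n) = n"
    unfolding monic_scaled_def by (subst degree_prod_eq_sum_degree) auto
  show "coeff (monic_scaled t x n) n = 1"
    using lead_coeff_prod[of "\<lambda>i. [:- (t * x i), 1:]" "{..<n}"] d by (simp add: monic_scaled_def)
  show "poly (monic_scaled t x n) z = (\<Prod>i<n. z - t * x i)" by (simp add: monic_scaled_def poly_prod)
qed

text \<open>The operator \<open>phi\<close> applied to \<open>\<Prod>z\<in>Z. \<Prod>i<n. z - x i\<close>.\<close>

definition phi_kernel :: "'a::field \<Rightarrow> (nat \<Rightarrow> 'a) \<Rightarrow> nat \<Rightarrow> (nat \<Rightarrow> nat) \<Rightarrow> 'a set \<Rightarrow> 'a" where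
  "phi_kernel q x n \<alpha> Z =
     (\<Sum>\<beta> | \<beta> \<in> multi n \<and> \<beta> \<le> \<alpha>. (- 1) ^ (msize n \<alpha> - msize n \<beta>) *
        q ^ ((msize n \<alpha> - msize n \<beta> + 1) choose 2) *
        cross q (nodes q x n \<beta>) (nodes q x n \<alpha> - nodes q x n \<beta>) * (\<Prod>z\<in>Z. shifted_prod q x n \<beta> z))"

text \<open>The shifted product at \<open>\<beta>\<close> vanishes on the nodes of \<open>\<delta>\<close> unless \<open>\<delta> \<le> \<beta>\<close>; as \<open>\<beta> \<le> \<alpha>\<close> and \<open>\<delta>\<close>, \<open>\<alpha>\<close> have
the same size, all three must then be equal.\<close>

lemma phi_kernel_nodes:
  assumes gen: "generic_nodes q x n" and a: "\<alpha> \<in> multi n" and d: "\<delta> \<in> multi n"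
    and eq: "msize n \<delta> = msize n \<alpha>"
  shows "phi_kernel q x n \<alpha> (nodes q x n \<delta>) =
    (if \<delta> = \<alpha> then (\<Prod>z\<in>nodes q x n \<alpha>. shifted_prod q x n \<alpha> z) else 0)"
proof -
  have "phi_kernel q x n \<alpha> (nodes q x n \<delta>) = (\<Sum>\<beta> | \<beta> \<in> multi n \<and> \<beta> \<le> \<alpha>.
      if \<beta> = \<alpha> then (if \<delta> = \<alpha> then (\<Prod>z\<in>nodes q x n \<alpha>. shifted_prod q x n \<alpha> z) else 0) else 0)"
    unfolding phi_kernel_def
  proof (intro sum.cong refl)
    fix \<beta> assume b: "\<beta> \<in> {\<beta>. \<beta> \<in> multi n \<and> \<beta> \<le> \<alpha>}"
    have z: "(\<Prod>z\<in>nodes q x n \<delta>. shifted_prod q x n \<beta> z) = 0" if "\<not> (\<beta> = \<alpha> \<and> \<delta> = \<alpha>)"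
    proof (rule shifted_prod_zero_at_nodes[OF gen d])
      show "\<beta> \<in> multi n" using b by simp
      show "\<not> \<delta> \<le> \<beta>"
      proof
        assume db: "\<delta> \<le> \<beta>"
        then have "msize n \<delta> \<le> msize n \<beta>" by (rule msize_mono)
        then have e: "msize n \<beta> = msize n \<alpha>" using eq b msize_mono[of \<beta> \<alpha> n] by simp
        have "\<beta> = \<alpha>" using multi_le_msize_eq[of \<beta> n \<alpha>] b a e by simp
        moreover have "\<delta> = \<beta>" using multi_le_msize_eq[of \<delta> n \<beta>] b d db e eq by simp
        ultimately show False using that by simp
      qed
    qed
    show "(- 1) ^ (msize n \<alpha> - msize n \<beta>) * q ^ ((msize n \<alpha> - msize n \<beta> + 1) choose 2) *
        cross q (nodes q x n \<beta>) (nodes q x n \<alpha> - nodes q x n \<beta>) *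
        (\<Prod>z\<in>nodes q x n \<delta>. shifted_prod q x n \<beta> z) =
      (if \<beta> = \<alpha> then (if \<delta> = \<alpha> then (\<Prod>z\<in>nodes q x n \<alpha>. shifted_prod q x n \<alpha> z) else 0) else 0)"
      using z by (auto simp: cross_def numeral_2_eq_2)
  qed
  also have "\<dots> = (if \<delta> = \<alpha> then (\<Prod>z\<in>nodes q x n \<alpha>. shifted_prod q x n \<alpha> z) else 0)"
    using a by (subst sum.delta[OF finite_multi_le]) simp
  finally show ?thesis .
qed

text \<open>Each summand has degree \<open>n\<close> in \<open>z\<close>. The value at \<open>z = 0\<close> is the sum of \<open>phi_sum_vanishes\<close>, so that one
factor \<open>z\<close> splits off and dividing by it lowers the degree below \<open>n\<close>, as \<open>interpolation_zero\<close> requires.\<close>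

lemma phi_kernel_poly:
  fixes q :: "'a::field"
  assumes gen: "generic_nodes q x n" and n: "n \<ge> 1" and q: "q \<noteq> 0"
    and x0: "\<And>i. i < n \<Longrightarrow> x i \<noteq> 0" and Z: "finite Z" "card Z < msize n \<alpha>"
  shows "\<exists>p. degree p < n \<and> (\<forall>z. z \<notin> Z \<union> {0} \<longrightarrow> phi_kernel q x n \<alpha> (insert z Z) = z * poly p z)"
proof -
  let ?A = "{\<beta>. \<beta> \<in> multi n \<and> \<beta> \<le> \<alpha>}"
  define m where "m = msize n \<alpha>"
  define c where "c \<beta> = (- 1) ^ (m - msize n \<beta>) * q ^ ((m - msize n \<beta> + 1) choose 2) *
        cross q (nodes q x n \<beta>) (nodes q x n \<alpha> - nodes q x n \<beta>) * (\<Prod>z\<in>Z. shifted_prod q x n \<beta> z)" for \<beta>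
  define N where "N = (\<Sum>\<beta>\<in>?A. smult (c \<beta>) (\<Prod>i<n. [:- (q ^ \<beta> i * x i), 1:]))"
  have N: "poly N z = phi_kernel q x n \<alpha> (insert z Z)" if "z \<notin> Z" for z
    unfolding N_def poly_sum phi_kernel_def
    using that Z(1) by (intro sum.cong refl) (simp add: c_def m_def poly_prod shifted_prod_def mult_ac)
  have dN: "degree N \<le> n"
    unfolding N_def
  proof (intro degree_sum_le finite_multi_le order.trans[OF degree_smult_le])
    show "degree (\<Prod>i<n. [:- (q ^ \<beta> i * x i), 1:]) \<le> n" for \<beta>
      by (subst degree_prod_eq_sum_degree) auto
  qed
  obtain h where h: "bij_betw h {0..<card Z} Z" using ex_bij_betw_nat_finite[OF Z(1)] by blast
  have "poly N 0 = (- 1) ^ m * (\<Prod>i<n. - x i) * (\<Sum>\<beta>\<in>?A. phi_weight q m (msize n \<beta>) *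
      cross q (nodes q x n \<beta>) (nodes q x n \<alpha> - nodes q x n \<beta>) *
      (\<Prod>r<card Z. shifted_prod q x n \<beta> (h r)))"
    unfolding N_def poly_sum sum_distrib_left
  proof (intro sum.cong refl)
    fix \<beta> assume b: "\<beta> \<in> ?A"
    have le: "msize n \<beta> \<le> m" using b msize_mono unfolding m_def by blast
    have "(- 1 :: 'a) ^ m = (- 1) ^ (m - msize n \<beta>) * (- 1) ^ msize n \<beta>"
      using le by (simp flip: power_add)
    then have s: "(- 1 :: 'a) ^ (m - msize n \<beta>) = (- 1) ^ m * (- 1) ^ msize n \<beta>"
      by (simp add: mult.assoc flip: power_mult_distrib)
    have "(\<Prod>i<n. - (q ^ \<beta> i * x i)) = (\<Prod>i<n. q ^ \<beta> i) * (\<Prod>i<n. - x i)"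
      unfolding prod.distrib[symmetric] by (intro prod.cong) auto
    then have p: "poly (\<Prod>i<n. [:- (q ^ \<beta> i * x i), 1:]) 0 = q ^ msize n \<beta> * (\<Prod>i<n. - x i)"
      by (simp add: poly_prod msize_def power_sum)
    have r: "(\<Prod>r<card Z. shifted_prod q x n \<beta> (h r)) = (\<Prod>z\<in>Z. shifted_prod q x n \<beta> z)"
      using prod.reindex_bij_betw[OF h, of "shifted_prod q x n \<beta>"] by (simp add: lessThan_atLeast0)
    show "poly (smult (c \<beta>) (\<Prod>i<n. [:- (q ^ \<beta> i * x i), 1:])) 0 =
      (- 1) ^ m * (\<Prod>i<n. - x i) * (phi_weight q m (msize n \<beta>) *
      cross q (nodes q x n \<beta>) (nodes q x n \<alpha> - nodes q x n \<beta>) *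
      (\<Prod>r<card Z. shifted_prod q x n \<beta> (h r)))"
      unfolding poly_smult p c_def s r phi_weight_def by (simp add: power_add mult_ac)
  qed
  also have "\<dots> = 0"
    unfolding m_def by (subst phi_sum_vanishes[OF gen n q x0 Z(2)]) simp_all
  finally have "[:0, 1:] dvd N" using poly_eq_0_iff_dvd[of N 0] by simp
  then obtain p where p: "N = [:0, 1:] * p" by (rule dvdE)
  have "degree p < n"
  proof (cases "p = 0")
    case False
    then have "degree N = Suc (degree p)" unfolding p by (subst degree_mult_eq) auto
    then show ?thesis using dN by simp
  qed (use n in simp)
  then show ?thesis using N unfolding p by (intro exI[of _ p]) (auto simp flip: N)
qed

text \<open>Both sides have degree less than \<open>n\<close> in each element of \<open>Z\<close> and agree at the node sets, where the
right-hand side collapses to one term by \<open>phi_kernel_nodes\<close>.\<close>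

theorem interpolation_formula:
  fixes q t :: "'a::field" and x :: "nat \<Rightarrow> 'a"
  assumes gen: "generic_nodes q x n" and n: "n \<ge> 1" and q: "q \<noteq> 0"
    and x0: "\<And>i. i < n \<Longrightarrow> x i \<noteq> 0" and Z: "finite Z" "card Z = m" "0 \<notin> Z"
      "\<And>i j. i < n \<Longrightarrow> q ^ j * x i \<notin> Z"
  defines "G \<equiv> cross_sum q (signed_q q) (monic_scaled t x n) (monic_scaled 1 x n)"
  shows "G Z = (\<Sum>\<alpha> | \<alpha> \<in> multi n \<and> msize n \<alpha> = m.
      G (nodes q x n \<alpha>) * (\<Prod>z\<in>nodes q x n \<alpha>. z) / (\<Prod>z\<in>nodes q x n \<alpha>. shifted_prod q x n \<alpha> z) *
      (phi_kernel q x n \<alpha> Z / (\<Prod>z\<in>Z. z)))"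
proof -
  let ?A = "{\<alpha>. \<alpha> \<in> multi n \<and> msize n \<alpha> = m}"
  define k where "k \<alpha> = G (nodes q x n \<alpha>) * (\<Prod>z\<in>nodes q x n \<alpha>. z) /
      (\<Prod>z\<in>nodes q x n \<alpha>. shifted_prod q x n \<alpha> z)" for \<alpha>
  define H where "H Z = G Z - (\<Sum>\<alpha>\<in>?A. k \<alpha> * (phi_kernel q x n \<alpha> Z / (\<Prod>z\<in>Z. z)))" for Z
  have "H Z = 0"
  proof (rule interpolation_zero[OF gen, of "{0}" m])
    show "q ^ j * x i \<notin> {0}" if "i < n" for i j using x0[OF that] q by simp
    show "finite Z" "card Z = m" by fact+
    show "Z \<inter> {0} = {}" using Z(3) by auto
    show "q ^ j * x i \<notin> Z" if "i < n" for i j using Z(4)[OF that] .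
    show "H (nodes q x n \<delta>) = 0" if d: "\<forall>i\<ge>n. \<delta> i = 0" "(\<Sum>i<n. \<delta> i) = m" for \<delta>
    proof -
      have dm: "\<delta> \<in> multi n" "msize n \<delta> = m" using d by (auto simp: multi_def msize_def)
      have n0: "(\<Prod>z\<in>nodes q x n \<delta>. z) \<noteq> 0" 
      proof -
        have "0 \<notin> nodes q x n \<delta>" using x0 q by (auto simp: nodes_def)
        then show ?thesis by (simp add: prod_zero_iff)
      qed
      have nz: "(\<Prod>z\<in>nodes q x n \<delta>. shifted_prod q x n \<delta> z) \<noteq> 0"
        by (rule shifted_prod_nonzero[OF gen order.refl])
      have "(\<Sum>\<alpha>\<in>?A. k \<alpha> * (phi_kernel q x n \<alpha> (nodes q x n \<delta>) / (\<Prod>z\<in>nodes q x n \<delta>. z))) =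
        (\<Sum>\<alpha>\<in>?A. if \<alpha> = \<delta> then G (nodes q x n \<delta>) else 0)"
        using dm n0 nz by (intro sum.cong refl) (auto simp: phi_kernel_nodes[OF gen] k_def)
      also have "\<dots> = G (nodes q x n \<delta>)"
        using dm by (subst sum.delta[OF finite_multi_msize_eq]) simp
      finally show ?thesis by (simp add: H_def)
    qed
    show "\<exists>p. degree p < n \<and> (\<forall>z. z \<notin> Y \<union> {0} \<longrightarrow> H (insert z Y) = poly p z)"
      if Y: "finite Y" "Suc (card Y) = m" "Y \<inter> {0} = {}" for Y
    proof -
      have "\<exists>p. degree p \<le> n \<and> (\<forall>z. z \<notin> Y \<longrightarrow> G (insert z Y) = poly p z) \<and>
         ((\<forall>k. signed_q q (Suc k) * coeff (monic_scaled t x n) n +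
            q ^ k * signed_q q k * coeff (monic_scaled 1 x n) n = 0) \<longrightarrow> coeff p n = 0)"
        unfolding G_def by (rule cross_sum_poly[OF Y(1) q]) (simp_all add: monic_scaled)
      moreover have "signed_q q (Suc k) * coeff (monic_scaled t x n) n +
            q ^ k * signed_q q k * coeff (monic_scaled 1 x n) n = 0" for k
        by (simp add: monic_scaled signed_q_def choose_two_Suc power_add)
      ultimately obtain p where p: "degree p \<le> n" "\<And>z. z \<notin> Y \<Longrightarrow> G (insert z Y) = poly p z" "coeff p n = 0"
        by blast
      have dp: "degree p < n"
      proof (rule ccontr)
        assume "\<not> degree p < n"
        then have "degree p = n" using p(1) by simp
        then show False using p(3) n leading_coeff_0_iff[of p] by auto
      qed
      define Q where "Q \<alpha> p \<longleftrightarrow> degree p < n \<and>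
          (\<forall>z. z \<notin> Y \<union> {0} \<longrightarrow> phi_kernel q x n \<alpha> (insert z Y) = z * poly p z)" for \<alpha> p
      define r where "r \<alpha> = (SOME p. Q \<alpha> p)" for \<alpha>
      have Qr: "Q \<alpha> (r \<alpha>)" if "\<alpha> \<in> ?A" for \<alpha>
      proof -
        have "\<exists>p. Q \<alpha> p"
          unfolding Q_def using that Y by (intro phi_kernel_poly[OF gen n q x0]) auto
        then show ?thesis unfolding r_def by (rule someI_ex)
      qed
      have r: "degree (r \<alpha>) \<le> n - 1"
        "\<And>z. z \<notin> Y \<union> {0} \<Longrightarrow> phi_kernel q x n \<alpha> (insert z Y) = z * poly (r \<alpha>) z" if "\<alpha> \<in> ?A" for \<alpha>
        using Qr[OF that] by (auto simp: Q_def)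
      define P where "P = p - (\<Sum>\<alpha>\<in>?A. smult (k \<alpha> / (\<Prod>z\<in>Y. z)) (r \<alpha>))"
      have "degree (\<Sum>\<alpha>\<in>?A. smult (k \<alpha> / (\<Prod>z\<in>Y. z)) (r \<alpha>)) \<le> n - 1"
        by (intro degree_sum_le finite_multi_msize_eq order.trans[OF degree_smult_le] r(1))
      then have "degree P \<le> n - 1"
        unfolding P_def using dp by (intro degree_diff_le) simp_all
      then have "degree P < n" using n by simp
      moreover have "H (insert z Y) = poly P z" if z: "z \<notin> Y \<union> {0}" for z
      proof -
        have y0: "(\<Prod>z\<in>Y. z) \<noteq> 0" using Y by auto
        have "(\<Sum>\<alpha>\<in>?A. k \<alpha> * (phi_kernel q x n \<alpha> (insert z Y) / (\<Prod>z\<in>insert z Y. z))) =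
          (\<Sum>\<alpha>\<in>?A. poly (smult (k \<alpha> / (\<Prod>z\<in>Y. z)) (r \<alpha>)) z)"
          using r(2)[OF _ z] z Y by (intro sum.cong refl) simp
        then show ?thesis using z p(2)[of z] by (simp add: H_def P_def poly_sum)
      qed
      ultimately show ?thesis by blast
    qed
  qed
  then show ?thesis by (simp add: H_def k_def)
qed

section \<open>Polynomials, rational functions and their rescalings\<close>

text \<open>Short names for the constants of polynomial mappings, which their theory keeps qualified.\<close>

abbreviation "lookup \<equiv> Poly_Mapping.lookup"
abbreviation "keys \<equiv> Poly_Mapping.keys"
abbreviation "single \<equiv> Poly_Mapping.single"

lemma of_mpol_0 [simp]: "of_mpol 0 = 0" by (simp add: of_mpol_def Zero_fract_def)
lemma of_mpol_1 [simp]: "of_mpol 1 = 1" by (simp add: of_mpol_def One_fract_def)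
lemma of_mpol_add: "of_mpol (p + q) = of_mpol p + of_mpol q" by (simp add: of_mpol_def)
lemma of_mpol_uminus: "of_mpol (- p) = - of_mpol p" by (simp add: of_mpol_def)
lemma of_mpol_diff: "of_mpol (p - q) = of_mpol p - of_mpol q" by (simp add: of_mpol_def)
lemma of_mpol_mult: "of_mpol (p * q) = of_mpol p * of_mpol q" by (simp add: of_mpol_def)
lemma of_mpol_eq_iff [simp]: "of_mpol p = of_mpol q \<longleftrightarrow> p = q" by (simp add: of_mpol_def eq_fract)
lemma of_mpol_eq_0_iff [simp]: "of_mpol p = 0 \<longleftrightarrow> p = 0" using of_mpol_eq_iff[of p 0] by simp
lemma of_mpol_sum: "of_mpol (\<Sum>i\<in>A. f i) = (\<Sum>i\<in>A. of_mpol (f i))"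
  by (induction A rule: infinite_finite_induct) (auto simp: of_mpol_add)
lemma of_mpol_prod: "of_mpol (\<Prod>i\<in>A. f i) = (\<Prod>i\<in>A. of_mpol (f i))"
  by (induction A rule: infinite_finite_induct) (auto simp: of_mpol_mult)
lemma Fract_eq_of_mpol: "b \<noteq> 0 \<Longrightarrow> Fraction_Field.Fract a b = of_mpol a / of_mpol b"
  by (simp add: of_mpol_def)

lemma of_K_0 [simp]: "of_K 0 = 0" by (simp add: of_K_def)
lemma of_K_1 [simp]: "of_K 1 = 1" by (simp add: of_K_def)
lemma of_K_add: "of_K (c + d) = of_K c + of_K d" by (simp add: of_K_def single_add of_mpol_add)
lemma of_K_uminus: "of_K (- c) = - of_K c" by (simp add: of_K_def single_uminus of_mpol_uminus)
lemma of_K_diff: "of_K (c - d) = of_K c - of_K d" by (simp add: of_K_def single_diff of_mpol_diff)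
lemma of_K_mult: "of_K (c * d) = of_K c * of_K d" by (simp add: of_K_def mult_single flip: of_mpol_mult)
lemma of_K_eq_iff [simp]: "of_K c = of_K d \<longleftrightarrow> c = d"
  unfolding of_K_def of_mpol_eq_iff by (rule inj_eq[OF inj_single])
lemma of_K_eq_0_iff [simp]: "of_K c = 0 \<longleftrightarrow> c = 0" using of_K_eq_iff[of c 0] by simp
lemma of_K_eq_1_iff [simp]: "of_K c = 1 \<longleftrightarrow> c = 1" using of_K_eq_iff[of c 1] by simp
lemma of_K_power: "of_K (c ^ k) = of_K c ^ k" by (induction k) (auto simp: of_K_mult)
lemma of_K_inverse: "of_K (inverse c) = inverse (of_K c)"
proof (cases "c = 0")
  case False
  then have "of_K (inverse c) * of_K c = 1" by (simp flip: of_K_mult)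
  then show ?thesis using False by (simp add: field_simps)
qed simp
lemma of_K_sum: "of_K (\<Sum>i\<in>A. f i) = (\<Sum>i\<in>A. of_K (f i))"
  by (induction A rule: infinite_finite_induct) (auto simp: of_K_add)
lemma of_K_prod: "of_K (\<Prod>i\<in>A. f i) = (\<Prod>i\<in>A. of_K (f i))"
  by (induction A rule: infinite_finite_induct) (auto simp: of_K_mult)
lemmas of_K_hom = of_K_add of_K_uminus of_K_diff of_K_mult of_K_power of_K_inverse of_K_sum of_K_prod

definition mon :: "(nat \<Rightarrow>\<^sub>0 nat) \<Rightarrow> ratfun" where
  "mon \<kappa> = of_mpol (single \<kappa> 1)"

lemma mon_0 [simp]: "mon 0 = 1" by (simp add: mon_def)
lemma mon_add: "mon (\<kappa> + \<kappa>') = mon \<kappa> * mon \<kappa>'" by (simp add: mon_def mult_single flip: of_mpol_mult)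
lemma mon_nonzero [simp]: "mon \<kappa> \<noteq> 0"
proof
  assume "mon \<kappa> = 0"
  then have "lookup (single \<kappa> (1 :: K)) \<kappa> = 0" by (simp add: mon_def)
  then show False by simp
qed
lemma xvar_eq_mon: "xvar i = mon (single i 1)" by (simp add: xvar_def mon_def)
lemma xvar_nonzero [simp]: "xvar i \<noteq> 0" by (simp add: xvar_eq_mon)
lemma mon_single: "mon (single i k) = xvar i ^ k"
proof (induction k)
  case (Suc k)
  have "single i (Suc k) = single i 1 + single i k"
    by (simp flip: single_add)
  then show ?case using Suc by (simp add: mon_add xvar_eq_mon)
qed simp
lemma mon_sum: "mon (\<Sum>i\<in>A. f i) = (\<Prod>i\<in>A. mon (f i))"
  by (induction A rule: infinite_finite_induct) (auto simp: mon_add)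
lemma of_mpol_single: "of_mpol (single \<kappa> c) = of_K c * mon \<kappa>"
  by (simp add: of_K_def mon_def mult_single flip: of_mpol_mult)

lemma lookup_times_finite:
  fixes p r :: "'a::monoid_add \<Rightarrow>\<^sub>0 'b::semiring_0"
  shows "lookup (p * r) \<kappa> = (\<Sum>\<mu>\<in>keys p. \<Sum>\<nu>\<in>keys r.
     if \<mu> + \<nu> = \<kappa> then lookup p \<mu> * lookup r \<nu> else 0)"
proof -
  have inner: "(\<Sum>v. lookup r v when \<kappa> = l + v) =
     (\<Sum>\<nu>\<in>keys r. lookup r \<nu> when \<kappa> = l + \<nu>)" for l
    by (rule Sum_any.expand_superset) (auto simp: in_keys_iff when_def)
  have "lookup (p * r) \<kappa> =
      (\<Sum>l. lookup p l * (\<Sum>v. lookup r v when \<kappa> = l + v))"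
    by (simp add: times_poly_mapping.rep_eq prod_fun_def)
  also have "\<dots> = (\<Sum>\<mu>\<in>keys p. lookup p \<mu> * (\<Sum>v. lookup r v when \<kappa> = \<mu> + v))"
    by (rule Sum_any.expand_superset) (auto simp: in_keys_iff)
  also have "\<dots> = (\<Sum>\<mu>\<in>keys p. \<Sum>\<nu>\<in>keys r.
     if \<mu> + \<nu> = \<kappa> then lookup p \<mu> * lookup r \<nu> else 0)"
    unfolding inner sum_distrib_left by (intro sum.cong refl) (auto simp: when_def)
  finally show ?thesis .
qed

lemma lookup_times_unique:
  fixes p r :: "'a::monoid_add \<Rightarrow>\<^sub>0 'b::semiring_0"
  assumes "\<And>\<mu> \<nu>. \<mu> \<in> keys p \<Longrightarrow> \<nu> \<in> keys r \<Longrightarrow> \<mu> + \<nu> = \<eta> + \<theta> \<Longrightarrow> \<mu> = \<eta> \<and> \<nu> = \<theta>"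
  shows "lookup (p * r) (\<eta> + \<theta>) = lookup p \<eta> * lookup r \<theta>"
proof -
  have "lookup (p * r) (\<eta> + \<theta>) = (\<Sum>\<mu>\<in>keys p. \<Sum>\<nu>\<in>keys r.
     if \<nu> = \<theta> then (if \<mu> = \<eta> then lookup p \<eta> * lookup r \<theta> else 0) else 0)"
    unfolding lookup_times_finite using assms by (intro sum.cong refl) auto
  then show ?thesis
    by (cases "lookup r \<theta> = 0") (simp_all add: in_keys_iff)
qed

text \<open>Addition is strictly monotone for the lexicographic order of exponents, so the sum of the two bounds arises
only from the bounds themselves.\<close>

lemma lookup_times_top:
  fixes p r :: "mpol"
  assumes "\<And>\<mu>. \<mu> \<in> keys p \<Longrightarrow> \<mu> \<le> \<eta>" "\<And>\<nu>. \<nu> \<in> keys r \<Longrightarrow> \<nu> \<le> \<theta>"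
  shows "lookup (p * r) (\<eta> + \<theta>) = lookup p \<eta> * lookup r \<theta>"
proof (rule lookup_times_unique)
  fix \<mu> \<nu> assume h: "\<mu> \<in> keys p" "\<nu> \<in> keys r" "\<mu> + \<nu> = \<eta> + \<theta>"
  have "\<mu> \<le> \<eta>" "\<nu> \<le> \<theta>" using assms h by auto
  have "\<not> \<mu> < \<eta>" using add_less_le_mono[of \<mu> \<eta> \<nu> \<theta>] h \<open>\<nu> \<le> \<theta>\<close> by auto
  then have "\<mu> = \<eta>" using \<open>\<mu> \<le> \<eta>\<close> by simp
  then show "\<mu> = \<eta> \<and> \<nu> = \<theta>" using h(3) by simp
qed

lemma keys_times_le:
  fixes p r :: "mpol"
  assumes "\<And>\<mu>. \<mu> \<in> keys p \<Longrightarrow> \<mu> \<le> \<eta>" "\<And>\<nu>. \<nu> \<in> keys r \<Longrightarrow> \<nu> \<le> \<theta>"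
    and "\<kappa> \<in> keys (p * r)"
  shows "\<kappa> \<le> \<eta> + \<theta>"
proof -
  obtain a b where "\<kappa> = a + b" "a \<in> keys p" "b \<in> keys r"
    using keys_mult[of p r] assms(3) by blast
  then show ?thesis using assms(1)[of a] assms(2)[of b] by (simp add: add_mono)
qed

definition mon_weight :: "(nat \<Rightarrow> K) \<Rightarrow> (nat \<Rightarrow>\<^sub>0 nat) \<Rightarrow> K" where
  "mon_weight s \<mu> = (\<Prod>i\<in>keys \<mu>. s i ^ lookup \<mu> i)"

lemma mon_weight_superset:
  assumes "finite A" "keys \<mu> \<subseteq> A"
  shows "mon_weight s \<mu> = (\<Prod>i\<in>A. s i ^ lookup \<mu> i)"
  unfolding mon_weight_def by (rule prod.mono_neutral_left[OF assms]) (simp add: in_keys_iff)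

lemma mon_weight_add: "mon_weight s (\<mu> + \<nu>) = mon_weight s \<mu> * mon_weight s \<nu>"
proof -
  let ?A = "keys \<mu> \<union> keys \<nu>"
  have k: "keys (\<mu> + \<nu>) \<subseteq> ?A" by (rule keys_add)
  have "mon_weight s (\<mu> + \<nu>) = (\<Prod>i\<in>?A. s i ^ lookup (\<mu> + \<nu>) i)"
    by (rule mon_weight_superset[OF _ k]) simp
  also have "\<dots> = (\<Prod>i\<in>?A. s i ^ lookup \<mu> i) * (\<Prod>i\<in>?A. s i ^ lookup \<nu> i)"
    by (simp add: lookup_add power_add prod.distrib)
  also have "\<dots> = mon_weight s \<mu> * mon_weight s \<nu>"
    using mon_weight_superset[of ?A \<mu> s] mon_weight_superset[of ?A \<nu> s] by simp
  finally show ?thesis .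
qed

lemma mon_weight_0 [simp]: "mon_weight s 0 = 1" by (simp add: mon_weight_def)
lemma mon_weight_single [simp]: "mon_weight s (single i k) = s i ^ k"
  by (cases "k = 0") (simp_all add: mon_weight_def)
lemma mon_weight_nonzero: "(\<And>i. s i \<noteq> 0) \<Longrightarrow> mon_weight s \<mu> \<noteq> 0" by (simp add: mon_weight_def)

definition scale_pol :: "(nat \<Rightarrow> K) \<Rightarrow> mpol \<Rightarrow> mpol" where
  "scale_pol s p = Poly_Mapping.mapp (\<lambda>\<mu> c. mon_weight s \<mu> * c) p"

lemma lookup_scale_pol: "lookup (scale_pol s p) \<mu> = mon_weight s \<mu> * lookup p \<mu>"
  by (simp add: scale_pol_def lookup_mapp in_keys_iff when_def)

lemma scale_pol_0 [simp]: "scale_pol s 0 = 0"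
  by (rule poly_mapping_eqI) (simp add: lookup_scale_pol)
lemma scale_pol_1 [simp]: "scale_pol s 1 = 1"
  by (rule poly_mapping_eqI) (simp add: lookup_scale_pol lookup_one when_def)
lemma scale_pol_add: "scale_pol s (p + r) = scale_pol s p + scale_pol s r"
  by (rule poly_mapping_eqI) (simp add: lookup_scale_pol lookup_add algebra_simps)
lemma scale_pol_single: "scale_pol s (single \<mu> c) = single \<mu> (mon_weight s \<mu> * c)"
  by (rule poly_mapping_eqI) (simp add: lookup_scale_pol lookup_single when_def)
lemma scale_pol_eq_0_iff: "(\<And>i. s i \<noteq> 0) \<Longrightarrow> scale_pol s p = 0 \<longleftrightarrow> p = 0"
  by (auto simp: poly_mapping_eq_iff fun_eq_iff lookup_scale_pol mon_weight_nonzero)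
lemma keys_scale_pol: "keys (scale_pol s p) \<subseteq> keys p"
  by (auto simp: in_keys_iff lookup_scale_pol)

lemma scale_pol_mult: "scale_pol s (p * r) = scale_pol s p * scale_pol s r"
proof (rule poly_mapping_eqI)
  fix \<kappa>
  have "lookup (scale_pol s p * scale_pol s r) \<kappa> =
     (\<Sum>\<mu>\<in>keys p. \<Sum>\<nu>\<in>keys r.
     if \<mu> + \<nu> = \<kappa> then lookup (scale_pol s p) \<mu> * lookup (scale_pol s r) \<nu> else 0)"
    unfolding lookup_times_finite
    by (rule sum.mono_neutral_cong_left)
       (auto simp: keys_scale_pol[THEN subsetD] in_keys_iff intro!: sum.neutral sum.mono_neutral_left
         dest: keys_scale_pol[THEN subsetD])
  also have "\<dots> = lookup (scale_pol s (p * r)) \<kappa>"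
    unfolding lookup_scale_pol lookup_times_finite sum_distrib_left
    by (intro sum.cong refl) (auto simp: mon_weight_add)
  finally show "lookup (scale_pol s (p * r)) \<kappa> =
      lookup (scale_pol s p * scale_pol s r) \<kappa>" by simp
qed

text \<open>A total version of the scaling factors: with a zero factor the denominator of a fraction could
become zero.\<close>

definition unit_or :: "(nat \<Rightarrow> K) \<Rightarrow> nat \<Rightarrow> K" where
  "unit_or s i = (if s i = 0 then 1 else s i)"

lemma unit_or_nonzero: "unit_or s i \<noteq> 0" by (simp add: unit_or_def)

text \<open>The substitution $x_i \mapsto s_i x_i$, for nonzero $s_i$ an automorphism of the field of rational functions.\<close>

lift_definition scale :: "(nat \<Rightarrow> K) \<Rightarrow> ratfun \<Rightarrow> ratfun"
  is "\<lambda>s (a, b). (scale_pol (unit_or s) a, scale_pol (unit_or s) b)"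
  by (auto simp: scale_pol_eq_0_iff unit_or_nonzero simp flip: scale_pol_mult)

lemma scale_Fract:
  assumes "\<And>i. s i \<noteq> 0"
  shows "scale s (Fraction_Field.Fract a b) = Fraction_Field.Fract (scale_pol s a) (scale_pol s b)"
proof -
  have "unit_or s = s" using assms by (auto simp: unit_or_def)
  then show ?thesis using assms by transfer (simp add: scale_pol_eq_0_iff)
qed

lemma scale_of_mpol: "(\<And>i. s i \<noteq> 0) \<Longrightarrow> scale s (of_mpol p) = of_mpol (scale_pol s p)"
  by (simp add: of_mpol_def scale_Fract)

context
  fixes s :: "nat \<Rightarrow> K"
  assumes s: "\<And>i. s i \<noteq> 0"
begin

lemma scale_of_K: "scale s (of_K c) = of_K c"
  by (simp add: of_K_def scale_of_mpol[OF s] scale_pol_single)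
lemma scale_0: "scale s 0 = 0" using scale_of_K[of 0] by simp
lemma scale_1: "scale s 1 = 1" using scale_of_K[of 1] by simp
lemma scale_mon: "scale s (mon \<kappa>) = of_K (mon_weight s \<kappa>) * mon \<kappa>"
proof -
  have "scale s (of_mpol (single \<kappa> 1)) = of_mpol (single \<kappa> (mon_weight s \<kappa>))"
    by (simp add: scale_of_mpol[OF s] scale_pol_single)
  then show ?thesis by (simp only: of_mpol_single of_K_1 mult_1)
qed
lemma scale_xvar: "scale s (xvar i) = of_K (s i) * xvar i"
  by (simp add: xvar_eq_mon scale_mon)

lemma scale_mult: "scale s (f * g) = scale s f * scale s g"
proof -
  obtain a b where f: "f = Fraction_Field.Fract a b" "b \<noteq> 0" by (rule Fract_cases)
  obtain c d where g: "g = Fraction_Field.Fract c d" "d \<noteq> 0" by (rule Fract_cases)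
  show ?thesis by (simp add: f g scale_Fract[OF s] scale_pol_mult)
qed

lemma scale_add: "scale s (f + g) = scale s f + scale s g"
proof -
  obtain a b where f: "f = Fraction_Field.Fract a b" "b \<noteq> 0" by (rule Fract_cases)
  obtain c d where g: "g = Fraction_Field.Fract c d" "d \<noteq> 0" by (rule Fract_cases)
  have "scale_pol s b \<noteq> 0" "scale_pol s d \<noteq> 0" using f g by (simp_all add: scale_pol_eq_0_iff[OF s])
  then show ?thesis using f g by (simp add: scale_Fract[OF s] scale_pol_mult scale_pol_add)
qed

lemma scale_eq_0_iff: "scale s f = 0 \<longleftrightarrow> f = 0"
proof -
  obtain a b where f: "f = Fraction_Field.Fract a b" "b \<noteq> 0" by (rule Fract_cases)
  then have "scale_pol s b \<noteq> 0" by (simp add: scale_pol_eq_0_iff[OF s])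
  then show ?thesis using f
    by (simp add: scale_Fract[OF s] Zero_fract_def eq_fract scale_pol_eq_0_iff[OF s])
qed

lemma scale_uminus: "scale s (- f) = - scale s f"
proof -
  have "scale s (- f) + scale s f = 0" by (simp flip: scale_add add: scale_0)
  then show ?thesis by (simp add: eq_neg_iff_add_eq_0)
qed

lemma scale_diff: "scale s (f - g) = scale s f - scale s g"
  using scale_add[of f "- g"] by (simp add: scale_uminus)

lemma scale_inverse: "scale s (inverse f) = inverse (scale s f)"
proof (cases "f = 0")
  case False
  then have "scale s (inverse f) * scale s f = 1" by (simp flip: scale_mult add: scale_1)
  then show ?thesis
    using inverse_unique[of "scale s f" "scale s (inverse f)"] by (simp add: mult.commute)
qed (simp add: scale_0)

lemma scale_divide: "scale s (f / g) = scale s f / scale s g"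
  by (simp add: divide_inverse scale_mult scale_inverse)

lemma scale_sum: "scale s (\<Sum>i\<in>A. f i) = (\<Sum>i\<in>A. scale s (f i))"
  by (induction A rule: infinite_finite_induct) (auto simp: scale_add scale_0)
lemma scale_prod: "scale s (\<Prod>i\<in>A. f i) = (\<Prod>i\<in>A. scale s (f i))"
  by (induction A rule: infinite_finite_induct) (auto simp: scale_mult scale_1)
lemma scale_power: "scale s (f ^ k) = scale s f ^ k"
  by (induction k) (auto simp: scale_mult scale_1)

end

lemma scale_scale:
  assumes s: "\<And>i. s i \<noteq> 0" and r: "\<And>i. r i \<noteq> 0"
  shows "scale s (scale r f) = scale (\<lambda>i. s i * r i) f"
proof -
  obtain a b where f: "f = Fraction_Field.Fract a b" "b \<noteq> 0" by (rule Fract_cases)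
  have sr: "s i * r i \<noteq> 0" for i using s r by simp
  have w: "mon_weight (\<lambda>i. s i * r i) \<mu> = mon_weight s \<mu> * mon_weight r \<mu>" for \<mu>
    by (simp add: mon_weight_def power_mult_distrib prod.distrib)
  have "scale_pol s (scale_pol r p) = scale_pol (\<lambda>i. s i * r i) p" for p
    by (rule poly_mapping_eqI) (simp add: lookup_scale_pol w)
  then show ?thesis by (simp add: f scale_Fract[OF s] scale_Fract[OF r] scale_Fract[OF sr])
qed

text \<open>The sets \<open>polys n\<close> and \<open>ratfuns n\<close> with any index set in place of \<open>{..<n}\<close>; the dual variables need \<open>{n..<n+m}\<close>.\<close>

definition polysV :: "nat set \<Rightarrow> mpol set" where
  "polysV A = {p. \<forall>\<mu>\<in>keys p. keys \<mu> \<subseteq> A}"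

definition ratV :: "nat set \<Rightarrow> ratfun set" where
  "ratV A = {Fraction_Field.Fract a b | a b. a \<in> polysV A \<and> b \<in> polysV A \<and> b \<noteq> 0}"

lemma polys_eq_polysV: "polys n = polysV {..<n}" by (simp add: polys_def polysV_def)
lemma ratfuns_eq_ratV: "ratfuns n = ratV {..<n}" by (simp add: ratfuns_def ratV_def polys_eq_polysV)

lemma polysV_single: "keys \<mu> \<subseteq> A \<Longrightarrow> single \<mu> c \<in> polysV A"
  by (simp add: polysV_def)
lemma polysV_0 [simp]: "0 \<in> polysV A" by (simp add: polysV_def)
lemma polysV_1 [simp]: "1 \<in> polysV A" by (simp add: polysV_def)
lemma polysV_add: "p \<in> polysV A \<Longrightarrow> r \<in> polysV A \<Longrightarrow> p + r \<in> polysV A"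
  using keys_add[of p r] by (auto simp: polysV_def)
lemma polysV_uminus: "p \<in> polysV A \<Longrightarrow> - p \<in> polysV A"
  by (auto simp: polysV_def in_keys_iff)
lemma polysV_mult: "p \<in> polysV A \<Longrightarrow> r \<in> polysV A \<Longrightarrow> p * r \<in> polysV A"
proof -
  assume h: "p \<in> polysV A" "r \<in> polysV A"
  show ?thesis unfolding polysV_def
  proof (intro CollectI ballI)
    fix \<kappa> assume "\<kappa> \<in> keys (p * r)"
    then obtain a b where ab: "\<kappa> = a + b" "a \<in> keys p" "b \<in> keys r"
      using keys_mult[of p r] by auto
    then have "keys a \<subseteq> A" "keys b \<subseteq> A" using h by (auto simp: polysV_def)
    then show "keys \<kappa> \<subseteq> A" unfolding ab(1) using keys_add[of a b] by blast
  qed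
qed
lemma polysV_sum: "(\<And>i. i \<in> I \<Longrightarrow> f i \<in> polysV A) \<Longrightarrow> (\<Sum>i\<in>I. f i) \<in> polysV A"
  by (induction I rule: infinite_finite_induct) (auto intro: polysV_add)
lemma polysV_scale: "p \<in> polysV A \<Longrightarrow> scale_pol s p \<in> polysV A"
  using keys_scale_pol[of s p] by (auto simp: polysV_def)

lemma ratVI: "a \<in> polysV A \<Longrightarrow> b \<in> polysV A \<Longrightarrow> b \<noteq> 0 \<Longrightarrow> Fraction_Field.Fract a b \<in> ratV A"
  by (auto simp: ratV_def)
lemma ratVE:
  assumes "f \<in> ratV A"
  obtains a b where "f = Fraction_Field.Fract a b" "a \<in> polysV A" "b \<in> polysV A" "b \<noteq> 0"
  using assms by (auto simp: ratV_def)
lemma ratV_of_mpol: "p \<in> polysV A \<Longrightarrow> of_mpol p \<in> ratV A"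
  unfolding of_mpol_def by (rule ratVI) auto
lemma ratV_of_K [simp]: "of_K c \<in> ratV A"
  unfolding of_K_def by (intro ratV_of_mpol polysV_single) auto
lemma ratV_0 [simp]: "0 \<in> ratV A" using ratV_of_K[of 0] by simp
lemma ratV_1 [simp]: "1 \<in> ratV A" using ratV_of_K[of 1] by simp
lemma ratV_mon: "keys \<kappa> \<subseteq> A \<Longrightarrow> mon \<kappa> \<in> ratV A"
  unfolding mon_def by (intro ratV_of_mpol polysV_single)
lemma ratV_xvar: "i \<in> A \<Longrightarrow> xvar i \<in> ratV A"
  unfolding xvar_eq_mon by (rule ratV_mon) auto
lemma ratV_add: "f \<in> ratV A \<Longrightarrow> g \<in> ratV A \<Longrightarrow> f + g \<in> ratV A"
  by (elim ratVE) (auto intro!: ratVI polysV_add polysV_mult)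
lemma ratV_mult: "f \<in> ratV A \<Longrightarrow> g \<in> ratV A \<Longrightarrow> f * g \<in> ratV A"
  by (elim ratVE) (auto intro!: ratVI polysV_mult)
lemma ratV_uminus: "f \<in> ratV A \<Longrightarrow> - f \<in> ratV A"
  by (elim ratVE) (auto intro!: ratVI polysV_uminus)
lemma ratV_diff: "f \<in> ratV A \<Longrightarrow> g \<in> ratV A \<Longrightarrow> f - g \<in> ratV A"
  using ratV_add[of f A "- g"] ratV_uminus[of g A] by simp
lemma ratV_inverse: "f \<in> ratV A \<Longrightarrow> inverse f \<in> ratV A"
proof (elim ratVE)
  fix a b assume h: "f = Fraction_Field.Fract a b" "a \<in> polysV A" "b \<in> polysV A" "b \<noteq> 0"
  show "inverse f \<in> ratV A"
  proof (cases "a = 0")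
    case True
    then have "f = 0" using h by (simp add: Zero_fract_def eq_fract)
    then show ?thesis by simp
  next
    case False
    then show ?thesis using h by (auto intro: ratVI)
  qed
qed
lemma ratV_divide: "f \<in> ratV A \<Longrightarrow> g \<in> ratV A \<Longrightarrow> f / g \<in> ratV A"
  by (simp add: divide_inverse ratV_mult ratV_inverse)
lemma ratV_sum: "(\<And>i. i \<in> I \<Longrightarrow> f i \<in> ratV A) \<Longrightarrow> (\<Sum>i\<in>I. f i) \<in> ratV A"
  by (induction I rule: infinite_finite_induct) (auto intro: ratV_add)
lemma ratV_prod: "(\<And>i. i \<in> I \<Longrightarrow> f i \<in> ratV A) \<Longrightarrow> (\<Prod>i\<in>I. f i) \<in> ratV A"
  by (induction I rule: infinite_finite_induct) (auto intro: ratV_mult)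
lemma ratV_power: "f \<in> ratV A \<Longrightarrow> f ^ k \<in> ratV A"
  by (induction k) (auto intro: ratV_mult)
lemma ratV_scale: "(\<And>i. s i \<noteq> 0) \<Longrightarrow> f \<in> ratV A \<Longrightarrow> scale s f \<in> ratV A"
  by (elim ratVE) (auto simp: scale_Fract scale_pol_eq_0_iff intro!: ratVI polysV_scale)

lemma scale_cong_ratV:
  assumes "\<And>i. s i \<noteq> 0" "\<And>i. r i \<noteq> 0" "f \<in> ratV A" "\<And>i. i \<in> A \<Longrightarrow> s i = r i"
  shows "scale s f = scale r f"
proof -
  obtain a b where f: "f = Fraction_Field.Fract a b" "a \<in> polysV A" "b \<in> polysV A" "b \<noteq> 0"
    using assms(3) by (rule ratVE)
  have "scale_pol s p = scale_pol r p" if "p \<in> polysV A" for p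
  proof (rule poly_mapping_eqI)
    fix \<mu>
    have "mon_weight s \<mu> = mon_weight r \<mu>" if "\<mu> \<in> keys p"
      unfolding mon_weight_def
    proof (intro prod.cong refl)
      fix x assume "x \<in> keys \<mu>"
      then have "x \<in> A" using that \<open>p \<in> polysV A\<close> by (auto simp: polysV_def)
      then show "s x ^ lookup \<mu> x = r x ^ lookup \<mu> x" by (simp add: assms(4))
    qed
    then show "lookup (scale_pol s p) \<mu> = lookup (scale_pol r p) \<mu>"
      by (cases "\<mu> \<in> keys p") (auto simp: lookup_scale_pol in_keys_iff)
  qed
  then show ?thesis using f assms(1,2) by (simp add: scale_Fract)
qed

lemma scale_pol_unit [simp]: "scale_pol (\<lambda>_. 1) p = p"
  by (rule poly_mapping_eqI) (simp add: lookup_scale_pol mon_weight_def)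

lemma scale_unit [simp]: "scale (\<lambda>_. 1) f = f"
proof -
  obtain a b where f: "f = Fraction_Field.Fract a b" "b \<noteq> 0" by (rule Fract_cases)
  then show ?thesis by (simp add: scale_Fract)
qed

lemma scale_trivial:
  assumes "\<And>i. s i \<noteq> 0" "f \<in> ratV A" "\<And>i. i \<in> A \<Longrightarrow> s i = 1"
  shows "scale s f = f"
  using scale_cong_ratV[of s "\<lambda>_. 1" f A] assms by simp

lemma qshift_eq_scale: "qshift i f = scale (\<lambda>j. if j = i then q_K else 1) f"
proof -
  obtain a b where f: "f = Fraction_Field.Fract a b" "b \<noteq> 0" by (rule Fract_cases)
  have w: "mon_weight (\<lambda>j. if j = i then q_K else 1) \<mu> = q_K ^ lookup \<mu> i" for \<mu>
  proof -
    have "mon_weight (\<lambda>j. if j = i then q_K else 1) \<mu> =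
        (\<Prod>j\<in>insert i (keys \<mu>). (if j = i then q_K else 1) ^ lookup \<mu> j)"
      by (rule mon_weight_superset) auto
    also have "\<dots> = (\<Prod>j\<in>insert i (keys \<mu>). if j = i then q_K ^ lookup \<mu> i else 1)"
      by (intro prod.cong refl) auto
    finally show ?thesis by simp
  qed
  have "qshift_pol i p = scale_pol (\<lambda>j. if j = i then q_K else 1) p" for p
    by (rule poly_mapping_eqI) (simp add: lookup_qshift_pol lookup_scale_pol w)
  then show ?thesis by (simp add: f qshift_Fract scale_Fract q_K_nonzero)
qed

lemma qshift_power_eq_scale: "(qshift i ^^ k) f = scale (\<lambda>j. if j = i then q_K ^ k else 1) f"
proof (induction k)
  case 0
  have "(\<lambda>j. if j = i then q_K ^ 0 else 1) = (\<lambda>_. 1)" by auto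
  then show ?case by simp
next
  case (Suc k)
  have "(\<lambda>j. (if j = i then q_K else 1) * (if j = i then q_K ^ k else 1)) = (\<lambda>j. if j = i then q_K ^ Suc k else 1)"
    by auto
  then show ?case using Suc by (simp add: qshift_eq_scale scale_scale q_K_nonzero)
qed

text \<open>All $q$-shift operators become instances of one substitution, so that their composition is a product of factors.\<close>

lemma qshifts_eq_scale: "qshifts n \<gamma> f = scale (\<lambda>i. if i < n then q_K ^ \<gamma> i else 1) f"
proof -
  have "distinct l \<Longrightarrow> foldr (\<lambda>i g. (qshift i ^^ \<gamma> i) \<circ> g) l id f =
      scale (\<lambda>i. if i \<in> set l then q_K ^ \<gamma> i else 1) f" for l
  proof (induction l)
    case (Cons a l)
    have "(\<lambda>i. (if i = a then q_K ^ \<gamma> a else 1) * (if i \<in> set l then q_K ^ \<gamma> i else 1)) =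
        (\<lambda>i. if i \<in> set (a # l) then q_K ^ \<gamma> i else 1)"
      using Cons.prems by auto
    then show ?case using Cons by (simp add: qshift_power_eq_scale scale_scale q_K_nonzero)
  qed simp
  from this[of "[0..<n]"] show ?thesis by (simp add: qshifts_def)
qed

section \<open>Separation of variables and the lexicographic place\<close>

lemma common_denominator:
  assumes "finite J" "\<And>j. j \<in> J \<Longrightarrow> s j \<in> ratV B"
  shows "\<exists>d \<sigma>. d \<in> polysV B \<and> d \<noteq> 0 \<and> (\<forall>j\<in>J. \<sigma> j \<in> polysV B \<and> s j = of_mpol (\<sigma> j) / of_mpol d)"
  using assms
proof (induction J rule: finite_induct)
  case empty
  show ?case by (intro exI[of _ 1]) simp
next
  case (insert i J)
  obtain d \<sigma> where d: "d \<in> polysV B" "d \<noteq> 0" "\<forall>j\<in>J. \<sigma> j \<in> polysV B \<and> s j = of_mpol (\<sigma> j) / of_mpol d"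
    using insert.IH insert.prems by blast
  obtain a b where ab: "s i = Fraction_Field.Fract a b" "a \<in> polysV B" "b \<in> polysV B" "b \<noteq> 0"
    using insert.prems[of i] by (auto elim: ratVE)
  show ?case
  proof (intro exI[of _ "d * b"] exI[of _ "\<lambda>j. if j = i then a * d else \<sigma> j * b"] conjI ballI)
    show "d * b \<in> polysV B" using d ab by (intro polysV_mult)
    show "d * b \<noteq> 0" using d ab by simp
  next
    fix j assume j: "j \<in> insert i J"
    show "(if j = i then a * d else \<sigma> j * b) \<in> polysV B" using j d ab by (auto intro: polysV_mult)
    show "s j = of_mpol (if j = i then a * d else \<sigma> j * b) / of_mpol (d * b)"
      using j d ab by (auto simp: of_mpol_mult Fract_eq_of_mpol)
  qed
qed

lemma lookup_single0_times: "lookup (single 0 c * p) \<rho> = c * lookup (p::mpol) \<rho>"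
proof -
  have "\<mu> = 0 \<and> \<nu> = \<rho>" if "\<mu> \<in> keys (single 0 c)" "\<mu> + \<nu> = 0 + \<rho>" for \<mu> \<nu>
    using that by (auto split: if_splits)
  then show ?thesis using lookup_times_unique[of "single 0 c" p 0 \<rho>] by simp
qed

lemma polysV_lookup: "p \<in> polysV A \<Longrightarrow> \<not> keys \<mu> \<subseteq> A \<Longrightarrow> lookup p \<mu> = 0"
  unfolding polysV_def using in_keys_iff[of \<mu> p] by blast

text \<open>Polynomials in the variables \<open>A\<close> may be compared coefficientwise when the scalars are rational
functions in disjoint variables \<open>B\<close>: after clearing denominators, the monomial \<open>\<tau> + \<rho>\<close> arises in a
product only from \<open>\<tau>\<close> and \<open>\<rho>\<close>.\<close>

lemma coefficient_separation:
  assumes J: "finite J" and AB: "A \<inter> B = {}" and p: "\<And>j. j \<in> J \<Longrightarrow> p j \<in> polysV A"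
    and s: "\<And>j. j \<in> J \<Longrightarrow> s j \<in> ratV B" and z: "(\<Sum>j\<in>J. of_mpol (p j) * s j) = 0"
  shows "(\<Sum>j\<in>J. of_K (lookup (p j) \<tau>) * s j) = 0"
proof (cases "keys \<tau> \<subseteq> A")
  case False
  then have "lookup (p j) \<tau> = 0" if "j \<in> J" for j
    using polysV_lookup[OF p[OF that]] by simp
  then show ?thesis by simp
next
  case True
  obtain d \<sigma> where d: "d \<in> polysV B" "d \<noteq> 0" "\<forall>j\<in>J. \<sigma> j \<in> polysV B \<and> s j = of_mpol (\<sigma> j) / of_mpol d"
    using common_denominator[OF J, of s B] s by blast
  have "(\<Sum>j\<in>J. of_mpol (p j) * s j) = of_mpol (\<Sum>j\<in>J. p j * \<sigma> j) / of_mpol d"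
    unfolding of_mpol_sum sum_divide_distrib of_mpol_mult using d(3) by (intro sum.cong refl) simp
  then have z': "(\<Sum>j\<in>J. p j * \<sigma> j) = 0" using z d(2) by simp
  have "(\<Sum>j\<in>J. single 0 (lookup (p j) \<tau>) * \<sigma> j) = 0"
  proof (rule poly_mapping_eqI)
    fix \<rho>
    show "lookup (\<Sum>j\<in>J. single 0 (lookup (p j) \<tau>) * \<sigma> j) \<rho> = lookup 0 \<rho>"
    proof (cases "keys \<rho> \<subseteq> B")
      case False
      then have "lookup (\<sigma> j) \<rho> = 0" if "j \<in> J" for j
        using d(3) that polysV_lookup by blast
      then show ?thesis by (simp add: lookup_sum lookup_single0_times)
    next
      case B: True
      \<comment> \<open>The variables are disjoint, so the exponents split uniquely.\<close>
      have "lookup (p j * \<sigma> j) (\<tau> + \<rho>) = lookup (p j) \<tau> * lookup (\<sigma> j) \<rho>"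
        if j: "j \<in> J" for j
      proof (rule lookup_times_unique)
        fix \<mu> \<nu> assume h: "\<mu> \<in> keys (p j)" "\<nu> \<in> keys (\<sigma> j)" "\<mu> + \<nu> = \<tau> + \<rho>"
        have k: "keys \<mu> \<subseteq> A" "keys \<nu> \<subseteq> B"
          using h p[OF j] d(3) j by (auto simp: polysV_def)
        have "lookup \<mu> i = lookup \<tau> i" for i
        proof -
          have "lookup \<mu> i + lookup \<nu> i = lookup \<tau> i + lookup \<rho> i"
            using h(3) by (metis lookup_add)
          moreover have "lookup \<mu> i = 0 \<and> lookup \<tau> i = 0" if "i \<notin> A"
            using k(1) True that by (auto simp: in_keys_iff)
          moreover have "lookup \<nu> i = 0 \<and> lookup \<rho> i = 0" if "i \<notin> B"
            using k(2) B that by (auto simp: in_keys_iff)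
          ultimately show ?thesis using AB by (cases "i \<in> A"; cases "i \<in> B") auto
        qed
        then have "\<mu> = \<tau>" by (simp add: poly_mapping_eq_iff fun_eq_iff)
        then show "\<mu> = \<tau> \<and> \<nu> = \<rho>" using h(3) by simp
      qed
      then have "lookup (\<Sum>j\<in>J. single 0 (lookup (p j) \<tau>) * \<sigma> j) \<rho> =
        lookup (\<Sum>j\<in>J. p j * \<sigma> j) (\<tau> + \<rho>)"
        by (simp add: lookup_sum lookup_single0_times)
      then show ?thesis using z' by simp
    qed
  qed
  then have "of_mpol (\<Sum>j\<in>J. single 0 (lookup (p j) \<tau>) * \<sigma> j) / of_mpol d = 0" by simp
  then show ?thesis
    using d(3) by (simp add: of_mpol_sum of_mpol_mult sum_divide_distrib of_K_def)
qed

text \<open>\<open>f\<close> is finite with value \<open>c\<close> at the place of the lexicographic order, that is, in the limit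
$x_0 \gg x_1 \gg \cdots$. This is a leading coefficient for rational functions which
is compatible with sums and products, and invariant under rescaling of the variables.\<close>

definition place :: "ratfun \<Rightarrow> K \<Rightarrow> bool" where
  "place f c \<longleftrightarrow> (\<exists>a b \<eta>. f = Fraction_Field.Fract a b \<and> (\<forall>\<kappa>\<in>keys a. \<kappa> \<le> \<eta>) \<and>
     (\<forall>\<kappa>\<in>keys b. \<kappa> \<le> \<eta>) \<and> lookup b \<eta> \<noteq> 0 \<and>
     lookup a \<eta> = c * lookup b \<eta>)"

lemma placeI:
  assumes "f = Fraction_Field.Fract a b" "\<And>\<kappa>. \<kappa> \<in> keys a \<Longrightarrow> \<kappa> \<le> \<eta>"
    "\<And>\<kappa>. \<kappa> \<in> keys b \<Longrightarrow> \<kappa> \<le> \<eta>" "lookup b \<eta> \<noteq> 0"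
    "lookup a \<eta> = c * lookup b \<eta>"
  shows "place f c"
  using assms unfolding place_def by blast

lemma placeE:
  assumes "place f c"
  obtains a b \<eta> where "f = Fraction_Field.Fract a b" "b \<noteq> 0" "\<forall>\<kappa>\<in>keys a. \<kappa> \<le> \<eta>"
    "\<forall>\<kappa>\<in>keys b. \<kappa> \<le> \<eta>" "lookup b \<eta> \<noteq> 0"
    "lookup a \<eta> = c * lookup b \<eta>"
proof -
  obtain a b \<eta> where h: "f = Fraction_Field.Fract a b" "\<forall>\<kappa>\<in>keys a. \<kappa> \<le> \<eta>"
    "\<forall>\<kappa>\<in>keys b. \<kappa> \<le> \<eta>" "lookup b \<eta> \<noteq> 0"
    "lookup a \<eta> = c * lookup b \<eta>"
    using assms unfolding place_def by blast
  have "b \<noteq> 0" using h(4) by auto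
  then show thesis using h that by blast
qed

lemma place_mult:
  assumes "place f c" "place g d"
  shows "place (f * g) (c * d)"
proof -
  obtain a b \<eta> where f: "f = Fraction_Field.Fract a b" "b \<noteq> 0" "\<forall>\<kappa>\<in>keys a. \<kappa> \<le> \<eta>"
    "\<forall>\<kappa>\<in>keys b. \<kappa> \<le> \<eta>" "lookup b \<eta> \<noteq> 0"
    "lookup a \<eta> = c * lookup b \<eta>" by (rule placeE[OF assms(1)])
  obtain a' b' \<eta>' where g: "g = Fraction_Field.Fract a' b'" "b' \<noteq> 0" "\<forall>\<kappa>\<in>keys a'. \<kappa> \<le> \<eta>'"
    "\<forall>\<kappa>\<in>keys b'. \<kappa> \<le> \<eta>'" "lookup b' \<eta>' \<noteq> 0"
    "lookup a' \<eta>' = d * lookup b' \<eta>'" by (rule placeE[OF assms(2)])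
  show ?thesis
  proof (rule placeI[of _ "a * a'" "b * b'" "\<eta> + \<eta>'"])
    show "f * g = Fraction_Field.Fract (a * a') (b * b')" by (simp add: f g)
    show "\<kappa> \<le> \<eta> + \<eta>'" if "\<kappa> \<in> keys (a * a')" for \<kappa>
      by (rule keys_times_le[OF f(3)[rule_format] g(3)[rule_format] that])
    show "\<kappa> \<le> \<eta> + \<eta>'" if "\<kappa> \<in> keys (b * b')" for \<kappa>
      by (rule keys_times_le[OF f(4)[rule_format] g(4)[rule_format] that])
    have l: "lookup (b * b') (\<eta> + \<eta>') = lookup b \<eta> * lookup b' \<eta>'"
      by (rule lookup_times_top[OF f(4)[rule_format] g(4)[rule_format]])
    show "lookup (b * b') (\<eta> + \<eta>') \<noteq> 0" using f g by (simp add: l)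
    have "lookup (a * a') (\<eta> + \<eta>') = lookup a \<eta> * lookup a' \<eta>'"
      by (rule lookup_times_top[OF f(3)[rule_format] g(3)[rule_format]])
    then show "lookup (a * a') (\<eta> + \<eta>') = c * d * lookup (b * b') (\<eta> + \<eta>')"
      using f g by (simp add: l)
  qed
qed

lemma place_add:
  assumes "place f c" "place g d"
  shows "place (f + g) (c + d)"
proof -
  obtain a b \<eta> where f: "f = Fraction_Field.Fract a b" "b \<noteq> 0" "\<forall>\<kappa>\<in>keys a. \<kappa> \<le> \<eta>"
    "\<forall>\<kappa>\<in>keys b. \<kappa> \<le> \<eta>" "lookup b \<eta> \<noteq> 0"
    "lookup a \<eta> = c * lookup b \<eta>" by (rule placeE[OF assms(1)])
  obtain a' b' \<eta>' where g: "g = Fraction_Field.Fract a' b'" "b' \<noteq> 0" "\<forall>\<kappa>\<in>keys a'. \<kappa> \<le> \<eta>'"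
    "\<forall>\<kappa>\<in>keys b'. \<kappa> \<le> \<eta>'" "lookup b' \<eta>' \<noteq> 0"
    "lookup a' \<eta>' = d * lookup b' \<eta>'" by (rule placeE[OF assms(2)])
  show ?thesis
  proof (rule placeI[of _ "a * b' + a' * b" "b * b'" "\<eta> + \<eta>'"])
    show "f + g = Fraction_Field.Fract (a * b' + a' * b) (b * b')" using f g by simp
    show "\<kappa> \<le> \<eta> + \<eta>'" if "\<kappa> \<in> keys (a * b' + a' * b)" for \<kappa>
    proof -
      have "\<kappa> \<in> keys (a * b') \<or> \<kappa> \<in> keys (a' * b)"
        using keys_add[of "a * b'" "a' * b"] that by blast
      then show ?thesis
        using keys_times_le[OF f(3)[rule_format] g(4)[rule_format]] keys_times_le[OF g(3)[rule_format] f(4)[rule_format]] by (auto simp: add.commute)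
    qed
    show "\<kappa> \<le> \<eta> + \<eta>'" if "\<kappa> \<in> keys (b * b')" for \<kappa>
      by (rule keys_times_le[OF f(4)[rule_format] g(4)[rule_format] that])
    have l: "lookup (b * b') (\<eta> + \<eta>') = lookup b \<eta> * lookup b' \<eta>'"
      by (rule lookup_times_top[OF f(4)[rule_format] g(4)[rule_format]])
    show "lookup (b * b') (\<eta> + \<eta>') \<noteq> 0" using f g by (simp add: l)
    have e: "\<eta>' + \<eta> = \<eta> + \<eta>'" by (rule add.commute)
    have "lookup (a * b') (\<eta> + \<eta>') = lookup a \<eta> * lookup b' \<eta>'"
      by (rule lookup_times_top[OF f(3)[rule_format] g(4)[rule_format]])
    then have m1: "lookup (a * b') (\<eta> + \<eta>') = c * (lookup b \<eta> * lookup b' \<eta>')"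
      by (simp add: f(6))
    have "lookup (a' * b) (\<eta>' + \<eta>) = lookup a' \<eta>' * lookup b \<eta>"
      by (rule lookup_times_top[OF g(3)[rule_format] f(4)[rule_format]])
    then have m2: "lookup (a' * b) (\<eta> + \<eta>') = d * (lookup b \<eta> * lookup b' \<eta>')"
      unfolding e g(6) by (simp only: mult_ac)
    show "lookup (a * b' + a' * b) (\<eta> + \<eta>') = (c + d) * lookup (b * b') (\<eta> + \<eta>')"
      unfolding lookup_add l m1 m2 by (rule distrib_right[symmetric])
  qed
qed

lemma place_of_K: "place (of_K c) c"
  by (rule placeI[of _ "single 0 c" 1 0]) (auto simp: of_K_def of_mpol_def split: if_splits)

lemma place_0: "place 0 0" using place_of_K[of 0] by simp
lemma place_1: "place 1 1" using place_of_K[of 1] by simp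

lemma place_uminus: "place f c \<Longrightarrow> place (- f) (- c)"
  using place_mult[OF place_of_K[of "- 1"], of f c] by (simp add: of_K_uminus)

lemma place_diff: "place f c \<Longrightarrow> place g d \<Longrightarrow> place (f - g) (c - d)"
  using place_add[OF _ place_uminus, of f c g d] by simp

lemma place_sum: "(\<And>i. i \<in> I \<Longrightarrow> place (f i) (c i)) \<Longrightarrow> place (\<Sum>i\<in>I. f i) (\<Sum>i\<in>I. c i)"
  by (induction I rule: infinite_finite_induct) (auto simp: place_0 intro: place_add)

lemma place_prod: "(\<And>i. i \<in> I \<Longrightarrow> place (f i) (c i)) \<Longrightarrow> place (\<Prod>i\<in>I. f i) (\<Prod>i\<in>I. c i)"
  by (induction I rule: infinite_finite_induct) (auto simp: place_1 intro: place_mult)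

lemma place_unique:
  assumes "place f c" "place f d"
  shows "c = d"
proof -
  have p0: "place 0 (c - d)" using place_diff[OF assms] by simp
  obtain a b \<eta> where h: "(0::ratfun) = Fraction_Field.Fract a b" "b \<noteq> 0" "\<forall>\<kappa>\<in>keys a. \<kappa> \<le> \<eta>"
    "\<forall>\<kappa>\<in>keys b. \<kappa> \<le> \<eta>" "lookup b \<eta> \<noteq> 0"
    "lookup a \<eta> = (c - d) * lookup b \<eta>" by (rule placeE[OF p0])
  have "a = 0" using h(1,2) by (simp add: Zero_fract_def eq_fract)
  then show ?thesis using h(5,6) by simp
qed

lemma place_scale:
  assumes s: "\<And>i. s i \<noteq> 0" and "place f c"
  shows "place (scale s f) c"
proof -
  obtain a b \<eta> where f: "f = Fraction_Field.Fract a b" "b \<noteq> 0" "\<forall>\<kappa>\<in>keys a. \<kappa> \<le> \<eta>"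
    "\<forall>\<kappa>\<in>keys b. \<kappa> \<le> \<eta>" "lookup b \<eta> \<noteq> 0"
    "lookup a \<eta> = c * lookup b \<eta>" by (rule placeE[OF assms(2)])
  show ?thesis
    by (rule placeI[of _ "scale_pol s a" "scale_pol s b" \<eta>])
       (use f keys_scale_pol in \<open>auto simp: scale_Fract[OF s] lookup_scale_pol mon_weight_nonzero[OF s] dest!: keys_scale_pol[THEN subsetD]\<close>)
qed

lemma single_less_single: "i < j \<Longrightarrow> single j (1::nat) < single i 1"
  unfolding less_poly_mapping.rep_eq less_fun_def
  by (intro exI[of _ i]) (auto simp: lookup_single when_def)

text \<open>In the limit $x_i/x_j$ is infinite if \<open>i < j\<close> and zero if \<open>j < i\<close>.\<close>

lemma place_coupling:
  assumes "i \<noteq> j"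
  shows "place ((1 - of_K s * xvar i / xvar j) / (1 - xvar i / xvar j)) (if i < j then s else 1)"
proof -
  let ?i = "single i (1::nat)" and ?j = "single j (1::nat)"
  define a where "a r = single ?j 1 - single ?i r" for r :: K
  have ij: "?i \<noteq> ?j"
  proof
    assume "?i = ?j"
    then have "lookup ?i i = lookup ?j i" by simp
    then show False using assms by (simp add: lookup_single when_def)
  qed
  have a: "of_mpol (a r) = xvar j - of_K r * xvar i" for r
    by (simp add: a_def of_mpol_diff of_mpol_single xvar_eq_mon)
  have la: "lookup (a r) ?i = - r" "lookup (a r) ?j = 1" for r
    using ij by (auto simp: a_def lookup_minus lookup_single when_def)
  have ka: "\<kappa> = ?i \<or> \<kappa> = ?j" if "\<kappa> \<in> keys (a r)" for \<kappa> r
    using that by (auto simp: a_def in_keys_iff lookup_minus lookup_single when_def split: if_splits)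
  have nz: "a r \<noteq> 0" for r using la(2)[of r] by auto
  have n1: "xvar j - xvar i \<noteq> 0" using nz[of 1] a[of 1] of_mpol_eq_0_iff[of "a 1"] by auto
  have "(1 - of_K s * xvar i / xvar j) / (1 - xvar i / xvar j) = of_mpol (a s) / of_mpol (a 1)"
    using n1 by (simp add: a field_simps)
  then have f: "(1 - of_K s * xvar i / xvar j) / (1 - xvar i / xvar j) = Fraction_Field.Fract (a s) (a 1)"
    using nz[of 1] by (simp add: Fract_eq_of_mpol)
  show ?thesis
  proof (cases "i < j")
    case True
    show ?thesis unfolding f
      by (rule placeI[of _ "a s" "a 1" ?i]) (use single_less_single[OF True] True in \<open>auto simp: la la[unfolded One_nat_def] dest!: ka\<close>)
  next
    case False
    then have "j < i" using assms by simp
    show ?thesis unfolding f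
      by (rule placeI[of _ "a s" "a 1" ?j]) (use single_less_single[OF \<open>j < i\<close>] False in \<open>auto simp: la la[unfolded One_nat_def] dest!: ka\<close>)
  qed
qed

lemma place_of_mpol:
  assumes "\<And>\<kappa>. \<kappa> \<in> keys p \<Longrightarrow> \<kappa> \<le> \<eta>"
  shows "place (of_mpol p / mon \<eta>) (lookup p \<eta>)"
proof -
  have "of_mpol p / mon \<eta> = Fraction_Field.Fract p (single \<eta> 1)"
    using mon_nonzero[of \<eta>] unfolding mon_def by (simp add: Fract_eq_of_mpol)
  then show ?thesis by (rule placeI[of _ _ _ \<eta>]) (use assms in \<open>auto split: if_splits\<close>)
qed

lemma keys_le_Max: "p \<noteq> 0 \<Longrightarrow> Max (keys p) \<in> keys p \<and>
    (\<forall>\<kappa>\<in>keys p. \<kappa> \<le> Max (keys (p::mpol)))"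
  by (intro conjI Max_in ballI Max_ge) auto

text \<open>Divide by the leading monomials of numerator and denominator.\<close>

lemma place_lead_exists:
  assumes f: "f \<in> ratV A" "f \<noteq> 0"
  shows "\<exists>\<kappa> \<kappa>' c. c \<noteq> 0 \<and> keys \<kappa> \<subseteq> A \<and> keys \<kappa>' \<subseteq> A \<and> place (f * mon \<kappa>' / mon \<kappa>) c"
proof -
  obtain a b where ab: "f = Fraction_Field.Fract a b" "a \<in> polysV A" "b \<in> polysV A" "b \<noteq> 0"
    using f(1) by (rule ratVE)
  have "a \<noteq> 0" using f(2) ab by (auto simp: Zero_fract_def eq_fract)
  define \<kappa> where "\<kappa> = Max (keys a)"
  define \<kappa>' where "\<kappa>' = Max (keys b)"
  note ka = keys_le_Max[OF \<open>a \<noteq> 0\<close>, folded \<kappa>_def] and kb = keys_le_Max[OF ab(4), folded \<kappa>'_def]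
  have "place (of_mpol a / mon \<kappa>) (lookup a \<kappa>)" using ka by (intro place_of_mpol) auto
  moreover have "place (mon \<kappa>' / of_mpol b) (inverse (lookup b \<kappa>'))"
  proof (rule placeI[of _ "single \<kappa>' 1" b \<kappa>'])
    show "mon \<kappa>' / of_mpol b = Fraction_Field.Fract (single \<kappa>' 1) b"
      using ab(4) by (simp add: Fract_eq_of_mpol mon_def)
  qed (use kb in \<open>auto simp: in_keys_iff split: if_splits\<close>)
  ultimately have "place (of_mpol a / mon \<kappa> * (mon \<kappa>' / of_mpol b)) (lookup a \<kappa> * inverse (lookup b \<kappa>'))"
    by (rule place_mult)
  moreover have "of_mpol a / mon \<kappa> * (mon \<kappa>' / of_mpol b) = f * mon \<kappa>' / mon \<kappa>"
    using ab by (simp add: Fract_eq_of_mpol)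
  ultimately have "place (f * mon \<kappa>' / mon \<kappa>) (lookup a \<kappa> * inverse (lookup b \<kappa>'))" by simp
  moreover have "lookup a \<kappa> * inverse (lookup b \<kappa>') \<noteq> 0"
    using ka kb by (simp add: in_keys_iff)
  moreover have "keys \<kappa> \<subseteq> A" "keys \<kappa>' \<subseteq> A"
    using ka kb ab by (auto simp: polysV_def)
  ultimately show ?thesis by blast
qed

section \<open>Independence of the powers of \<open>q\<close> and \<open>t\<close>\<close>

definition qt_mono :: "int \<Rightarrow> int \<Rightarrow> K" where
  "qt_mono a b = q_K powi a * t_K powi b"

lemma t_K_nonzero: "t_K \<noteq> 0"
  by (simp add: t_K_def Zero_fract_def eq_fract)

lemma Fract_power: "Fraction_Field.Fract (a::'a::idom) 1 ^ k = Fraction_Field.Fract (a ^ k) 1"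
  by (induction k) (auto simp: One_fract_def)

lemma Fract_sum: "(\<Sum>i\<in>I. Fraction_Field.Fract (f i :: 'a::idom) 1) = Fraction_Field.Fract (\<Sum>i\<in>I. f i) 1"
  by (induction I rule: infinite_finite_induct) (auto simp: Zero_fract_def)

lemma qt_power_eq_Fract: "q_K ^ a * t_K ^ b = Fraction_Field.Fract (monom (monom 1 a) b) 1"
proof -
  have q: "[:[:0, 1:]:] ^ a = monom (monom (1::rat) a) 0"
    by (simp add: monom_0 poly_const_pow monom_altdef)
  have t: "[:0, 1:] ^ b = monom (1::rat poly) b" by (simp add: monom_altdef)
  show ?thesis
    unfolding q_K_def t_K_def Fract_power q t by (simp add: mult_monom)
qed

lemma coeff_sum_monom_monom:
  assumes "finite I"
  shows "coeff (coeff (\<Sum>i\<in>I. monom (monom (1::rat) (a i)) (b i)) l) k = of_nat (card {i\<in>I. a i = k \<and> b i = l})"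
proof -
  have "coeff (coeff (\<Sum>i\<in>I. monom (monom (1::rat) (a i)) (b i)) l) k =
     (\<Sum>i\<in>I. if a i = k \<and> b i = l then 1 else 0)"
    unfolding coeff_sum by (intro sum.cong refl) auto
  also have "\<dots> = of_nat (card {i\<in>I. a i = k \<and> b i = l})"
    using assms by (simp add: sum.If_cases Int_def conj_commute)
  finally show ?thesis .
qed

lemma sum_qt_power_determines:
  assumes fin: "finite I" "finite J"
    and eq: "(\<Sum>i\<in>I. q_K ^ a i * t_K ^ b i) = (\<Sum>j\<in>J. q_K ^ a' j * t_K ^ b' j)"
  shows "card {i\<in>I. a i = k \<and> b i = l} = card {j\<in>J. a' j = k \<and> b' j = l}"
proof -
  have "(\<Sum>i\<in>I. monom (monom (1::rat) (a i)) (b i)) = (\<Sum>j\<in>J. monom (monom 1 (a' j)) (b' j))"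
    using eq unfolding qt_power_eq_Fract Fract_sum by (simp add: eq_fract)
  then have "coeff (coeff (\<Sum>i\<in>I. monom (monom (1::rat) (a i)) (b i)) l) k =
      coeff (coeff (\<Sum>j\<in>J. monom (monom 1 (a' j)) (b' j)) l) k" by simp
  then show ?thesis by (simp add: coeff_sum_monom_monom fin)
qed

text \<open>Multiplication by a common power of \<open>q\<close> and \<open>t\<close> makes all exponents natural numbers; then the sums are
polynomials whose coefficients count the exponent pairs. An injective second (or first) exponent
recovers the indexing.\<close>

lemma sum_qt_mono_determines:
  assumes fin: "finite I"
    and eq: "(\<Sum>i\<in>I. qt_mono (a i) (b i)) = (\<Sum>i\<in>I. qt_mono (a' i) (b' i))"
    and same: "inj_on b I \<and> (\<forall>i\<in>I. b' i = b i) \<or> inj_on a I \<and> (\<forall>i\<in>I. a' i = a i)"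
  shows "\<forall>i\<in>I. a' i = a i \<and> b' i = b i"
proof -
  obtain M :: nat where M: "\<And>i. i \<in> I \<Longrightarrow> \<bar>a i\<bar> \<le> int M \<and> \<bar>b i\<bar> \<le> int M \<and> \<bar>a' i\<bar> \<le> int M \<and> \<bar>b' i\<bar> \<le> int M"
  proof
    define M where "M = (\<Sum>i\<in>I. nat \<bar>a i\<bar> + nat \<bar>b i\<bar> + nat \<bar>a' i\<bar> + nat \<bar>b' i\<bar>)"
    fix i assume i: "i \<in> I"
    have "nat \<bar>a i\<bar> + nat \<bar>b i\<bar> + nat \<bar>a' i\<bar> + nat \<bar>b' i\<bar> \<le> M"
      unfolding M_def by (rule member_le_sum[OF i]) (use fin in auto)
    then have "nat \<bar>a i\<bar> \<le> M \<and> nat \<bar>b i\<bar> \<le> M \<and> nat \<bar>a' i\<bar> \<le> M \<and> nat \<bar>b' i\<bar> \<le> M" by simp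
    then show "\<bar>a i\<bar> \<le> int M \<and> \<bar>b i\<bar> \<le> int M \<and> \<bar>a' i\<bar> \<le> int M \<and> \<bar>b' i\<bar> \<le> int M"
      by (simp only: nat_le_iff)
  qed
  define n where "n c = nat (c + int M)" for c
  have nn: "c + int M = int (n c)" if "\<bar>c\<bar> \<le> int M" for c
    using that by (simp add: n_def)
  have shift1: "z powi c * z ^ M = z ^ n c" if "\<bar>c\<bar> \<le> int M" "z \<noteq> 0" for c and z :: K
  proof -
    have "z powi c * z ^ M = z powi (c + int M)" using that(2) by (simp add: power_int_add)
    then show ?thesis by (simp only: nn[OF that(1)] power_int_of_nat)
  qed
  have shift: "qt_mono c d * (q_K ^ M * t_K ^ M) = q_K ^ n c * t_K ^ n d" if "\<bar>c\<bar> \<le> int M" "\<bar>d\<bar> \<le> int M" for c d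
    unfolding qt_mono_def shift1[OF that(1) q_K_nonzero, symmetric] shift1[OF that(2) t_K_nonzero, symmetric]
    by (simp only: mult_ac)
  have "(\<Sum>i\<in>I. q_K ^ n (a i) * t_K ^ n (b i)) = (\<Sum>i\<in>I. q_K ^ n (a' i) * t_K ^ n (b' i))"
  proof -
    have "(\<Sum>i\<in>I. q_K ^ n (a i) * t_K ^ n (b i)) = (\<Sum>i\<in>I. qt_mono (a i) (b i)) * (q_K ^ M * t_K ^ M)"
      unfolding sum_distrib_right using M by (intro sum.cong refl shift[symmetric]) auto
    also have "\<dots> = (\<Sum>i\<in>I. q_K ^ n (a' i) * t_K ^ n (b' i))"
      unfolding eq sum_distrib_right using M by (intro sum.cong refl shift) auto
    finally show ?thesis .
  qed
  note cards = sum_qt_power_determines[OF fin fin this]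
  show ?thesis
  proof
    fix i assume i: "i \<in> I"
    have "card {j\<in>I. n (a j) = n (a i) \<and> n (b j) = n (b i)} \<noteq> 0" using i fin by auto
    then have "card {j\<in>I. n (a' j) = n (a i) \<and> n (b' j) = n (b i)} \<noteq> 0" using cards by simp
    then obtain j where j: "j \<in> I" "n (a' j) = n (a i)" "n (b' j) = n (b i)"
      using fin by (auto simp: card_eq_0_iff)
    have "c = d" if "n c = n d" "\<bar>c\<bar> \<le> int M" "\<bar>d\<bar> \<le> int M" for c d
      using eq_nat_nat_iff[of "c + int M" "d + int M"] that by (simp add: n_def abs_le_iff)
    then have "a' j = a i \<and> b' j = b i" using j M[OF j(1)] M[OF i] by blast
    moreover have "j = i" using same calculation i j(1) inj_onD[of b I j i] inj_onD[of a I j i] by auto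
    ultimately show "a' i = a i \<and> b' i = b i" by simp
  qed
qed

text \<open>For \<open>I = {..<n}\<close> this is the exponent \<open>n - 1 - i\<close> of \<open>t\<close> in the Macdonald eigenvalue. Counting larger
elements makes sense for any set of variables, in particular for the \<open>y\<close> variables.\<close>

definition rank_in :: "nat set \<Rightarrow> nat \<Rightarrow> nat" where
  "rank_in I i = card {j\<in>I. i < j}"

lemma inj_on_rank: "finite I \<Longrightarrow> inj_on (rank_in I) I"
proof (rule linorder_inj_onI)
  fix i j assume h: "finite I" "i < j" "i \<in> I" "j \<in> I"
  have "{k\<in>I. j < k} \<subset> {k\<in>I. i < k}" using h by auto
  then have "rank_in I j < rank_in I i" unfolding rank_in_def using h(1) by (intro psubset_card_mono) auto
  then show "rank_in I i \<noteq> rank_in I j" by simp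
qed auto

text \<open>The elementary symmetric function of degree \<open>r\<close> in $p^{e_i}s^{\mathrm{rank}(i)}$: the eigenvalue of the \<open>r\<close>-th Macdonald operator.\<close>

definition macev :: "nat set \<Rightarrow> K \<Rightarrow> K \<Rightarrow> nat \<Rightarrow> (nat \<Rightarrow> int) \<Rightarrow> K" where
  "macev I p s r e = (\<Sum>L | L \<subseteq> I \<and> card L = r. \<Prod>i\<in>L. p powi e i * s ^ rank_in I i)"

lemma macev_1:
  assumes "finite I"
  shows "macev I p s 1 e = (\<Sum>i\<in>I. p powi e i * s ^ rank_in I i)"
proof -
  have "{L. L \<subseteq> I \<and> card L = 1} = (\<lambda>i. {i}) ` I" by (auto simp: card_1_singleton_iff)
  then show ?thesis unfolding macev_def by (simp add: sum.reindex)
qed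

text \<open>The first eigenvalue determines the exponents. The uniqueness of eigenfunctions rests on
this.\<close>

definition separating :: "K \<Rightarrow> K \<Rightarrow> bool" where
  "separating p s \<longleftrightarrow> (\<forall>I e e'. finite I \<longrightarrow> macev I p s 1 e = macev I p s 1 e' \<longrightarrow> (\<forall>i\<in>I. e i = e' i))"

lemma separating_qt: "separating q_K t_K" "separating (inverse q_K) (inverse t_K)"
  "separating t_K q_K" "separating (inverse t_K) (inverse q_K)"
proof -
  have r: "inj_on (\<lambda>i. int (rank_in I i)) I" "inj_on (\<lambda>i. - int (rank_in I i)) I" if "finite I" for I
    using inj_on_rank[OF that] by (auto simp: inj_on_def)
  show "separating q_K t_K"
    unfolding separating_def
  proof (intro allI impI)
    fix I e e' assume I: "finite I" and "macev I q_K t_K 1 e = macev I q_K t_K 1 e'"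
    then have "(\<Sum>i\<in>I. qt_mono (e i) (int (rank_in I i))) = (\<Sum>i\<in>I. qt_mono (e' i) (int (rank_in I i)))"
      by (simp add: macev_1[unfolded One_nat_def] qt_mono_def)
    from sum_qt_mono_determines[OF I this] r(1)[OF I] show "\<forall>i\<in>I. e i = e' i" by auto
  qed
  show "separating (inverse q_K) (inverse t_K)"
    unfolding separating_def
  proof (intro allI impI)
    fix I e e' assume I: "finite I" and "macev I (inverse q_K) (inverse t_K) 1 e = macev I (inverse q_K) (inverse t_K) 1 e'"
    then have "(\<Sum>i\<in>I. qt_mono (- e i) (- int (rank_in I i))) = (\<Sum>i\<in>I. qt_mono (- e' i) (- int (rank_in I i)))"
      by (simp add: macev_1[unfolded One_nat_def] qt_mono_def power_int_minus power_int_inverse power_inverse)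
    from sum_qt_mono_determines[OF I this] r(2)[OF I] show "\<forall>i\<in>I. e i = e' i" by auto
  qed
  show "separating t_K q_K"
    unfolding separating_def
  proof (intro allI impI)
    fix I e e' assume I: "finite I" and "macev I t_K q_K 1 e = macev I t_K q_K 1 e'"
    then have "(\<Sum>i\<in>I. qt_mono (int (rank_in I i)) (e i)) = (\<Sum>i\<in>I. qt_mono (int (rank_in I i)) (e' i))"
      by (simp add: macev_1[unfolded One_nat_def] qt_mono_def mult.commute)
    from sum_qt_mono_determines[OF I this] r(1)[OF I] show "\<forall>i\<in>I. e i = e' i" by auto
  qed
  show "separating (inverse t_K) (inverse q_K)"
    unfolding separating_def
  proof (intro allI impI)
    fix I e e' assume I: "finite I" and "macev I (inverse t_K) (inverse q_K) 1 e = macev I (inverse t_K) (inverse q_K) 1 e'"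
    then have "(\<Sum>i\<in>I. qt_mono (- int (rank_in I i)) (- e i)) = (\<Sum>i\<in>I. qt_mono (- int (rank_in I i)) (- e' i))"
      by (simp add: macev_1[unfolded One_nat_def] qt_mono_def power_int_minus power_int_inverse power_inverse mult.commute)
    from sum_qt_mono_determines[OF I this] r(2)[OF I] show "\<forall>i\<in>I. e i = e' i" by auto
  qed
qed

lemma qt_power_inj:
  assumes "q_K ^ a * t_K ^ b = q_K ^ a' * t_K ^ b'"
  shows "a = a' \<and> b = b'"
proof (rule ccontr)
  assume h: "\<not> (a = a' \<and> b = b')"
  then have "{i\<in>{()}. a' = a \<and> b' = b} = {}" by auto
  moreover have "card {i\<in>{()}. a = a \<and> b = b} = card {i\<in>{()}. a' = a \<and> b' = b}"
    by (rule sum_qt_power_determines[of "{()}" "{()}" "\<lambda>_. a" "\<lambda>_. b" "\<lambda>_. a'" "\<lambda>_. b'"]) (use assms in auto)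
  ultimately show False by simp
qed

lemma qt_distinct: "q_K \<noteq> 1" "t_K \<noteq> 1" "q_K \<noteq> t_K" "q_K ^ k = 1 \<longleftrightarrow> k = 0"
proof -
  show "q_K \<noteq> 1" using qt_power_inj[of 1 0 0 0] by auto
  show "t_K \<noteq> 1" using qt_power_inj[of 0 1 0 0] by auto
  show "q_K \<noteq> t_K" using qt_power_inj[of 1 0 0 1] by auto
  show "q_K ^ k = 1 \<longleftrightarrow> k = 0" using qt_power_inj[of k 0 0 0] by auto
qed

section \<open>Macdonald operators and a commutation relation\<close>

text \<open>The coupling factor in the coefficients of the Macdonald operators.\<close>

definition cpl :: "'a::field \<Rightarrow> 'a \<Rightarrow> 'a \<Rightarrow> 'a" where
  "cpl s u v = (1 - s * u / v) / (1 - u / v)"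

lemma cpl_scale_both: "c \<noteq> 0 \<Longrightarrow> cpl s (c * u) (c * v) = cpl s u v"
  by (simp add: cpl_def)

lemma cpl_inverse:
  fixes s :: "'a::field"
  assumes "s \<noteq> 0" "u \<noteq> 0" "v \<noteq> 0" "u \<noteq> v"
  shows "cpl (inverse s) u v = inverse s * cpl s v u"
proof -
  have e: "1 - inverse s * u / v = - (u / v) * inverse s * (1 - s * v / u)" "1 - u / v = - (u / v) * (1 - v / u)"
    using assms by (simp_all add: field_simps)
  have "1 - v / u \<noteq> 0" using assms by simp
  then show ?thesis unfolding cpl_def e using assms by simp
qed

text \<open>The elementary move behind the commutation: shifting \<open>u\<close> down in one coupling is the same as shifting
\<open>v\<close> up in the other.\<close>

lemma cpl_exchange:
  fixes s p :: "'a::field"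
  assumes "s \<noteq> 0" "p \<noteq> 0" "u \<noteq> 0" "v \<noteq> 0" "u \<noteq> v" "u \<noteq> p * v"
  shows "cpl (inverse s) u v * cpl s v (inverse p * u) = cpl s v u * cpl (inverse s) u (p * v)"
proof -
  have "cpl (inverse s) u v = inverse s * cpl s v u" using assms by (intro cpl_inverse) auto
  moreover have "cpl (inverse s) u (p * v) = inverse s * cpl s (p * v) u" using assms by (intro cpl_inverse) auto
  moreover have "cpl s v (inverse p * u) = cpl s (p * v) u"
    using cpl_scale_both[of p s v "inverse p * u"] assms by (simp flip: mult.assoc)
  ultimately show ?thesis by (simp add: mult_ac)
qed

text \<open>When the index \<open>k\<close> moved by the inverse operator is not in the set \<open>L\<close> moved by the other operator, the two
coefficients agree factor by factor.\<close>

lemma cpl_prod_exchange_outside: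
  fixes x :: "'i \<Rightarrow> 'a::field"
  assumes fin: "finite I" and L: "L \<subseteq> I" and k: "k \<in> I" "k \<notin> L" and s: "s \<noteq> 0" and p: "p \<noteq> 0"
    and inj: "inj_on x I" and x0: "\<And>i. i \<in> I \<Longrightarrow> x i \<noteq> 0"
    and xp: "\<And>i j. i \<in> I \<Longrightarrow> j \<in> I \<Longrightarrow> x i \<noteq> p * x j"
  shows "(\<Prod>l\<in>I - {k}. cpl (inverse s) (x k) (x l)) *
      (\<Prod>i\<in>L. \<Prod>j\<in>I - L. cpl s (x i) (if j = k then inverse p * x j else x j)) =
    (\<Prod>i\<in>L. \<Prod>j\<in>I - L. cpl s (x i) (x j)) *
      (\<Prod>l\<in>I - {k}. cpl (inverse s) (x k) (if l \<in> L then p * x l else x l))"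
proof -
  define R where "R = I - L - {k}"
  have fL: "finite L" "finite R" using fin L finite_subset by (auto simp: R_def)
  have e1: "I - {k} = L \<union> R" "L \<inter> R = {}" using L k by (auto simp: R_def)
  have e2: "I - L = insert k R" "k \<notin> R" using k by (auto simp: R_def)
  have a: "(\<Prod>l\<in>I - {k}. g l) = (\<Prod>l\<in>L. g l) * (\<Prod>l\<in>R. g l)" for g :: "'i \<Rightarrow> 'a"
    unfolding e1(1) by (rule prod.union_disjoint[OF fL e1(2)])
  have b: "(\<Prod>i\<in>L. \<Prod>j\<in>I - L. h i j) = (\<Prod>i\<in>L. h i k) * (\<Prod>i\<in>L. \<Prod>j\<in>R. h i j)" for h :: "'i \<Rightarrow> 'i \<Rightarrow> 'a"
    unfolding e2(1) using e2(2) fL by (simp add: prod.distrib)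
  have c: "(\<Prod>i\<in>L. \<Prod>j\<in>R. cpl s (x i) (if j = k then inverse p * x j else x j)) = (\<Prod>i\<in>L. \<Prod>j\<in>R. cpl s (x i) (x j))"
    using e2 by (intro prod.cong refl) auto
  have d: "(\<Prod>l\<in>R. cpl (inverse s) (x k) (if l \<in> L then p * x l else x l)) = (\<Prod>l\<in>R. cpl (inverse s) (x k) (x l))"
    using e1 by (intro prod.cong refl) auto
  have e: "(\<Prod>l\<in>L. cpl (inverse s) (x k) (x l)) * (\<Prod>i\<in>L. cpl s (x i) (inverse p * x k)) =
      (\<Prod>i\<in>L. cpl s (x i) (x k)) * (\<Prod>l\<in>L. cpl (inverse s) (x k) (p * x l))"
    unfolding prod.distrib[symmetric]
  proof (intro prod.cong refl cpl_exchange s p)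
    fix l assume l: "l \<in> L"
    then have "l \<in> I" "l \<noteq> k" using L k by auto
    then show "x k \<noteq> 0" "x l \<noteq> 0" "x k \<noteq> x l" "x k \<noteq> p * x l"
      using x0 k inj_onD[OF inj, of k l] xp by auto
  qed
  show ?thesis
    unfolding a b using c d e by (simp add: mult_ac)
qed

text \<open>When \<open>k\<close> lies in the moved set, the net shift only moves \<open>M\<close>, and the coefficients agree only after
summation over \<open>k\<close>: this is \<open>shift_exchange_identity\<close> on the variables outside \<open>M\<close>.\<close>

lemma cpl_prod_exchange_inside:
  fixes x :: "'i \<Rightarrow> 'a::field"
  assumes fin: "finite I" and M: "M \<subseteq> I" and s: "s \<noteq> 0" "s \<noteq> 1" "s \<noteq> p" and p: "p \<noteq> 0"
    and inj: "inj_on x I" and x0: "\<And>i. i \<in> I \<Longrightarrow> x i \<noteq> 0"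
    and xp: "\<And>i j. i \<in> I \<Longrightarrow> j \<in> I \<Longrightarrow> x i \<noteq> p * x j"
  shows "(\<Sum>k\<in>I - M. (\<Prod>l\<in>I - {k}. cpl (inverse s) (x k) (x l)) *
      (\<Prod>i\<in>insert k M. \<Prod>j\<in>I - insert k M. cpl s (if i = k then inverse p * x i else x i) (x j))) =
    (\<Sum>k\<in>I - M. (\<Prod>i\<in>insert k M. \<Prod>j\<in>I - insert k M. cpl s (x i) (x j)) *
      (\<Prod>l\<in>I - {k}. cpl (inverse s) (p * x k) (if l \<in> insert k M then p * x l else x l)))"
proof -
  define c where "c = inverse s ^ card M * (\<Prod>i\<in>M. \<Prod>j\<in>I - M. cpl s (x i) (x j))"
  have fM: "finite M" using fin M finite_subset by auto
  have main: "(\<Prod>l\<in>I - {k}. cpl (inverse s) (x k) (x l)) *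
      (\<Prod>i\<in>insert k M. \<Prod>j\<in>I - insert k M. cpl s (if i = k then inverse p * x i else x i) (x j)) =
      c * (\<Prod>j\<in>I - M - {k}. cpl (inverse s) (x k) (x j) * cpl s (inverse p * x k) (x j))" (is ?A)
    "(\<Prod>i\<in>insert k M. \<Prod>j\<in>I - insert k M. cpl s (x i) (x j)) *
      (\<Prod>l\<in>I - {k}. cpl (inverse s) (p * x k) (if l \<in> insert k M then p * x l else x l)) =
      c * (\<Prod>j\<in>I - M - {k}. cpl s (x k) (x j) * cpl (inverse s) (p * x k) (x j))" (is ?B)
    if k: "k \<in> I - M" for k
  proof -
    define R where "R = I - M - {k}"
    have fR: "finite R" using fin by (simp add: R_def)
    have e1: "I - {k} = M \<union> R" "M \<inter> R = {}" using M k by (auto simp: R_def)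
    have e2: "I - insert k M = R" "k \<notin> M" "k \<notin> R" "I - M = insert k R" using k by (auto simp: R_def)
    have a: "(\<Prod>l\<in>I - {k}. g l) = (\<Prod>l\<in>M. g l) * (\<Prod>l\<in>R. g l)" for g :: "'i \<Rightarrow> 'a"
      unfolding e1(1) by (rule prod.union_disjoint[OF fM fR e1(2)])
    have b: "(\<Prod>i\<in>insert k M. \<Prod>j\<in>R. h i j) = (\<Prod>j\<in>R. h k j) * (\<Prod>i\<in>M. \<Prod>j\<in>R. h i j)" for h :: "'i \<Rightarrow> 'i \<Rightarrow> 'a"
      using e2(2) fM by simp
    have m: "(\<Prod>l\<in>M. cpl (inverse s) (x k) (x l)) = inverse s ^ card M * (\<Prod>l\<in>M. cpl s (x l) (x k))"
    proof -
      have "(\<Prod>l\<in>M. cpl (inverse s) (x k) (x l)) = (\<Prod>l\<in>M. inverse s * cpl s (x l) (x k))"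
      proof (intro prod.cong refl cpl_inverse s)
        fix l assume "l \<in> M"
        then have "l \<in> I" "l \<noteq> k" using M e2 by auto
        then show "x k \<noteq> 0" "x l \<noteq> 0" "x k \<noteq> x l" using x0 k inj_onD[OF inj, of k l] by auto
      qed
      then show ?thesis by (simp add: prod.distrib)
    qed
    have m': "c = (\<Prod>l\<in>M. cpl (inverse s) (x k) (x l)) * (\<Prod>i\<in>M. \<Prod>j\<in>R. cpl s (x i) (x j))"
      unfolding m c_def e2(4) using e2(3) fR by (simp add: prod.distrib)
    have i1: "(\<Prod>i\<in>M. \<Prod>j\<in>R. cpl s (if i = k then inverse p * x i else x i) (x j)) = (\<Prod>i\<in>M. \<Prod>j\<in>R. cpl s (x i) (x j))"
      using e2 by (intro prod.cong refl) auto
    have i2: "(\<Prod>l\<in>M. cpl (inverse s) (p * x k) (if l \<in> insert k M then p * x l else x l)) =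
       (\<Prod>l\<in>M. cpl (inverse s) (x k) (x l))"
      using p by (intro prod.cong refl) (simp add: cpl_scale_both)
    have i3: "(\<Prod>l\<in>R. cpl (inverse s) (p * x k) (if l \<in> insert k M then p * x l else x l)) =
       (\<Prod>l\<in>R. cpl (inverse s) (p * x k) (x l))"
      using e1 e2 by (intro prod.cong refl) auto
    show ?A unfolding e2(1) a b i1 m' R_def[symmetric] by (simp add: prod.distrib mult_ac)
    show ?B unfolding e2(1) a b i2 i3 m' R_def[symmetric] by (simp add: prod.distrib mult_ac)
  qed
  have "(\<Sum>k\<in>I - M. \<Prod>j\<in>I - M - {k}. cpl (inverse s) (x k) (x j) * cpl s (inverse p * x k) (x j)) =
    (\<Sum>k\<in>I - M. \<Prod>j\<in>I - M - {k}. cpl s (x k) (x j) * cpl (inverse s) (p * x k) (x j))"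
    using shift_exchange_identity[of "I - M" x p s] fin inj x0 xp s p
    by (simp add: cpl_def mult.assoc inj_on_diff)
  then have "c * (\<Sum>k\<in>I - M. \<Prod>j\<in>I - M - {k}. cpl (inverse s) (x k) (x j) * cpl s (inverse p * x k) (x j)) =
    c * (\<Sum>k\<in>I - M. \<Prod>j\<in>I - M - {k}. cpl s (x k) (x j) * cpl (inverse s) (p * x k) (x j))" by simp
  then show ?thesis unfolding sum_distrib_left by (simp only: main cong: sum.cong)
qed

definition sub_scale :: "nat set \<Rightarrow> K \<Rightarrow> nat \<Rightarrow> K" where
  "sub_scale L p i = (if i \<in> L then p else 1)"

lemma sub_scale_nonzero: "p \<noteq> 0 \<Longrightarrow> sub_scale L p i \<noteq> 0" by (simp add: sub_scale_def)

definition mac_coeff :: "nat set \<Rightarrow> K \<Rightarrow> nat set \<Rightarrow> ratfun" where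
  "mac_coeff I s L = (\<Prod>i\<in>L. \<Prod>j\<in>I - L. cpl (of_K s) (xvar i) (xvar j))"

text \<open>The \<open>r\<close>-th Macdonald operator in the variables \<open>I\<close>, with \<open>p\<close> in the role of \<open>q\<close> and \<open>s\<close> in the role
of \<open>t\<close>. The parameters are free because the dual variables need them exchanged and inverted.\<close>

definition Dr :: "nat set \<Rightarrow> K \<Rightarrow> K \<Rightarrow> nat \<Rightarrow> ratfun \<Rightarrow> ratfun" where
  "Dr I p s r f = (\<Sum>L | L \<subseteq> I \<and> card L = r. of_K (s ^ (r choose 2)) * mac_coeff I s L * scale (sub_scale L p) f)"

lemma finite_subsets_card: "finite I \<Longrightarrow> finite {L. L \<subseteq> I \<and> card L = r}"
  by (rule finite_subset[of _ "Pow I"]) auto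

lemma Dr_1:
  assumes "finite I"
  shows "Dr I p s 1 f = (\<Sum>k\<in>I. (\<Prod>l\<in>I - {k}. cpl (of_K s) (xvar k) (xvar l)) * scale (sub_scale {k} p) f)"
proof -
  have "{L. L \<subseteq> I \<and> card L = 1} = (\<lambda>i. {i}) ` I" by (auto simp: card_1_singleton_iff)
  then show ?thesis unfolding Dr_def by (simp add: sum.reindex mac_coeff_def numeral_2_eq_2)
qed

lemma ratV_cpl: "i \<in> A \<Longrightarrow> j \<in> A \<Longrightarrow> cpl (of_K s) (xvar i) (xvar j) \<in> ratV A"
  unfolding cpl_def by (intro ratV_divide ratV_diff ratV_mult ratV_xvar ratV_of_K ratV_1)

lemma Dr_ratV:
  assumes "I \<subseteq> A" "f \<in> ratV A" "p \<noteq> 0"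
  shows "Dr I p s r f \<in> ratV A"
  unfolding Dr_def mac_coeff_def using assms sub_scale_nonzero[OF assms(3)]
  by (intro ratV_sum ratV_mult ratV_of_K ratV_prod ratV_cpl ratV_scale) auto

lemma Dr_add: "p \<noteq> 0 \<Longrightarrow> Dr I p s r (f + g) = Dr I p s r f + Dr I p s r g"
  by (simp add: Dr_def scale_add[OF sub_scale_nonzero] distrib_left sum.distrib)

lemma Dr_0: "p \<noteq> 0 \<Longrightarrow> Dr I p s r 0 = 0"
  by (simp add: Dr_def scale_0[OF sub_scale_nonzero])

lemma Dr_sum: "p \<noteq> 0 \<Longrightarrow> Dr I p s r (\<Sum>j\<in>J. f j) = (\<Sum>j\<in>J. Dr I p s r (f j))"
  by (induction J rule: infinite_finite_induct) (auto simp: Dr_add Dr_0)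

lemma Dr_mult_fixed:
  assumes p: "p \<noteq> 0" and g: "g \<in> ratV B" "B \<inter> I = {}"
  shows "Dr I p s r (g * f) = g * Dr I p s r f"
  unfolding Dr_def sum_distrib_left
proof (intro sum.cong refl)
  fix L assume L: "L \<in> {L. L \<subseteq> I \<and> card L = r}"
  have "scale (sub_scale L p) g = g"
    by (rule scale_trivial[OF sub_scale_nonzero[OF p] g(1)]) (use L g(2) in \<open>auto simp: sub_scale_def\<close>)
  then show "of_K (s ^ (r choose 2)) * mac_coeff I s L * scale (sub_scale L p) (g * f) =
     g * (of_K (s ^ (r choose 2)) * mac_coeff I s L * scale (sub_scale L p) f)"
    by (simp add: scale_mult[OF sub_scale_nonzero[OF p]] mult_ac)
qed

lemma Dr_cmult: "p \<noteq> 0 \<Longrightarrow> Dr I p s r (of_K c * f) = of_K c * Dr I p s r f"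
  by (rule Dr_mult_fixed[of p "of_K c" "{}"]) auto

lemma scale_cpl:
  assumes "\<And>i. \<sigma> i \<noteq> 0"
  shows "scale \<sigma> (cpl (of_K s) u v) = cpl (of_K s) (scale \<sigma> u) (scale \<sigma> v)"
  unfolding cpl_def
  by (simp add: scale_divide[OF assms] scale_diff[OF assms] scale_mult[OF assms] scale_of_K[OF assms] scale_1[OF assms])

lemma xvar_ne_scaled:
  assumes "i \<noteq> j"
  shows "xvar i \<noteq> of_K c * xvar j"
proof
  assume "xvar i = of_K c * xvar j"
  then have "single (single i (1::nat)) (1::K) = single (single j (1::nat)) c"
    unfolding xvar_eq_mon of_mpol_single[symmetric] by (simp add: mon_def)
  then have "lookup (single (single i (1::nat)) (1::K)) (single i (1::nat)) =
    lookup (single (single j (1::nat)) c) (single i (1::nat))" by (rule arg_cong)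
  moreover have "single i (1::nat) \<noteq> single j (1::nat)"
  proof
    assume "single i (1::nat) = single j (1::nat)"
    then have "lookup (single i (1::nat)) i = lookup (single j (1::nat)) i" by simp
    then show False using assms by (simp add: lookup_single when_def)
  qed
  ultimately show False by (simp add: lookup_single when_def)
qed

lemma xvar_inj: "inj_on xvar A"
  using xvar_ne_scaled[of _ _ 1] by (intro inj_onI) auto

lemma xvar_ne_shifted: "c \<noteq> 1 \<Longrightarrow> xvar i \<noteq> of_K c * xvar j"
  using xvar_ne_scaled[of i j c] by (cases "i = j") auto

text \<open>Compare the coefficients of each composite shift. A pair of an index \<open>k\<close> and a set \<open>L\<close> with \<open>k\<close> outside \<open>L\<close>
is treated by \<open>cpl_prod_exchange_outside\<close>; the pairs \<open>k\<close>, \<open>insert k M\<close> with fixed \<open>M\<close> all give the shift of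
\<open>M\<close> and are treated together by \<open>cpl_prod_exchange_inside\<close>.\<close>

lemma Dr_commute:
  assumes fin: "finite I" and p: "p \<noteq> 0" "p \<noteq> 1" and s: "s \<noteq> 0" "s \<noteq> 1" "s \<noteq> p"
  shows "Dr I (inverse p) (inverse s) 1 (Dr I p s r f) = Dr I p s r (Dr I (inverse p) (inverse s) 1 f)"
proof -
  have p': "inverse p \<noteq> 0" using p by simp
  note nz = sub_scale_nonzero[OF p(1)] sub_scale_nonzero[OF p']
  define w where "w = of_K (s ^ (r choose 2))"
  define T where "T L k = scale (\<lambda>i. sub_scale {k} (inverse p) i * sub_scale L p i) f" for L k
  define a where "a k L = (\<Prod>l\<in>I - {k}. cpl (inverse (of_K s)) (xvar k) (xvar l)) *
     (\<Prod>i\<in>L. \<Prod>j\<in>I - L. cpl (of_K s) (of_K (sub_scale {k} (inverse p) i) * xvar i) (of_K (sub_scale {k} (inverse p) j) * xvar j))" for k L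
  define b where "b k L = (\<Prod>i\<in>L. \<Prod>j\<in>I - L. cpl (of_K s) (xvar i) (xvar j)) *
     (\<Prod>l\<in>I - {k}. cpl (inverse (of_K s)) (of_K (sub_scale L p k) * xvar k) (of_K (sub_scale L p l) * xvar l))" for k L
  let ?S = "{L. L \<subseteq> I \<and> card L = r}"
  have finS: "finite ?S" by (rule finite_subsets_card[OF fin])
  have lhs: "Dr I (inverse p) (inverse s) 1 (Dr I p s r f) = (\<Sum>k\<in>I. \<Sum>L\<in>?S. w * a k L * T L k)"
    unfolding Dr_1[OF fin]
  proof (intro sum.cong refl)
    fix k
    have "scale (sub_scale {k} (inverse p)) (scale (sub_scale L p) f) = T L k" for L
      unfolding T_def by (rule scale_scale[OF nz(2,1)])
    then show "(\<Prod>l\<in>I - {k}. cpl (of_K (inverse s)) (xvar k) (xvar l)) * scale (sub_scale {k} (inverse p)) (Dr I p s r f) =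
      (\<Sum>L\<in>?S. w * a k L * T L k)"
      unfolding Dr_def scale_sum[OF nz(2)] sum_distrib_left
      by (intro sum.cong refl)
         (simp add: scale_mult[OF nz(2)] scale_of_K[OF nz(2)] mac_coeff_def scale_prod[OF nz(2)] scale_cpl[OF nz(2)]
           scale_xvar[OF nz(2)] w_def a_def of_K_inverse mult_ac)
  qed
  have rhs: "Dr I p s r (Dr I (inverse p) (inverse s) 1 f) = (\<Sum>L\<in>?S. \<Sum>k\<in>I. w * b k L * T L k)"
    unfolding Dr_def[of I p s r]
  proof (intro sum.cong refl)
    fix L
    have "scale (sub_scale L p) (scale (sub_scale {k} (inverse p)) f) = T L k" for k
      unfolding T_def by (subst scale_scale[OF nz(1,2)]) (simp add: mult.commute)
    then show "of_K (s ^ (r choose 2)) * mac_coeff I s L * scale (sub_scale L p) (Dr I (inverse p) (inverse s) 1 f) =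
      (\<Sum>k\<in>I. w * b k L * T L k)"
      unfolding Dr_1[OF fin] scale_sum[OF nz(1)] sum_distrib_left
      by (intro sum.cong refl)
         (simp add: scale_mult[OF nz(1)] scale_prod[OF nz(1)] mac_coeff_def scale_cpl[OF nz(1)] scale_xvar[OF nz(1)]
           w_def b_def[folded of_K_inverse] mult_ac)
  qed
  have hyp: "of_K s \<noteq> 0" "of_K s \<noteq> 1" "of_K s \<noteq> of_K p" "of_K p \<noteq> 0" "inj_on xvar I"
    "\<And>i. i \<in> I \<Longrightarrow> xvar i \<noteq> 0" "\<And>i j. i \<in> I \<Longrightarrow> j \<in> I \<Longrightarrow> xvar i \<noteq> of_K p * xvar j"
    using s p xvar_ne_shifted[OF p(2)] xvar_inj by auto
  have out: "a k L = b k L" if kL: "k \<in> I" "k \<notin> L" "L \<subseteq> I" for k L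
  proof -
    have "a k L = (\<Prod>l\<in>I - {k}. cpl (inverse (of_K s)) (xvar k) (xvar l)) *
      (\<Prod>i\<in>L. \<Prod>j\<in>I - L. cpl (of_K s) (xvar i) (if j = k then inverse (of_K p) * xvar j else xvar j))"
      unfolding a_def using kL by (intro arg_cong2[where f = "(*)"] prod.cong refl) (auto simp: sub_scale_def of_K_inverse)
    also have "\<dots> = (\<Prod>i\<in>L. \<Prod>j\<in>I - L. cpl (of_K s) (xvar i) (xvar j)) *
      (\<Prod>l\<in>I - {k}. cpl (inverse (of_K s)) (xvar k) (if l \<in> L then of_K p * xvar l else xvar l))"
      by (rule cpl_prod_exchange_outside[OF fin kL(3,1,2) hyp(1,4,5,6,7)])
    also have "\<dots> = b k L"
      unfolding b_def using kL by (intro arg_cong2[where f = "(*)"] prod.cong refl) (auto simp: sub_scale_def)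
    finally show ?thesis .
  qed
  have ins: "(\<Sum>k\<in>I - M. a k (insert k M)) = (\<Sum>k\<in>I - M. b k (insert k M))" if M: "M \<subseteq> I" for M
  proof -
    have "(\<Sum>k\<in>I - M. a k (insert k M)) = (\<Sum>k\<in>I - M. (\<Prod>l\<in>I - {k}. cpl (inverse (of_K s)) (xvar k) (xvar l)) *
      (\<Prod>i\<in>insert k M. \<Prod>j\<in>I - insert k M. cpl (of_K s) (if i = k then inverse (of_K p) * xvar i else xvar i) (xvar j)))"
      unfolding a_def by (intro sum.cong arg_cong2[where f = "(*)"] prod.cong refl) (auto simp: sub_scale_def of_K_inverse)
    also have "\<dots> = (\<Sum>k\<in>I - M. (\<Prod>i\<in>insert k M. \<Prod>j\<in>I - insert k M. cpl (of_K s) (xvar i) (xvar j)) *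
      (\<Prod>l\<in>I - {k}. cpl (inverse (of_K s)) (of_K p * xvar k) (if l \<in> insert k M then of_K p * xvar l else xvar l)))"
      by (rule cpl_prod_exchange_inside[OF fin M hyp])
    also have "\<dots> = (\<Sum>k\<in>I - M. b k (insert k M))"
      unfolding b_def by (intro sum.cong arg_cong2[where f = "(*)"] prod.cong refl) (auto simp: sub_scale_def)
    finally show ?thesis .
  qed
  \<comment> \<open>The difference of the two compositions, term by term.\<close>
  define c where "c k L = (a k L - b k L) * T L k" for k L
  have "(\<Sum>L\<in>?S. \<Sum>k\<in>I. c k L) = (\<Sum>L\<in>?S. \<Sum>k\<in>L. c k L)"
  proof (rule sum.cong[OF refl])
    fix L assume L: "L \<in> ?S"
    show "(\<Sum>k\<in>I. c k L) = (\<Sum>k\<in>L. c k L)"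
      by (rule sum.mono_neutral_right[OF fin]) (use L out in \<open>auto simp: c_def\<close>)
  qed
  also have "\<dots> = (\<Sum>(L, k)\<in>(SIGMA L:?S. L). c k L)"
    using finS fin finite_subset by (subst sum.Sigma) auto
  also have "\<dots> = (\<Sum>(M, k)\<in>(SIGMA M:{M. M \<subseteq> I \<and> Suc (card M) = r}. I - M). c k (insert k M))"
  proof (rule sum.reindex_bij_witness[of _ "\<lambda>(M, k). (insert k M, k)" "\<lambda>(L, k). (L - {k}, k)"])
    fix z assume z: "z \<in> (SIGMA L:?S. L)"
    obtain L k where Lk: "z = (L, k)" "L \<subseteq> I" "card L = r" "k \<in> L" using z by auto
    have "finite L" using Lk fin finite_subset by blast
    then have "Suc (card (L - {k})) = r" using Lk card_Suc_Diff1 by metis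
    then show "(case z of (L, k) \<Rightarrow> (L - {k}, k)) \<in> (SIGMA M:{M. M \<subseteq> I \<and> Suc (card M) = r}. I - M)"
      using Lk by auto
    show "(case case z of (L, k) \<Rightarrow> (L - {k}, k) of (M, k) \<Rightarrow> (insert k M, k)) = z" using Lk by auto
    show "(case case z of (L, k) \<Rightarrow> (L - {k}, k) of (M, k) \<Rightarrow> c k (insert k M)) = (case z of (L, k) \<Rightarrow> c k L)"
      using Lk by (simp add: insert_absorb)
  next
    fix z assume z: "z \<in> (SIGMA M:{M. M \<subseteq> I \<and> Suc (card M) = r}. I - M)"
    obtain M k where Mk: "z = (M, k)" "M \<subseteq> I" "Suc (card M) = r" "k \<in> I" "k \<notin> M" using z by auto
    have "finite M" using Mk fin finite_subset by blast
    then show "(case z of (M, k) \<Rightarrow> (insert k M, k)) \<in> (SIGMA L:?S. L)" using Mk by auto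
    show "(case case z of (M, k) \<Rightarrow> (insert k M, k) of (L, k) \<Rightarrow> (L - {k}, k)) = z" using Mk by auto
  qed
  also have "\<dots> = (\<Sum>M | M \<subseteq> I \<and> Suc (card M) = r. \<Sum>k\<in>I - M. c k (insert k M))"
  proof -
    have "finite {M. M \<subseteq> I \<and> Suc (card M) = r}" by (rule finite_subset[of _ "Pow I"]) (use fin in auto)
    then show ?thesis using fin by (subst sum.Sigma) auto
  qed
  also have "\<dots> = 0"
  proof (rule sum.neutral, rule ballI)
    fix M assume M: "M \<in> {M. M \<subseteq> I \<and> Suc (card M) = r}"
    have "(\<Sum>k\<in>I - M. c k (insert k M)) = (\<Sum>k\<in>I - M. a k (insert k M) - b k (insert k M)) * scale (sub_scale M p) f"
      unfolding sum_distrib_right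
    proof (intro sum.cong refl)
      fix k assume "k \<in> I - M"
      then have "(\<lambda>i. sub_scale {k} (inverse p) i * sub_scale (insert k M) p i) = sub_scale M p"
        using p by (auto simp: sub_scale_def)
      then show "c k (insert k M) = (a k (insert k M) - b k (insert k M)) * scale (sub_scale M p) f"
        by (simp add: c_def T_def)
    qed
    then show "(\<Sum>k\<in>I - M. c k (insert k M)) = 0" using ins[of M] M by (simp add: sum_subtractf)
  qed
  finally have z: "(\<Sum>L\<in>?S. \<Sum>k\<in>I. c k L) = 0" .
  have "(\<Sum>k\<in>I. \<Sum>L\<in>?S. w * a k L * T L k) = (\<Sum>L\<in>?S. \<Sum>k\<in>I. w * a k L * T L k)" by (rule sum.swap)
  moreover have "(\<Sum>L\<in>?S. \<Sum>k\<in>I. w * a k L * T L k) - (\<Sum>L\<in>?S. \<Sum>k\<in>I. w * b k L * T L k) = w * (\<Sum>L\<in>?S. \<Sum>k\<in>I. c k L)"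
    by (simp add: sum_distrib_left c_def algebra_simps sum_subtractf)
  ultimately show ?thesis unfolding lhs rhs z by simp
qed

section \<open>Eigenfunctions of the Macdonald operators\<close>

lemma sum_card_greater:
  fixes L :: "nat set"
  assumes "finite L"
  shows "(\<Sum>i\<in>L. card {j\<in>L. i < j}) = card L choose 2"
  using assms
proof (induction L rule: finite_linorder_max_induct)
  case empty
  show ?case by simp
next
  case (insert b A)
  have b: "b \<notin> A" using insert.hyps by auto
  have 1: "card {j\<in>insert b A. i < j} = Suc (card {j\<in>A. i < j})" if "i \<in> A" for i
  proof -
    have "{j\<in>insert b A. i < j} = insert b {j\<in>A. i < j}" using insert.hyps that by auto
    then show ?thesis using b insert.hyps by simp
  qed
  have 2: "{j\<in>insert b A. b < j} = {}" using insert.hyps by fastforce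
  have "(\<Sum>i\<in>insert b A. card {j\<in>insert b A. i < j}) = (\<Sum>i\<in>A. Suc (card {j\<in>A. i < j}))"
    unfolding sum.insert[OF insert.hyps(1) b] 2 using 1 by (auto intro: sum.cong)
  also have "\<dots> = (card A choose 2) + card A" by (simp add: sum.distrib sum_Suc insert.IH)
  finally show ?case using b insert.hyps by (simp add: numeral_2_eq_2)
qed

text \<open>Splitting the larger elements of \<open>I\<close> into those in \<open>L\<close> and the others explains the factor
$s^{r(r-1)/2}$ in the operators: it completes the limits of the couplings to
the product of the $s^{\mathrm{rank}(i)}$.\<close>

lemma sum_rank_in:
  assumes "finite I" "L \<subseteq> I"
  shows "(card L choose 2) + (\<Sum>i\<in>L. card {j\<in>I - L. i < j}) = (\<Sum>i\<in>L. rank_in I i)"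
proof -
  have fL: "finite L" using assms finite_subset by blast
  have "rank_in I i = card {j\<in>L. i < j} + card {j\<in>I - L. i < j}" for i
  proof -
    have "{j\<in>I. i < j} = {j\<in>L. i < j} \<union> {j\<in>I - L. i < j}" using assms by auto
    then show ?thesis unfolding rank_in_def using fL assms by (simp add: card_Un_disjoint disjoint_iff)
  qed
  then show ?thesis by (simp add: sum.distrib sum_card_greater[OF fL])
qed

lemma place_mac_coeff:
  assumes "finite I" "L \<subseteq> I"
  shows "place (of_K (s ^ (card L choose 2)) * mac_coeff I s L) (\<Prod>i\<in>L. s ^ rank_in I i)"
proof -
  have "place (mac_coeff I s L) (\<Prod>i\<in>L. \<Prod>j\<in>I - L. if i < j then s else 1)"
    unfolding mac_coeff_def
  proof (rule place_prod, rule place_prod)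
    fix i j assume "i \<in> L" "j \<in> I - L"
    then have "i \<noteq> j" by auto
    then show "place (cpl (of_K s) (xvar i) (xvar j)) (if i < j then s else 1)"
      unfolding cpl_def by (rule place_coupling)
  qed
  from place_mult[OF place_of_K this]
  have "place (of_K (s ^ (card L choose 2)) * mac_coeff I s L)
     (s ^ (card L choose 2) * (\<Prod>i\<in>L. \<Prod>j\<in>I - L. if i < j then s else 1))" .
  moreover have "(\<Prod>j\<in>I - L. if i < j then s else 1) = s ^ card {j\<in>I - L. i < j}" for i
    using assms(1) by (simp add: prod.If_cases Int_def)
  ultimately show ?thesis
    using sum_rank_in[OF assms] by (simp flip: power_sum power_add)
qed

lemma mon_weight_sub_scale:
  assumes "finite L"
  shows "mon_weight (sub_scale L p) \<kappa> = (\<Prod>i\<in>L. p ^ lookup \<kappa> i)"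
proof -
  have "mon_weight (sub_scale L p) \<kappa> = (\<Prod>i\<in>keys \<kappa> \<union> L. sub_scale L p i ^ lookup \<kappa> i)"
    using assms by (intro mon_weight_superset) auto
  also have "\<dots> = (\<Prod>i\<in>L. sub_scale L p i ^ lookup \<kappa> i)"
    using assms by (intro prod.mono_neutral_right) (auto simp: sub_scale_def)
  also have "\<dots> = (\<Prod>i\<in>L. p ^ lookup \<kappa> i)"
    by (intro prod.cong refl) (simp add: sub_scale_def)
  finally show ?thesis .
qed

text \<open>Exponents of a rational function with leading monomials \<open>\<kappa>\<close> and \<open>\<kappa>'\<close> in numerator and denominator.\<close>

definition expo :: "(nat \<Rightarrow>\<^sub>0 nat) \<Rightarrow> (nat \<Rightarrow>\<^sub>0 nat) \<Rightarrow> nat \<Rightarrow> int" where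
  "expo \<kappa> \<kappa>' i = int (lookup \<kappa> i) - int (lookup \<kappa>' i)"

text \<open>Macdonald operators are triangular for the lexicographic order, with the eigenvalues on the diagonal, also on rational functions.\<close>

lemma Dr_lead:
  assumes fin: "finite I" and p: "p \<noteq> 0" and f: "place (f * mon \<kappa>' / mon \<kappa>) c"
  shows "place (Dr I p s r f * mon \<kappa>' / mon \<kappa>) (macev I p s r (expo \<kappa> \<kappa>') * c)"
proof -
  note nz = sub_scale_nonzero[OF p]
  let ?S = "{L. L \<subseteq> I \<and> card L = r}"
  have main: "place (\<Sum>L\<in>?S. of_K (s ^ (r choose 2)) * mac_coeff I s L *
      (of_K (\<Prod>i\<in>L. p powi expo \<kappa> \<kappa>' i) * scale (sub_scale L p) (f * mon \<kappa>' / mon \<kappa>)))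
     (\<Sum>L | L \<subseteq> I \<and> card L = r. (\<Prod>i\<in>L. s ^ rank_in I i) * ((\<Prod>i\<in>L. p powi expo \<kappa> \<kappa>' i) * c))"
    by (rule place_sum) (auto intro!: place_mult place_of_K place_scale f nz place_mac_coeff[OF fin])
  have term_eq: "of_K (s ^ (r choose 2)) * mac_coeff I s L *
      (of_K (\<Prod>i\<in>L. p powi expo \<kappa> \<kappa>' i) * scale (sub_scale L p) (f * mon \<kappa>' / mon \<kappa>)) =
      of_K (s ^ (r choose 2)) * mac_coeff I s L * scale (sub_scale L p) f * mon \<kappa>' / mon \<kappa>"
    if L: "L \<in> {L. L \<subseteq> I \<and> card L = r}" for L
  proof -
    have fL: "finite L" using L fin finite_subset by auto
    have w: "(\<Prod>i\<in>L. p powi expo \<kappa> \<kappa>' i) * mon_weight (sub_scale L p) \<kappa>' = mon_weight (sub_scale L p) \<kappa>"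
      unfolding mon_weight_sub_scale[OF fL] prod.distrib[symmetric]
      by (intro prod.cong refl) (simp add: expo_def power_int_diff p)
    have "scale (sub_scale L p) (f * mon \<kappa>' / mon \<kappa>) = scale (sub_scale L p) f *
       (of_K (mon_weight (sub_scale L p) \<kappa>') * mon \<kappa>') / (of_K (mon_weight (sub_scale L p) \<kappa>) * mon \<kappa>)"
      by (simp add: scale_divide[OF nz] scale_mult[OF nz] scale_mon[OF nz])
    moreover have "of_K (mon_weight (sub_scale L p) \<kappa>) \<noteq> 0" using mon_weight_nonzero[OF nz] by simp
    ultimately show ?thesis
      unfolding w[symmetric] of_K_mult by (simp add: field_simps)
  qed
  have "(\<Sum>L\<in>?S. of_K (s ^ (r choose 2)) * mac_coeff I s L *
      (of_K (\<Prod>i\<in>L. p powi expo \<kappa> \<kappa>' i) * scale (sub_scale L p) (f * mon \<kappa>' / mon \<kappa>))) =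
    (\<Sum>L\<in>?S. of_K (s ^ (r choose 2)) * mac_coeff I s L * scale (sub_scale L p) f * mon \<kappa>' / mon \<kappa>)"
    by (rule sum.cong[OF refl term_eq])
  also have "\<dots> = Dr I p s r f * mon \<kappa>' / mon \<kappa>"
    unfolding Dr_def sum_distrib_right sum_divide_distrib ..
  finally have e1: "(\<Sum>L\<in>?S. of_K (s ^ (r choose 2)) * mac_coeff I s L *
      (of_K (\<Prod>i\<in>L. p powi expo \<kappa> \<kappa>' i) * scale (sub_scale L p) (f * mon \<kappa>' / mon \<kappa>))) =
    Dr I p s r f * mon \<kappa>' / mon \<kappa>" .
  have e2: "(\<Sum>L | L \<subseteq> I \<and> card L = r. (\<Prod>i\<in>L. s ^ rank_in I i) * ((\<Prod>i\<in>L. p powi expo \<kappa> \<kappa>' i) * c)) =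
    macev I p s r (expo \<kappa> \<kappa>') * c"
    unfolding macev_def sum_distrib_right by (intro sum.cong refl) (simp add: prod.distrib mult_ac)
  show ?thesis using main unfolding e1 e2 .
qed

lemma eigen_lead_exponent:
  assumes fin: "finite I" and p: "p \<noteq> 0" and sep: "separating p s"
    and eig: "Dr I p s 1 f = of_K (macev I p s 1 e) * f"
    and lead: "place (f * mon \<kappa>' / mon \<kappa>) c" "c \<noteq> 0"
  shows "\<forall>i\<in>I. expo \<kappa> \<kappa>' i = e i"
proof -
  have "place (Dr I p s 1 f * mon \<kappa>' / mon \<kappa>) (macev I p s 1 (expo \<kappa> \<kappa>') * c)"
    by (rule Dr_lead[OF fin p lead(1)])
  moreover have "place (Dr I p s 1 f * mon \<kappa>' / mon \<kappa>) (macev I p s 1 e * c)"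
    unfolding eig using place_mult[OF place_of_K lead(1)] by (simp add: mult.assoc)
  ultimately have "macev I p s 1 (expo \<kappa> \<kappa>') = macev I p s 1 e"
    using place_unique lead(2) by (metis mult_right_cancel)
  then show ?thesis using sep fin unfolding separating_def by blast
qed

lemma eigen_lead_transport:
  assumes fin: "finite I" and p: "p \<noteq> 0" and sep: "separating p s"
    and eig: "Dr I p s 1 f = of_K (macev I p s 1 e) * f" and f: "f \<in> ratV I" "f \<noteq> 0"
    and \<kappa>: "keys \<kappa> \<subseteq> I" "keys \<kappa>' \<subseteq> I" "\<forall>i\<in>I. expo \<kappa> \<kappa>' i = e i"
  shows "\<exists>c. c \<noteq> 0 \<and> place (f * mon \<kappa>' / mon \<kappa>) c"
proof -
  obtain \<eta> \<eta>' c where l: "c \<noteq> 0" "keys \<eta> \<subseteq> I" "keys \<eta>' \<subseteq> I" "place (f * mon \<eta>' / mon \<eta>) c"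
    using place_lead_exists[OF f] by blast
  have e: "\<forall>i\<in>I. expo \<eta> \<eta>' i = e i" by (rule eigen_lead_exponent[OF fin p sep eig l(4,1)])
  have "\<eta> + \<kappa>' = \<kappa> + \<eta>'"
  proof (rule poly_mapping_eqI)
    fix i
    show "lookup (\<eta> + \<kappa>') i = lookup (\<kappa> + \<eta>') i"
    proof (cases "i \<in> I")
      case True
      then have "expo \<eta> \<eta>' i = expo \<kappa> \<kappa>' i" using e \<kappa>(3) by simp
      then show ?thesis by (simp add: expo_def lookup_add)
    next
      case False
      then have "i \<notin> keys \<eta>" "i \<notin> keys \<eta>'" "i \<notin> keys \<kappa>" "i \<notin> keys \<kappa>'"
        using l \<kappa> by auto
      then show ?thesis by (simp add: lookup_add in_keys_iff)
    qed
  qed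
  then have "mon \<eta> * mon \<kappa>' = mon \<kappa> * mon \<eta>'" by (simp flip: mon_add)
  then have "f * mon \<kappa>' / mon \<kappa> = f * mon \<eta>' / mon \<eta>" by (simp add: field_simps)
  then show ?thesis using l by auto
qed

text \<open>Two eigenfunctions with the same eigenvalue have the same leading exponents. Subtracting a multiple
cancels the leading term, and an eigenfunction without the leading term prescribed by its eigenvalue is zero.\<close>

lemma eigen_unique:
  assumes fin: "finite I" and p: "p \<noteq> 0" and sep: "separating p s"
    and f: "f \<in> ratV I" "Dr I p s 1 f = of_K (macev I p s 1 e) * f"
    and g: "g \<in> ratV I" "Dr I p s 1 g = of_K (macev I p s 1 e) * g" "g \<noteq> 0"
  shows "\<exists>c. f = of_K c * g"
proof (cases "f = 0")
  case True
  then show ?thesis by (intro exI[of _ 0]) simp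
next
  case False
  obtain \<kappa> \<kappa>' c where l: "c \<noteq> 0" "keys \<kappa> \<subseteq> I" "keys \<kappa>' \<subseteq> I" "place (g * mon \<kappa>' / mon \<kappa>) c"
    using place_lead_exists[OF g(1,3)] by blast
  have e: "\<forall>i\<in>I. expo \<kappa> \<kappa>' i = e i" by (rule eigen_lead_exponent[OF fin p sep g(2) l(4,1)])
  obtain d where d: "place (f * mon \<kappa>' / mon \<kappa>) d"
    using eigen_lead_transport[OF fin p sep f(2,1) False l(2,3) e] by blast
  \<comment> \<open>The leading terms of \<open>f\<close> and of this multiple of \<open>g\<close> agree.\<close>
  define h where "h = f - of_K (d / c) * g"
  have hr: "h \<in> ratV I" unfolding h_def by (intro ratV_diff ratV_mult f g ratV_of_K)
  have "Dr I p s 1 h + Dr I p s 1 (of_K (d / c) * g) = Dr I p s 1 f"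
    unfolding Dr_add[OF p, symmetric] by (simp add: h_def)
  then have heig: "Dr I p s 1 h = of_K (macev I p s 1 e) * h"
    unfolding Dr_cmult[OF p] f(2) g(2) by (simp add: h_def algebra_simps)
  have "place (f * mon \<kappa>' / mon \<kappa> - of_K (d / c) * (g * mon \<kappa>' / mon \<kappa>)) (d - d / c * c)"
    by (intro place_diff place_mult place_of_K d l)
  moreover have "f * mon \<kappa>' / mon \<kappa> - of_K (d / c) * (g * mon \<kappa>' / mon \<kappa>) = h * mon \<kappa>' / mon \<kappa>"
    by (simp add: h_def diff_divide_distrib left_diff_distrib)
  ultimately have h0: "place (h * mon \<kappa>' / mon \<kappa>) 0" using l(1) by simp
  have "h = 0"
  proof (rule ccontr)
    assume "h \<noteq> 0"
    then obtain b where "b \<noteq> 0" "place (h * mon \<kappa>' / mon \<kappa>) b"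
      using eigen_lead_transport[OF fin p sep heig hr _ l(2,3) e] by blast
    then show False using place_unique h0 by blast
  qed
  then show ?thesis by (auto simp: h_def)
qed

text \<open>An operator that commutes with a first-order operator preserves its eigenspaces, which are
one-dimensional; the new eigenvalue can be read off the leading term.\<close>

lemma eigen_transfer:
  assumes fin: "finite I" and p: "p \<noteq> 0" "p' \<noteq> 0" and sep: "separating p s"
    and f: "f \<in> ratV I" "f \<noteq> 0" "Dr I p s 1 f = of_K (macev I p s 1 e) * f"
    and comm: "Dr I p s 1 (Dr I p' s' r f) = Dr I p' s' r (Dr I p s 1 f)"
  shows "Dr I p' s' r f = of_K (macev I p' s' r e) * f"
proof -
  have "Dr I p' s' r f \<in> ratV I" by (rule Dr_ratV[OF order.refl f(1) p(2)])
  moreover have "Dr I p s 1 (Dr I p' s' r f) = of_K (macev I p s 1 e) * Dr I p' s' r f"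
    unfolding comm f(3) by (rule Dr_cmult[OF p(2)])
  ultimately obtain a where a: "Dr I p' s' r f = of_K a * f"
    using eigen_unique[OF fin p(1) sep _ _ f(1,3,2)] by blast
  obtain \<kappa> \<kappa>' c where l: "c \<noteq> 0" "keys \<kappa> \<subseteq> I" "keys \<kappa>' \<subseteq> I" "place (f * mon \<kappa>' / mon \<kappa>) c"
    using place_lead_exists[OF f(1,2)] by blast
  have e: "\<forall>i\<in>I. expo \<kappa> \<kappa>' i = e i" by (rule eigen_lead_exponent[OF fin p(1) sep f(3) l(4,1)])
  then have m: "macev I p' s' r (expo \<kappa> \<kappa>') = macev I p' s' r e"
    unfolding macev_def by (intro sum.cong prod.cong refl) auto
  have "place (Dr I p' s' r f * mon \<kappa>' / mon \<kappa>) (macev I p' s' r e * c)"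
    using Dr_lead[OF fin p(2) l(4), of s' r] by (simp add: m)
  moreover have "place (Dr I p' s' r f * mon \<kappa>' / mon \<kappa>) (a * c)"
    unfolding a using place_mult[OF place_of_K l(4)] by (simp add: mult.assoc)
  ultimately have "a = macev I p' s' r e" using place_unique l(1) by (metis mult_right_cancel)
  then show ?thesis using a by simp
qed

lemma neg_var_power: "(- [:0, 1:]) ^ k = monom ((- 1) ^ k :: 'a::comm_ring_1) k"
proof -
  have "(- [:0, 1:] :: 'a poly) = monom (- 1) 1" by (simp add: monom_altdef)
  then show ?thesis by (simp add: monom_power)
qed

lemma rank_lessThan: "rank_in {..<n} i = n - 1 - i"
proof -
  have "{j\<in>{..<n}. i < j} = {Suc i..<n}" by auto
  then show ?thesis by (simp add: rank_in_def)
qed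

lemma coeff_D_op: "coeff (D_op n f) r = (- 1) ^ r * Dr {..<n} q_K t_K r f"
proof -
  have "coeff (D_op n f) r = (\<Sum>L\<in>Pow {..<n}. if card L = r then
     (- 1) ^ r * (of_K (t_K ^ (r choose 2)) * mac_coeff {..<n} t_K L * scale (sub_scale L q_K) f) else 0)"
    unfolding D_op_def coeff_sum
  proof (intro sum.cong refl)
    fix L assume L: "L \<in> Pow {..<n}"
    have "(\<lambda>i. if i < n then q_K ^ (if i \<in> L then 1 else 0) else 1) = sub_scale L q_K"
    proof (rule ext)
      show "(if i < n then q_K ^ (if i \<in> L then 1 else 0) else 1) = sub_scale L q_K i" for i
        using L by (cases "i \<in> L") (auto simp: sub_scale_def)
    qed
    then have "qshifts n (\<lambda>i. if i \<in> L then 1 else 0) f = scale (sub_scale L q_K) f"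
      by (simp add: qshifts_eq_scale)
    moreover have "(\<Prod>i\<in>L. \<Prod>j\<in>{..<n} - L. (1 - tF * xvar i / xvar j) / (1 - xvar i / xvar j)) = mac_coeff {..<n} t_K L"
      by (simp add: mac_coeff_def cpl_def tF_def)
    ultimately show "coeff ((- [:0, 1:]) ^ card L *
     [: tF ^ (card L choose 2) *
        (\<Prod>i\<in>L. \<Prod>j\<in>{..<n} - L. (1 - tF * xvar i / xvar j) / (1 - xvar i / xvar j)) *
        qshifts n (\<lambda>i. if i \<in> L then 1 else 0) f :]) r = (if card L = r then
     (- 1) ^ r * (of_K (t_K ^ (r choose 2)) * mac_coeff {..<n} t_K L * scale (sub_scale L q_K) f) else 0)"
      unfolding neg_var_power by (simp add: tF_def of_K_power)
  qed
  also have "\<dots> = (\<Sum>L | L \<subseteq> {..<n} \<and> card L = r.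
      (- 1) ^ r * (of_K (t_K ^ (r choose 2)) * mac_coeff {..<n} t_K L * scale (sub_scale L q_K) f))"
    by (simp add: sum.If_cases Int_def Pow_def)
  finally show ?thesis by (simp add: Dr_def sum_distrib_left)
qed

lemma coeff_eigenvalue:
  "coeff ([:f:] * (\<Prod>i<n. 1 - [:0, 1:] * [:qF ^ \<nu> i * tF ^ (n - 1 - i):])) r =
    (- 1) ^ r * (of_K (macev {..<n} q_K t_K r (\<lambda>i. int (\<nu> i))) * f)"
proof -
  define c where "c i = qF ^ \<nu> i * tF ^ (n - 1 - i)" for i
  have "(\<Prod>i<n. 1 - [:0, 1:] * [:c i:]) = (\<Prod>i<n. (- [:0, 1:]) * [:c i:] + 1)"
    by (intro prod.cong refl) simp
  also have "\<dots> = (\<Sum>X\<in>Pow {..<n}. (\<Prod>i\<in>X. (- [:0, 1:]) * [:c i:]) * (\<Prod>i\<in>{..<n} - X. 1))"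
    by (rule prod_add) simp
  also have "\<dots> = (\<Sum>X\<in>Pow {..<n}. monom ((- 1) ^ card X * (\<Prod>i\<in>X. c i)) (card X))"
  proof (rule sum.cong[OF refl])
    fix X
    have "(\<Prod>i\<in>X. [:c i:]) = [:\<Prod>i\<in>X. c i:]"
      by (induction X rule: infinite_finite_induct) (auto simp: one_pCons)
    then show "(\<Prod>i\<in>X. (- [:0, 1:]) * [:c i:]) * (\<Prod>i\<in>{..<n} - X. 1) = monom ((- 1) ^ card X * (\<Prod>i\<in>X. c i)) (card X)"
      unfolding prod.distrib prod_constant neg_var_power by (simp add: smult_monom mult.commute)
  qed
  finally have "coeff ([:f:] * (\<Prod>i<n. 1 - [:0, 1:] * [:c i:])) r =
     (\<Sum>X\<in>Pow {..<n}. if card X = r then f * ((- 1) ^ r * (\<Prod>i\<in>X. c i)) else 0)"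
    by (simp add: coeff_sum sum_distrib_left) (intro sum.cong refl, auto)
  also have "\<dots> = (\<Sum>X | X \<subseteq> {..<n} \<and> card X = r. f * ((- 1) ^ r * (\<Prod>i\<in>X. c i)))"
    by (simp add: sum.If_cases Int_def Pow_def)
  also have "\<dots> = (- 1) ^ r * (of_K (macev {..<n} q_K t_K r (\<lambda>i. int (\<nu> i))) * f)"
    unfolding macev_def c_def
    by (simp add: of_K_hom rank_lessThan qF_def tF_def sum_distrib_left sum_distrib_right mult_ac)
  finally show ?thesis by (simp add: c_def)
qed

text \<open>The operator \<open>D_op\<close> is the generating function of the \<open>Dr\<close>, and its eigenvalue the one of the \<open>macev\<close>.\<close>

lemma D_op_eigen_iff:
  "D_op n f = [:f:] * (\<Prod>i<n. 1 - [:0, 1:] * [:qF ^ \<nu> i * tF ^ (n - 1 - i):]) \<longleftrightarrow>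
   (\<forall>r. Dr {..<n} q_K t_K r f = of_K (macev {..<n} q_K t_K r (\<lambda>i. int (\<nu> i))) * f)"
  unfolding poly_eq_iff coeff_D_op coeff_eigenvalue by simp

section \<open>Products of elementary symmetric polynomials\<close>

text \<open>The exponent vector of the squarefree monomial with support \<open>L\<close>.\<close>

definition ind :: "nat set \<Rightarrow> (nat \<Rightarrow>\<^sub>0 nat)" where
  "ind L = (\<Sum>i\<in>L. single i 1)"

lemma lookup_ind: "finite L \<Longrightarrow> lookup (ind L) i = (if i \<in> L then 1 else 0)"
  unfolding ind_def lookup_sum by (simp add: lookup_single when_def)

lemma keys_ind: "finite L \<Longrightarrow> keys (ind L) = L"
  by (auto simp: in_keys_iff lookup_ind split: if_splits)

text \<open>The elementary symmetric polynomial of degree \<open>r\<close> in \<open>n\<close> variables.\<close>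

definition elem :: "nat \<Rightarrow> nat \<Rightarrow> mpol" where
  "elem n r = (\<Sum>L | L \<subseteq> {..<n} \<and> card L = r. single (ind L) 1)"

lemma of_mpol_elem: "of_mpol (elem n r) = (\<Sum>L | L \<subseteq> {..<n} \<and> card L = r. \<Prod>i\<in>L. xvar i)"
  unfolding elem_def of_mpol_sum
proof (rule sum.cong[OF refl])
  fix L
  have "of_mpol (single (ind L) 1) = mon (ind L)" by (simp add: mon_def)
  also have "\<dots> = (\<Prod>i\<in>L. xvar i)" unfolding ind_def mon_sum xvar_eq_mon ..
  finally show "of_mpol (single (ind L) 1) = (\<Prod>i\<in>L. xvar i)" .
qed

lemma lookup_elem:
  "lookup (elem n r) \<mu> =
    (if keys \<mu> \<subseteq> {..<n} \<and> card (keys \<mu>) = r \<and> (\<forall>i. lookup \<mu> i \<le> 1) then 1 else 0)"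
proof -
  let ?S = "{L. L \<subseteq> {..<n} \<and> card L = r}"
  have finS: "finite ?S" by (rule finite_subset[of _ "Pow {..<n}"]) auto
  have iff: "ind L = \<mu> \<longleftrightarrow> L = keys \<mu> \<and> (\<forall>i. lookup \<mu> i \<le> 1)" if "L \<in> ?S" for L
  proof
    have fL: "finite L" using that finite_subset by auto
    assume "ind L = \<mu>"
    then show "L = keys \<mu> \<and> (\<forall>i. lookup \<mu> i \<le> 1)"
      using keys_ind[OF fL] lookup_ind[OF fL] by auto
  next
    assume h: "L = keys \<mu> \<and> (\<forall>i. lookup \<mu> i \<le> 1)"
    show "ind L = \<mu>"
    proof (rule poly_mapping_eqI)
      fix i
      have "lookup \<mu> i \<le> 1" using h by simp
      then have "lookup \<mu> i = (if i \<in> keys \<mu> then 1 else 0)"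
        by (cases "lookup \<mu> i") (auto simp: in_keys_iff)
      then show "lookup (ind L) i = lookup \<mu> i"
        using h by (simp add: lookup_ind)
    qed
  qed
  have "lookup (elem n r) \<mu> = (\<Sum>L\<in>?S. if L = keys \<mu> then (if \<forall>i. lookup \<mu> i \<le> 1 then 1 else 0) else 0)"
    unfolding elem_def lookup_sum
  proof (rule sum.cong[OF refl])
    fix L assume "L \<in> ?S"
    then show "lookup (single (ind L) 1) \<mu> = (if L = keys \<mu> then (if \<forall>i. lookup \<mu> i \<le> 1 then 1 else 0) else 0)"
      using iff by (auto simp: lookup_single when_def)
  qed
  also have "\<dots> = (if keys \<mu> \<in> ?S then (if \<forall>i. lookup \<mu> i \<le> 1 then 1 else 0) else 0)"
    by (rule sum.delta[OF finS])
  finally show ?thesis by auto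
qed

definition kernelF :: "nat \<Rightarrow> nat \<Rightarrow> ratfun" where
  "kernelF n m = (\<Prod>i\<in>{..<n}. \<Prod>j\<in>{n..<n+m}. 1 + xvar i * xvar j)"

definition box :: "nat \<Rightarrow> nat \<Rightarrow> (nat \<Rightarrow> nat) set" where
  "box n m = PiE {..<m} (\<lambda>_. {..n})"

lemma finite_box: "finite (box n m)" unfolding box_def by (intro finite_PiE) auto

definition elem_prod :: "nat \<Rightarrow> nat \<Rightarrow> (nat \<Rightarrow> nat) \<Rightarrow> mpol" where
  "elem_prod n m \<kappa> = (\<Prod>k<m. elem n (\<kappa> k))"

definition yexp :: "nat \<Rightarrow> nat \<Rightarrow> (nat \<Rightarrow> nat) \<Rightarrow> (nat \<Rightarrow>\<^sub>0 nat)" where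
  "yexp n m \<kappa> = (\<Sum>k<m. single (n + k) (\<kappa> k))"

lemma mon_yexp: "mon (yexp n m \<kappa>) = (\<Prod>k<m. xvar (n + k) ^ \<kappa> k)"
  unfolding yexp_def mon_sum mon_single ..

lemma prod_one_plus_elem:
  fixes y :: ratfun
  shows "(\<Prod>i<n. 1 + xvar i * y) = (\<Sum>r\<le>n. y ^ r * of_mpol (elem n r))"
proof -
  have "(\<Prod>i<n. 1 + xvar i * y) = (\<Prod>i<n. xvar i * y + 1)" by (intro prod.cong refl) (rule add.commute)
  also have "\<dots> = (\<Sum>X\<in>Pow {..<n}. (\<Prod>i\<in>X. xvar i * y) * (\<Prod>i\<in>{..<n} - X. 1))"
    by (rule prod_add) simp
  also have "\<dots> = (\<Sum>X\<in>Pow {..<n}. y ^ card X * (\<Prod>i\<in>X. xvar i))"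
    by (intro sum.cong refl) (simp add: prod.distrib mult.commute)
  also have "\<dots> = (\<Sum>r\<in>{..n}. \<Sum>X | X \<in> Pow {..<n} \<and> card X = r. y ^ card X * (\<Prod>i\<in>X. xvar i))"
    by (rule sum.group[symmetric]) (auto dest: card_mono[rotated])
  also have "\<dots> = (\<Sum>r\<le>n. y ^ r * of_mpol (elem n r))"
    unfolding of_mpol_elem sum_distrib_left by (intro sum.cong refl) auto
  finally show ?thesis .
qed

lemma prod_atLeast_shift: "(\<Prod>j\<in>{n..<n+m}. f j) = (\<Prod>k<m. f (n + k :: nat))"
  by (rule prod.reindex_bij_witness[of _ "\<lambda>k. n + k" "\<lambda>j. j - n"]) auto

text \<open>The kernel generates the products of elementary symmetric polynomials. The \<open>y k\<close> are arbitrary rational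
functions here, so that the identity can be specialised later.\<close>

lemma sum_PiE_kernel:
  fixes y :: "nat \<Rightarrow> ratfun"
  shows "(\<Prod>k<m. \<Prod>i<n. 1 + xvar i * y k) = (\<Sum>\<kappa>\<in>box n m. (\<Prod>k<m. y k ^ \<kappa> k) * of_mpol (elem_prod n m \<kappa>))"
proof -
  have "(\<Prod>k<m. \<Prod>i<n. 1 + xvar i * y k) = (\<Prod>k<m. \<Sum>r\<in>{..n}. y k ^ r * of_mpol (elem n r))"
    unfolding prod_one_plus_elem ..
  also have "\<dots> = (\<Sum>\<kappa>\<in>box n m. \<Prod>k<m. y k ^ \<kappa> k * of_mpol (elem n (\<kappa> k)))"
    unfolding box_def by (rule prod_sum_PiE) auto
  finally show ?thesis by (simp add: prod.distrib elem_prod_def of_mpol_prod)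
qed

lemma kernelF_expand: "kernelF n m = (\<Sum>\<kappa>\<in>box n m. mon (yexp n m \<kappa>) * of_mpol (elem_prod n m \<kappa>))"
proof -
  have "kernelF n m = (\<Prod>k<m. \<Prod>i<n. 1 + xvar i * xvar (n + k))"
    unfolding kernelF_def prod_atLeast_shift by (rule prod.swap)
  also have "\<dots> = (\<Sum>\<kappa>\<in>box n m. (\<Prod>k<m. xvar (n + k) ^ \<kappa> k) * of_mpol (elem_prod n m \<kappa>))"
    by (rule sum_PiE_kernel)
  finally show ?thesis by (simp add: mon_yexp)
qed

lemma lookup_yexp: "lookup (yexp n m \<kappa>) j = (if n \<le> j \<and> j < n + m then \<kappa> (j - n) else 0)"
proof -
  have "lookup (yexp n m \<kappa>) j = (\<Sum>k<m. if k = j - n then (if n \<le> j then \<kappa> k else 0) else 0)"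
    unfolding yexp_def lookup_sum by (intro sum.cong refl) (auto simp: lookup_single when_def)
  then show ?thesis by (auto simp: sum.delta)
qed

lemma keys_yexp: "keys (yexp n m \<kappa>) \<subseteq> {n..<n+m}"
  by (auto simp: in_keys_iff lookup_yexp split: if_splits)

lemma inj_on_yexp: "inj_on (yexp n m) (box n m)"
proof (rule inj_onI)
  fix \<kappa> \<kappa>' assume h: "\<kappa> \<in> box n m" "\<kappa>' \<in> box n m" "yexp n m \<kappa> = yexp n m \<kappa>'"
  show "\<kappa> = \<kappa>'"
  proof (rule PiE_ext[of _ "{..<m}" "\<lambda>_. {..n}"])
    fix k assume "k \<in> {..<m}"
    then show "\<kappa> k = \<kappa>' k" using arg_cong[OF h(3), of "\<lambda>e. lookup e (n + k)"] by (simp add: lookup_yexp)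
  qed (use h in \<open>auto simp: box_def\<close>)
qed

text \<open>Partitions in the rectangle with \<open>n\<close> rows and \<open>m\<close> columns, as exponent vectors.\<close>

definition parts :: "nat \<Rightarrow> nat \<Rightarrow> (nat \<Rightarrow>\<^sub>0 nat) set" where
  "parts n m = {\<rho>. keys \<rho> \<subseteq> {..<n} \<and> antimono (lookup \<rho>) \<and> lookup \<rho> 0 \<le> m}"

lemma parts_le: "\<rho> \<in> parts n m \<Longrightarrow> lookup \<rho> i \<le> m"
  unfolding parts_def using antimonoD[of "lookup \<rho>" 0 i] by (auto intro: order.trans)

lemma finite_parts: "finite (parts n m)"
proof (rule finite_imageD)
  show "finite (lookup ` parts n m)"
  proof (rule finite_subset)
    show "lookup ` parts n m \<subseteq> {\<beta>. \<beta> \<in> multi n \<and> (\<forall>i<n. \<beta> i \<le> m)}"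
    proof
      fix \<beta> assume "\<beta> \<in> lookup ` parts n m"
      then obtain \<rho> where l: "\<rho> \<in> parts n m" "\<beta> = lookup \<rho>" by auto
      have "\<beta> i = 0" if "i \<ge> n" for i
      proof -
        have "i \<notin> keys \<rho>" using l that by (auto simp: parts_def)
        then show ?thesis by (simp add: l in_keys_iff)
      qed
      then show "\<beta> \<in> {\<beta>. \<beta> \<in> multi n \<and> (\<forall>i<n. \<beta> i \<le> m)}" using parts_le[OF l(1)] l by (auto simp: multi_def)
    qed
    show "finite {\<beta>. \<beta> \<in> multi n \<and> (\<forall>i<n. \<beta> i \<le> m)}" by (rule finite_multi_bounded)
  qed
  show "inj_on lookup (parts n m)" by (rule inj_onI) (rule poly_mapping_eqI, simp)
qed

text \<open>The conjugate partition; columns are counted from \<open>0\<close>.\<close>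

definition conj_part :: "nat \<Rightarrow> (nat \<Rightarrow>\<^sub>0 nat) \<Rightarrow> nat \<Rightarrow> nat" where
  "conj_part n \<rho> k = card {i\<in>{..<n}. k < lookup \<rho> i}"

lemma down_closed_eq_lessThan:
  fixes S :: "nat set"
  assumes fin: "finite S" and down: "\<And>i j. i \<in> S \<Longrightarrow> j \<le> i \<Longrightarrow> j \<in> S"
  shows "S = {..<card S}"
proof -
  have "S \<subseteq> {..<card S}"
  proof
    fix i assume "i \<in> S"
    then have "{..i} \<subseteq> S" using down by auto
    then have "card {..i} \<le> card S" by (rule card_mono[OF fin])
    then show "i \<in> {..<card S}" by simp
  qed
  then show ?thesis by (rule card_subset_eq[rotated]) simp_all
qed

lemma less_conj_part_iff:
  assumes "\<rho> \<in> parts n m" "i < n"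
  shows "i < conj_part n \<rho> k \<longleftrightarrow> k < lookup \<rho> i"
proof -
  have mono: "antimono (lookup \<rho>)" using assms(1) by (simp add: parts_def)
  have "{i\<in>{..<n}. k < lookup \<rho> i} = {..<conj_part n \<rho> k}"
    unfolding conj_part_def
  proof (rule down_closed_eq_lessThan)
    fix i j assume "i \<in> {i\<in>{..<n}. k < lookup \<rho> i}" "j \<le> i"
    then show "j \<in> {i\<in>{..<n}. k < lookup \<rho> i}" using antimonoD[OF mono \<open>j \<le> i\<close>] by simp
  qed simp
  then show ?thesis using assms(2) by blast
qed

lemma conj_part_le: "conj_part n \<rho> k \<le> n"
  unfolding conj_part_def by (rule order.trans[OF card_mono[of "{..<n}"]]) auto

text \<open>The conjugate partition as an element of \<open>box n m\<close>, which consists of extensional functions.\<close>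

definition conj_box :: "nat \<Rightarrow> nat \<Rightarrow> (nat \<Rightarrow>\<^sub>0 nat) \<Rightarrow> (nat \<Rightarrow> nat)" where
  "conj_box n m \<rho> = restrict (conj_part n \<rho>) {..<m}"

lemma conj_box_in: "conj_box n m \<rho> \<in> box n m"
  unfolding conj_box_def box_def by (auto simp: PiE_def extensional_def conj_part_le)

lemma ind_le_initial:
  assumes "L \<subseteq> {..<n}" "card L = r"
  shows "ind L \<le> ind {..<r}"
proof (cases "L = {..<r}")
  case False
  have fL: "finite L" using assms finite_subset by auto
  have "\<not> {..<r} \<subseteq> L"
  proof
    assume "{..<r} \<subseteq> L"
    then have "{..<r} = L" using assms fL by (intro card_subset_eq) auto
    then show False using False by simp
  qed
  then have ex: "\<exists>i. i < r \<and> i \<notin> L" by auto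
  \<comment> \<open>The first position where \<open>L\<close> has a gap decides the lexicographic comparison.\<close>
  define k where "k = (LEAST i. i < r \<and> i \<notin> L)"
  have k: "k < r" "k \<notin> L" using LeastI_ex[OF ex] by (auto simp: k_def)
  have below: "i \<in> L" if "i < k" for i
    using not_less_Least[of i "\<lambda>i. i < r \<and> i \<notin> L"] that k by (auto simp: k_def)
  have "ind L < ind {..<r}"
    unfolding less_poly_mapping.rep_eq less_fun_def
    using k below fL by (intro exI[of _ k]) (auto simp: lookup_ind)
  then show ?thesis by simp
qed simp

lemma keys_elem_le:
  assumes "\<mu> \<in> keys (elem n r)"
  shows "\<mu> \<le> ind {..<r}"
proof -
  have h: "keys \<mu> \<subseteq> {..<n}" "card (keys \<mu>) = r" "\<forall>i. lookup \<mu> i \<le> 1"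
    using assms by (auto simp: in_keys_iff[of \<mu>] lookup_elem split: if_splits)
  have "\<mu> = ind (keys \<mu>)"
  proof (rule poly_mapping_eqI)
    fix i
    have "lookup \<mu> i \<le> 1" using h by simp
    then show "lookup \<mu> i = lookup (ind (keys \<mu>)) i"
      by (cases "lookup \<mu> i") (auto simp: in_keys_iff lookup_ind)
  qed
  then show ?thesis using ind_le_initial[OF h(1,2)] by simp
qed

lemma lookup_elem_top: "r \<le> n \<Longrightarrow> lookup (elem n r) (ind {..<r}) = 1"
  by (auto simp: lookup_elem keys_ind lookup_ind)

lemma prod_top:
  fixes p :: "'i \<Rightarrow> mpol"
  assumes "finite A" "\<And>k \<mu>. k \<in> A \<Longrightarrow> \<mu> \<in> keys (p k) \<Longrightarrow> \<mu> \<le> \<eta> k"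
  shows "(\<forall>\<mu>\<in>keys (\<Prod>k\<in>A. p k). \<mu> \<le> (\<Sum>k\<in>A. \<eta> k)) \<and>
    lookup (\<Prod>k\<in>A. p k) (\<Sum>k\<in>A. \<eta> k) = (\<Prod>k\<in>A. lookup (p k) (\<eta> k))"
  using assms
proof (induction A rule: finite_induct)
  case (insert a A)
  have IH: "\<forall>\<mu>\<in>keys (\<Prod>k\<in>A. p k). \<mu> \<le> (\<Sum>k\<in>A. \<eta> k)"
    "lookup (\<Prod>k\<in>A. p k) (\<Sum>k\<in>A. \<eta> k) = (\<Prod>k\<in>A. lookup (p k) (\<eta> k))"
    using insert.IH insert.prems by blast+
  have a: "\<mu> \<le> \<eta> a" if "\<mu> \<in> keys (p a)" for \<mu> using insert.prems that by blast
  show ?case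
    using insert.hyps lookup_times_top[of "p a" "\<eta> a" "\<Prod>k\<in>A. p k" "\<Sum>k\<in>A. \<eta> k"] a IH
      keys_times_le[of "p a" "\<eta> a" "\<Prod>k\<in>A. p k" "\<Sum>k\<in>A. \<eta> k"] by auto
qed auto

lemma conj_sum_ind:
  assumes l: "\<rho> \<in> parts n m"
  shows "(\<Sum>k<m. ind {..<conj_box n m \<rho> k}) = \<rho>"
proof (rule poly_mapping_eqI)
  fix i
  have "lookup (\<Sum>k<m. ind {..<conj_box n m \<rho> k}) i = (\<Sum>k<m. if i < conj_part n \<rho> k then 1 else 0)"
    unfolding lookup_sum by (intro sum.cong refl) (simp add: lookup_ind conj_box_def)
  also have "\<dots> = (\<Sum>k<m. if k < lookup \<rho> i then 1 else 0)"
  proof (rule sum.cong[OF refl])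
    fix k
    show "(if i < conj_part n \<rho> k then 1 else 0) = (if k < lookup \<rho> i then 1 else 0)"
    proof (cases "i < n")
      case True
      then show ?thesis using less_conj_part_iff[OF l, of i k] by simp
    next
      case False
      then have "i \<notin> keys \<rho>" using l by (auto simp: parts_def)
      then show ?thesis using False conj_part_le[of n \<rho> k] by (simp add: in_keys_iff)
    qed
  qed
  also have "\<dots> = card {k\<in>{..<m}. k < lookup \<rho> i}" by (simp add: sum.If_cases Int_def)
  also have "{k\<in>{..<m}. k < lookup \<rho> i} = {..<lookup \<rho> i}"
    using parts_le[OF l, of i] by auto
  finally show "lookup (\<Sum>k<m. ind {..<conj_box n m \<rho> k}) i = lookup \<rho> i" by simp
qed

text \<open>Leading monomials multiply, the one of \<open>elem n r\<close> is the product of the first \<open>r\<close> variables, and a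
partition is the sum of its columns.\<close>

lemma elem_prod_top:
  assumes l: "\<rho> \<in> parts n m"
  shows "\<forall>\<mu>\<in>keys (elem_prod n m (conj_box n m \<rho>)). \<mu> \<le> \<rho>"
    "lookup (elem_prod n m (conj_box n m \<rho>)) \<rho> = 1"
proof -
  have c: "conj_box n m \<rho> k \<le> n" if "k < m" for k using that conj_part_le by (simp add: conj_box_def)
  have "(\<forall>\<mu>\<in>keys (elem_prod n m (conj_box n m \<rho>)). \<mu> \<le> (\<Sum>k<m. ind {..<conj_box n m \<rho> k})) \<and>
    lookup (elem_prod n m (conj_box n m \<rho>)) (\<Sum>k<m. ind {..<conj_box n m \<rho> k}) =
     (\<Prod>k<m. lookup (elem n (conj_box n m \<rho> k)) (ind {..<conj_box n m \<rho> k}))"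
    unfolding elem_prod_def by (rule prod_top) (auto intro: keys_elem_le)
  moreover have "(\<Prod>k<m. lookup (elem n (conj_box n m \<rho> k)) (ind {..<conj_box n m \<rho> k})) = 1"
    using c by (intro prod.neutral) (simp add: lookup_elem_top)
  ultimately show "\<forall>\<mu>\<in>keys (elem_prod n m (conj_box n m \<rho>)). \<mu> \<le> \<rho>"
    "lookup (elem_prod n m (conj_box n m \<rho>)) \<rho> = 1"
    unfolding conj_sum_ind[OF l] by auto
qed

lemma lookup_map_key: "inj \<pi> \<Longrightarrow> lookup (Poly_Mapping.map_key \<pi> \<mu>) i = lookup \<mu> (\<pi> i)"
  by (simp add: map_key.rep_eq)

text \<open>Invariance under the variable permutation \<open>\<pi>\<close>, expressed on coefficients as in \<open>symmetric_pol\<close>.\<close>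

definition invariant :: "(nat \<Rightarrow> nat) \<Rightarrow> mpol \<Rightarrow> bool" where
  "invariant \<pi> p \<longleftrightarrow> (\<forall>\<mu>. lookup p (Poly_Mapping.map_key \<pi> \<mu>) = lookup p \<mu>)"

lemma invariant_mult:
  assumes pi: "bij \<pi>" and p: "invariant \<pi> p" and r: "invariant \<pi> r"
  shows "invariant \<pi> (p * r)"
  unfolding invariant_def
proof
  fix \<kappa>
  have ipi: "inj \<pi>" "inj (inv \<pi>)" using pi by (auto simp: bij_is_inj bij_imp_bij_inv)
  have io: "\<pi> \<circ> inv \<pi> = (\<lambda>x. x)" "inv \<pi> \<circ> \<pi> = (\<lambda>x. x)" using pi by (auto simp: fun_eq_iff bij_is_inj bij_is_surj surj_f_inv_f)
  have inv1: "Poly_Mapping.map_key \<pi> (Poly_Mapping.map_key (inv \<pi>) \<mu>) = \<mu>" for \<mu> :: "nat \<Rightarrow>\<^sub>0 nat"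
    using map_key_compose[OF ipi(1,2), of \<mu>] by (simp add: io map_key_id)
  have inv2: "Poly_Mapping.map_key (inv \<pi>) (Poly_Mapping.map_key \<pi> \<mu>) = \<mu>" for \<mu> :: "nat \<Rightarrow>\<^sub>0 nat"
    using map_key_compose[OF ipi(2,1), of \<mu>] by (simp add: io map_key_id)
  have bij: "bij_betw (Poly_Mapping.map_key \<pi>) (keys f) (keys f)" if f: "invariant \<pi> f" for f
  proof (rule bij_betw_byWitness[of _ "Poly_Mapping.map_key (inv \<pi>)"])
    show "Poly_Mapping.map_key \<pi> ` keys f \<subseteq> keys f"
      using f by (auto simp: in_keys_iff[of _ f] invariant_def)
    show "Poly_Mapping.map_key (inv \<pi>) ` keys f \<subseteq> keys f"
    proof
      fix z assume "z \<in> Poly_Mapping.map_key (inv \<pi>) ` keys f"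
      then obtain \<mu> where "\<mu> \<in> keys f" "z = Poly_Mapping.map_key (inv \<pi>) \<mu>" by auto
      moreover have "lookup f (Poly_Mapping.map_key \<pi> z) = lookup f z" for z
        using f by (simp add: invariant_def)
      ultimately show "z \<in> keys f" using inv1[of \<mu>] by (metis in_keys_iff)
    qed
  qed (use inv1 inv2 in auto)
  have "lookup (p * r) (Poly_Mapping.map_key \<pi> \<kappa>) =
     (\<Sum>\<mu>\<in>keys p. \<Sum>\<nu>\<in>keys r.
     if Poly_Mapping.map_key \<pi> \<mu> + Poly_Mapping.map_key \<pi> \<nu> = Poly_Mapping.map_key \<pi> \<kappa>
     then lookup p (Poly_Mapping.map_key \<pi> \<mu>) * lookup r (Poly_Mapping.map_key \<pi> \<nu>) else 0)"
    unfolding lookup_times_finite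
    by (subst sum.reindex_bij_betw[OF bij[OF p], symmetric], rule sum.cong[OF refl],
        subst sum.reindex_bij_betw[OF bij[OF r], symmetric], rule refl)
  also have "\<dots> = lookup (p * r) \<kappa>"
    unfolding lookup_times_finite
  proof (rule sum.cong[OF refl], rule sum.cong[OF refl])
    fix \<mu> \<nu>
    have "Poly_Mapping.map_key \<pi> \<mu> + Poly_Mapping.map_key \<pi> \<nu> = Poly_Mapping.map_key \<pi> \<kappa> \<longleftrightarrow> \<mu> + \<nu> = \<kappa>"
      unfolding map_key_plus[OF ipi(1), symmetric] using inv2 by metis
    then show "(if Poly_Mapping.map_key \<pi> \<mu> + Poly_Mapping.map_key \<pi> \<nu> = Poly_Mapping.map_key \<pi> \<kappa>
     then lookup p (Poly_Mapping.map_key \<pi> \<mu>) * lookup r (Poly_Mapping.map_key \<pi> \<nu>) else 0) =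
     (if \<mu> + \<nu> = \<kappa> then lookup p \<mu> * lookup r \<nu> else 0)"
      using p r by (simp add: invariant_def)
  qed
  finally show "lookup (p * r) (Poly_Mapping.map_key \<pi> \<kappa>) = lookup (p * r) \<kappa>" .
qed

lemma invariant_elem:
  assumes pi: "\<pi> permutes {..<n}"
  shows "invariant \<pi> (elem n r)"
  unfolding invariant_def
proof
  fix \<mu> :: "nat \<Rightarrow>\<^sub>0 nat"
  have b: "bij \<pi>" using pi by (rule permutes_bij)
  have k: "keys (Poly_Mapping.map_key \<pi> \<mu>) = \<pi> -` keys \<mu>" by (rule keys_map_key[OF bij_is_inj[OF b]])
  have "card (\<pi> -` keys \<mu>) = card (keys \<mu>)"
    using b by (intro card_vimage_inj) (auto simp: bij_is_inj bij_is_surj)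
  moreover have "\<pi> -` keys \<mu> \<subseteq> {..<n} \<longleftrightarrow> keys \<mu> \<subseteq> {..<n}"
  proof -
    have "i \<in> {..<n} \<longleftrightarrow> \<pi> i \<in> {..<n}" for i using permutes_in_image[OF pi] by blast
    moreover have "\<exists>j. i = \<pi> j" for i using b by (metis bij_pointE)
    ultimately show ?thesis by (metis subset_iff vimage_eq)
  qed
  moreover have "(\<forall>i. lookup (Poly_Mapping.map_key \<pi> \<mu>) i \<le> 1) \<longleftrightarrow> (\<forall>i. lookup \<mu> i \<le> 1)"
    using b by (simp add: lookup_map_key[OF bij_is_inj[OF b]]) (metis bij_pointE)
  ultimately show "lookup (elem n r) (Poly_Mapping.map_key \<pi> \<mu>) = lookup (elem n r) \<mu>"
    unfolding lookup_elem k by simp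
qed

lemma invariant_elem_prod:
  assumes pi: "\<pi> permutes {..<n}"
  shows "invariant \<pi> (elem_prod n m \<kappa>)"
proof -
  have b: "bij \<pi>" using pi by (rule permutes_bij)
  have one: "invariant \<pi> 1"
    unfolding invariant_def
  proof
    fix \<mu> :: "nat \<Rightarrow>\<^sub>0 nat"
    have "Poly_Mapping.map_key \<pi> \<mu> = 0 \<longleftrightarrow> \<mu> = 0"
      unfolding poly_mapping_eq_iff fun_eq_iff lookup_map_key[OF bij_is_inj[OF b]] using b by simp (metis bij_pointE)
    then show "lookup 1 (Poly_Mapping.map_key \<pi> \<mu>) = (lookup 1 \<mu> :: K)"
      by (simp add: lookup_one when_def)
  qed
  show ?thesis
    unfolding elem_prod_def
    by (induction m) (auto simp: one intro!: invariant_mult[OF b] invariant_elem[OF pi])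
qed

lemma keys_elem_prod:
  assumes "\<mu> \<in> keys (elem_prod n m \<kappa>)"
  shows "keys \<mu> \<subseteq> {..<n} \<and> (\<forall>i. lookup \<mu> i \<le> m)"
  using assms
proof (induction m arbitrary: \<mu>)
  case 0
  then show ?case by (simp add: elem_prod_def)
next
  case (Suc m)
  have "elem_prod n (Suc m) \<kappa> = elem_prod n m \<kappa> * elem n (\<kappa> m)" by (simp add: elem_prod_def)
  then obtain a b where ab: "\<mu> = a + b" "a \<in> keys (elem_prod n m \<kappa>)" "b \<in> keys (elem n (\<kappa> m))"
    using Suc.prems keys_mult[of "elem_prod n m \<kappa>" "elem n (\<kappa> m)"] by auto
  have b: "keys b \<subseteq> {..<n}" "\<forall>i. lookup b i \<le> 1"
    using ab(3) by (auto simp: in_keys_iff[of b] lookup_elem split: if_splits)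
  have a: "keys a \<subseteq> {..<n}" "\<forall>i. lookup a i \<le> m" using Suc.IH[OF ab(2)] by auto
  have "lookup \<mu> i \<le> Suc m" for i
    using a(2)[rule_format, of i] b(2)[rule_format, of i] by (simp add: ab(1) lookup_add)
  moreover have "keys \<mu> \<subseteq> {..<n}" using keys_add[of a b] a b by (auto simp: ab(1))
  ultimately show ?case by blast
qed

section \<open>The kernel equation\<close>

definition scal :: "K \<Rightarrow> mpol \<Rightarrow> mpol" where
  "scal c p = single 0 c * p"

lemma lookup_scal: "lookup (scal c p) \<mu> = c * lookup p \<mu>"
  by (simp add: scal_def lookup_single0_times)

lemma of_mpol_scal: "of_mpol (scal c p) = of_K c * of_mpol p"
  by (simp add: scal_def of_mpol_mult of_K_def)

text \<open>The span over \<open>K\<close> of the products of at most \<open>m\<close> elementary symmetric polynomials.\<close>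

definition elem_span :: "nat \<Rightarrow> nat \<Rightarrow> mpol set" where
  "elem_span n m = {\<Sum>\<kappa>\<in>box n m. scal (c \<kappa>) (elem_prod n m \<kappa>) | c. True}"

lemma elem_spanI: "(\<Sum>\<kappa>\<in>box n m. scal (c \<kappa>) (elem_prod n m \<kappa>)) \<in> elem_span n m"
  by (auto simp: elem_span_def)

lemma elem_spanE:
  assumes "w \<in> elem_span n m"
  obtains c where "w = (\<Sum>\<kappa>\<in>box n m. scal (c \<kappa>) (elem_prod n m \<kappa>))"
  using assms by (auto simp: elem_span_def)

lemma elem_span_add: assumes "v \<in> elem_span n m" "w \<in> elem_span n m" shows "v + w \<in> elem_span n m"
proof -
  obtain c d where "v = (\<Sum>\<kappa>\<in>box n m. scal (c \<kappa>) (elem_prod n m \<kappa>))" "w = (\<Sum>\<kappa>\<in>box n m. scal (d \<kappa>) (elem_prod n m \<kappa>))"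
    using assms by (auto simp: elem_span_def)
  then have "v + w = (\<Sum>\<kappa>\<in>box n m. scal (c \<kappa> + d \<kappa>) (elem_prod n m \<kappa>))"
    by (simp add: scal_def single_add distrib_right sum.distrib)
  then show ?thesis using elem_spanI[where c = "\<lambda>\<kappa>. c \<kappa> + d \<kappa>"] by simp
qed

lemma elem_span_scal: assumes "w \<in> elem_span n m" shows "scal a w \<in> elem_span n m"
proof -
  obtain c where "w = (\<Sum>\<kappa>\<in>box n m. scal (c \<kappa>) (elem_prod n m \<kappa>))"
    using assms by (auto simp: elem_span_def)
  then have "scal a w = (\<Sum>\<kappa>\<in>box n m. scal (a * c \<kappa>) (elem_prod n m \<kappa>))"
    by (simp add: scal_def sum_distrib_left mult_single flip: mult.assoc)
  then show ?thesis using elem_spanI[where c = "\<lambda>\<kappa>. a * c \<kappa>"] by simp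
qed

lemma elem_span_0: "0 \<in> elem_span n m" using elem_spanI[of "\<lambda>_. 0" n m] by (simp add: scal_def)

lemma elem_span_diff: assumes "v \<in> elem_span n m" "w \<in> elem_span n m" shows "v - w \<in> elem_span n m"
proof -
  have e: "v - w = v + scal (- 1) w" by (rule poly_mapping_eqI) (simp add: lookup_scal lookup_add lookup_minus)
  show ?thesis unfolding e by (intro elem_span_add elem_span_scal assms)
qed

lemma elem_span_sum: "(\<And>i. i \<in> A \<Longrightarrow> f i \<in> elem_span n m) \<Longrightarrow> (\<Sum>i\<in>A. f i) \<in> elem_span n m"
  by (induction A rule: infinite_finite_induct) (auto intro: elem_span_add elem_span_0)

lemma elem_prod_elem_span: assumes "\<kappa> \<in> box n m" shows "elem_prod n m \<kappa> \<in> elem_span n m"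
proof -
  have "(\<Sum>\<kappa>'\<in>box n m. scal (if \<kappa>' = \<kappa> then 1 else 0) (elem_prod n m \<kappa>')) =
      (\<Sum>\<kappa>'\<in>box n m. if \<kappa>' = \<kappa> then elem_prod n m \<kappa> else 0)"
    by (intro sum.cong refl) (simp add: scal_def)
  also have "\<dots> = elem_prod n m \<kappa>" using assms by (simp add: sum.delta[OF finite_box])
  finally show ?thesis using elem_spanI[of "\<lambda>\<kappa>'. if \<kappa>' = \<kappa> then 1 else 0" n m] by simp
qed

lemma lookup_elem_span: "lookup (\<Sum>\<kappa>\<in>A. scal (c \<kappa>) (f \<kappa>)) \<mu> = (\<Sum>\<kappa>\<in>A. c \<kappa> * lookup (f \<kappa>) \<mu>)"
  by (simp add: lookup_sum lookup_scal)

lemma keys_elem_span: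
  assumes "w \<in> elem_span n m" "\<mu> \<in> keys w"
  shows "keys \<mu> \<subseteq> {..<n} \<and> (\<forall>i. lookup \<mu> i \<le> m)"
proof -
  obtain c where c: "w = (\<Sum>\<kappa>\<in>box n m. scal (c \<kappa>) (elem_prod n m \<kappa>))" using assms(1) by (rule elem_spanE)
  have "\<exists>\<kappa>\<in>box n m. \<mu> \<in> keys (elem_prod n m \<kappa>)"
  proof (rule ccontr)
    assume "\<not> ?thesis"
    then have "lookup w \<mu> = 0"
      unfolding c lookup_elem_span by (intro sum.neutral) (auto simp: in_keys_iff[of \<mu>])
    then show False using assms(2) by (simp add: in_keys_iff)
  qed
  then show ?thesis using keys_elem_prod by blast
qed

lemma elem_span_polysV: "w \<in> elem_span n m \<Longrightarrow> w \<in> polysV {..<n}"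
  using keys_elem_span by (auto simp: polysV_def)

lemma invariant_elem_span:
  assumes "w \<in> elem_span n m" "\<pi> permutes {..<n}"
  shows "invariant \<pi> w"
proof -
  obtain c where c: "w = (\<Sum>\<kappa>\<in>box n m. scal (c \<kappa>) (elem_prod n m \<kappa>))" using assms(1) by (rule elem_spanE)
  show ?thesis
    using invariant_elem_prod[OF assms(2)] unfolding invariant_def c lookup_elem_span by simp
qed

text \<open>The leading exponent of a symmetric polynomial is weakly decreasing, since a transposition would
otherwise produce a larger one.\<close>

lemma symmetric_lead_part:
  assumes w: "w \<in> elem_span n m" "w \<noteq> 0"
  shows "Max (keys w) \<in> parts n m"
proof -
  define \<mu> where "\<mu> = Max (keys w)"
  have mu: "\<mu> \<in> keys w" "\<And>\<kappa>. \<kappa> \<in> keys w \<Longrightarrow> \<kappa> \<le> \<mu>"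
    using keys_le_Max[OF w(2)] by (auto simp: \<mu>_def)
  note k = keys_elem_span[OF w(1) mu(1)]
  have "lookup \<mu> j \<le> lookup \<mu> i" if ij: "i \<le> j" for i j
  proof (rule ccontr)
    assume "\<not> ?thesis"
    then have lt: "lookup \<mu> i < lookup \<mu> j" by simp
    then have "i \<noteq> j" by auto
    then have "i < j" using ij by simp
    have "j < n" using k lt in_keys_iff[of j \<mu>] by auto
    define \<pi> where "\<pi> = Transposition.transpose i j"
    have p: "\<pi> permutes {..<n}"
      unfolding \<pi>_def using \<open>i < j\<close> \<open>j < n\<close> by (intro permutes_swap_id) auto
    have ip: "inj \<pi>" using p by (rule permutes_inj)
    have "lookup w (Poly_Mapping.map_key \<pi> \<mu>) = lookup w \<mu>"
      using invariant_elem_span[OF w(1) p] by (simp add: invariant_def)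
    then have "Poly_Mapping.map_key \<pi> \<mu> \<in> keys w" using mu(1) in_keys_iff[of _ w] by metis
    then have "Poly_Mapping.map_key \<pi> \<mu> \<le> \<mu>" by (rule mu(2))
    moreover have "\<mu> < Poly_Mapping.map_key \<pi> \<mu>"
      unfolding less_poly_mapping.rep_eq less_fun_def
    proof (intro exI[of _ i] conjI allI impI)
      show "lookup \<mu> i < lookup (Poly_Mapping.map_key \<pi> \<mu>) i"
        unfolding lookup_map_key[OF ip] using lt by (simp add: \<pi>_def)
      fix k' assume "k' < i"
      then have "\<pi> k' = k'" using \<open>i < j\<close> by (simp add: \<pi>_def transpose_def)
      then show "lookup \<mu> k' = lookup (Poly_Mapping.map_key \<pi> \<mu>) k'"
        by (simp add: lookup_map_key[OF ip])
    qed
    ultimately show False by simp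
  qed
  then show ?thesis using k by (auto simp: parts_def antimono_def \<mu>_def[symmetric])
qed

lemma one_plus_xx_nonzero: "1 + xvar i * xvar j \<noteq> 0"
proof
  assume h: "1 + xvar i * xvar j = 0"
  let ?\<eta> = "single i (1::nat) + single j 1"
  have "of_mpol (1 + single ?\<eta> 1) = 1 + mon ?\<eta>" by (simp add: of_mpol_add mon_def)
  also have "\<dots> = 0" using h by (simp add: mon_add xvar_eq_mon)
  finally have z: "(1 + single ?\<eta> 1 :: mpol) = 0" by simp
  have "?\<eta> \<noteq> 0"
  proof
    assume "?\<eta> = 0"
    then have "lookup ?\<eta> i = 0" by simp
    then show False by (simp add: lookup_add)
  qed
  then have "lookup (1 + single ?\<eta> 1 :: mpol) 0 = 1"
    by (simp add: lookup_add lookup_single when_def)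
  then show False unfolding z by simp
qed

definition pair_kernel :: "nat set \<Rightarrow> nat set \<Rightarrow> ratfun" where
  "pair_kernel I J = (\<Prod>i\<in>I. \<Prod>j\<in>J. 1 + xvar i * xvar j)"

lemma pair_kernel_swap: "pair_kernel I J = pair_kernel J I"
  unfolding pair_kernel_def by (subst prod.swap) (simp add: mult.commute)

lemma scale_pair_kernel:
  assumes fin: "finite I" "finite J" and IJ: "I \<inter> J = {}" and k: "k \<in> I" and p: "p \<noteq> 0"
  shows "scale (sub_scale {k} p) (pair_kernel I J) = pair_kernel I J * (\<Prod>j\<in>J. (1 + of_K p * xvar k * xvar j) / (1 + xvar k * xvar j))"
proof -
  note nz = sub_scale_nonzero[OF p]
  have "scale (sub_scale {k} p) (pair_kernel I J) = (\<Prod>i\<in>I. \<Prod>j\<in>J. 1 + of_K (sub_scale {k} p i) * xvar i * xvar j)"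
    unfolding pair_kernel_def scale_prod[OF nz]
  proof (rule prod.cong[OF refl], rule prod.cong[OF refl])
    fix i j assume "i \<in> I" "j \<in> J"
    then have "j \<noteq> k" using k IJ by auto
    then show "scale (sub_scale {k} p) (1 + xvar i * xvar j) = 1 + of_K (sub_scale {k} p i) * xvar i * xvar j"
      by (simp add: scale_add[OF nz] scale_mult[OF nz] scale_1[OF nz] scale_xvar[OF nz] sub_scale_def[of _ _ j] mult_ac)
  qed
  also have "\<dots> = (\<Prod>j\<in>J. 1 + of_K p * xvar k * xvar j) * (\<Prod>i\<in>I - {k}. \<Prod>j\<in>J. 1 + xvar i * xvar j)"
    unfolding prod.remove[OF fin(1) k] by (intro arg_cong2[where f = "(*)"] prod.cong refl) (auto simp: sub_scale_def)
  also have "(\<Prod>j\<in>J. 1 + of_K p * xvar k * xvar j) = (\<Prod>j\<in>J. 1 + xvar k * xvar j) *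
      (\<Prod>j\<in>J. (1 + of_K p * xvar k * xvar j) / (1 + xvar k * xvar j))"
    unfolding prod.distrib[symmetric] using one_plus_xx_nonzero by (intro prod.cong refl) simp
  finally show ?thesis
    unfolding pair_kernel_def prod.remove[OF fin(1) k, of "\<lambda>i. \<Prod>j\<in>J. 1 + xvar i * xvar j"] by (simp add: mult_ac)
qed

text \<open>On the kernel each operator is the multiplication by a rational function, and \<open>kernel_identity\<close> says that a
linear combination of the two functions is constant.\<close>

lemma kernel_eq:
  assumes fin: "finite I" "finite J" and IJ: "I \<inter> J = {}" and q: "q \<noteq> 0" and t: "t \<noteq> 0"
  shows "of_K (t - 1) * Dr I q t 1 (pair_kernel I J) +
     of_K ((q - 1) * t ^ card I * q ^ (card J - 1)) * Dr J (inverse t) (inverse q) 1 (pair_kernel I J) =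
    of_K (t ^ card I * q ^ card J - 1) * pair_kernel I J"
proof -
  have t': "inverse t \<noteq> 0" using t by simp
  define A where "A = (\<Sum>k\<in>I. (\<Prod>l\<in>I - {k}. cpl (of_K t) (xvar k) (xvar l)) *
     (\<Prod>j\<in>J. (1 + of_K q * xvar k * xvar j) / (1 + xvar k * xvar j)))"
  define B where "B = (\<Sum>k\<in>J. (\<Prod>l\<in>J - {k}. cpl (inverse (of_K q)) (xvar k) (xvar l)) *
     (\<Prod>i\<in>I. (1 + inverse (of_K t) * xvar i * xvar k) / (1 + xvar i * xvar k)))"
  have a: "Dr I q t 1 (pair_kernel I J) = pair_kernel I J * A"
    unfolding Dr_1[OF fin(1)] A_def sum_distrib_left
    by (rule sum.cong[OF refl]) (simp add: scale_pair_kernel[OF fin IJ _ q] mult_ac)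
  have b: "Dr J (inverse t) (inverse q) 1 (pair_kernel I J) = pair_kernel I J * B"
    unfolding Dr_1[OF fin(2)] B_def sum_distrib_left
  proof (rule sum.cong[OF refl])
    fix k assume k: "k \<in> J"
    have JI: "J \<inter> I = {}" using IJ by auto
    have "scale (sub_scale {k} (inverse t)) (pair_kernel I J) =
       pair_kernel I J * (\<Prod>i\<in>I. (1 + of_K (inverse t) * xvar k * xvar i) / (1 + xvar k * xvar i))"
      unfolding pair_kernel_swap[of I J] by (rule scale_pair_kernel[OF fin(2,1) JI k t'])
    also have "(\<Prod>i\<in>I. (1 + of_K (inverse t) * xvar k * xvar i) / (1 + xvar k * xvar i)) =
      (\<Prod>i\<in>I. (1 + inverse (of_K t) * xvar i * xvar k) / (1 + xvar i * xvar k))"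
      by (intro prod.cong refl) (simp add: of_K_inverse mult.assoc mult.commute[of "xvar k"])
    finally show "(\<Prod>l\<in>J - {k}. cpl (of_K (inverse q)) (xvar k) (xvar l)) * scale (sub_scale {k} (inverse t)) (pair_kernel I J) =
      pair_kernel I J * ((\<Prod>l\<in>J - {k}. cpl (inverse (of_K q)) (xvar k) (xvar l)) *
       (\<Prod>i\<in>I. (1 + inverse (of_K t) * xvar i * xvar k) / (1 + xvar i * xvar k)))"
      by (simp add: of_K_inverse mult_ac)
  qed
  have "(of_K t - 1) * A + (of_K q - 1) * of_K t ^ card I * of_K q ^ (card J - 1) * B = of_K t ^ card I * of_K q ^ card J - 1"
    unfolding A_def B_def cpl_def
    by (rule kernel_identity[OF fin]) (use q t xvar_inj one_plus_xx_nonzero in auto)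
  then have "pair_kernel I J * ((of_K t - 1) * A + (of_K q - 1) * of_K t ^ card I * of_K q ^ (card J - 1) * B) =
    pair_kernel I J * (of_K t ^ card I * of_K q ^ card J - 1)" by simp
  then show ?thesis unfolding a b by (simp add: of_K_hom algebra_simps)
qed

lemma kernelF_eq_pair_kernel: "kernelF n m = pair_kernel {..<n} {n..<n+m}" by (simp add: kernelF_def pair_kernel_def)

text \<open>Compare the coefficients of the monomials of \<open>y\<close>. The \<open>r \<kappa>\<close> are only rational in \<open>y\<close>; therefore a common
denominator \<open>h\<close> is cleared first, and its leading coefficient allows to solve for the \<open>g \<kappa>\<close> one after the
other.\<close>

lemma expansion_in_elem_span:
  assumes g: "\<And>\<kappa>. \<kappa> \<in> box n m \<Longrightarrow> g \<kappa> \<in> ratV {..<n}"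
    and r: "\<And>\<kappa>. \<kappa> \<in> box n m \<Longrightarrow> r \<kappa> \<in> ratV {n..<n+m}"
    and eq: "(\<Sum>\<kappa>\<in>box n m. mon (yexp n m \<kappa>) * g \<kappa>) = (\<Sum>\<kappa>\<in>box n m. r \<kappa> * of_mpol (elem_prod n m \<kappa>))"
    and k: "\<kappa>0 \<in> box n m"
  shows "g \<kappa>0 \<in> of_mpol ` elem_span n m"
proof -
  let ?Y = "{n..<n+m}"
  obtain h a where h: "h \<in> polysV ?Y" "h \<noteq> 0" "\<forall>\<kappa>\<in>box n m. a \<kappa> \<in> polysV ?Y \<and> r \<kappa> = of_mpol (a \<kappa>) / of_mpol h"
    using common_denominator[OF finite_box, of n m r ?Y] r by blast
  define p where "p \<kappa> = h * single (yexp n m \<kappa>) 1" for \<kappa>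
  have pV: "p \<kappa> \<in> polysV ?Y" for \<kappa>
    unfolding p_def by (intro polysV_mult h(1) polysV_single keys_yexp)
  have eq2: "(\<Sum>\<kappa>\<in>box n m. of_mpol (p \<kappa>) * g \<kappa>) - (\<Sum>\<kappa>\<in>box n m. of_mpol (a \<kappa>) * of_mpol (elem_prod n m \<kappa>)) = 0"
  proof -
    have "(\<Sum>\<kappa>\<in>box n m. of_mpol (p \<kappa>) * g \<kappa>) = of_mpol h * (\<Sum>\<kappa>\<in>box n m. mon (yexp n m \<kappa>) * g \<kappa>)"
      unfolding sum_distrib_left by (intro sum.cong refl) (simp add: p_def of_mpol_mult mon_def)
    also have "\<dots> = (\<Sum>\<kappa>\<in>box n m. of_mpol (a \<kappa>) * of_mpol (elem_prod n m \<kappa>))"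
      unfolding eq sum_distrib_left using h by (intro sum.cong refl) simp
    finally show ?thesis by simp
  qed
  have sep: "(\<Sum>\<kappa>\<in>box n m. of_K (lookup (p \<kappa>) \<tau>) * g \<kappa>) =
      (\<Sum>\<kappa>\<in>box n m. of_K (lookup (a \<kappa>) \<tau>) * of_mpol (elem_prod n m \<kappa>))" for \<tau>
  proof -
    define P where "P = (\<lambda>(b, \<kappa>). if b then p \<kappa> else a \<kappa>)"
    define S where "S = (\<lambda>(b, \<kappa>). if b then g \<kappa> else - of_mpol (elem_prod n m \<kappa>))"
    have split: "(\<Sum>j\<in>UNIV \<times> box n m. F j) = (\<Sum>\<kappa>\<in>box n m. F (True, \<kappa>)) + (\<Sum>\<kappa>\<in>box n m. F (False, \<kappa>))"
      for F :: "bool \<times> (nat \<Rightarrow> nat) \<Rightarrow> ratfun"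
    proof -
      have "(\<Sum>j\<in>UNIV \<times> box n m. F j) = (\<Sum>b\<in>UNIV. \<Sum>\<kappa>\<in>box n m. F (b, \<kappa>))"
        by (simp add: sum.cartesian_product)
      then show ?thesis by (simp add: UNIV_bool add.commute)
    qed
    have "(\<Sum>j\<in>UNIV \<times> box n m. of_K (lookup (P j) \<tau>) * S j) = 0"
    proof (rule coefficient_separation[of _ ?Y "{..<n}"])
      show "P j \<in> polysV ?Y" if "j \<in> UNIV \<times> box n m" for j using that pV h by (auto simp: P_def)
      show "S j \<in> ratV {..<n}" if "j \<in> UNIV \<times> box n m" for j
        using that g elem_span_polysV[OF elem_prod_elem_span] by (auto simp: S_def intro!: ratV_uminus ratV_of_mpol)
      show "(\<Sum>j\<in>UNIV \<times> box n m. of_mpol (P j) * S j) = 0"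
        unfolding split using eq2 by (simp add: P_def S_def sum_negf)
    qed (auto simp: finite_box)
    then show ?thesis unfolding split by (simp add: P_def S_def sum_negf)
  qed
  \<comment> \<open>The coefficient at \<open>\<eta> + yexp n m \<kappa>\<close> involves \<open>g \<kappa>\<close> and the \<open>g\<close> with larger exponents only.\<close>
  define \<eta> where "\<eta> = Max (keys h)"
  have eta: "\<eta> \<in> keys h" "\<And>\<mu>. \<mu> \<in> keys h \<Longrightarrow> \<mu> \<le> \<eta>"
    using keys_le_Max[OF h(2)] by (auto simp: \<eta>_def)
  define H where "H = lookup h \<eta>"
  have H: "H \<noteq> 0" using eta(1) by (simp add: H_def in_keys_iff)
  have single_le: "\<nu> \<le> \<theta>" if "\<nu> \<in> keys (single \<theta> (1::K))" for \<nu> \<theta> :: "nat \<Rightarrow>\<^sub>0 nat"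
    using that by (auto split: if_splits)
  have top: "lookup (p \<kappa>) (\<eta> + yexp n m \<kappa>) = H" for \<kappa>
    unfolding p_def H_def by (subst lookup_times_top[OF eta(2) single_le]) simp_all
  have low: "lookup (p \<kappa>) (\<eta> + yexp n m \<kappa>') = 0" if lt: "yexp n m \<kappa> < yexp n m \<kappa>'" for \<kappa> \<kappa>'
  proof (rule ccontr)
    assume "lookup (p \<kappa>) (\<eta> + yexp n m \<kappa>') \<noteq> 0"
    then have kk: "\<eta> + yexp n m \<kappa>' \<in> keys (p \<kappa>)" by (simp add: in_keys_iff)
    have "\<eta> + yexp n m \<kappa>' \<le> \<eta> + yexp n m \<kappa>"
      by (rule keys_times_le[OF eta(2) single_le kk[unfolded p_def]])
    then show False using lt by simp
  qed
  have Wadd: "f - f' \<in> of_mpol ` elem_span n m" if "f \<in> of_mpol ` elem_span n m" "f' \<in> of_mpol ` elem_span n m" for f f'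
    using that elem_span_diff by (auto simp flip: of_mpol_diff)
  have Wsc: "of_K c * f \<in> of_mpol ` elem_span n m" if "f \<in> of_mpol ` elem_span n m" for c f
    using that elem_span_scal by (auto simp flip: of_mpol_scal)
  have Wsum: "(\<Sum>i\<in>A. f i) \<in> of_mpol ` elem_span n m" if "\<And>i. i \<in> A \<Longrightarrow> f i \<in> of_mpol ` elem_span n m" for A :: "(nat \<Rightarrow> nat) set" and f
    using that
  proof (induction A rule: infinite_finite_induct)
    case (insert x F)
    have "f x \<in> of_mpol ` elem_span n m" "(\<Sum>i\<in>F. f i) \<in> of_mpol ` elem_span n m" using insert.IH insert.prems by simp_all
    then obtain u v where "f x = of_mpol u" "u \<in> elem_span n m" "(\<Sum>i\<in>F. f i) = of_mpol v" "v \<in> elem_span n m" by blast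
    then show ?case using insert.hyps elem_span_add[of u n m v] by (simp flip: of_mpol_add)
  qed (use elem_span_0 in \<open>auto intro!: image_eqI[of _ _ 0]\<close>)
  have "g \<kappa> \<in> of_mpol ` elem_span n m" if "\<kappa> \<in> box n m" for \<kappa>
    using that
  proof (induction "card {\<kappa>'\<in>box n m. yexp n m \<kappa> < yexp n m \<kappa>'}" arbitrary: \<kappa> rule: less_induct)
    case less
    let ?up = "{\<kappa>'\<in>box n m. yexp n m \<kappa> < yexp n m \<kappa>'}"
    have IH: "g \<kappa>' \<in> of_mpol ` elem_span n m" if k': "\<kappa>' \<in> ?up" for \<kappa>'
    proof (rule less.hyps)
      show "card {\<kappa>''\<in>box n m. yexp n m \<kappa>' < yexp n m \<kappa>''} < card ?up"
      proof (rule psubset_card_mono)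
        show "finite ?up" using finite_box by simp
        show "{\<kappa>''\<in>box n m. yexp n m \<kappa>' < yexp n m \<kappa>''} \<subset> ?up" using k' by (auto intro: less_trans)
      qed
      show "\<kappa>' \<in> box n m" using k' by simp
    qed
    let ?\<tau> = "\<eta> + yexp n m \<kappa>"
    have "(\<Sum>\<kappa>'\<in>box n m. of_K (lookup (p \<kappa>') ?\<tau>) * g \<kappa>') =
      (\<Sum>\<kappa>'\<in>insert \<kappa> ?up. of_K (lookup (p \<kappa>') ?\<tau>) * g \<kappa>')"
    proof (rule sum.mono_neutral_right[OF finite_box])
      show "insert \<kappa> ?up \<subseteq> box n m" using less.prems by auto
      show "\<forall>\<kappa>'\<in>box n m - insert \<kappa> ?up. of_K (lookup (p \<kappa>') ?\<tau>) * g \<kappa>' = 0"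
      proof
        fix \<kappa>' assume h: "\<kappa>' \<in> box n m - insert \<kappa> ?up"
        then have "yexp n m \<kappa>' \<noteq> yexp n m \<kappa>" using inj_onD[OF inj_on_yexp, of n m \<kappa>' \<kappa>] less.prems by auto
        then have "yexp n m \<kappa>' < yexp n m \<kappa>" using h by auto
        then show "of_K (lookup (p \<kappa>') ?\<tau>) * g \<kappa>' = 0" using low by simp
      qed
    qed
    also have "\<dots> = of_K H * g \<kappa> + (\<Sum>\<kappa>'\<in>?up. of_K (lookup (p \<kappa>') ?\<tau>) * g \<kappa>')"
      using finite_box by (subst sum.insert) (auto simp: top)
    finally have "of_K H * g \<kappa> = (\<Sum>\<kappa>'\<in>box n m. of_K (lookup (a \<kappa>') ?\<tau>) * of_mpol (elem_prod n m \<kappa>')) -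
       (\<Sum>\<kappa>'\<in>?up. of_K (lookup (p \<kappa>') ?\<tau>) * g \<kappa>')"
      unfolding sep by simp
    also have "\<dots> \<in> of_mpol ` elem_span n m"
      by (intro Wadd Wsum Wsc IH imageI elem_prod_elem_span)
    finally have "of_K (inverse H) * (of_K H * g \<kappa>) \<in> of_mpol ` elem_span n m" by (rule Wsc)
    then show ?case using H by (simp add: of_K_inverse flip: mult.assoc)
  qed
  then show ?thesis using k by blast
qed

section \<open>Existence of the Macdonald polynomials\<close>

text \<open>By \<open>kernel_eq\<close> the operator in \<open>x\<close> can be replaced on the kernel by an operator in \<open>y\<close>, which leaves the
\<open>elem_prod n m \<kappa>\<close> untouched.\<close>

lemma kernelF_D1_coeffs:
  assumes k: "\<kappa> \<in> box n m"
  shows "Dr {..<n} q_K t_K 1 (of_mpol (elem_prod n m \<kappa>)) \<in> of_mpol ` elem_span n m"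
proof -
  let ?I = "{..<n}" and ?Y = "{n..<n+m}"
  have IY: "?I \<inter> ?Y = {}" "?Y \<inter> ?I = {}" by auto
  have t': "inverse t_K \<noteq> 0" using t_K_nonzero by simp
  have t1: "of_K (t_K - 1) \<noteq> 0" using qt_distinct(2) by simp
  define c where "c = of_K (t_K ^ card ?I * q_K ^ card ?Y - 1)"
  define c' where "c' = of_K ((q_K - 1) * t_K ^ card ?I * q_K ^ (card ?Y - 1))"
  define r where "r \<kappa> = (c * mon (yexp n m \<kappa>) - c' * Dr ?Y (inverse t_K) (inverse q_K) 1 (mon (yexp n m \<kappa>))) / of_K (t_K - 1)" for \<kappa>
  have monY: "mon (yexp n m \<kappa>) \<in> ratV ?Y" for \<kappa> by (rule ratV_mon[OF keys_yexp])
  have EI: "of_mpol (elem_prod n m \<kappa>) \<in> ratV ?I" if "\<kappa> \<in> box n m" for \<kappa>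
    by (rule ratV_of_mpol[OF elem_span_polysV[OF elem_prod_elem_span[OF that]]])
  have dx: "Dr ?I q_K t_K 1 (kernelF n m) = (\<Sum>\<kappa>\<in>box n m. mon (yexp n m \<kappa>) * Dr ?I q_K t_K 1 (of_mpol (elem_prod n m \<kappa>)))"
    unfolding kernelF_expand Dr_sum[OF q_K_nonzero]
    by (rule sum.cong[OF refl]) (rule Dr_mult_fixed[OF q_K_nonzero monY IY(2)])
  have dy: "Dr ?Y (inverse t_K) (inverse q_K) 1 (kernelF n m) =
      (\<Sum>\<kappa>\<in>box n m. of_mpol (elem_prod n m \<kappa>) * Dr ?Y (inverse t_K) (inverse q_K) 1 (mon (yexp n m \<kappa>)))"
    unfolding kernelF_expand Dr_sum[OF t']
    by (rule sum.cong[OF refl], subst mult.commute, rule Dr_mult_fixed[OF t' EI IY(1)])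
  have ker: "of_K (t_K - 1) * Dr ?I q_K t_K 1 (kernelF n m) = c * kernelF n m - c' * Dr ?Y (inverse t_K) (inverse q_K) 1 (kernelF n m)"
    using kernel_eq[of ?I ?Y q_K t_K] q_K_nonzero t_K_nonzero IY by (simp add: kernelF_eq_pair_kernel c_def c'_def algebra_simps)
  have "of_K (t_K - 1) * Dr ?I q_K t_K 1 (kernelF n m) =
      of_K (t_K - 1) * (\<Sum>\<kappa>\<in>box n m. r \<kappa> * of_mpol (elem_prod n m \<kappa>))"
    unfolding ker dy unfolding kernelF_expand sum_distrib_left sum_subtractf[symmetric]
  proof (rule sum.cong[OF refl])
    fix \<kappa>
    have "of_K (t_K - 1) * r \<kappa> = c * mon (yexp n m \<kappa>) - c' * Dr ?Y (inverse t_K) (inverse q_K) 1 (mon (yexp n m \<kappa>))"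
      unfolding r_def using t1 by simp
    then have "of_K (t_K - 1) * (r \<kappa> * of_mpol (elem_prod n m \<kappa>)) =
       (c * mon (yexp n m \<kappa>) - c' * Dr ?Y (inverse t_K) (inverse q_K) 1 (mon (yexp n m \<kappa>))) * of_mpol (elem_prod n m \<kappa>)"
      by (simp only: mult.assoc[symmetric])
    then show "c * (mon (yexp n m \<kappa>) * of_mpol (elem_prod n m \<kappa>)) -
        c' * (of_mpol (elem_prod n m \<kappa>) * Dr ?Y (inverse t_K) (inverse q_K) 1 (mon (yexp n m \<kappa>))) =
       of_K (t_K - 1) * (r \<kappa> * of_mpol (elem_prod n m \<kappa>))" by (simp only: left_diff_distrib right_diff_distrib mult_ac)
  qed
  then have eq: "(\<Sum>\<kappa>\<in>box n m. mon (yexp n m \<kappa>) * Dr ?I q_K t_K 1 (of_mpol (elem_prod n m \<kappa>))) =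
      (\<Sum>\<kappa>\<in>box n m. r \<kappa> * of_mpol (elem_prod n m \<kappa>))" using t1 dx by simp
  show ?thesis
  proof (rule expansion_in_elem_span[OF _ _ eq k])
    show "Dr ?I q_K t_K 1 (of_mpol (elem_prod n m \<kappa>)) \<in> ratV ?I" if "\<kappa> \<in> box n m" for \<kappa>
      by (rule Dr_ratV[OF order.refl EI[OF that] q_K_nonzero])
    show "r \<kappa> \<in> ratV ?Y" for \<kappa>
      unfolding r_def c_def c'_def
      by (intro ratV_divide ratV_diff ratV_mult ratV_of_K monY Dr_ratV[OF order.refl _ t'])
  qed
qed

lemma D1_elem_span:
  assumes "w \<in> elem_span n m"
  shows "Dr {..<n} q_K t_K 1 (of_mpol w) \<in> of_mpol ` elem_span n m"
proof -
  obtain c where w: "w = (\<Sum>\<kappa>\<in>box n m. scal (c \<kappa>) (elem_prod n m \<kappa>))" using assms by (rule elem_spanE)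
  define u where "u \<kappa> = (SOME u. u \<in> elem_span n m \<and> Dr {..<n} q_K t_K 1 (of_mpol (elem_prod n m \<kappa>)) = of_mpol u)" for \<kappa>
  have u: "u \<kappa> \<in> elem_span n m \<and> Dr {..<n} q_K t_K 1 (of_mpol (elem_prod n m \<kappa>)) = of_mpol (u \<kappa>)" if "\<kappa> \<in> box n m" for \<kappa>
    unfolding u_def by (rule someI_ex) (use kernelF_D1_coeffs[OF that] in auto)
  have "Dr {..<n} q_K t_K 1 (of_mpol w) = (\<Sum>\<kappa>\<in>box n m. of_K (c \<kappa>) * Dr {..<n} q_K t_K 1 (of_mpol (elem_prod n m \<kappa>)))"
    unfolding w of_mpol_sum of_mpol_scal Dr_sum[OF q_K_nonzero] Dr_cmult[OF q_K_nonzero] ..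
  also have "\<dots> = of_mpol (\<Sum>\<kappa>\<in>box n m. scal (c \<kappa>) (u \<kappa>))"
    unfolding of_mpol_sum of_mpol_scal using u by (intro sum.cong refl) simp
  finally show ?thesis using u by (auto intro!: imageI elem_span_sum elem_span_scal)
qed

definition eigenval :: "nat \<Rightarrow> nat \<Rightarrow> (nat \<Rightarrow>\<^sub>0 nat) \<Rightarrow> K" where
  "eigenval n r \<mu> = macev {..<n} q_K t_K r (\<lambda>i. int (lookup \<mu> i))"

lemma eigenval_inj:
  assumes "\<mu> \<in> parts n m" "\<nu> \<in> parts n m" "eigenval n 1 \<mu> = eigenval n 1 \<nu>"
  shows "\<mu> = \<nu>"
proof (rule poly_mapping_eqI)
  fix i
  have "\<forall>i\<in>{..<n}. int (lookup \<mu> i) = int (lookup \<nu> i)"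
    using separating_qt(1) assms(3) unfolding separating_def eigenval_def by blast
  moreover have "lookup \<mu> i = 0 \<and> lookup \<nu> i = 0" if "\<not> i < n"
    using assms(1,2) that in_keys_iff[of i \<mu>] in_keys_iff[of i \<nu>] unfolding parts_def by auto
  ultimately show "lookup \<mu> i = lookup \<nu> i" by (cases "i < n") auto
qed

lemma place_mon_ratio_less:
  assumes "\<eta> < \<mu>"
  shows "place (mon \<eta> / mon \<mu>) 0"
proof (rule placeI[of _ "single \<eta> 1" "single \<mu> 1" \<mu>])
  show "mon \<eta> / mon \<mu> = Fraction_Field.Fract (single \<eta> 1) (single \<mu> 1)"
    using mon_nonzero[of \<mu>] unfolding mon_def by (simp add: Fract_eq_of_mpol)
qed (use assms in \<open>auto simp: lookup_single when_def split: if_splits\<close>)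

lemma place_imp_keys:
  assumes "place (of_mpol p / mon \<eta>) c"
  shows "(\<forall>\<kappa>\<in>keys p. \<kappa> \<le> \<eta>) \<and> lookup p \<eta> = c"
proof -
  have le: "\<forall>\<kappa>\<in>keys p. \<kappa> \<le> \<eta>"
  proof (cases "p = 0")
    case False
    define \<mu> where "\<mu> = Max (keys p)"
    have mu: "\<mu> \<in> keys p" "\<And>\<kappa>. \<kappa> \<in> keys p \<Longrightarrow> \<kappa> \<le> \<mu>"
      using keys_le_Max[OF False] by (auto simp: \<mu>_def)
    have "\<not> \<eta> < \<mu>"
    proof
      assume "\<eta> < \<mu>"
      from place_mult[OF assms place_mon_ratio_less[OF this]]
      have "place (of_mpol p / mon \<mu>) 0" by simp
      moreover have "place (of_mpol p / mon \<mu>) (lookup p \<mu>)" by (rule place_of_mpol[OF mu(2)])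
      ultimately have "lookup p \<mu> = 0" using place_unique by blast
      then show False using mu(1) by (simp add: in_keys_iff)
    qed
    then show ?thesis using mu(2) by (meson not_less order.trans)
  qed simp
  then have "place (of_mpol p / mon \<eta>) (lookup p \<eta>)" by (intro place_of_mpol) auto
  then show ?thesis using le place_unique[OF assms] by simp
qed

lemma D1_lead:
  assumes "\<And>\<kappa>. \<kappa> \<in> keys w \<Longrightarrow> \<kappa> \<le> \<eta>" "Dr {..<n} q_K t_K 1 (of_mpol w) = of_mpol w'"
  shows "(\<forall>\<kappa>\<in>keys w'. \<kappa> \<le> \<eta>) \<and> lookup w' \<eta> = eigenval n 1 \<eta> * lookup w \<eta>"
proof -
  have "place (of_mpol w * mon 0 / mon \<eta>) (lookup w \<eta>)" using place_of_mpol[OF assms(1)] by simp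
  from Dr_lead[OF finite_lessThan q_K_nonzero this, of n t_K 1, unfolded assms(2)]
  have "place (of_mpol w' / mon \<eta>) (macev {..<n} q_K t_K 1 (expo \<eta> 0) * lookup w \<eta>)"
    by simp
  moreover have "expo \<eta> 0 = (\<lambda>i. int (lookup \<eta> i))" by (auto simp: expo_def)
  ultimately show ?thesis using place_imp_keys by (simp add: eigenval_def)
qed

definition eigenvec :: "nat \<Rightarrow> nat \<Rightarrow> (nat \<Rightarrow>\<^sub>0 nat) \<Rightarrow> mpol \<Rightarrow> bool" where
  "eigenvec n m \<mu> p \<longleftrightarrow> p \<in> elem_span n m \<and> Dr {..<n} q_K t_K 1 (of_mpol p) = of_K (eigenval n 1 \<mu>) * of_mpol p \<and>
     (\<forall>\<kappa>\<in>keys p. \<kappa> \<le> \<mu>)"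

lemma eigenvec_0: "eigenvec n m \<mu> 0"
  by (simp add: eigenvec_def elem_span_0 Dr_0[OF q_K_nonzero])

lemma eigenvec_scal: "eigenvec n m \<mu> p \<Longrightarrow> eigenvec n m \<mu> (scal c p)"
  by (auto simp: eigenvec_def elem_span_scal of_mpol_scal Dr_cmult[OF q_K_nonzero] mult_ac in_keys_iff lookup_scal)

text \<open>The operator is triangular with distinct diagonal entries. The part of \<open>D w\<close> below the leading monomial
splits by induction, and dividing each piece by the difference of eigenvalues corrects \<open>w\<close> to an eigenvector.\<close>

lemma elem_span_decompose:
  assumes "w \<in> elem_span n m" "\<And>\<kappa>. \<kappa> \<in> keys w \<Longrightarrow> \<kappa> \<le> \<eta>"
  shows "\<exists>v. (\<forall>\<mu>. eigenvec n m \<mu> (v \<mu>)) \<and> w = (\<Sum>\<mu> | \<mu> \<in> parts n m \<and> \<mu> \<le> \<eta>. v \<mu>)"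
  using assms
proof (induction "card {\<mu>. \<mu> \<in> parts n m \<and> \<mu> \<le> \<eta>}" arbitrary: w \<eta> rule: less_induct)
  case less
  let ?S = "\<lambda>\<eta>. {\<mu>. \<mu> \<in> parts n m \<and> \<mu> \<le> \<eta>}"
  have fin: "finite (?S \<eta>)" for \<eta> using finite_parts by auto
  show ?case
  proof (cases "w = 0")
    case True
    then show ?thesis by (intro exI[of _ "\<lambda>_. 0"]) (simp add: eigenvec_0)
  next
    case False
    define \<eta>0 where "\<eta>0 = Max (keys w)"
    have e0: "\<eta>0 \<in> keys w" "\<And>\<kappa>. \<kappa> \<in> keys w \<Longrightarrow> \<kappa> \<le> \<eta>0" "\<eta>0 \<in> parts n m"
      using keys_le_Max[OF False] symmetric_lead_part[OF less.prems(1) False] by (auto simp: \<eta>0_def)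
    have e0le: "\<eta>0 \<le> \<eta>" using less.prems(2) e0(1) by blast
    obtain u where u: "u \<in> elem_span n m" "Dr {..<n} q_K t_K 1 (of_mpol w) = of_mpol u" using D1_elem_span[OF less.prems(1)] by auto
    \<comment> \<open>Applying the operator minus its diagonal entry removes the leading monomial.\<close>
    define w' where "w' = u - scal (eigenval n 1 \<eta>0) w"
    have w': "w' \<in> elem_span n m" unfolding w'_def by (intro elem_span_diff elem_span_scal u less.prems)
    have lead: "(\<forall>\<kappa>\<in>keys u. \<kappa> \<le> \<eta>0) \<and> lookup u \<eta>0 = eigenval n 1 \<eta>0 * lookup w \<eta>0"
      by (rule D1_lead[OF e0(2) u(2)])
    have w'lt: "\<kappa> < \<eta>0" if "\<kappa> \<in> keys w'" for \<kappa>
    proof -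
      have "\<kappa> \<in> keys u \<or> \<kappa> \<in> keys w"
        using that by (auto simp: in_keys_iff[of \<kappa>] w'_def lookup_minus lookup_scal)
      then have "\<kappa> \<le> \<eta>0" using lead e0(2) by blast
      moreover have "\<kappa> \<noteq> \<eta>0" using that lead by (auto simp: in_keys_iff[of \<kappa>] w'_def lookup_minus lookup_scal)
      ultimately show ?thesis by simp
    qed
    have "\<exists>v. (\<forall>\<mu>. eigenvec n m \<mu> (v \<mu>)) \<and> w' = (\<Sum>\<mu> | \<mu> \<in> parts n m \<and> \<mu> < \<eta>0. v \<mu>)"
    proof (cases "w' = 0")
      case True
      then show ?thesis by (intro exI[of _ "\<lambda>_. 0"]) (simp add: eigenvec_0)
    next
      case w'0: False
      define \<eta>1 where "\<eta>1 = Max (keys w')"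
      have e1: "\<eta>1 \<in> keys w'" "\<And>\<kappa>. \<kappa> \<in> keys w' \<Longrightarrow> \<kappa> \<le> \<eta>1"
        using keys_le_Max[OF w'0] by (auto simp: \<eta>1_def)
      have lt: "\<eta>1 < \<eta>0" by (rule w'lt[OF e1(1)])
      have "?S \<eta>1 \<subset> ?S \<eta>"
      proof
        show "?S \<eta>1 \<subseteq> ?S \<eta>" using lt e0le by auto
        have "\<eta>0 \<in> ?S \<eta>" "\<eta>0 \<notin> ?S \<eta>1" using e0 e0le lt by auto
        then show "?S \<eta>1 \<noteq> ?S \<eta>" by blast
      qed
      then have "card (?S \<eta>1) < card (?S \<eta>)" by (rule psubset_card_mono[OF fin])
      then obtain v where v: "\<And>\<mu>. eigenvec n m \<mu> (v \<mu>)" "w' = (\<Sum>\<mu>\<in>?S \<eta>1. v \<mu>)"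
        using less.hyps[of \<eta>1 w'] w' e1(2) by blast
      have "(\<Sum>\<mu> | \<mu> \<in> parts n m \<and> \<mu> < \<eta>0. if \<mu> \<le> \<eta>1 then v \<mu> else 0) = (\<Sum>\<mu>\<in>?S \<eta>1. if \<mu> \<le> \<eta>1 then v \<mu> else 0)"
        by (rule sum.mono_neutral_right) (use finite_parts lt in auto)
      also have "\<dots> = w'" unfolding v(2) by (intro sum.cong) auto
      finally show ?thesis
        by (intro exI[of _ "\<lambda>\<mu>. if \<mu> \<le> \<eta>1 then v \<mu> else 0"]) (simp add: v(1) eigenvec_0)
    qed
    then obtain v where v: "\<And>\<mu>. eigenvec n m \<mu> (v \<mu>)" "w' = (\<Sum>\<mu> | \<mu> \<in> parts n m \<and> \<mu> < \<eta>0. v \<mu>)" by blast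
    let ?L = "{\<mu>. \<mu> \<in> parts n m \<and> \<mu> < \<eta>0}"
    \<comment> \<open>Distinct partitions have distinct eigenvalues.\<close>
    define d where "d \<mu> = inverse (eigenval n 1 \<mu> - eigenval n 1 \<eta>0)" for \<mu>
    have d: "eigenval n 1 \<mu> - eigenval n 1 \<eta>0 \<noteq> 0" if "\<mu> \<in> ?L" for \<mu>
      using eigenval_inj[of \<mu> n m \<eta>0] that e0(3) by auto
    define z where "z = (\<Sum>\<mu>\<in>?L. scal (d \<mu>) (v \<mu>))"
    define v0 where "v0 = w - z"
    have zW: "z \<in> elem_span n m" unfolding z_def using v(1) by (intro elem_span_sum elem_span_scal) (simp add: eigenvec_def)
    have Dz: "Dr {..<n} q_K t_K 1 (of_mpol z) - of_K (eigenval n 1 \<eta>0) * of_mpol z = of_mpol w'"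
    proof -
      have "Dr {..<n} q_K t_K 1 (of_mpol z) - of_K (eigenval n 1 \<eta>0) * of_mpol z =
        (\<Sum>\<mu>\<in>?L. of_K (d \<mu>) * (of_K (eigenval n 1 \<mu>) * of_mpol (v \<mu>)) - of_K (eigenval n 1 \<eta>0) * (of_K (d \<mu>) * of_mpol (v \<mu>)))"
        unfolding z_def of_mpol_sum of_mpol_scal Dr_sum[OF q_K_nonzero] Dr_cmult[OF q_K_nonzero] sum_distrib_left sum_subtractf
        using v(1) by (simp add: eigenvec_def)
      also have "\<dots> = (\<Sum>\<mu>\<in>?L. of_mpol (v \<mu>))"
      proof (rule sum.cong[OF refl])
        fix \<mu> assume mu: "\<mu> \<in> ?L"
        have "of_K (d \<mu>) * (of_K (eigenval n 1 \<mu>) * f) - of_K (eigenval n 1 \<eta>0) * (of_K (d \<mu>) * f) =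
          of_K (d \<mu> * (eigenval n 1 \<mu> - eigenval n 1 \<eta>0)) * f" for f
          by (simp add: of_K_mult of_K_diff algebra_simps)
        then show "of_K (d \<mu>) * (of_K (eigenval n 1 \<mu>) * of_mpol (v \<mu>)) - of_K (eigenval n 1 \<eta>0) * (of_K (d \<mu>) * of_mpol (v \<mu>)) = of_mpol (v \<mu>)"
          using d[OF mu] by (simp add: d_def)
      qed
      finally show ?thesis by (simp add: v(2) of_mpol_sum)
    qed
    have zlt: "\<kappa> < \<eta>0" if "\<kappa> \<in> keys z" for \<kappa>
    proof -
      have "\<exists>\<mu>\<in>?L. \<kappa> \<in> keys (v \<mu>)"
      proof (rule ccontr)
        assume "\<not> ?thesis"
        then have "lookup z \<kappa> = 0"
          unfolding z_def lookup_sum lookup_scal by (intro sum.neutral) (auto simp: in_keys_iff[of \<kappa>])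
        then show False using that by (simp add: in_keys_iff)
      qed
      then obtain \<mu> where "\<mu> < \<eta>0" "\<kappa> \<in> keys (v \<mu>)" by blast
      then show ?thesis using v(1)[of \<mu>] by (auto simp: eigenvec_def)
    qed
    have "eigenvec n m \<eta>0 v0"
      unfolding eigenvec_def
    proof (intro conjI ballI)
      have alg: "X = e * (a - b)" if "X + B = A" "W = A - e * a" "B - e * b = W" for X A B W e a b :: ratfun
      proof -
        have 1: "X = A - B" using that(1) by (simp add: eq_diff_eq)
        have 2: "A = W + e * a" by (simp add: that(2))
        have 3: "B = W + e * b" by (simp add: that(3)[symmetric])
        show ?thesis unfolding 1 2 3 by (simp add: right_diff_distrib)
      qed
      show "v0 \<in> elem_span n m" unfolding v0_def by (rule elem_span_diff[OF less.prems(1) zW])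
      have "Dr {..<n} q_K t_K 1 (of_mpol v0) + Dr {..<n} q_K t_K 1 (of_mpol z) = Dr {..<n} q_K t_K 1 (of_mpol w)"
        unfolding Dr_add[OF q_K_nonzero, symmetric] by (simp add: v0_def of_mpol_diff)
      moreover have "of_mpol w' = Dr {..<n} q_K t_K 1 (of_mpol w) - of_K (eigenval n 1 \<eta>0) * of_mpol w"
        by (simp only: w'_def u(2) of_mpol_diff of_mpol_scal)
      ultimately show "Dr {..<n} q_K t_K 1 (of_mpol v0) = of_K (eigenval n 1 \<eta>0) * of_mpol v0"
        using Dz unfolding v0_def of_mpol_diff by (rule alg)
      fix \<kappa> assume "\<kappa> \<in> keys v0"
      then have "\<kappa> \<in> keys w \<or> \<kappa> \<in> keys z"
        by (auto simp: in_keys_iff[of \<kappa>] v0_def lookup_minus)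
      then show "\<kappa> \<le> \<eta>0" using e0(2) zlt[of \<kappa>] by auto
    qed
    define V where "V \<mu> = (if \<mu> = \<eta>0 then v0 else if \<mu> < \<eta>0 then scal (d \<mu>) (v \<mu>) else 0)" for \<mu>
    have "(\<Sum>\<mu>\<in>?S \<eta>. V \<mu>) = (\<Sum>\<mu>\<in>insert \<eta>0 ?L. V \<mu>)"
      by (rule sum.mono_neutral_right[OF fin]) (use e0 e0le in \<open>auto simp: V_def\<close>)
    also have "\<dots> = v0 + (\<Sum>\<mu>\<in>?L. V \<mu>)"
      using finite_parts by (subst sum.insert) (auto simp: V_def)
    also have "(\<Sum>\<mu>\<in>?L. V \<mu>) = z" unfolding z_def by (intro sum.cong refl) (auto simp: V_def)
    finally have "w = (\<Sum>\<mu>\<in>?S \<eta>. V \<mu>)" by (simp add: v0_def)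
    moreover have "eigenvec n m \<mu> (V \<mu>)" for \<mu>
      using \<open>eigenvec n m \<eta>0 v0\<close> v(1) by (auto simp: V_def eigenvec_0 intro: eigenvec_scal)
    ultimately show ?thesis by (intro exI[of _ V]) simp
  qed
qed

text \<open>The Macdonald polynomial, as a monic eigenvector of the first operator in the span of the products of elementary
symmetric polynomials.\<close>

definition monicP :: "nat \<Rightarrow> nat \<Rightarrow> (nat \<Rightarrow>\<^sub>0 nat) \<Rightarrow> mpol" where
  "monicP n m \<mu> = (SOME p. eigenvec n m \<mu> p \<and> lookup p \<mu> = 1)"

lemma monicP:
  assumes l: "\<rho> \<in> parts n m"
  shows "eigenvec n m \<rho> (monicP n m \<rho>) \<and> lookup (monicP n m \<rho>) \<rho> = 1"
  unfolding monicP_def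
proof (rule someI_ex)
  let ?w = "elem_prod n m (conj_box n m \<rho>)"
  obtain v where v: "\<And>\<mu>. eigenvec n m \<mu> (v \<mu>)" "?w = (\<Sum>\<mu> | \<mu> \<in> parts n m \<and> \<mu> \<le> \<rho>. v \<mu>)"
    using elem_span_decompose[of ?w n m \<rho>, OF elem_prod_elem_span[OF conj_box_in]] elem_prod_top(1)[OF l] by blast
  have "1 = (\<Sum>\<mu> | \<mu> \<in> parts n m \<and> \<mu> \<le> \<rho>. lookup (v \<mu>) \<rho>)"
    using elem_prod_top(2)[OF l] unfolding v(2) lookup_sum by simp
  also have "\<dots> = (\<Sum>\<mu> | \<mu> \<in> parts n m \<and> \<mu> \<le> \<rho>. if \<mu> = \<rho> then lookup (v \<rho>) \<rho> else 0)"
  proof (rule sum.cong[OF refl])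
    fix \<mu> assume mu: "\<mu> \<in> {\<mu>. \<mu> \<in> parts n m \<and> \<mu> \<le> \<rho>}"
    show "lookup (v \<mu>) \<rho> = (if \<mu> = \<rho> then lookup (v \<rho>) \<rho> else 0)"
    proof (cases "\<mu> = \<rho>")
      case False
      then have "\<rho> \<notin> keys (v \<mu>)" using v(1)[of \<mu>] mu by (auto simp: eigenvec_def)
      then show ?thesis using False by (simp add: in_keys_iff)
    qed simp
  qed
  also have "\<dots> = lookup (v \<rho>) \<rho>" using l finite_parts by (simp add: sum.delta)
  finally show "\<exists>p. eigenvec n m \<rho> p \<and> lookup p \<rho> = 1" using v(1) by metis
qed

lemma eigen_poly_unique:
  assumes p: "p \<in> polysV {..<n}" "Dr {..<n} q_K t_K 1 (of_mpol p) = of_K (eigenval n 1 \<mu>) * of_mpol p"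
    and r: "r \<in> polysV {..<n}" "Dr {..<n} q_K t_K 1 (of_mpol r) = of_K (eigenval n 1 \<mu>) * of_mpol r"
    and l: "lookup r \<mu> = 1"
  shows "p = scal (lookup p \<mu>) r"
proof -
  have "r \<noteq> 0" using l by auto
  then obtain c where "of_mpol p = of_K c * of_mpol r"
    using eigen_unique[OF finite_lessThan q_K_nonzero separating_qt(1) ratV_of_mpol[OF p(1)] p(2)[unfolded eigenval_def]
        ratV_of_mpol[OF r(1)] r(2)[unfolded eigenval_def]] by auto
  then have "p = scal c r" by (simp flip: of_mpol_scal)
  then show ?thesis using l by (simp add: lookup_scal)
qed

text \<open>The first operator with parameters \<open>(q, t)\<close> commutes with the first one for \<open>(1/q, 1/t)\<close>, and the latter
commutes with all operators for \<open>(q, t)\<close>; so the eigenvector property is transferred twice.\<close>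

lemma Dr_monicP:
  assumes l: "\<rho> \<in> parts n m"
  shows "Dr {..<n} q_K t_K r (of_mpol (monicP n m \<rho>)) = of_K (eigenval n r \<rho>) * of_mpol (monicP n m \<rho>)"
proof -
  let ?P = "of_mpol (monicP n m \<rho>)" and ?e = "\<lambda>i. int (lookup \<rho> i)"
  note P = monicP[OF l, unfolded eigenvec_def]
  have V: "?P \<in> ratV {..<n}" using P elem_span_polysV by (auto intro: ratV_of_mpol)
  have "monicP n m \<rho> \<noteq> 0" using P by auto
  then have nz: "?P \<noteq> 0" by simp
  have q': "inverse q_K \<noteq> 0" using q_K_nonzero by simp
  have comm: "Dr {..<n} (inverse q_K) (inverse t_K) 1 (Dr {..<n} q_K t_K r f) = Dr {..<n} q_K t_K r (Dr {..<n} (inverse q_K) (inverse t_K) 1 f)" for r f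
    using Dr_commute[of "{..<n}" q_K t_K r f] q_K_nonzero t_K_nonzero qt_distinct by auto
  have "Dr {..<n} (inverse q_K) (inverse t_K) 1 ?P = of_K (macev {..<n} (inverse q_K) (inverse t_K) 1 ?e) * ?P"
    by (rule eigen_transfer[OF finite_lessThan q_K_nonzero q' separating_qt(1) V nz])
       (use P comm[of 1 ?P] in \<open>auto simp: eigenval_def\<close>)
  from eigen_transfer[OF finite_lessThan q' q_K_nonzero separating_qt(2) V nz this comm]
  show ?thesis by (simp add: eigenval_def)
qed

lemma is_macdonald_monicP:
  assumes l: "\<rho> \<in> parts n m"
  shows "is_macdonald n (lookup \<rho>) (monicP n m \<rho>)"
proof -
  note P = monicP[OF l, unfolded eigenvec_def]
  show ?thesis
    unfolding is_macdonald_def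
  proof (intro conjI)
    show "symmetric_pol n (monicP n m \<rho>)"
      unfolding symmetric_pol_def polys_eq_polysV
      using P elem_span_polysV invariant_elem_span unfolding invariant_def by blast
    show "D_op n (of_mpol (monicP n m \<rho>)) = [:of_mpol (monicP n m \<rho>):] *
        (\<Prod>i<n. 1 - [:0, 1:] * [:qF ^ lookup \<rho> i * tF ^ (n - 1 - i):])"
      unfolding D_op_eigen_iff using Dr_monicP[OF l] by (simp add: eigenval_def)
    show "lookup (monicP n m \<rho>) (Abs_poly_mapping (lookup \<rho>)) = 1"
      using P by (simp add: lookup_inverse)
  qed
qed

lemma macdonald_P_eq:
  assumes l: "\<rho> \<in> parts n m"
  shows "macdonald_P n (lookup \<rho>) = monicP n m \<rho>"
  unfolding macdonald_P_def
proof (rule the_equality[where P = "is_macdonald n (lookup \<rho>)", OF is_macdonald_monicP[OF l]])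
  fix p assume p: "is_macdonald n (lookup \<rho>) p"
  note P = monicP[OF l, unfolded eigenvec_def]
  have "p = scal (lookup p \<rho>) (monicP n m \<rho>)"
  proof (rule eigen_poly_unique)
    show "p \<in> polysV {..<n}" using p by (simp add: is_macdonald_def symmetric_pol_def polys_eq_polysV)
    show "Dr {..<n} q_K t_K 1 (of_mpol p) = of_K (eigenval n 1 \<rho>) * of_mpol p"
      using p unfolding is_macdonald_def D_op_eigen_iff eigenval_def by blast
  qed (use P elem_span_polysV in auto)
  moreover have "lookup p \<rho> = 1" using p by (simp add: is_macdonald_def lookup_inverse)
  ultimately show "p = monicP n m \<rho>" by (simp add: scal_def)
qed

lemma elem_span_expand:
  assumes "w \<in> elem_span n m"
  shows "\<exists>c. w = (\<Sum>\<mu>\<in>parts n m. scal (c \<mu>) (monicP n m \<mu>)) \<and>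
     (\<forall>\<eta>. (\<forall>\<kappa>\<in>keys w. \<kappa> \<le> \<eta>) \<longrightarrow> (\<forall>\<mu>\<in>parts n m. \<eta> < \<mu> \<longrightarrow> c \<mu> = 0))"
proof (cases "w = 0")
  case True
  then show ?thesis by (intro exI[of _ "\<lambda>_. 0"]) (simp add: scal_def)
next
  case False
  define \<eta> where "\<eta> = Max (keys w)"
  have eta: "\<eta> \<in> keys w" "\<And>\<kappa>. \<kappa> \<in> keys w \<Longrightarrow> \<kappa> \<le> \<eta>"
    using keys_le_Max[OF False] by (auto simp: \<eta>_def)
  obtain v where v: "\<And>\<mu>. eigenvec n m \<mu> (v \<mu>)" "w = (\<Sum>\<mu> | \<mu> \<in> parts n m \<and> \<mu> \<le> \<eta>. v \<mu>)"
    using elem_span_decompose[OF assms eta(2)] by blast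
  define c where "c \<mu> = (if \<mu> \<le> \<eta> then lookup (v \<mu>) \<mu> else 0)" for \<mu>
  have vc: "v \<mu> = scal (lookup (v \<mu>) \<mu>) (monicP n m \<mu>)" if "\<mu> \<in> parts n m" for \<mu>
    using v(1)[of \<mu>] monicP[OF that] elem_span_polysV unfolding eigenvec_def by (intro eigen_poly_unique) blast+
  have "(\<Sum>\<mu>\<in>parts n m. scal (c \<mu>) (monicP n m \<mu>)) = (\<Sum>\<mu> | \<mu> \<in> parts n m \<and> \<mu> \<le> \<eta>. scal (c \<mu>) (monicP n m \<mu>))"
    by (rule sum.mono_neutral_right[OF finite_parts]) (auto simp: c_def scal_def)
  also have "\<dots> = w"
    unfolding v(2)
  proof (rule sum.cong[OF refl])
    fix \<mu> assume "\<mu> \<in> {\<mu>. \<mu> \<in> parts n m \<and> \<mu> \<le> \<eta>}"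
    then show "scal (c \<mu>) (monicP n m \<mu>) = v \<mu>" using vc[of \<mu>] by (simp add: c_def)
  qed
  finally have e: "w = (\<Sum>\<mu>\<in>parts n m. scal (c \<mu>) (monicP n m \<mu>))" ..
  have "c \<mu> = 0" if h: "\<forall>\<kappa>\<in>keys w. \<kappa> \<le> \<theta>" "\<theta> < \<mu>" for \<theta> \<mu>
  proof -
    have "\<eta> < \<mu>" using h eta(1) by (auto intro: le_less_trans)
    then show ?thesis by (simp add: c_def)
  qed
  then show ?thesis using e by blast
qed

section \<open>The dual family in the kernel expansion\<close>

lemma monicP_polysV: "\<mu> \<in> parts n m \<Longrightarrow> monicP n m \<mu> \<in> polysV {..<n}"
  by (rule elem_span_polysV[of _ n m]) (use monicP in \<open>simp add: eigenvec_def\<close>)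

lemma monicP_indep:
  assumes s: "\<And>\<mu>. \<mu> \<in> parts n m \<Longrightarrow> s \<mu> \<in> ratV B" and B: "{..<n} \<inter> B = {}"
    and z: "(\<Sum>\<mu>\<in>parts n m. of_mpol (monicP n m \<mu>) * s \<mu>) = 0" and mu: "\<mu> \<in> parts n m"
  shows "s \<mu> = 0"
proof (rule ccontr)
  assume "s \<mu> \<noteq> 0"
  \<comment> \<open>At the largest partition with nonzero coefficient only one term contributes, by triangularity.\<close>
  define M where "M = Max {\<mu>\<in>parts n m. s \<mu> \<noteq> 0}"
  have fin: "finite {\<mu>\<in>parts n m. s \<mu> \<noteq> 0}" using finite_parts by simp
  have "M \<in> {\<mu>\<in>parts n m. s \<mu> \<noteq> 0}" unfolding M_def using \<open>s \<mu> \<noteq> 0\<close> mu by (intro Max_in fin) auto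
  then have M: "M \<in> parts n m" "s M \<noteq> 0" by auto
  have above: "s \<nu> = 0" if nu: "\<nu> \<in> parts n m" "M < \<nu>" for \<nu>
  proof (rule ccontr)
    assume "s \<nu> \<noteq> 0"
    then have "\<nu> \<le> M" unfolding M_def using nu(1) by (intro Max_ge[OF fin]) simp
    then show False using nu(2) by simp
  qed
  have "(\<Sum>\<mu>\<in>parts n m. of_K (lookup (monicP n m \<mu>) M) * s \<mu>) = 0"
    by (rule coefficient_separation[OF finite_parts B monicP_polysV s z])
  moreover have "(\<Sum>\<mu>\<in>parts n m. of_K (lookup (monicP n m \<mu>) M) * s \<mu>) =
      (\<Sum>\<mu>\<in>parts n m. if \<mu> = M then s M else 0)"
  proof (rule sum.cong[OF refl])
    fix \<nu> assume nu: "\<nu> \<in> parts n m"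
    show "of_K (lookup (monicP n m \<nu>) M) * s \<nu> = (if \<nu> = M then s M else 0)"
    proof (cases \<nu> M rule: linorder_cases)
      case less
      then have "M \<notin> keys (monicP n m \<nu>)" using monicP[OF nu] by (auto simp: eigenvec_def)
      then show ?thesis using less by (simp add: in_keys_iff)
    next
      case equal
      then show ?thesis using monicP[OF nu] by simp
    next
      case greater
      then show ?thesis using above[OF nu] by simp
    qed
  qed
  ultimately show False using M by (simp add: sum.delta[OF finite_parts])
qed

text \<open>Coefficients of the products of elementary symmetric polynomials in the basis of Macdonald
polynomials, chosen triangular.\<close>

definition elem_coeff :: "nat \<Rightarrow> nat \<Rightarrow> (nat \<Rightarrow> nat) \<Rightarrow> (nat \<Rightarrow>\<^sub>0 nat) \<Rightarrow> K" where
  "elem_coeff n m \<kappa> = (SOME c. elem_prod n m \<kappa> = (\<Sum>\<mu>\<in>parts n m. scal (c \<mu>) (monicP n m \<mu>)) \<and>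
     (\<forall>\<eta>. (\<forall>\<theta>\<in>keys (elem_prod n m \<kappa>). \<theta> \<le> \<eta>) \<longrightarrow> (\<forall>\<mu>\<in>parts n m. \<eta> < \<mu> \<longrightarrow> c \<mu> = 0)))"

lemma elem_coeff:
  assumes "\<kappa> \<in> box n m"
  shows "elem_prod n m \<kappa> = (\<Sum>\<mu>\<in>parts n m. scal (elem_coeff n m \<kappa> \<mu>) (monicP n m \<mu>)) \<and>
     (\<forall>\<eta>. (\<forall>\<theta>\<in>keys (elem_prod n m \<kappa>). \<theta> \<le> \<eta>) \<longrightarrow> (\<forall>\<mu>\<in>parts n m. \<eta> < \<mu> \<longrightarrow> elem_coeff n m \<kappa> \<mu> = 0))"
  unfolding elem_coeff_def by (rule someI_ex[OF elem_span_expand[OF elem_prod_elem_span[OF assms]]])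

lemma elem_coeff_above:
  assumes "\<rho> \<in> parts n m" "\<mu> \<in> parts n m" "\<rho> < \<mu>"
  shows "elem_coeff n m (conj_box n m \<rho>) \<mu> = 0"
  using elem_coeff[OF conj_box_in] elem_prod_top(1)[OF assms(1)] assms(2,3) by blast

lemma elem_coeff_diag:
  assumes r: "\<rho> \<in> parts n m"
  shows "elem_coeff n m (conj_box n m \<rho>) \<rho> = 1"
proof -
  have e: "elem_prod n m (conj_box n m \<rho>) = (\<Sum>\<mu>\<in>parts n m. scal (elem_coeff n m (conj_box n m \<rho>) \<mu>) (monicP n m \<mu>))"
    using elem_coeff[OF conj_box_in] by blast
  have "1 = (\<Sum>\<mu>\<in>parts n m. elem_coeff n m (conj_box n m \<rho>) \<mu> * lookup (monicP n m \<mu>) \<rho>)"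
    using elem_prod_top(2)[OF r] unfolding e lookup_elem_span by simp
  also have "\<dots> = (\<Sum>\<mu>\<in>parts n m. if \<mu> = \<rho> then elem_coeff n m (conj_box n m \<rho>) \<rho> else 0)"
  proof (rule sum.cong[OF refl])
    fix \<mu> assume mu: "\<mu> \<in> parts n m"
    show "elem_coeff n m (conj_box n m \<rho>) \<mu> * lookup (monicP n m \<mu>) \<rho> = (if \<mu> = \<rho> then elem_coeff n m (conj_box n m \<rho>) \<rho> else 0)"
    proof (cases \<mu> \<rho> rule: linorder_cases)
      case less
      then have "\<rho> \<notin> keys (monicP n m \<mu>)" using monicP[OF mu] by (auto simp: eigenvec_def)
      then show ?thesis using less by (simp add: in_keys_iff)
    next
      case equal
      then show ?thesis using monicP[OF mu] by simp
    next
      case greater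
      then show ?thesis using elem_coeff_above[OF r mu] by simp
    qed
  qed
  also have "\<dots> = elem_coeff n m (conj_box n m \<rho>) \<rho>" using r by (simp add: sum.delta[OF finite_parts])
  finally show ?thesis by simp
qed

text \<open>The coefficient of \<open>monicP n m \<mu>\<close> in the kernel, a polynomial in the variables \<open>y\<close>.\<close>

definition polyQ :: "nat \<Rightarrow> nat \<Rightarrow> (nat \<Rightarrow>\<^sub>0 nat) \<Rightarrow> mpol" where
  "polyQ n m \<mu> = (\<Sum>\<kappa>\<in>box n m. single (yexp n m \<kappa>) (elem_coeff n m \<kappa> \<mu>))"

lemma polyQ_polysV: "polyQ n m \<mu> \<in> polysV {n..<n+m}"
  unfolding polyQ_def by (intro polysV_sum polysV_single keys_yexp)

lemma lookup_polyQ: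
  assumes "\<kappa> \<in> box n m"
  shows "lookup (polyQ n m \<mu>) (yexp n m \<kappa>) = elem_coeff n m \<kappa> \<mu>"
proof -
  have "lookup (polyQ n m \<mu>) (yexp n m \<kappa>) = (\<Sum>\<kappa>'\<in>box n m. if \<kappa>' = \<kappa> then elem_coeff n m \<kappa> \<mu> else 0)"
    unfolding polyQ_def lookup_sum
  proof (rule sum.cong[OF refl])
    fix \<kappa>' assume "\<kappa>' \<in> box n m"
    then have "yexp n m \<kappa>' = yexp n m \<kappa> \<longleftrightarrow> \<kappa>' = \<kappa>" using inj_on_eq_iff[OF inj_on_yexp] assms by blast
    then show "lookup (single (yexp n m \<kappa>') (elem_coeff n m \<kappa>' \<mu>)) (yexp n m \<kappa>) =
       (if \<kappa>' = \<kappa> then elem_coeff n m \<kappa> \<mu> else 0)"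
      by (auto simp: lookup_single when_def)
  qed
  then show ?thesis using assms by (simp add: sum.delta[OF finite_box])
qed

lemma polyQ_nonzero: "\<rho> \<in> parts n m \<Longrightarrow> polyQ n m \<rho> \<noteq> 0"
  using lookup_polyQ[OF conj_box_in, of n m \<rho> \<rho>] elem_coeff_diag[of \<rho> n m] by auto

lemma kernelF_PQ: "kernelF n m = (\<Sum>\<mu>\<in>parts n m. of_mpol (monicP n m \<mu>) * of_mpol (polyQ n m \<mu>))"
proof -
  have "kernelF n m = (\<Sum>\<kappa>\<in>box n m. \<Sum>\<mu>\<in>parts n m. mon (yexp n m \<kappa>) * (of_K (elem_coeff n m \<kappa> \<mu>) * of_mpol (monicP n m \<mu>)))"
    unfolding kernelF_expand sum_distrib_left[symmetric]
  proof (rule sum.cong[OF refl])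
    fix \<kappa> assume "\<kappa> \<in> box n m"
    then have "elem_prod n m \<kappa> = (\<Sum>\<mu>\<in>parts n m. scal (elem_coeff n m \<kappa> \<mu>) (monicP n m \<mu>))" using elem_coeff by blast
    then have "of_mpol (elem_prod n m \<kappa>) = (\<Sum>\<mu>\<in>parts n m. of_K (elem_coeff n m \<kappa> \<mu>) * of_mpol (monicP n m \<mu>))"
      by (simp only: of_mpol_sum of_mpol_scal)
    then show "mon (yexp n m \<kappa>) * of_mpol (elem_prod n m \<kappa>) =
        mon (yexp n m \<kappa>) * (\<Sum>\<mu>\<in>parts n m. of_K (elem_coeff n m \<kappa> \<mu>) * of_mpol (monicP n m \<mu>))" by simp
  qed
  also have "\<dots> = (\<Sum>\<mu>\<in>parts n m. \<Sum>\<kappa>\<in>box n m. mon (yexp n m \<kappa>) * (of_K (elem_coeff n m \<kappa> \<mu>) * of_mpol (monicP n m \<mu>)))"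
    by (rule sum.swap)
  also have "\<dots> = (\<Sum>\<mu>\<in>parts n m. of_mpol (monicP n m \<mu>) * of_mpol (polyQ n m \<mu>))"
    unfolding polyQ_def of_mpol_sum of_mpol_single sum_distrib_left by (intro sum.cong refl) (simp add: mult_ac)
  finally show ?thesis .
qed

lemma geometric_from:
  fixes q :: "'a::comm_ring_1"
  assumes "l \<le> m"
  shows "(q - 1) * (\<Sum>k<m. if l \<le> k then q ^ k else 0) = q ^ m - q ^ l"
  using assms
proof (induction m)
  case (Suc m)
  show ?case
  proof (cases "l \<le> m")
    case True
    then show ?thesis using Suc.IH by (simp add: algebra_simps)
  next
    case False
    then have "l = Suc m" using Suc.prems by simp
    then show ?thesis by simp
  qed
qed simp

lemma geometric_from_rev:
  fixes t :: "'a::comm_ring_1"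
  assumes "c \<le> n"
  shows "(t - 1) * (\<Sum>i<n. if c \<le> i then t ^ (n - 1 - i) else 0) = t ^ (n - c) - 1"
  using assms
proof (induction n)
  case (Suc n)
  have e: "(\<Sum>i<n. if c \<le> i then t ^ (n - i) else 0) = t * (\<Sum>i<n. if c \<le> i then t ^ (n - 1 - i) else 0)"
    unfolding sum_distrib_left
  proof (rule sum.cong[OF refl])
    fix i assume "i \<in> {..<n}"
    then have "n - i = Suc (n - 1 - i)" by auto
    then show "(if c \<le> i then t ^ (n - i) else 0) = t * (if c \<le> i then t ^ (n - 1 - i) else 0)" by simp
  qed
  show ?case
  proof (cases "c \<le> n")
    case True
    have "(t - 1) * (\<Sum>i<Suc n. if c \<le> i then t ^ (Suc n - 1 - i) else 0) =
        t * ((t - 1) * (\<Sum>i<n. if c \<le> i then t ^ (n - 1 - i) else 0)) + (t - 1)"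
      unfolding diff_Suc_1 sum.lessThan_Suc e using True by (simp add: algebra_simps)
    also have "\<dots> = t ^ (Suc n - c) - 1"
      unfolding Suc.IH[OF True] using True by (simp add: Suc_diff_le algebra_simps)
    finally show ?thesis .
  next
    case False
    then have "c = Suc n" using Suc.prems by simp
    then show ?thesis by simp
  qed
qed simp

text \<open>The boundary of a partition in the rectangle: each row contributes a step by a factor \<open>t\<close>,
each column a step by a factor \<open>q\<close>, and the total telescopes from one corner of the rectangle to the opposite one.\<close>

lemma boundary_identity:
  fixes q t :: "'a::comm_ring_1"
  assumes r: "\<rho> \<in> parts n m"
  shows "(t - 1) * (\<Sum>i<n. q ^ lookup \<rho> i * t ^ (n - 1 - i)) +
     (q - 1) * (\<Sum>k<m. t ^ (n - conj_part n \<rho> k) * q ^ k) = t ^ n * q ^ m - 1"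
proof -
  let ?l = "lookup \<rho>"
  have "(\<Sum>k<m. t ^ (n - conj_part n \<rho> k) * q ^ k) =
     (\<Sum>k<m. q ^ k) + (\<Sum>k<m. (t - 1) * (\<Sum>i<n. if ?l i \<le> k then t ^ (n - 1 - i) * q ^ k else 0))"
    unfolding sum.distrib[symmetric]
  proof (rule sum.cong[OF refl])
    fix k
    have "t ^ (n - conj_part n \<rho> k) = 1 + (t - 1) * (\<Sum>i<n. if conj_part n \<rho> k \<le> i then t ^ (n - 1 - i) else 0)"
      unfolding geometric_from_rev[OF conj_part_le] by simp
    also have "(\<Sum>i<n. if conj_part n \<rho> k \<le> i then t ^ (n - 1 - i) else 0) = (\<Sum>i<n. if ?l i \<le> k then t ^ (n - 1 - i) else 0)"
      using less_conj_part_iff[OF r, of _ k] by (intro sum.cong refl) (auto simp: not_less[symmetric])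
    finally have X: "t ^ (n - conj_part n \<rho> k) = 1 + (t - 1) * (\<Sum>i<n. if ?l i \<le> k then t ^ (n - 1 - i) else 0)" .
    have "t ^ (n - conj_part n \<rho> k) * q ^ k = q ^ k + (t - 1) * ((\<Sum>i<n. if ?l i \<le> k then t ^ (n - 1 - i) else 0) * q ^ k)"
      unfolding X by (simp only: distrib_right mult.assoc mult_1_left)
    also have "(\<Sum>i<n. if ?l i \<le> k then t ^ (n - 1 - i) else 0) * q ^ k = (\<Sum>i<n. if ?l i \<le> k then t ^ (n - 1 - i) * q ^ k else 0)"
      unfolding sum_distrib_right by (intro sum.cong refl) simp
    finally show "t ^ (n - conj_part n \<rho> k) * q ^ k =
      q ^ k + (t - 1) * (\<Sum>i<n. if ?l i \<le> k then t ^ (n - 1 - i) * q ^ k else 0)" .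
  qed
  also have "(\<Sum>k<m. (t - 1) * (\<Sum>i<n. if ?l i \<le> k then t ^ (n - 1 - i) * q ^ k else 0)) =
     (t - 1) * (\<Sum>i<n. \<Sum>k<m. if ?l i \<le> k then t ^ (n - 1 - i) * q ^ k else 0)"
    unfolding sum_distrib_left[symmetric] by (subst sum.swap) simp
  finally have "(q - 1) * (\<Sum>k<m. t ^ (n - conj_part n \<rho> k) * q ^ k) =
     (q - 1) * (\<Sum>k<m. q ^ k) + (t - 1) * (\<Sum>i<n. (q - 1) * (\<Sum>k<m. if ?l i \<le> k then t ^ (n - 1 - i) * q ^ k else 0))"
    by (simp add: distrib_left sum_distrib_left mult.left_commute)
  also have "(\<Sum>i<n. (q - 1) * (\<Sum>k<m. if ?l i \<le> k then t ^ (n - 1 - i) * q ^ k else 0)) =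
     (\<Sum>i<n. t ^ (n - 1 - i) * (q ^ m - q ^ ?l i))"
  proof (rule sum.cong[OF refl])
    fix i
    have e: "(\<Sum>k<m. if ?l i \<le> k then t ^ (n - 1 - i) * q ^ k else 0) = t ^ (n - 1 - i) * (\<Sum>k<m. if ?l i \<le> k then q ^ k else 0)"
      unfolding sum_distrib_left by (intro sum.cong refl) simp
    show "(q - 1) * (\<Sum>k<m. if ?l i \<le> k then t ^ (n - 1 - i) * q ^ k else 0) = t ^ (n - 1 - i) * (q ^ m - q ^ ?l i)"
      unfolding e mult.left_commute[of "q - 1"] geometric_from[OF parts_le[OF r, of i], of q] ..
  qed
  also have "(q - 1) * (\<Sum>k<m. q ^ k) = q ^ m - 1"
    using geometric_from[of 0 m q] by simp
  finally have main: "(q - 1) * (\<Sum>k<m. t ^ (n - conj_part n \<rho> k) * q ^ k) =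
     q ^ m - 1 + (t - 1) * (\<Sum>i<n. t ^ (n - 1 - i) * (q ^ m - q ^ ?l i))" .
  have "(t - 1) * (\<Sum>i<n. q ^ ?l i * t ^ (n - 1 - i)) + (t - 1) * (\<Sum>i<n. t ^ (n - 1 - i) * (q ^ m - q ^ ?l i)) =
     ((t - 1) * (\<Sum>i<n. t ^ (n - 1 - i))) * q ^ m"
    unfolding distrib_left[symmetric] sum.distrib[symmetric] mult.assoc sum_distrib_right
    by (intro arg_cong2[where f = "(*)"] sum.cong refl) (simp add: algebra_simps)
  also have "(t - 1) * (\<Sum>i<n. t ^ (n - 1 - i)) = t ^ n - 1"
    using geometric_from_rev[of 0 n t] by simp
  finally show ?thesis unfolding main by (simp add: algebra_simps)
qed

definition conj_exp :: "nat \<Rightarrow> (nat \<Rightarrow>\<^sub>0 nat) \<Rightarrow> nat \<Rightarrow> int" where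
  "conj_exp n \<mu> j = int (conj_part n \<mu> (j - n))"

lemma rank_atLeastLessThan: "k < m \<Longrightarrow> rank_in {n..<n+m} (n + k) = m - 1 - k"
proof -
  assume "k < m"
  then have "{j\<in>{n..<n+m}. n + k < j} = {Suc (n + k)..<n+m}" by auto
  then show ?thesis using \<open>k < m\<close> by (simp add: rank_in_def)
qed

lemma sum_atLeast_shift: "(\<Sum>j\<in>{n..<n+m}. f j) = (\<Sum>k<m. f (n + k :: nat))"
  by (rule sum.reindex_bij_witness[of _ "\<lambda>k. n + k" "\<lambda>j. j - n"]) auto

text \<open>The eigenvalues of the two sides of the kernel equation are related exactly by the conjugation of
partitions.\<close>

lemma dual_eigenvalue:
  assumes r: "\<rho> \<in> parts n m"
  shows "(t_K - 1) * eigenval n 1 \<rho> + (q_K - 1) * t_K ^ n * q_K ^ (m - 1) *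
      macev {n..<n+m} (inverse t_K) (inverse q_K) 1 (conj_exp n \<rho>) = t_K ^ n * q_K ^ m - 1"
proof -
  have a: "eigenval n 1 \<rho> = (\<Sum>i<n. q_K ^ lookup \<rho> i * t_K ^ (n - 1 - i))"
    unfolding eigenval_def macev_1[OF finite_lessThan] by (simp add: rank_lessThan)
  have "t_K ^ n * q_K ^ (m - 1) * macev {n..<n+m} (inverse t_K) (inverse q_K) 1 (conj_exp n \<rho>) =
     (\<Sum>k<m. t_K ^ (n - conj_part n \<rho> k) * q_K ^ k)"
    unfolding macev_1[OF finite_atLeastLessThan] sum_atLeast_shift sum_distrib_left
  proof (rule sum.cong[OF refl])
    fix k assume k: "k \<in> {..<m}"
    have "t_K ^ n = t_K ^ (n - conj_part n \<rho> k) * t_K ^ conj_part n \<rho> k"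
      using conj_part_le[of n \<rho> k] by (simp flip: power_add)
    moreover have "q_K ^ (m - 1) = q_K ^ k * q_K ^ (m - 1 - k)"
      using k by (simp flip: power_add)
    ultimately show "t_K ^ n * q_K ^ (m - 1) * (inverse t_K powi conj_exp n \<rho> (n + k) * inverse q_K ^ rank_in {n..<n + m} (n + k)) =
      t_K ^ (n - conj_part n \<rho> k) * q_K ^ k"
      using k q_K_nonzero t_K_nonzero
      by (simp add: conj_exp_def rank_atLeastLessThan power_inverse, simp add: field_simps)
  qed
  then show ?thesis using boundary_identity[OF r, of t_K q_K] unfolding a by (simp add: mult.assoc)
qed

text \<open>Inserting the kernel expansion in the kernel equation and comparing the coefficients of the Macdonald polynomials in \<open>x\<close>.\<close>

lemma Dm_polyQ:
  assumes mu: "\<mu> \<in> parts n m"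
  shows "Dr {n..<n+m} (inverse t_K) (inverse q_K) 1 (of_mpol (polyQ n m \<mu>)) =
    of_K (macev {n..<n+m} (inverse t_K) (inverse q_K) 1 (conj_exp n \<mu>)) * of_mpol (polyQ n m \<mu>)"
proof -
  let ?I = "{..<n}" and ?Y = "{n..<n+m}"
  let ?D = "Dr ?Y (inverse t_K) (inverse q_K) 1"
  have IY: "?I \<inter> ?Y = {}" "?Y \<inter> ?I = {}" by auto
  have t': "inverse t_K \<noteq> 0" using t_K_nonzero by simp
  define c where "c = of_K (t_K ^ n * q_K ^ m - 1)"
  define c' where "c' = of_K ((q_K - 1) * t_K ^ n * q_K ^ (m - 1))"
  \<comment> \<open>The coefficient of \<open>monicP n m \<mu>\<close> in the kernel equation.\<close>
  define s where "s \<mu> = (of_K ((t_K - 1) * eigenval n 1 \<mu>) - c) * of_mpol (polyQ n m \<mu>) + c' * ?D (of_mpol (polyQ n m \<mu>))" for \<mu>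
  have c'0: "c' \<noteq> 0" using qt_distinct q_K_nonzero t_K_nonzero by (simp add: c'_def)
  have QY: "of_mpol (polyQ n m \<mu>) \<in> ratV ?Y" for \<mu> by (rule ratV_of_mpol[OF polyQ_polysV])
  have PI: "of_mpol (monicP n m \<mu>) \<in> ratV ?I" if "\<mu> \<in> parts n m" for \<mu>
    by (rule ratV_of_mpol[OF monicP_polysV[OF that]])
  have dx: "Dr ?I q_K t_K 1 (kernelF n m) = (\<Sum>\<mu>\<in>parts n m. of_mpol (monicP n m \<mu>) * (of_K (eigenval n 1 \<mu>) * of_mpol (polyQ n m \<mu>)))"
    unfolding kernelF_PQ Dr_sum[OF q_K_nonzero]
  proof (rule sum.cong[OF refl])
    fix \<mu> assume mu: "\<mu> \<in> parts n m"
    have "Dr ?I q_K t_K 1 (of_mpol (polyQ n m \<mu>) * of_mpol (monicP n m \<mu>)) = of_mpol (polyQ n m \<mu>) * (of_K (eigenval n 1 \<mu>) * of_mpol (monicP n m \<mu>))"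
      unfolding Dr_mult_fixed[OF q_K_nonzero QY IY(2)] Dr_monicP[OF mu] ..
    then show "Dr ?I q_K t_K 1 (of_mpol (monicP n m \<mu>) * of_mpol (polyQ n m \<mu>)) = of_mpol (monicP n m \<mu>) * (of_K (eigenval n 1 \<mu>) * of_mpol (polyQ n m \<mu>))"
      by (simp only: mult_ac)
  qed
  have dy: "?D (kernelF n m) = (\<Sum>\<mu>\<in>parts n m. of_mpol (monicP n m \<mu>) * ?D (of_mpol (polyQ n m \<mu>)))"
    unfolding kernelF_PQ Dr_sum[OF t'] by (rule sum.cong[OF refl]) (rule Dr_mult_fixed[OF t' PI IY(1)])
  have "of_K (t_K - 1) * Dr ?I q_K t_K 1 (kernelF n m) + c' * ?D (kernelF n m) - c * kernelF n m = 0"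
    using kernel_eq[of ?I ?Y q_K t_K] q_K_nonzero t_K_nonzero IY by (simp add: kernelF_eq_pair_kernel c_def c'_def)
  moreover have "of_K (t_K - 1) * Dr ?I q_K t_K 1 (kernelF n m) + c' * ?D (kernelF n m) - c * kernelF n m =
      (\<Sum>\<mu>\<in>parts n m. of_mpol (monicP n m \<mu>) * s \<mu>)"
    unfolding dx dy unfolding kernelF_PQ sum_distrib_left sum.distrib[symmetric] sum_subtractf[symmetric]
    by (rule sum.cong[OF refl]) (simp add: s_def of_K_hom algebra_simps)
  ultimately have z: "(\<Sum>\<mu>\<in>parts n m. of_mpol (monicP n m \<mu>) * s \<mu>) = 0" by simp
  have "s \<mu> = 0"
  proof (rule monicP_indep[OF _ IY(1) z mu])
    show "s \<mu> \<in> ratV ?Y" for \<mu>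
      unfolding s_def c_def c'_def
      by (intro ratV_add ratV_mult ratV_diff ratV_of_K QY Dr_ratV[OF order.refl QY t'])
  qed
  then have A: "(of_K ((t_K - 1) * eigenval n 1 \<mu>) - c) * of_mpol (polyQ n m \<mu>) + c' * ?D (of_mpol (polyQ n m \<mu>)) = 0"
    unfolding s_def .
  have B: "of_K ((t_K - 1) * eigenval n 1 \<mu>) - c = - c' * of_K (macev ?Y (inverse t_K) (inverse q_K) 1 (conj_exp n \<mu>))"
    unfolding c_def c'_def dual_eigenvalue[OF mu, symmetric] by (simp add: of_K_hom)
  have "c' * (?D (of_mpol (polyQ n m \<mu>)) - of_K (macev ?Y (inverse t_K) (inverse q_K) 1 (conj_exp n \<mu>)) * of_mpol (polyQ n m \<mu>)) = 0"
    using A unfolding B right_diff_distrib by (simp only: mult_minus_left mult.assoc diff_conv_add_uminus add.commute)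
  then show ?thesis using c'0 by simp
qed

text \<open>The commuting operators carry the eigenvector property from parameters \<open>(1/t, 1/q)\<close> over to \<open>(t, q)\<close>.\<close>

lemma Dr_polyQ:
  assumes mu: "\<mu> \<in> parts n m"
  shows "Dr {n..<n+m} t_K q_K r (of_mpol (polyQ n m \<mu>)) = of_K (macev {n..<n+m} t_K q_K r (conj_exp n \<mu>)) * of_mpol (polyQ n m \<mu>)"
proof (rule eigen_transfer[OF _ _ t_K_nonzero separating_qt(4) ratV_of_mpol[OF polyQ_polysV] _ Dm_polyQ[OF mu]])
  show "inverse t_K \<noteq> 0" using t_K_nonzero by simp
  show "of_mpol (polyQ n m \<mu>) \<noteq> 0" using polyQ_nonzero[OF mu] by simp
  show "Dr {n..<n+m} (inverse t_K) (inverse q_K) 1 (Dr {n..<n+m} t_K q_K r (of_mpol (polyQ n m \<mu>))) =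
    Dr {n..<n+m} t_K q_K r (Dr {n..<n+m} (inverse t_K) (inverse q_K) 1 (of_mpol (polyQ n m \<mu>)))"
    using qt_distinct q_K_nonzero t_K_nonzero by (intro Dr_commute) auto
qed simp

section \<open>From the kernel to the raising property\<close>

definition part_cons :: "nat \<Rightarrow> (nat \<Rightarrow>\<^sub>0 nat) \<Rightarrow> (nat \<Rightarrow>\<^sub>0 nat)" where
  "part_cons m \<rho> = Abs_poly_mapping (case_nat m (lookup \<rho>))"

lemma lookup_part_cons: "lookup (part_cons m \<rho>) = case_nat m (lookup \<rho>)"
proof -
  have "{i. case_nat m (lookup \<rho>) i \<noteq> 0} \<subseteq> insert 0 (Suc ` keys \<rho>)"
  proof
    fix i assume "i \<in> {i. case_nat m (lookup \<rho>) i \<noteq> 0}"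
    then show "i \<in> insert 0 (Suc ` keys \<rho>)" by (cases i) (auto simp: in_keys_iff)
  qed
  then have "finite {i. case_nat m (lookup \<rho>) i \<noteq> 0}" by (rule finite_subset) simp
  then show ?thesis unfolding part_cons_def by (simp add: lookup_Abs_poly_mapping)
qed

text \<open>Partitions of length less than \<open>n\<close> (for \<open>n \<ge> 1\<close>); their extension by a first part \<open>m\<close> still fits.\<close>

definition short_parts :: "nat \<Rightarrow> nat \<Rightarrow> (nat \<Rightarrow>\<^sub>0 nat) set" where
  "short_parts n m = {\<rho>\<in>parts n m. lookup \<rho> (n - 1) = 0}"

lemma part_zero_beyond: "\<rho> \<in> parts n m \<Longrightarrow> n \<le> i \<Longrightarrow> lookup \<rho> i = 0"
proof (rule ccontr)
  assume h: "\<rho> \<in> parts n m" "n \<le> i" "lookup \<rho> i \<noteq> 0"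
  then have "i \<in> keys \<rho>" by (simp add: in_keys_iff)
  then have "i \<in> {..<n}" using h(1) unfolding parts_def by blast
  then show False using h(2) by simp
qed

lemma part_cons_in_parts:
  assumes "n \<ge> 1" "\<rho> \<in> short_parts n m"
  shows "part_cons m \<rho> \<in> parts n m"
proof -
  have r: "\<rho> \<in> parts n m" "lookup \<rho> (n - 1) = 0" using assms by (auto simp: short_parts_def)
  have lt: "i < n" if "lookup (part_cons m \<rho>) i \<noteq> 0" for i
  proof (cases i)
    case (Suc j)
    then have nz: "lookup \<rho> j \<noteq> 0" using that by (simp add: lookup_part_cons)
    then have "j \<noteq> n - 1" using r(2) by auto
    moreover have "\<not> n \<le> j" using part_zero_beyond[OF r(1), of j] nz by auto
    ultimately show ?thesis using Suc by simp
  qed (use assms in simp)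
  moreover have "antimono (case_nat m (lookup \<rho>))"
  proof (rule antimonoI)
    fix i j :: nat assume "i \<le> j"
    have mono: "antimono (lookup \<rho>)" using r(1) by (simp add: parts_def)
    show "case_nat m (lookup \<rho>) j \<le> case_nat m (lookup \<rho>) i"
    proof (cases i)
      case 0
      then show ?thesis using parts_le[OF r(1)] by (cases j) simp_all
    next
      case (Suc i')
      then obtain j' where "j = Suc j'" "i' \<le> j'" using \<open>i \<le> j\<close> by (cases j) auto
      then show ?thesis using Suc antimonoD[OF mono] by simp
    qed
  qed
  moreover have "keys (part_cons m \<rho>) \<subseteq> {..<n}"
  proof
    fix i assume "i \<in> keys (part_cons m \<rho>)"
    then have "lookup (part_cons m \<rho>) i \<noteq> 0" by (simp add: in_keys_iff)
    then show "i \<in> {..<n}" using lt by simp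
  qed
  ultimately show ?thesis by (simp add: parts_def lookup_part_cons)
qed

lemma conj_part_cons:
  assumes n: "n \<ge> 1" and r: "\<rho> \<in> short_parts n m" and k: "k < m"
  shows "conj_part n (part_cons m \<rho>) k = Suc (conj_part n \<rho> k)"
proof -
  have z: "lookup \<rho> (n - 1) = 0" using r by (simp add: short_parts_def)
  have "{i\<in>{..<n}. k < lookup (part_cons m \<rho>) i} = insert 0 (Suc ` {i\<in>{..<n}. k < lookup \<rho> i})" (is "?A = ?B")
  proof (intro set_eqI)
    fix i
    have "Suc j < n \<longleftrightarrow> j < n" if "k < lookup \<rho> j" for j
    proof -
      have "j \<noteq> n - 1" using that z by auto
      then show ?thesis by auto
    qed
    then show "i \<in> ?A \<longleftrightarrow> i \<in> ?B" using n k by (cases i) (auto simp: lookup_part_cons)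
  qed
  then show ?thesis by (simp add: conj_part_def card_image)
qed

lemma part_cons_image: 
  assumes n: "n \<ge> 1"
  shows "part_cons m ` short_parts n m = {\<mu>\<in>parts n m. lookup \<mu> 0 = m}"
proof (intro subset_antisym subsetI)
  fix \<mu> assume "\<mu> \<in> part_cons m ` short_parts n m"
  then show "\<mu> \<in> {\<mu>\<in>parts n m. lookup \<mu> 0 = m}"
    using part_cons_in_parts[OF n] by (auto simp: lookup_part_cons)
next
  fix \<mu> assume "\<mu> \<in> {\<mu>\<in>parts n m. lookup \<mu> 0 = m}"
  then have mu: "\<mu> \<in> parts n m" "lookup \<mu> 0 = m" by auto
  define \<rho> where "\<rho> = Poly_Mapping.map_key Suc \<mu>"
  have l: "lookup \<rho> i = lookup \<mu> (Suc i)" for i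
    unfolding \<rho>_def by (simp add: lookup_map_key)
  have "keys \<rho> \<subseteq> {..<n}"
  proof
    fix i assume "i \<in> keys \<rho>"
    then have "lookup \<mu> (Suc i) \<noteq> 0" by (simp add: in_keys_iff l)
    then show "i \<in> {..<n}" using part_zero_beyond[OF mu(1), of "Suc i"] by (cases "n \<le> Suc i") auto
  qed
  moreover have "lookup \<mu> (Suc 0) \<le> m" by (rule parts_le[OF mu(1)])
  moreover have "antimono (lookup \<rho>)"
    using mu(1) by (auto simp: parts_def antimono_def l)
  ultimately have "\<rho> \<in> parts n m" by (simp add: parts_def l)
  moreover have "lookup \<mu> n = 0" by (rule part_zero_beyond[OF mu(1)]) simp
  ultimately have "\<rho> \<in> short_parts n m" using n by (simp add: short_parts_def l)
  moreover have "part_cons m \<rho> = \<mu>"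
    by (rule poly_mapping_eqI) (auto simp: lookup_part_cons l mu(2) split: nat.split)
  ultimately show "\<mu> \<in> part_cons m ` short_parts n m" by blast
qed

lemma inj_on_part_cons: "inj_on (part_cons m) S"
proof (rule inj_onI)
  fix \<rho> \<nu> assume h: "part_cons m \<rho> = part_cons m \<nu>"
  show "\<rho> = \<nu>"
  proof (rule poly_mapping_eqI)
    fix i
    have "lookup (part_cons m \<rho>) (Suc i) = lookup (part_cons m \<nu>) (Suc i)" using h by simp
    then show "lookup \<rho> i = lookup \<nu> i" by (simp add: lookup_part_cons)
  qed
qed

definition yprod :: "nat \<Rightarrow> nat \<Rightarrow> ratfun" where
  "yprod n m = (\<Prod>k<m. xvar (n + k))"

lemma yprod_eq_mon: "yprod n m = mon (yexp n m (\<lambda>_. 1))"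
  unfolding yprod_def mon_yexp by simp

lemma yprod_nonzero: "yprod n m \<noteq> 0" unfolding yprod_eq_mon by simp

lemma yprod_ratV: "yprod n m \<in> ratV {n..<n+m}" unfolding yprod_eq_mon by (rule ratV_mon[OF keys_yexp])

lemma Dr_yprod:
  assumes p: "p \<noteq> 0"
  shows "Dr {n..<n+m} p s r (yprod n m * f) = of_K (p ^ r) * yprod n m * Dr {n..<n+m} p s r f"
  unfolding Dr_def sum_distrib_left
proof (rule sum.cong[OF refl])
  fix L assume L: "L \<in> {L. L \<subseteq> {n..<n+m} \<and> card L = r}"
  note nz = sub_scale_nonzero[OF p]
  have "(\<Prod>k<m. sub_scale L p (n + k)) = (\<Prod>j\<in>{n..<n+m}. sub_scale L p j)"
    by (rule prod_atLeast_shift[symmetric])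
  also have "\<dots> = (\<Prod>j\<in>L. p)"
    using L by (intro prod.mono_neutral_cong_right) (auto simp: sub_scale_def)
  also have "\<dots> = p ^ r" using L by simp
  finally have e: "(\<Prod>k<m. sub_scale L p (n + k)) = p ^ r" .
  have "scale (sub_scale L p) (yprod n m) = of_K (\<Prod>k<m. sub_scale L p (n + k)) * yprod n m"
    unfolding yprod_def by (simp add: scale_prod[OF nz] scale_xvar[OF nz] of_K_prod prod.distrib)
  then show "of_K (s ^ (r choose 2)) * mac_coeff {n..<n+m} s L * scale (sub_scale L p) (yprod n m * f) =
      of_K (p ^ r) * yprod n m * (of_K (s ^ (r choose 2)) * mac_coeff {n..<n+m} s L * scale (sub_scale L p) f)"
    unfolding scale_mult[OF nz] e by (simp only: mult_ac)
qed

lemma conj_exp_part_cons: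
  assumes n: "n \<ge> 1" and r: "\<rho> \<in> short_parts n m" and j: "j \<in> {n..<n+m}"
  shows "conj_exp n (part_cons m \<rho>) j = conj_exp n \<rho> j + 1"
  unfolding conj_exp_def using conj_part_cons[OF n r, of "j - n"] j by auto

lemma macev_shift:
  assumes "p \<noteq> 0" "finite I" "\<And>j. j \<in> I \<Longrightarrow> e' j = e j + 1"
  shows "macev I p s 1 e' = p * macev I p s 1 e"
  unfolding macev_1[OF assms(2)] sum_distrib_left
  using assms by (intro sum.cong refl) (simp add: power_int_add mult_ac)

text \<open>Multiplication by $y_1\cdots y_m$ raises all conjugate parts by one, as does the new first row. So both sides are
eigenfunctions with the same eigenvalue, and the coefficient at the conjugate of \<open>part_cons m \<rho>\<close> is \<open>1\<close> on
both sides.\<close>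

lemma polyQ_part_cons:
  assumes n: "n \<ge> 1" and r: "\<rho> \<in> short_parts n m"
  shows "of_mpol (polyQ n m (part_cons m \<rho>)) = yprod n m * of_mpol (polyQ n m \<rho>)"
proof -
  let ?Y = "{n..<n+m}" and ?\<eta> = "yexp n m (\<lambda>_. 1)" and ?\<theta> = "yexp n m (conj_box n m \<rho>)"
  let ?\<mu> = "part_cons m \<rho>"
  have rp: "\<rho> \<in> parts n m" using r by (simp add: short_parts_def)
  note mp = part_cons_in_parts[OF n r]
  have t': "inverse t_K \<noteq> 0" using t_K_nonzero by simp
  note QV = ratV_of_mpol[OF polyQ_polysV[of n m]]
  have ev: "macev ?Y (inverse t_K) (inverse q_K) 1 (conj_exp n ?\<mu>) = inverse t_K * macev ?Y (inverse t_K) (inverse q_K) 1 (conj_exp n \<rho>)"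
    by (rule macev_shift[OF t' _ conj_exp_part_cons[OF n r]]) simp_all
  have e2: "Dr ?Y (inverse t_K) (inverse q_K) 1 (yprod n m * of_mpol (polyQ n m \<rho>)) =
      of_K (macev ?Y (inverse t_K) (inverse q_K) 1 (conj_exp n ?\<mu>)) * (yprod n m * of_mpol (polyQ n m \<rho>))"
    unfolding Dr_yprod[OF t'] Dm_polyQ[OF rp] ev of_K_mult by (simp only: power_one_right mult_ac)
  have nz: "yprod n m * of_mpol (polyQ n m \<rho>) \<noteq> 0" using yprod_nonzero polyQ_nonzero[OF rp] by simp
  obtain c where "of_mpol (polyQ n m ?\<mu>) = of_K c * (yprod n m * of_mpol (polyQ n m \<rho>))"
    using eigen_unique[OF _ t' separating_qt(4) QV Dm_polyQ[OF mp] ratV_mult[OF yprod_ratV QV] e2 nz] by auto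
  also have "\<dots> = of_mpol (scal c (single ?\<eta> 1 * polyQ n m \<rho>))"
    unfolding of_mpol_scal of_mpol_mult yprod_eq_mon mon_def ..
  finally have e: "polyQ n m ?\<mu> = scal c (single ?\<eta> 1 * polyQ n m \<rho>)" by simp
  have add: "yexp n m (conj_box n m ?\<mu>) = ?\<eta> + ?\<theta>"
  proof (rule poly_mapping_eqI)
    fix j
    show "lookup (yexp n m (conj_box n m ?\<mu>)) j = lookup (?\<eta> + ?\<theta>) j"
      using conj_part_cons[OF n r, of "j - n"] by (auto simp: lookup_add lookup_yexp conj_box_def)
  qed
  have "1 = lookup (polyQ n m ?\<mu>) (?\<eta> + ?\<theta>)"
    unfolding add[symmetric] lookup_polyQ[OF conj_box_in] elem_coeff_diag[OF mp] ..
  also have "\<dots> = c * lookup (single ?\<eta> 1 * polyQ n m \<rho>) (?\<eta> + ?\<theta>)"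
    unfolding e lookup_scal ..
  also have "lookup (single ?\<eta> 1 * polyQ n m \<rho>) (?\<eta> + ?\<theta>) =
      lookup (single ?\<eta> (1::K)) ?\<eta> * lookup (polyQ n m \<rho>) ?\<theta>"
    by (rule lookup_times_unique) (auto split: if_splits)
  also have "\<dots> = 1" unfolding lookup_polyQ[OF conj_box_in] elem_coeff_diag[OF rp] by simp
  finally have "c = 1" by simp
  then show ?thesis unfolding e of_mpol_scal of_mpol_mult yprod_eq_mon mon_def by simp
qed

text \<open>The eigenvalue of $\sum_r (-1)^r D_r^y$ on \<open>polyQ n m \<mu>\<close>; it equals $c_\mu/c_\rho$ for \<open>\<mu> = part_cons m \<rho>\<close> with \<open>\<rho>\<close> in \<open>short_parts n m\<close>.\<close>

definition raise_norm :: "nat \<Rightarrow> nat \<Rightarrow> (nat \<Rightarrow>\<^sub>0 nat) \<Rightarrow> K" where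
  "raise_norm n m \<mu> = (\<Prod>k<m. 1 - t_K ^ conj_part n \<mu> k * q_K ^ (m - 1 - k))"

lemma alternating_macev:
  assumes "finite I"
  shows "(\<Sum>r\<le>card I. (- 1) ^ r * macev I p s r e) = (\<Prod>i\<in>I. 1 - p powi e i * s ^ rank_in I i)"
proof -
  let ?u = "\<lambda>i. p powi e i * s ^ rank_in I i"
  have "(\<Prod>i\<in>I. 1 - ?u i) = (\<Prod>i\<in>I. - ?u i + 1)" by (rule prod.cong[OF refl]) simp
  also have "\<dots> = (\<Sum>L\<in>Pow I. (\<Prod>i\<in>L. - ?u i) * (\<Prod>i\<in>I - L. 1))" by (rule prod_add[OF assms])
  also have "\<dots> = (\<Sum>L\<in>Pow I. (- 1) ^ card L * (\<Prod>i\<in>L. ?u i))"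
    by (rule sum.cong[OF refl]) (simp only: prod_uminus prod.neutral_const mult_1_right)
  also have "\<dots> = (\<Sum>r\<in>{..card I}. \<Sum>L | L \<in> Pow I \<and> card L = r. (- 1) ^ card L * (\<Prod>i\<in>L. ?u i))"
    by (rule sum.group[symmetric]) (use assms card_mono in auto)
  also have "\<dots> = (\<Sum>r\<le>card I. (- 1) ^ r * macev I p s r e)"
    unfolding macev_def sum_distrib_left by (intro sum.cong) auto
  finally show ?thesis ..
qed

definition raised_kernel :: "nat \<Rightarrow> nat \<Rightarrow> ratfun" where
  "raised_kernel n m = inverse (yprod n m) * (\<Sum>r\<le>m. (- 1) ^ r * Dr {n..<n+m} t_K q_K r (kernelF n m))"

text \<open>If the first part is less than \<open>m\<close> then the last conjugate part is \<open>0\<close>, and the last factor is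
\<open>1 - t ^ 0 * q ^ 0\<close>.\<close>

lemma raise_norm_zero:
  assumes "\<mu> \<in> parts n m" "lookup \<mu> 0 \<noteq> m"
  shows "raise_norm n m \<mu> = 0"
proof -
  have lt: "lookup \<mu> i < m" for i
  proof -
    have "lookup \<mu> i \<le> lookup \<mu> 0" using assms(1) by (auto simp: parts_def antimono_def)
    then show ?thesis using parts_le[OF assms(1), of 0] assms(2) by simp
  qed
  \<comment> \<open>The column \<open>m - 1\<close> exists because the first part is less than \<open>m\<close>.\<close>
  have m: "m - 1 < m" using lt[of 0] by simp
  have "lookup \<mu> i \<le> m - 1" for i using lt[of i] by simp
  then have "conj_part n \<mu> (m - 1) = 0" unfolding conj_part_def by (auto simp: not_less)
  then have "1 - t_K ^ conj_part n \<mu> (m - 1) * q_K ^ (m - 1 - (m - 1)) = 0" by simp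
  then show ?thesis unfolding raise_norm_def using m by (intro prod_zero bexI[of _ "m - 1"]) simp_all
qed

lemma raised_polyQ:
  assumes mu: "\<mu> \<in> parts n m"
  shows "(\<Sum>r\<le>m. (- 1) ^ r * Dr {n..<n+m} t_K q_K r (of_mpol (polyQ n m \<mu>))) = of_K (raise_norm n m \<mu>) * of_mpol (polyQ n m \<mu>)"
proof -
  let ?Y = "{n..<n+m}"
  have "(\<Sum>r\<le>m. (- 1) ^ r * Dr ?Y t_K q_K r (of_mpol (polyQ n m \<mu>))) =
      (\<Sum>r\<le>card ?Y. of_K ((- 1) ^ r * macev ?Y t_K q_K r (conj_exp n \<mu>))) * of_mpol (polyQ n m \<mu>)"
    unfolding Dr_polyQ[OF mu] sum_distrib_right by (intro sum.cong) (simp_all add: of_K_hom mult_ac)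
  also have "(\<Sum>r\<le>card ?Y. of_K ((- 1) ^ r * macev ?Y t_K q_K r (conj_exp n \<mu>))) = of_K (\<Prod>i\<in>?Y. 1 - t_K powi conj_exp n \<mu> i * q_K ^ rank_in ?Y i)"
    unfolding of_K_sum[symmetric] alternating_macev[OF finite_atLeastLessThan] ..
  also have "(\<Prod>i\<in>?Y. 1 - t_K powi conj_exp n \<mu> i * q_K ^ rank_in ?Y i) = raise_norm n m \<mu>"
    unfolding raise_norm_def
  proof (rule prod.reindex_bij_witness[of _ "\<lambda>k. n + k" "\<lambda>j. j - n"])
    fix j assume "j \<in> ?Y"
    then have "rank_in ?Y j = m - 1 - (j - n)" using rank_atLeastLessThan[of "j - n" m n] by auto
    then show "1 - t_K ^ conj_part n \<mu> (j - n) * q_K ^ (m - 1 - (j - n)) = 1 - t_K powi conj_exp n \<mu> j * q_K ^ rank_in ?Y j"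
      by (simp add: conj_exp_def)
  qed auto
  finally show ?thesis .
qed

lemma raised_kernel_expand:
  assumes n: "n \<ge> 1"
  shows "raised_kernel n m = (\<Sum>\<rho>\<in>short_parts n m.
    of_K (raise_norm n m (part_cons m \<rho>)) * of_mpol (monicP n m (part_cons m \<rho>)) * of_mpol (polyQ n m \<rho>))"
proof -
  let ?Y = "{n..<n+m}"
  let ?T = "\<lambda>\<mu>. of_mpol (monicP n m \<mu>) * (of_K (raise_norm n m \<mu>) * of_mpol (polyQ n m \<mu>))"
  have IY: "{..<n} \<inter> ?Y = {}" by auto
  have D: "Dr ?Y t_K q_K r (kernelF n m) = (\<Sum>\<mu>\<in>parts n m. of_mpol (monicP n m \<mu>) * Dr ?Y t_K q_K r (of_mpol (polyQ n m \<mu>)))" for r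
    unfolding kernelF_PQ Dr_sum[OF t_K_nonzero]
    by (rule sum.cong[OF refl]) (rule Dr_mult_fixed[OF t_K_nonzero ratV_of_mpol[OF monicP_polysV] IY])
  have "(\<Sum>r\<le>m. (- 1) ^ r * Dr ?Y t_K q_K r (kernelF n m)) =
      (\<Sum>r\<le>m. \<Sum>\<mu>\<in>parts n m. of_mpol (monicP n m \<mu>) * ((- 1) ^ r * Dr ?Y t_K q_K r (of_mpol (polyQ n m \<mu>))))"
    unfolding D sum_distrib_left by (simp only: mult.left_commute)
  also have "\<dots> = (\<Sum>\<mu>\<in>parts n m. \<Sum>r\<le>m. of_mpol (monicP n m \<mu>) * ((- 1) ^ r * Dr ?Y t_K q_K r (of_mpol (polyQ n m \<mu>))))"
    by (rule sum.swap)
  also have "\<dots> = (\<Sum>\<mu>\<in>parts n m. ?T \<mu>)"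
    unfolding sum_distrib_left[symmetric] by (rule sum.cong[OF refl]) (simp only: raised_polyQ)
  also have "\<dots> = (\<Sum>\<mu> | \<mu> \<in> parts n m \<and> lookup \<mu> 0 = m. ?T \<mu>)"
    by (rule sum.mono_neutral_right[OF finite_parts]) (auto simp: raise_norm_zero)
  also have "\<dots> = (\<Sum>\<rho>\<in>short_parts n m. ?T (part_cons m \<rho>))"
    unfolding part_cons_image[OF n, symmetric] by (rule sum.reindex[OF inj_on_part_cons, unfolded comp_def])
  also have "\<dots> = yprod n m * (\<Sum>\<rho>\<in>short_parts n m.
    of_K (raise_norm n m (part_cons m \<rho>)) * of_mpol (monicP n m (part_cons m \<rho>)) * of_mpol (polyQ n m \<rho>))"
    unfolding sum_distrib_left by (rule sum.cong[OF refl]) (simp only: polyQ_part_cons[OF n] mult_ac)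
  finally show ?thesis unfolding raised_kernel_def by (simp add: yprod_nonzero)
qed

text \<open>The coefficients at the exponents of conjugate partitions form a unitriangular matrix, by \<open>elem_coeff_above\<close> and
\<open>elem_coeff_diag\<close>.\<close>

lemma polyQ_indep:
  assumes s: "\<And>\<mu>. \<mu> \<in> parts n m \<Longrightarrow> s \<mu> \<in> ratV B" and B: "{n..<n+m} \<inter> B = {}"
    and z: "(\<Sum>\<mu>\<in>parts n m. of_mpol (polyQ n m \<mu>) * s \<mu>) = 0" and mu: "\<mu> \<in> parts n m"
  shows "s \<mu> = 0"
proof (rule ccontr)
  assume "s \<mu> \<noteq> 0"
  \<comment> \<open>Triangularity goes the other way for the dual family: the smallest partition decides.\<close>
  define M where "M = Min {\<mu>\<in>parts n m. s \<mu> \<noteq> 0}"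
  have fin: "finite {\<mu>\<in>parts n m. s \<mu> \<noteq> 0}" using finite_parts by simp
  have "M \<in> {\<mu>\<in>parts n m. s \<mu> \<noteq> 0}" unfolding M_def using \<open>s \<mu> \<noteq> 0\<close> mu by (intro Min_in fin) auto
  then have M: "M \<in> parts n m" "s M \<noteq> 0" by auto
  have below: "s \<nu> = 0" if nu: "\<nu> \<in> parts n m" "\<nu> < M" for \<nu>
  proof (rule ccontr)
    assume "s \<nu> \<noteq> 0"
    then have "M \<le> \<nu>" unfolding M_def using nu(1) by (intro Min_le[OF fin]) simp
    then show False using nu(2) by simp
  qed
  have "(\<Sum>\<mu>\<in>parts n m. of_K (lookup (polyQ n m \<mu>) (yexp n m (conj_box n m M))) * s \<mu>) = 0"
    by (rule coefficient_separation[OF finite_parts B polyQ_polysV s z])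
  moreover have "(\<Sum>\<mu>\<in>parts n m. of_K (lookup (polyQ n m \<mu>) (yexp n m (conj_box n m M))) * s \<mu>) =
      (\<Sum>\<mu>\<in>parts n m. if \<mu> = M then s M else 0)"
  proof (rule sum.cong[OF refl])
    fix \<nu> assume nu: "\<nu> \<in> parts n m"
    show "of_K (lookup (polyQ n m \<nu>) (yexp n m (conj_box n m M))) * s \<nu> = (if \<nu> = M then s M else 0)"
      unfolding lookup_polyQ[OF conj_box_in]
    proof (cases \<nu> M rule: linorder_cases)
      case less
      then show "of_K (elem_coeff n m (conj_box n m M) \<nu>) * s \<nu> = (if \<nu> = M then s M else 0)" using below[OF nu] by simp
    next
      case equal
      then show "of_K (elem_coeff n m (conj_box n m M) \<nu>) * s \<nu> = (if \<nu> = M then s M else 0)" using elem_coeff_diag[OF M(1)] by simp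
    next
      case greater
      then show "of_K (elem_coeff n m (conj_box n m M) \<nu>) * s \<nu> = (if \<nu> = M then s M else 0)" using elem_coeff_above[OF M(1) nu] by simp
    qed
  qed
  ultimately show False using M by (simp add: sum.delta[OF finite_parts])
qed

definition qcomb :: "nat \<Rightarrow> (nat \<Rightarrow> nat) set \<Rightarrow> ((nat \<Rightarrow> nat) \<Rightarrow> ratfun) \<Rightarrow> ratfun \<Rightarrow> ratfun" where
  "qcomb n G b f = (\<Sum>\<gamma>\<in>G. b \<gamma> * qshifts n \<gamma> f)"

lemma qshift_scale_nonzero: "(if i < n then q_K ^ \<gamma> i else 1) \<noteq> 0"
  by (simp add: q_K_nonzero)

lemma qshifts_sum: "qshifts n \<gamma> (\<Sum>j\<in>J. f j) = (\<Sum>j\<in>J. qshifts n \<gamma> (f j))"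
  unfolding qshifts_eq_scale by (rule scale_sum, rule qshift_scale_nonzero)

lemma qshifts_mult: "qshifts n \<gamma> (f * g) = qshifts n \<gamma> f * qshifts n \<gamma> g"
  unfolding qshifts_eq_scale by (rule scale_mult, rule qshift_scale_nonzero)

lemma qshifts_fixed:
  assumes "g \<in> ratV B" "B \<inter> {..<n} = {}"
  shows "qshifts n \<gamma> g = g"
  unfolding qshifts_eq_scale
proof (rule scale_trivial[OF _ assms(1)])
  show "(if i < n then q_K ^ \<gamma> i else 1) \<noteq> 0" for i by (rule qshift_scale_nonzero)
qed (use assms(2) in auto)

lemma qcomb_sum: "qcomb n G b (\<Sum>j\<in>J. f j) = (\<Sum>j\<in>J. qcomb n G b (f j))"
  unfolding qcomb_def qshifts_sum sum_distrib_left by (rule sum.swap)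

lemma qcomb_fixed:
  assumes "g \<in> ratV B" "B \<inter> {..<n} = {}"
  shows "qcomb n G b (g * f) = g * qcomb n G b f"
  unfolding qcomb_def qshifts_mult qshifts_fixed[OF assms] sum_distrib_left by (simp only: mult.left_commute)

lemma qcomb_cmult: "qcomb n G b (of_K c * f) = of_K c * qcomb n G b f"
  by (rule qcomb_fixed[of _ "{}"]) auto

lemma qcomb_ratV:
  assumes "\<And>\<gamma>. \<gamma> \<in> G \<Longrightarrow> b \<gamma> \<in> ratV {..<n}" "f \<in> ratV {..<n}"
  shows "qcomb n G b f \<in> ratV {..<n}"
  unfolding qcomb_def qshifts_eq_scale
proof (intro ratV_sum ratV_mult)
  fix \<gamma> assume "\<gamma> \<in> G"
  then show "b \<gamma> \<in> ratV {..<n}" by (rule assms(1))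
  show "scale (\<lambda>i. if i < n then q_K ^ \<gamma> i else 1) f \<in> ratV {..<n}"
    by (rule ratV_scale[OF qshift_scale_nonzero assms(2)])
qed

text \<open>Expanding the assumption on the kernel in the \<open>polyQ n m \<mu>\<close>, which are inert for operators in \<open>x\<close> and
independent over the rational functions in \<open>x\<close>.\<close>

theorem raising_from_kernel:
  assumes n: "n \<ge> 1" and b: "\<And>\<gamma>. \<gamma> \<in> G \<Longrightarrow> b \<gamma> \<in> ratV {..<n}"
    and ker: "qcomb n G b (kernelF n m) = raised_kernel n m" and r: "\<rho> \<in> parts n m"
  shows "qcomb n G b (of_mpol (monicP n m \<rho>)) =
    (if \<rho> \<in> short_parts n m then of_K (raise_norm n m (part_cons m \<rho>)) * of_mpol (monicP n m (part_cons m \<rho>)) else 0)"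
proof -
  let ?R = "\<lambda>\<rho>. if \<rho> \<in> short_parts n m then of_K (raise_norm n m (part_cons m \<rho>)) * of_mpol (monicP n m (part_cons m \<rho>)) else 0"
  define s where "s \<mu> = qcomb n G b (of_mpol (monicP n m \<mu>)) - ?R \<mu>" for \<mu>
  have sub: "short_parts n m \<subseteq> parts n m" by (auto simp: short_parts_def)
  have "qcomb n G b (kernelF n m) = (\<Sum>\<mu>\<in>parts n m. of_mpol (polyQ n m \<mu>) * qcomb n G b (of_mpol (monicP n m \<mu>)))"
    unfolding kernelF_PQ qcomb_sum
  proof (rule sum.cong[OF refl])
    fix \<mu>
    show "qcomb n G b (of_mpol (monicP n m \<mu>) * of_mpol (polyQ n m \<mu>)) = of_mpol (polyQ n m \<mu>) * qcomb n G b (of_mpol (monicP n m \<mu>))"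
      unfolding mult.commute[of "of_mpol (monicP n m \<mu>)"]
      by (rule qcomb_fixed[OF ratV_of_mpol[OF polyQ_polysV]]) auto
  qed
  moreover have "raised_kernel n m = (\<Sum>\<mu>\<in>parts n m. of_mpol (polyQ n m \<mu>) * ?R \<mu>)"
  proof -
    have "raised_kernel n m = (\<Sum>\<mu>\<in>short_parts n m. of_mpol (polyQ n m \<mu>) * ?R \<mu>)"
      unfolding raised_kernel_expand[OF n] by (rule sum.cong[OF refl]) (simp add: mult_ac)
    also have "\<dots> = (\<Sum>\<mu>\<in>parts n m. of_mpol (polyQ n m \<mu>) * ?R \<mu>)"
      by (rule sum.mono_neutral_left[OF finite_parts sub]) auto
    finally show ?thesis .
  qed
  ultimately have z: "(\<Sum>\<mu>\<in>parts n m. of_mpol (polyQ n m \<mu>) * s \<mu>) = 0"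
    using ker unfolding s_def right_diff_distrib sum_subtractf by simp
  have "s \<rho> = 0"
  proof (rule polyQ_indep[OF _ _ z r])
    show "{n..<n+m} \<inter> {..<n} = {}" by auto
    fix \<mu> assume mu: "\<mu> \<in> parts n m"
    have "qcomb n G b (of_mpol (monicP n m \<mu>)) \<in> ratV {..<n}"
      by (rule qcomb_ratV[OF b ratV_of_mpol[OF monicP_polysV[OF mu]]])
    moreover have "?R \<mu> \<in> ratV {..<n}"
      using part_cons_in_parts[OF n, of \<mu> m] by (auto intro!: ratV_mult ratV_of_mpol monicP_polysV)
    ultimately show "s \<mu> \<in> ratV {..<n}" unfolding s_def by (rule ratV_diff)
  qed
  then show ?thesis by (simp add: s_def)
qed

section \<open>The explicit operator applied to the kernel\<close>

lemma qF_nonzero: "qF \<noteq> 0" by (simp add: qF_def q_K_nonzero)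

lemma generic_nodes_qF: "generic_nodes qF xvar n"
  unfolding generic_nodes_def
proof (intro allI impI)
  fix i j i' j' assume h: "qF ^ j * xvar i = qF ^ j' * xvar i'"
  have e: "xvar i = of_K (q_K ^ j' / q_K ^ j) * xvar i'"
  proof -
    have "xvar i = qF ^ j' * xvar i' / qF ^ j" using qF_nonzero by (simp flip: h)
    then show ?thesis by (simp add: qF_def divide_inverse of_K_hom)
  qed
  then have i: "i = i'" using xvar_ne_scaled by blast
  then have "qF ^ j = qF ^ j'" using h by (simp add: xvar_nonzero)
  then have p: "q_K ^ j = q_K ^ j'" by (simp add: qF_def flip: of_K_power)
  have le_eq: "a = b" if "a \<le> b" "q_K ^ a = q_K ^ b" for a b
  proof -
    have "q_K ^ a * q_K ^ (b - a) = q_K ^ b" using that(1) unfolding power_add[symmetric] by simp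
    then have "q_K ^ (b - a) = 1" using q_K_nonzero that(2) by simp
    then show ?thesis using qt_distinct(4)[of "b - a"] that(1) by simp
  qed
  have "j = j'"
  proof (cases "j \<le> j'")
    case True
    then show ?thesis by (rule le_eq[OF _ p])
  next
    case False
    then have "j' \<le> j" by simp
    then show ?thesis by (rule le_eq[OF _ p[symmetric], symmetric])
  qed
  then show "i = i' \<and> j = j'" using i by simp
qed

text \<open>Reading the product backwards replaces $q^{1-b}\cdot q^r$ by $q^{-s}$ with $s = b - 1 - r$.\<close>

lemma qpoch_reverse:
  assumes "k \<le> b" "y = c * qF powi (1 - int b)"
  shows "qpoch y k = (\<Prod>s\<in>{b - k..<b}. 1 - c / qF ^ s)"
  unfolding qpoch_def
proof (rule prod.reindex_bij_witness[of _ "\<lambda>s. b - 1 - s" "\<lambda>r. b - 1 - r"])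
  fix r assume r: "r \<in> {..<k}"
  have "qF powi (1 - int b) * qF ^ r = qF powi (1 - int b + int r)"
    using qF_nonzero by (simp add: power_int_add)
  also have "1 - int b + int r = - int (b - 1 - r)" using r assms(1) by auto
  also have "qF powi - int (b - 1 - r) = inverse (qF ^ (b - 1 - r))" by (simp add: power_int_minus)
  finally have "y * qF ^ r = c / qF ^ (b - 1 - r)" unfolding assms(2) by (simp add: divide_inverse mult.assoc)
  then show "1 - c / qF ^ (b - 1 - r) = 1 - y * qF ^ r" by simp
qed (use assms in auto)

lemma one_minus_ratio: "xvar j \<noteq> 0 \<Longrightarrow> 1 - c * xvar i / xvar j / qF ^ s = (qF ^ s * xvar j - c * xvar i) / (qF ^ s * xvar j)"
  using qF_nonzero by (simp add: field_simps)

lemma qpoch_shift: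
  assumes "e = int a - int b + 1"
  shows "qpoch (qF powi e * xvar i / xvar j) b = (\<Prod>s<b. (qF ^ s * xvar j - qF ^ a * xvar i) / (qF ^ s * xvar j))"
proof -
  have "e = int a + (1 - int b)" using assms by simp
  then have "qF powi e = qF ^ a * qF powi (1 - int b)"
    using power_int_add[of qF "int a" "1 - int b"] qF_nonzero by simp
  then have "qpoch (qF powi e * xvar i / xvar j) b = (\<Prod>s\<in>{b - b..<b}. 1 - qF ^ a * xvar i / xvar j / qF ^ s)"
    by (intro qpoch_reverse) simp_all
  then show ?thesis by (simp only: one_minus_ratio[OF xvar_nonzero] lessThan_atLeast0 diff_self_eq_0)
qed

text \<open>Both products have denominators $q^s x_j$, which cancel.\<close>

lemma C_coef_eq_cross:
  assumes "\<beta> \<le> \<alpha>"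
  shows "C_coef n \<alpha> \<beta> = cross qF (nodes qF xvar n \<beta>) (nodes qF xvar n \<alpha> - nodes qF xvar n \<beta>)"
  unfolding cross_nodes[OF generic_nodes_qF assms] C_coef_def
proof (rule prod.cong[OF refl], rule prod.cong[OF refl])
  fix i j
  have nz: "qF ^ s * xvar j \<noteq> 0" for s using qF_nonzero xvar_nonzero by simp
  show "qpoch (qF powi (int (\<alpha> i) - int (\<beta> j) + 1) * xvar i / xvar j) (\<beta> j) /
     qpoch (qF powi (int (\<beta> i) - int (\<beta> j) + 1) * xvar i / xvar j) (\<beta> j) =
    (\<Prod>s<\<beta> j. (qF ^ s * xvar j - qF ^ \<alpha> i * xvar i) / (qF ^ s * xvar j - qF ^ \<beta> i * xvar i))"
    unfolding qpoch_shift[OF refl] prod_dividef[symmetric] using nz by (intro prod.cong refl) simp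
qed

lemma prod_node_values: "(\<Prod>z\<in>nodes qF xvar n \<alpha>. z) = qF ^ (\<Sum>i<n. \<alpha> i choose 2) * (\<Prod>i<n. xvar i ^ \<alpha> i)"
proof -
  have e: "(\<Prod>j<a. qF ^ j) = qF ^ (a choose 2)" for a
    by (induction a) (simp_all add: choose_two_Suc power_add numeral_2_eq_2[symmetric], simp add: numeral_2_eq_2)
  show ?thesis
    unfolding prod_nodes[OF generic_nodes_qF, of "\<lambda>z. z"] power_sum prod.distrib e by simp
qed

lemma prod_nodes_diff:
  "prod f (nodes qF xvar n \<alpha> - nodes qF xvar n \<beta>) = (\<Prod>j<n. \<Prod>s\<in>{\<beta> j..<\<alpha> j}. f (qF ^ s * xvar j))"
  unfolding nodes_diff[OF generic_nodes_qF] prod.Sigma[OF finite_lessThan ballI[OF finite_atLeastLessThan]]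
  by (simp only: prod.reindex[OF inj_on_nodes[OF generic_nodes_qF]]) (simp add: split_def comp_def)

text \<open>The subset sum that represents \<open>raised_kernel\<close> in the variables $-1/y_k$.\<close>

definition residue_kernel :: "nat \<Rightarrow> ratfun set \<Rightarrow> ratfun" where
  "residue_kernel n = cross_sum qF (signed_q qF) (monic_scaled tF xvar n) (monic_scaled 1 xvar n)"

text \<open>By \<open>sum_Pow_nodes\<close> the subset sum at the nodes of \<open>\<alpha>\<close> runs over \<open>\<beta> \<le> \<alpha>\<close>. The two \<open>q\<close>-shifted factorials in
the numerator are the polynomials with roots \<open>t * x i\<close> and \<open>x i\<close> at the nodes inside and outside of \<open>\<beta>\<close>, the
denominator is the shifted product at \<open>\<alpha>\<close>.\<close>

lemma b_tilde_eq:
  assumes a: "\<alpha> \<in> multi n"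
  shows "b_tilde n \<alpha> = (- 1) ^ msize n \<alpha> * (residue_kernel n (nodes qF xvar n \<alpha>) * (\<Prod>z\<in>nodes qF xvar n \<alpha>. z) /
    (\<Prod>z\<in>nodes qF xvar n \<alpha>. shifted_prod qF xvar n \<alpha> z))"
proof -
  let ?N = "nodes qF xvar n"
  note g = generic_nodes_qF
  define F where "F = (\<Prod>z\<in>?N \<alpha>. shifted_prod qF xvar n \<alpha> z)"
  have nz: "qF ^ s * xvar j \<noteq> 0" for s j using qF_nonzero xvar_nonzero by simp
  have summand: "(\<Prod>i<n. \<Prod>j<n. qpoch (tF * qF powi (- int (\<beta> j) + 1) * xvar i / xvar j) (\<beta> j) *
           qpoch (qF powi (- int (\<alpha> j) + 1) * xvar i / xvar j) (\<alpha> j - \<beta> j) /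
           qpoch (qF powi (int (\<alpha> i) - int (\<alpha> j) + 1) * xvar i / xvar j) (\<alpha> j)) =
      (\<Prod>z\<in>?N \<beta>. poly (monic_scaled tF xvar n) z) * (\<Prod>z\<in>?N \<alpha> - ?N \<beta>. poly (monic_scaled 1 xvar n) z) / F"
    if le: "\<beta> \<le> \<alpha>" for \<beta>
  proof -
    have lej: "\<beta> j \<le> \<alpha> j" for j using le by (simp add: le_fun_def)
    define d where "d j s = qF ^ s * xvar j" for j s
    have K: "qpoch (tF * qF powi (- int (\<beta> j) + 1) * xvar i / xvar j) (\<beta> j) = (\<Prod>s<\<beta> j. (d j s - tF * xvar i) / d j s)" for i j
    proof -
      have "qpoch (tF * qF powi (- int (\<beta> j) + 1) * xvar i / xvar j) (\<beta> j) = (\<Prod>s\<in>{\<beta> j - \<beta> j..<\<beta> j}. 1 - tF * xvar i / xvar j / qF ^ s)"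
        by (rule qpoch_reverse) simp_all
      then show ?thesis by (simp only: one_minus_ratio[OF xvar_nonzero] lessThan_atLeast0 diff_self_eq_0 d_def)
    qed
    have L: "qpoch (qF powi (- int (\<alpha> j) + 1) * xvar i / xvar j) (\<alpha> j - \<beta> j) = (\<Prod>s\<in>{\<beta> j..<\<alpha> j}. (d j s - 1 * xvar i) / d j s)" for i j
    proof -
      have "qpoch (qF powi (- int (\<alpha> j) + 1) * xvar i / xvar j) (\<alpha> j - \<beta> j) =
         (\<Prod>s\<in>{\<alpha> j - (\<alpha> j - \<beta> j)..<\<alpha> j}. 1 - 1 * xvar i / xvar j / qF ^ s)"
        by (rule qpoch_reverse) simp_all
      then show ?thesis unfolding one_minus_ratio[OF xvar_nonzero] d_def using lej[of j] by simp
    qed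
    have split: "(\<Prod>s<\<alpha> j. h s) = (\<Prod>s<\<beta> j. h s) * (\<Prod>s\<in>{\<beta> j..<\<alpha> j}. h s)" for j and h :: "nat \<Rightarrow> ratfun"
      using prod.atLeastLessThan_concat[of 0 "\<beta> j" "\<alpha> j" h] lej[of j] by (simp add: lessThan_atLeast0)
    have "(\<Prod>s<\<beta> j. (d j s - tF * xvar i) / d j s) * (\<Prod>s\<in>{\<beta> j..<\<alpha> j}. (d j s - 1 * xvar i) / d j s) /
        (\<Prod>s<\<alpha> j. (d j s - qF ^ \<alpha> i * xvar i) / d j s) =
        (\<Prod>s<\<beta> j. d j s - tF * xvar i) * (\<Prod>s\<in>{\<beta> j..<\<alpha> j}. d j s - 1 * xvar i) / (\<Prod>s<\<alpha> j. d j s - qF ^ \<alpha> i * xvar i)" for i j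
    proof -
      have "(\<Prod>s<\<beta> j. d j s) \<noteq> 0" "(\<Prod>s\<in>{\<beta> j..<\<alpha> j}. d j s) \<noteq> 0" using nz by (simp_all add: d_def)
      then show ?thesis unfolding prod_dividef split[of "d j" j] by simp
    qed
    then have "(\<Prod>i<n. \<Prod>j<n. qpoch (tF * qF powi (- int (\<beta> j) + 1) * xvar i / xvar j) (\<beta> j) *
           qpoch (qF powi (- int (\<alpha> j) + 1) * xvar i / xvar j) (\<alpha> j - \<beta> j) /
           qpoch (qF powi (int (\<alpha> i) - int (\<alpha> j) + 1) * xvar i / xvar j) (\<alpha> j)) =
       (\<Prod>i<n. \<Prod>j<n. (\<Prod>s<\<beta> j. d j s - tF * xvar i) * (\<Prod>s\<in>{\<beta> j..<\<alpha> j}. d j s - 1 * xvar i) / (\<Prod>s<\<alpha> j. d j s - qF ^ \<alpha> i * xvar i))"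
      unfolding K L qpoch_shift[OF refl] d_def by simp
    also have "\<dots> = (\<Prod>j<n. \<Prod>s<\<beta> j. \<Prod>i<n. d j s - tF * xvar i) * (\<Prod>j<n. \<Prod>s\<in>{\<beta> j..<\<alpha> j}. \<Prod>i<n. d j s - 1 * xvar i) /
       (\<Prod>j<n. \<Prod>s<\<alpha> j. \<Prod>i<n. d j s - qF ^ \<alpha> i * xvar i)"
    proof -
      have sw: "(\<Prod>i<n. \<Prod>j<n. \<Prod>s\<in>A j. h i j s) = (\<Prod>j<n. \<Prod>s\<in>A j. \<Prod>i<n. h i j s)" for A and h :: "nat \<Rightarrow> nat \<Rightarrow> nat \<Rightarrow> ratfun"
      proof -
        have "(\<Prod>i<n. \<Prod>j<n. \<Prod>s\<in>A j. h i j s) = (\<Prod>j<n. \<Prod>i<n. \<Prod>s\<in>A j. h i j s)" by (rule prod.swap)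
        also have "\<dots> = (\<Prod>j<n. \<Prod>s\<in>A j. \<Prod>i<n. h i j s)" by (rule prod.cong[OF refl]) (rule prod.swap)
        finally show ?thesis .
      qed
      show ?thesis unfolding prod_dividef prod.distrib sw ..
    qed
    also have "\<dots> = (\<Prod>z\<in>?N \<beta>. poly (monic_scaled tF xvar n) z) * (\<Prod>z\<in>?N \<alpha> - ?N \<beta>. poly (monic_scaled 1 xvar n) z) / F"
      unfolding F_def prod_nodes_diff prod_nodes[OF g] monic_scaled(3) shifted_prod_def d_def ..
    finally show ?thesis .
  qed
  have "residue_kernel n (?N \<alpha>) = (\<Sum>K\<in>Pow (?N \<alpha>). (signed_q qF (card K) * (\<Prod>z\<in>K. poly (monic_scaled tF xvar n) z) *
        (\<Prod>z\<in>?N \<alpha> - K. poly (monic_scaled 1 xvar n) z)) * cross qF K (?N \<alpha> - K))"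
    unfolding residue_kernel_def cross_sum_def by (rule sum.cong[OF refl]) (simp only: mult_ac)
  also have "\<dots> = (\<Sum>\<beta> | \<beta> \<in> multi n \<and> \<beta> \<le> \<alpha>. (signed_q qF (card (?N \<beta>)) * (\<Prod>z\<in>?N \<beta>. poly (monic_scaled tF xvar n) z) *
        (\<Prod>z\<in>?N \<alpha> - ?N \<beta>. poly (monic_scaled 1 xvar n) z)) * cross qF (?N \<beta>) (?N \<alpha> - ?N \<beta>))"
    by (rule sum_Pow_nodes[OF g])
  finally have R0: "residue_kernel n (?N \<alpha>) = (\<Sum>\<beta> | \<beta> \<in> multi n \<and> \<beta> \<le> \<alpha>. (signed_q qF (card (?N \<beta>)) * (\<Prod>z\<in>?N \<beta>. poly (monic_scaled tF xvar n) z) *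
        (\<Prod>z\<in>?N \<alpha> - ?N \<beta>. poly (monic_scaled 1 xvar n) z)) * cross qF (?N \<beta>) (?N \<alpha> - ?N \<beta>))" .
  have R: "residue_kernel n (?N \<alpha>) / F = (\<Sum>\<beta> | \<beta> \<in> multi n \<and> \<beta> \<le> \<alpha>. 
       (-1) ^ msize n \<beta> * qF ^ (msize n \<beta> choose 2) * C_coef n \<alpha> \<beta> *
        ((\<Prod>z\<in>?N \<beta>. poly (monic_scaled tF xvar n) z) * (\<Prod>z\<in>?N \<alpha> - ?N \<beta>. poly (monic_scaled 1 xvar n) z) / F))"
    unfolding R0 sum_divide_distrib
  proof (rule sum.cong[OF refl])
    fix \<beta> assume b: "\<beta> \<in> {\<beta>. \<beta> \<in> multi n \<and> \<beta> \<le> \<alpha>}"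
    then have le: "\<beta> \<le> \<alpha>" by simp
    show "(signed_q qF (card (?N \<beta>)) * (\<Prod>z\<in>?N \<beta>. poly (monic_scaled tF xvar n) z) *
        (\<Prod>z\<in>?N \<alpha> - ?N \<beta>. poly (monic_scaled 1 xvar n) z)) * cross qF (?N \<beta>) (?N \<alpha> - ?N \<beta>) / F =
       (-1) ^ msize n \<beta> * qF ^ (msize n \<beta> choose 2) * C_coef n \<alpha> \<beta> *
        ((\<Prod>z\<in>?N \<beta>. poly (monic_scaled tF xvar n) z) * (\<Prod>z\<in>?N \<alpha> - ?N \<beta>. poly (monic_scaled 1 xvar n) z) / F)"
      unfolding C_coef_eq_cross[OF le] card_nodes[OF g] signed_q_def msize_def by (simp only: mult_ac times_divide_eq_right)
  qed
  have "b_tilde n \<alpha> = (- 1) ^ msize n \<alpha> * (\<Prod>z\<in>?N \<alpha>. z) * (residue_kernel n (?N \<alpha>) / F)"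
    unfolding b_tilde_def R prod_node_values
    using summand by (simp add: mult.assoc)
  then show ?thesis unfolding F_def by (simp add: mult_ac)
qed

text \<open>As $1 + c\,x_i y$ vanishes where $-1/y = c\,x_i$, the kernel is a product of differences in these points.\<close>

definition dual_point :: "nat \<Rightarrow> ratfun" where
  "dual_point j = - inverse (xvar j)"

lemma dual_point_nonzero: "dual_point j \<noteq> 0" by (simp add: dual_point_def)

lemma inj_on_dual_point: "inj_on dual_point A"
proof (rule inj_onI)
  fix i j assume "dual_point i = dual_point j"
  then have "xvar i = xvar j" by (simp add: dual_point_def)
  then show "i = j" by (rule inj_onD[OF xvar_inj[of UNIV]]) simp_all
qed

lemma one_plus_dual: "1 + c * xvar i * xvar j = (dual_point j - c * xvar i) / dual_point j"
  by (simp add: dual_point_def field_simps)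

lemma scale_kernelF:
  assumes nz: "\<And>i. s i \<noteq> 0"
  shows "scale s (kernelF n m) =
    (\<Prod>j\<in>{n..<n+m}. \<Prod>i<n. dual_point j - of_K (s i * s j) * xvar i) / (\<Prod>j\<in>{n..<n+m}. dual_point j) ^ n"
proof -
  have "scale s (kernelF n m) = (\<Prod>i<n. \<Prod>j\<in>{n..<n+m}. (dual_point j - of_K (s i * s j) * xvar i) / dual_point j)"
    unfolding kernelF_def scale_prod[OF nz] one_plus_dual[symmetric]
    by (simp add: scale_add[OF nz] scale_mult[OF nz] scale_1[OF nz] scale_xvar[OF nz] of_K_mult mult_ac)
  also have "\<dots> = (\<Prod>i<n. \<Prod>j\<in>{n..<n+m}. dual_point j - of_K (s i * s j) * xvar i) / (\<Prod>j\<in>{n..<n+m}. dual_point j) ^ n"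
    unfolding prod_dividef by simp
  finally show ?thesis unfolding prod.swap[of _ "{n..<n+m}"] .
qed

abbreviation "dual_points n m \<equiv> dual_point ` {n..<n+m}"

lemma prod_dual_points: "prod f (dual_points n m) = (\<Prod>j\<in>{n..<n+m}. f (dual_point j))"
  by (simp add: prod.reindex[OF inj_on_dual_point])

lemma phi_kernelF:
  "phi n \<alpha> (kernelF n m) = phi_kernel qF xvar n \<alpha> (dual_points n m) / (\<Prod>z\<in>dual_points n m. z) ^ n"
  unfolding phi_def phi_kernel_def sum_divide_distrib
proof (rule sum.cong[OF refl])
  fix \<beta> assume "\<beta> \<in> {\<beta>. \<beta> \<in> multi n \<and> \<beta> \<le> \<alpha>}"
  then have le: "\<beta> \<le> \<alpha>" by simp
  have "qshifts n \<beta> (kernelF n m) = (\<Prod>j\<in>{n..<n+m}. \<Prod>i<n. dual_point j - of_K ((if i < n then q_K ^ \<beta> i else 1) * (if j < n then q_K ^ \<beta> j else 1)) * xvar i) /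
      (\<Prod>j\<in>{n..<n+m}. dual_point j) ^ n"
    unfolding qshifts_eq_scale by (rule scale_kernelF, rule qshift_scale_nonzero)
  also have "(\<Prod>j\<in>{n..<n+m}. \<Prod>i<n. dual_point j - of_K ((if i < n then q_K ^ \<beta> i else 1) * (if j < n then q_K ^ \<beta> j else 1)) * xvar i) =
      (\<Prod>j\<in>{n..<n+m}. shifted_prod qF xvar n \<beta> (dual_point j))"
    unfolding shifted_prod_def by (intro prod.cong refl) (simp_all add: qF_def of_K_power)
  finally have q: "qshifts n \<beta> (kernelF n m) = (\<Prod>z\<in>dual_points n m. shifted_prod qF xvar n \<beta> z) / (\<Prod>z\<in>dual_points n m. z) ^ n"
    unfolding prod_dual_points .
  show "(- 1) ^ (msize n \<alpha> - msize n \<beta>) * qF ^ ((msize n \<alpha> - msize n \<beta> + 1) choose 2) * C_coef n \<alpha> \<beta> * qshifts n \<beta> (kernelF n m) =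
    (- 1) ^ (msize n \<alpha> - msize n \<beta>) * qF ^ ((msize n \<alpha> - msize n \<beta> + 1) choose 2) *
     cross qF (nodes qF xvar n \<beta>) (nodes qF xvar n \<alpha> - nodes qF xvar n \<beta>) * (\<Prod>z\<in>dual_points n m. shifted_prod qF xvar n \<beta> z) /
     (\<Prod>z\<in>dual_points n m. z) ^ n"
    unfolding q C_coef_eq_cross[OF le] times_divide_eq_right ..
qed

lemma cross_dual_points:
  assumes "L \<subseteq> {n..<n+m}"
  shows "cross qF (dual_point ` L) (dual_points n m - dual_point ` L) = mac_coeff {n..<n+m} q_K L"
proof -
  have e: "dual_points n m - dual_point ` L = dual_point ` ({n..<n+m} - L)"
    using inj_on_image_set_diff[OF inj_on_dual_point[of UNIV], of "{n..<n+m}" L] by simp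
  have "(dual_point i - qF * dual_point j) / (dual_point i - dual_point j) = cpl (of_K q_K) (xvar i) (xvar j)" for i j
  proof -
    have "dual_point i - c * dual_point j = - inverse (xvar i) * (1 - c * xvar i / xvar j)" for c
      by (simp add: dual_point_def field_simps)
    from this[of qF] this[of 1] show ?thesis unfolding cpl_def by (simp add: qF_def)
  qed
  then show ?thesis unfolding e cross_def mac_coeff_def by (simp add: prod.reindex[OF inj_on_dual_point])
qed

text \<open>Passing from $y_k$ to $z_k = -1/y_k$ turns the couplings of the Macdonald operators into cross factors, since
$y_i/y_j = z_j/z_i$, and the sets of shifted variables into the subsets of the points.\<close>

lemma raised_kernel_eq:
  "raised_kernel n m = (- 1) ^ m * (\<Prod>z\<in>dual_points n m. z) *
     (residue_kernel n (dual_points n m) / (\<Prod>z\<in>dual_points n m. z) ^ n)"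
proof -
  let ?Y = "{n..<n+m}" and ?Z = "dual_points n m"
  let ?d = "(\<Prod>z\<in>dual_points n m. z) ^ n"
  let ?a = "poly (monic_scaled tF xvar n)" and ?b = "poly (monic_scaled 1 xvar n)"
  let ?t = "\<lambda>L. signed_q qF (card L) * mac_coeff ?Y q_K L * scale (sub_scale L t_K) (kernelF n m)"
  have fY: "finite ?Y" by simp
  have "(\<Sum>r\<le>m. (- 1) ^ r * Dr ?Y t_K q_K r (kernelF n m)) = (\<Sum>r\<in>{..m}. \<Sum>L | L \<in> Pow ?Y \<and> card L = r. ?t L)"
    unfolding Dr_def sum_distrib_left
    by (intro sum.cong) (auto simp: signed_q_def qF_def of_K_power)
  also have "\<dots> = (\<Sum>L\<in>Pow ?Y. ?t L)"
    by (rule sum.group) (use card_mono[OF fY] in auto)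
  also have "\<dots> = (\<Sum>L\<in>Pow ?Y. signed_q qF (card (dual_point ` L)) * cross qF (dual_point ` L) (?Z - dual_point ` L) *
      (\<Prod>z\<in>dual_point ` L. ?a z) * (\<Prod>w\<in>?Z - dual_point ` L. ?b w) / ?d)"
  proof (rule sum.cong[OF refl])
    fix L assume "L \<in> Pow ?Y"
    then have L: "L \<subseteq> ?Y" by simp
    have e: "?Z - dual_point ` L = dual_point ` (?Y - L)"
      using inj_on_image_set_diff[OF inj_on_dual_point[of UNIV], of ?Y L] by simp
    have "scale (sub_scale L t_K) (kernelF n m) =
      (\<Prod>j\<in>?Y. \<Prod>i<n. dual_point j - of_K (sub_scale L t_K i * sub_scale L t_K j) * xvar i) / (\<Prod>j\<in>?Y. dual_point j) ^ n"
      by (rule scale_kernelF) (rule sub_scale_nonzero[OF t_K_nonzero])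
    also have "(\<Prod>j\<in>?Y. \<Prod>i<n. dual_point j - of_K (sub_scale L t_K i * sub_scale L t_K j) * xvar i) =
        (\<Prod>j\<in>?Y. if j \<in> L then ?a (dual_point j) else ?b (dual_point j))"
    proof (rule prod.cong[OF refl])
      fix j
      have "(\<Prod>i<n. dual_point j - of_K (sub_scale L t_K i * sub_scale L t_K j) * xvar i) =
          (\<Prod>i<n. dual_point j - (if j \<in> L then tF else 1) * xvar i)"
      proof (rule prod.cong[OF refl])
        fix i assume "i \<in> {..<n}"
        then have "i \<notin> L" using L by auto
        then show "dual_point j - of_K (sub_scale L t_K i * sub_scale L t_K j) * xvar i = dual_point j - (if j \<in> L then tF else 1) * xvar i"
          by (simp add: sub_scale_def tF_def)
      qed
      then show "(\<Prod>i<n. dual_point j - of_K (sub_scale L t_K i * sub_scale L t_K j) * xvar i) = (if j \<in> L then ?a (dual_point j) else ?b (dual_point j))"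
        by (simp add: monic_scaled(3))
    qed
    also have "\<dots> = (\<Prod>j\<in>L. ?a (dual_point j)) * (\<Prod>j\<in>?Y - L. ?b (dual_point j))"
      using L by (simp add: prod.If_cases Int_absorb1 Diff_eq)
    finally have s: "scale (sub_scale L t_K) (kernelF n m) = (\<Prod>z\<in>dual_point ` L. ?a z) * (\<Prod>w\<in>?Z - dual_point ` L. ?b w) / ?d"
      unfolding e by (simp add: prod.reindex[OF inj_on_dual_point])
    show "?t L = signed_q qF (card (dual_point ` L)) * cross qF (dual_point ` L) (?Z - dual_point ` L) *
      (\<Prod>z\<in>dual_point ` L. ?a z) * (\<Prod>w\<in>?Z - dual_point ` L. ?b w) / ?d"
      unfolding s cross_dual_points[OF L] card_image[OF inj_on_dual_point] by (simp add: mult.assoc)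
  qed
  also have "\<dots> = residue_kernel n ?Z / ?d"
    unfolding residue_kernel_def cross_sum_def sum_divide_distrib[symmetric] image_Pow_surj[OF refl, symmetric]
    by (simp add: sum.reindex[OF inj_on_image_Pow[OF inj_on_dual_point]])
  finally have S: "(\<Sum>r\<le>m. (- 1) ^ r * Dr ?Y t_K q_K r (kernelF n m)) = residue_kernel n ?Z / ?d" .
  have "inverse (yprod n m) = (\<Prod>j\<in>?Y. - 1 * dual_point j)"
  proof -
    have "yprod n m = (\<Prod>j\<in>?Y. xvar j)"
      unfolding yprod_def by (rule prod_atLeast_shift[symmetric])
    then show ?thesis using prod_inversef[of xvar ?Y] by (simp add: dual_point_def comp_def)
  qed
  also have "\<dots> = (- 1) ^ m * (\<Prod>z\<in>?Z. z)"
    unfolding prod.distrib prod_dual_points by simp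
  finally show ?thesis unfolding raised_kernel_def S by simp
qed

definition explicit_op :: "nat \<Rightarrow> nat \<Rightarrow> ratfun \<Rightarrow> ratfun" where
  "explicit_op n m f = (\<Sum>\<alpha> | \<alpha> \<in> multi n \<and> msize n \<alpha> = m. b_tilde n \<alpha> * phi n \<alpha> f)"

lemma shifted_node_not_dual:
  assumes "i < n"
  shows "qF ^ j * xvar i \<notin> dual_points n m"
proof
  assume "qF ^ j * xvar i \<in> dual_points n m"
  then obtain k where k: "n \<le> k" "qF ^ j * xvar i = dual_point k" by auto
  have nz: "sub_scale {i} (q_K ^ j) l \<noteq> 0" for l by (rule sub_scale_nonzero) (simp add: q_K_nonzero)
  have "scale (sub_scale {i} (q_K ^ j)) (1 + xvar i * xvar k) = 1 + qF ^ j * xvar i * xvar k"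
    using k(1) assms unfolding scale_add[OF nz] scale_mult[OF nz] scale_1[OF nz] scale_xvar[OF nz]
    by (simp add: sub_scale_def qF_def of_K_power)
  also have "\<dots> = 0" unfolding k(2) by (simp add: dual_point_def)
  finally have "scale (sub_scale {i} (q_K ^ j)) (1 + xvar i * xvar k) = 0" .
  then have "1 + xvar i * xvar k = 0" unfolding scale_eq_0_iff[OF nz] .
  then show False using one_plus_xx_nonzero[of i k] by contradiction
qed

text \<open>This is \<open>interpolation_formula\<close> at the points $-1/y_k$, up to sign multiplied by a power of their product.\<close>

theorem explicit_op_kernel:
  assumes n: "n \<ge> 1"
  shows "explicit_op n m (kernelF n m) = raised_kernel n m"
proof -
  let ?Z = "dual_points n m"
  let ?p = "\<Prod>z\<in>?Z. z"
  let ?A = "{\<alpha>. \<alpha> \<in> multi n \<and> msize n \<alpha> = m}"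
  let ?k = "\<lambda>\<alpha>. residue_kernel n (nodes qF xvar n \<alpha>) * (\<Prod>z\<in>nodes qF xvar n \<alpha>. z) / (\<Prod>z\<in>nodes qF xvar n \<alpha>. shifted_prod qF xvar n \<alpha> z)"
  have p0: "?p \<noteq> 0" by (simp add: prod_dual_points dual_point_nonzero)
  have G: "residue_kernel n ?Z = (\<Sum>\<alpha>\<in>?A. ?k \<alpha> * (phi_kernel qF xvar n \<alpha> ?Z / ?p))"
    unfolding residue_kernel_def
  proof (rule interpolation_formula[OF generic_nodes_qF n qF_nonzero])
    show "card ?Z = m" by (simp add: card_image[OF inj_on_dual_point])
    show "0 \<notin> ?Z"
    proof
      assume "0 \<in> ?Z"
      then obtain j where "0 = dual_point j" by blast
      then show False using dual_point_nonzero[of j] by simp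
    qed
  qed (simp_all add: shifted_node_not_dual)
  have "explicit_op n m (kernelF n m) = (\<Sum>\<alpha>\<in>?A. (- 1) ^ m * ?p / ?p ^ n * (?k \<alpha> * (phi_kernel qF xvar n \<alpha> ?Z / ?p)))"
    unfolding explicit_op_def
  proof (rule sum.cong[OF refl])
    fix \<alpha> assume a: "\<alpha> \<in> ?A"
    then have am: "\<alpha> \<in> multi n" "msize n \<alpha> = m" by auto
    show "b_tilde n \<alpha> * phi n \<alpha> (kernelF n m) = (- 1) ^ m * ?p / ?p ^ n * (?k \<alpha> * (phi_kernel qF xvar n \<alpha> ?Z / ?p))"
      unfolding b_tilde_eq[OF am(1)] phi_kernelF am(2) using p0 by (simp add: divide_inverse mult_ac)
  qed
  also have "\<dots> = (- 1) ^ m * ?p / ?p ^ n * residue_kernel n ?Z" unfolding G sum_distrib_left ..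
  finally show ?thesis unfolding raised_kernel_eq by (simp add: mult_ac)
qed

section \<open>Normalization, uniqueness and the theorem\<close>

lemma partition_support:
  assumes "is_partition \<nu>"
  shows "{i. \<nu> i \<noteq> 0} = {..<len \<nu>}"
  unfolding len_def
proof (rule down_closed_eq_lessThan)
  show "finite {i. \<nu> i \<noteq> 0}" using assms by (simp add: is_partition_def)
  fix i j assume "i \<in> {i. \<nu> i \<noteq> 0}" "j \<le> i"
  moreover have "\<nu> i \<le> \<nu> j" using assms \<open>j \<le> i\<close> by (simp add: is_partition_def antimono_def)
  ultimately show "j \<in> {i. \<nu> i \<noteq> 0}" by auto
qed

lemma partition_in_parts:
  assumes "is_partition \<nu>" "len \<nu> \<le> n" "\<nu> 0 \<le> m"
  shows "lookup (Abs_poly_mapping \<nu>) = \<nu>" "Abs_poly_mapping \<nu> \<in> parts n m"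
proof -
  show l: "lookup (Abs_poly_mapping \<nu>) = \<nu>"
    using assms(1) by (intro lookup_Abs_poly_mapping) (simp add: is_partition_def)
  have "keys (Abs_poly_mapping \<nu>) \<subseteq> {..<n}"
  proof
    fix i assume "i \<in> keys (Abs_poly_mapping \<nu>)"
    then have "i \<in> {i. \<nu> i \<noteq> 0}" by (simp add: in_keys_iff l)
    then show "i \<in> {..<n}" unfolding partition_support[OF assms(1)] using assms(2) by simp
  qed
  then show "Abs_poly_mapping \<nu> \<in> parts n m"
    using assms by (simp add: parts_def l is_partition_def)
qed

lemma short_iff:
  assumes "is_partition \<nu>" "len \<nu> \<le> n" "\<nu> 0 \<le> m" "n \<ge> 1"
  shows "Abs_poly_mapping \<nu> \<in> short_parts n m \<longleftrightarrow> len \<nu> < n"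
proof -
  have "\<nu> (n - 1) \<noteq> 0 \<longleftrightarrow> n - 1 < len \<nu>" using partition_support[OF assms(1)] by auto
  then show ?thesis using partition_in_parts[OF assms(1-3)] assms(2,4) by (auto simp: short_parts_def)
qed

lemma parts_is_partition:
  assumes "\<rho> \<in> parts n m"
  shows "is_partition (lookup \<rho>)" "len (lookup \<rho>) \<le> n" "lookup \<rho> 0 \<le> m"
proof -
  have s: "{i. lookup \<rho> i \<noteq> 0} \<subseteq> {..<n}"
  proof
    fix i assume "i \<in> {i. lookup \<rho> i \<noteq> 0}"
    then show "i \<in> {..<n}" using part_zero_beyond[OF assms, of i] by (cases "n \<le> i") auto
  qed
  then show "is_partition (lookup \<rho>)" using assms finite_subset[OF s] by (simp add: is_partition_def parts_def)
  show "len (lookup \<rho>) \<le> n" unfolding len_def using card_mono[OF _ s] by simp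
  show "lookup \<rho> 0 \<le> m" using assms by (simp add: parts_def)
qed

lemma boxes_Sigma: "boxes \<nu> = (SIGMA i:{i. \<nu> i \<noteq> 0}. {..<\<nu> i})"
  by (auto simp: boxes_def)

lemma finite_boxes: "is_partition \<nu> \<Longrightarrow> finite (boxes \<nu>)"
  unfolding boxes_Sigma is_partition_def by auto

text \<open>The normalizing constant \<open>c_norm\<close> as an element of the base field.\<close>

definition c_normK :: "(nat \<Rightarrow> nat) \<Rightarrow> K" where
  "c_normK \<nu> = (\<Prod>s\<in>boxes \<nu>. 1 - q_K ^ arm \<nu> s * t_K ^ (leg \<nu> s + 1))"

lemma c_norm_eq: "c_norm \<nu> = of_K (c_normK \<nu>)"
  by (simp add: c_norm_def c_normK_def of_K_hom qF_def tF_def)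

lemma c_normK_nonzero:
  assumes "is_partition \<nu>"
  shows "c_normK \<nu> \<noteq> 0"
proof -
  have "1 - q_K ^ a * t_K ^ (l + 1) \<noteq> 0" for a l
  proof
    assume "1 - q_K ^ a * t_K ^ (l + 1) = 0"
    then have "q_K ^ a * t_K ^ (l + 1) = q_K ^ 0 * t_K ^ 0" by simp
    then have "l + 1 = 0" using qt_power_inj by blast
    then show False by simp
  qed
  then show ?thesis unfolding c_normK_def using finite_boxes[OF assms] by simp
qed

text \<open>The boxes of $(m,\nu)$ are those of the first row and those of \<open>\<nu>\<close> moved down by one, with arms and legs
unchanged. In the first row the arm of column \<open>k\<close> is \<open>m - 1 - k\<close> and the leg is the conjugate part of \<open>\<nu>\<close>.\<close>

lemma c_normK_cons:
  assumes nu: "is_partition \<nu>"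
  shows "c_normK (case_nat m \<nu>) = c_normK \<nu> * (\<Prod>k<m. 1 - t_K ^ Suc (card {i. k < \<nu> i}) * q_K ^ (m - 1 - k))"
proof -
  let ?\<mu> = "case_nat m \<nu>" and ?s = "\<lambda>(i, j). (Suc i, j :: nat)"
  have B: "boxes ?\<mu> = Pair 0 ` {..<m} \<union> ?s ` boxes \<nu>" (is "?A = ?C")
  proof (intro set_eqI)
    fix s :: "nat \<times> nat"
    obtain i j where s: "s = (i, j)" by (cases s)
    show "s \<in> ?A \<longleftrightarrow> s \<in> ?C" unfolding s by (cases i) (auto simp: boxes_def image_iff)
  qed
  have a0: "arm ?\<mu> (0, k) = m - 1 - k" for k
  proof -
    have "{j'. k < j' \<and> j' < m} = {Suc k..<m}" by auto
    then show ?thesis by (simp add: arm_def boxes_def)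
  qed
  have l0: "leg ?\<mu> (0, k) = card {i. k < \<nu> i}" for k
  proof -
    have "{i'. 0 < i' \<and> k < ?\<mu> i'} = Suc ` {i. k < \<nu> i}"
    proof (intro set_eqI)
      fix i show "i \<in> {i'. 0 < i' \<and> k < ?\<mu> i'} \<longleftrightarrow> i \<in> Suc ` {i. k < \<nu> i}" by (cases i) auto
    qed
    then show ?thesis by (simp add: leg_def boxes_def card_image)
  qed
  have aS: "arm ?\<mu> (Suc i, k) = arm \<nu> (i, k)" for i k by (simp add: arm_def boxes_def)
  have lS: "leg ?\<mu> (Suc i, k) = leg \<nu> (i, k)" for i k
  proof -
    have "{i'. Suc i < i' \<and> k < ?\<mu> i'} = Suc ` {i'. i < i' \<and> k < \<nu> i'}"
    proof (intro set_eqI)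
      fix j show "j \<in> {i'. Suc i < i' \<and> k < ?\<mu> i'} \<longleftrightarrow> j \<in> Suc ` {i'. i < i' \<and> k < \<nu> i'}" by (cases j) auto
    qed
    then show ?thesis by (simp add: leg_def boxes_def card_image)
  qed
  have fin: "finite (Pair (0::nat) ` {..<m})" "finite (?s ` boxes \<nu>)" using finite_boxes[OF nu] by auto
  have disj: "Pair 0 ` {..<m} \<inter> ?s ` boxes \<nu> = {}" by auto
  have inj: "inj_on ?s (boxes \<nu>)" by (auto intro!: inj_onI)
  have "(\<Prod>s\<in>Pair 0 ` {..<m}. 1 - q_K ^ arm ?\<mu> s * t_K ^ (leg ?\<mu> s + 1)) =
      (\<Prod>k<m. 1 - t_K ^ Suc (card {i. k < \<nu> i}) * q_K ^ (m - 1 - k))"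
    by (subst prod.reindex) (auto intro: inj_onI simp: a0 l0 mult_ac)
  moreover have "(\<Prod>s\<in>?s ` boxes \<nu>. 1 - q_K ^ arm ?\<mu> s * t_K ^ (leg ?\<mu> s + 1)) = c_normK \<nu>"
    unfolding c_normK_def by (subst prod.reindex[OF inj]) (auto intro!: prod.cong simp: aS lS split: prod.split)
  ultimately show ?thesis
    unfolding c_normK_def[of ?\<mu>] B prod.union_disjoint[OF fin disj] by (simp only: mult.commute)
qed

lemma raise_norm_part_cons:
  assumes n: "n \<ge> 1" and r: "\<rho> \<in> short_parts n m"
  shows "c_normK (case_nat m (lookup \<rho>)) = c_normK (lookup \<rho>) * raise_norm n m (part_cons m \<rho>)"
proof -
  have rp: "\<rho> \<in> parts n m" using r by (simp add: short_parts_def)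
  have "card {i. k < lookup \<rho> i} = conj_part n \<rho> k" for k
  proof -
    have "{i. k < lookup \<rho> i} = {i\<in>{..<n}. k < lookup \<rho> i}"
      using part_zero_beyond[OF rp] by (auto simp: not_le[symmetric])
    then show ?thesis by (simp add: conj_part_def)
  qed
  then have "raise_norm n m (part_cons m \<rho>) = (\<Prod>k<m. 1 - t_K ^ Suc (card {i. k < lookup \<rho> i}) * q_K ^ (m - 1 - k))"
    unfolding raise_norm_def by (intro prod.cong refl) (simp add: conj_part_cons[OF n r])
  then show ?thesis unfolding c_normK_cons[OF parts_is_partition(1)[OF rp]] by simp
qed

text \<open>The expansion of the kernel with the shift acting on \<open>x\<close> only. The \<open>y k\<close> may themselves contain
\<open>x\<close>; therefore the inverse substitution is applied to them first.\<close>

lemma qcomb_kernel: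
  fixes y :: "nat \<Rightarrow> ratfun"
  shows "(\<Sum>\<kappa>\<in>box n m. (\<Prod>k<m. y k ^ \<kappa> k) * qshifts n \<gamma> (of_mpol (elem_prod n m \<kappa>))) =
    (\<Prod>k<m. \<Prod>i<n. 1 + qF ^ \<gamma> i * xvar i * y k)"
proof -
  define s where "s = (\<lambda>i. if i < n then q_K ^ \<gamma> i else 1)"
  have nz: "s i \<noteq> 0" for i by (simp add: s_def q_K_nonzero)
  have nz': "inverse (s i) \<noteq> 0" for i using nz by simp
  \<comment> \<open>After the shift these become the given \<open>y k\<close>.\<close>
  define y' where "y' k = scale (\<lambda>i. inverse (s i)) (y k)" for k
  have y: "scale s (y' k) = y k" for k
    unfolding y'_def scale_scale[OF nz nz'] using nz by simp
  have q: "qshifts n \<gamma> f = scale s f" for f by (simp add: qshifts_eq_scale s_def)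
  have "scale s (\<Prod>k<m. \<Prod>i<n. 1 + xvar i * y' k) = scale s (\<Sum>\<kappa>\<in>box n m. (\<Prod>k<m. y' k ^ \<kappa> k) * of_mpol (elem_prod n m \<kappa>))"
    unfolding sum_PiE_kernel ..
  then have "(\<Prod>k<m. \<Prod>i<n. 1 + of_K (s i) * xvar i * y k) = (\<Sum>\<kappa>\<in>box n m. (\<Prod>k<m. y k ^ \<kappa> k) * scale s (of_mpol (elem_prod n m \<kappa>)))"
    unfolding scale_prod[OF nz] scale_sum[OF nz] scale_mult[OF nz] scale_add[OF nz] scale_1[OF nz] scale_xvar[OF nz] scale_power[OF nz] y .
  then show ?thesis unfolding q by (simp add: s_def qF_def of_K_power)
qed

text \<open>Specialise the kernel at $y = -1/z$ for the nodes \<open>z\<close> of some \<open>\<delta>\<close> of maximal size with \<open>d \<delta> \<noteq> 0\<close>, and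
at \<open>y = 0\<close> for the remaining variables. All terms with \<open>\<not> \<delta> \<le> \<gamma>\<close> vanish, and by maximality only
\<open>\<gamma> = \<delta>\<close> is left.\<close>

lemma qcomb_zero:
  assumes fin: "finite G" and G: "\<And>\<gamma>. \<gamma> \<in> G \<Longrightarrow> \<gamma> \<in> multi n \<and> msize n \<gamma> \<le> m"
    and z: "\<And>\<kappa>. \<kappa> \<in> box n m \<Longrightarrow> qcomb n G d (of_mpol (elem_prod n m \<kappa>)) = 0"
    and g: "\<gamma>0 \<in> G"
  shows "d \<gamma>0 = 0"
proof (rule ccontr)
  assume "d \<gamma>0 \<noteq> 0"
  let ?S = "{\<gamma>\<in>G. d \<gamma> \<noteq> 0}"
  have S: "finite ?S" "?S \<noteq> {}" using fin g \<open>d \<gamma>0 \<noteq> 0\<close> by auto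
  have "Max (msize n ` ?S) \<in> msize n ` ?S" using S by (intro Max_in) auto
  then obtain \<delta> where "\<delta> \<in> ?S" "msize n \<delta> = Max (msize n ` ?S)" by auto
  moreover have "msize n \<gamma> \<le> Max (msize n ` ?S)" if "\<gamma> \<in> ?S" for \<gamma> using S(1) that by simp
  ultimately have d: "\<delta> \<in> G" "d \<delta> \<noteq> 0" and max: "\<And>\<gamma>. \<gamma> \<in> ?S \<Longrightarrow> msize n \<gamma> \<le> msize n \<delta>" by auto
  note dm = G[OF d(1)]
  let ?N = "nodes qF xvar n \<delta>"
  have cN: "card ?N = msize n \<delta>" unfolding msize_def by (rule card_nodes[OF generic_nodes_qF])
  obtain h where h: "bij_betw h {0..<card ?N} ?N" using ex_bij_betw_nat_finite[OF finite_nodes] by blast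
  have N0: "z \<noteq> 0" if "z \<in> ?N" for z using that qF_nonzero by (auto simp: nodes_def)
  \<comment> \<open>There may be fewer than \<open>m\<close> nodes; a zero \<open>y k\<close> contributes the factor \<open>1\<close>.\<close>
  define y where "y k = (if k < card ?N then - inverse (h k) else 0)" for k
  have ev: "(\<Prod>k<m. \<Prod>i<n. 1 + qF ^ \<gamma> i * xvar i * y k) = (\<Prod>z\<in>?N. shifted_prod qF xvar n \<gamma> z) / (\<Prod>z\<in>?N. z) ^ n" for \<gamma>
  proof -
    have "(\<Prod>k<m. \<Prod>i<n. 1 + qF ^ \<gamma> i * xvar i * y k) = (\<Prod>k\<in>{0..<card ?N}. \<Prod>i<n. 1 + qF ^ \<gamma> i * xvar i * - inverse (h k))"
      by (rule prod.mono_neutral_cong_right) (use cN dm in \<open>auto simp: y_def\<close>)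
    also have "\<dots> = (\<Prod>z\<in>?N. \<Prod>i<n. 1 + qF ^ \<gamma> i * xvar i * - inverse z)"
      by (rule prod.reindex_bij_betw[OF h])
    also have "\<dots> = (\<Prod>z\<in>?N. shifted_prod qF xvar n \<gamma> z / z ^ n)"
    proof (rule prod.cong[OF refl])
      fix z assume "z \<in> ?N"
      then have "z \<noteq> 0" by (rule N0)
      then have "1 + c * - inverse z = (z - c) / z" for c by (simp add: field_simps)
      then show "(\<Prod>i<n. 1 + qF ^ \<gamma> i * xvar i * - inverse z) = shifted_prod qF xvar n \<gamma> z / z ^ n"
        by (simp add: shifted_prod_def prod_dividef)
    qed
    finally show ?thesis by (simp add: prod_dividef prod_power_distrib)
  qed
  have "0 = (\<Sum>\<kappa>\<in>box n m. (\<Prod>k<m. y k ^ \<kappa> k) * qcomb n G d (of_mpol (elem_prod n m \<kappa>)))"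
    using z by simp
  also have "\<dots> = (\<Sum>\<gamma>\<in>G. \<Sum>\<kappa>\<in>box n m. d \<gamma> * ((\<Prod>k<m. y k ^ \<kappa> k) * qshifts n \<gamma> (of_mpol (elem_prod n m \<kappa>))))"
    unfolding qcomb_def sum_distrib_left by (subst sum.swap) (simp only: mult.left_commute)
  also have "\<dots> = (\<Sum>\<gamma>\<in>G. d \<gamma> * ((\<Prod>z\<in>?N. shifted_prod qF xvar n \<gamma> z) / (\<Prod>z\<in>?N. z) ^ n))"
    unfolding sum_distrib_left[symmetric] qcomb_kernel ev ..
  also have "\<dots> = (\<Sum>\<gamma>\<in>G. if \<gamma> = \<delta> then d \<delta> * ((\<Prod>z\<in>?N. shifted_prod qF xvar n \<delta> z) / (\<Prod>z\<in>?N. z) ^ n) else 0)"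
  proof (rule sum.cong[OF refl])
    fix \<gamma> assume gG: "\<gamma> \<in> G"
    show "d \<gamma> * ((\<Prod>z\<in>?N. shifted_prod qF xvar n \<gamma> z) / (\<Prod>z\<in>?N. z) ^ n) =
       (if \<gamma> = \<delta> then d \<delta> * ((\<Prod>z\<in>?N. shifted_prod qF xvar n \<delta> z) / (\<Prod>z\<in>?N. z) ^ n) else 0)"
    proof (cases "d \<gamma> = 0 \<or> \<gamma> = \<delta>")
      case False
      have "\<not> \<delta> \<le> \<gamma>"
      proof
        assume le: "\<delta> \<le> \<gamma>"
        have "msize n \<gamma> \<le> msize n \<delta>" using max[of \<gamma>] gG False by simp
        then have "msize n \<delta> = msize n \<gamma>" using msize_mono[OF le, of n] by simp
        then have "\<delta> = \<gamma>" using multi_le_msize_eq[OF _ _ le] dm G[OF gG] by blast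
        then show False using False by simp
      qed
      then have "(\<Prod>z\<in>?N. shifted_prod qF xvar n \<gamma> z) = 0"
        using shifted_prod_zero_at_nodes[OF generic_nodes_qF] dm G[OF gG] by blast
      then show ?thesis using False by simp
    qed (use d in auto)
  qed
  also have "\<dots> = d \<delta> * ((\<Prod>z\<in>?N. shifted_prod qF xvar n \<delta> z) / (\<Prod>z\<in>?N. z) ^ n)"
    using d(1) by (simp add: sum.delta[OF fin])
  finally have "(\<Prod>z\<in>?N. shifted_prod qF xvar n \<delta> z) = 0 \<or> (\<Prod>z\<in>?N. z) = 0" using d(2) by auto
  moreover have "(\<Prod>z\<in>?N. z) \<noteq> 0" using N0 by auto
  ultimately show False using shifted_prod_nonzero[OF generic_nodes_qF order.refl, of n \<delta>] by simp
qed

abbreviation "shifts_upto n m \<equiv> {\<gamma>. \<gamma> \<in> multi n \<and> msize n \<gamma> \<le> m}"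

lemma qdiff_op_iff: "qdiff_op n m B \<longleftrightarrow> (\<exists>b. (\<forall>\<gamma>. b \<gamma> \<in> ratV {..<n}) \<and> B = qcomb n (shifts_upto n m) b)"
  unfolding qdiff_op_def ratfuns_eq_ratV qcomb_def by (simp add: fun_eq_iff)

lemma qcomb_diff: "qcomb n G (\<lambda>\<gamma>. b \<gamma> - c \<gamma>) f = qcomb n G b f - qcomb n G c f"
  by (simp add: qcomb_def left_diff_distrib sum_subtractf)

lemma qcomb_scal: "qcomb n G b (of_mpol (scal c p)) = of_K c * qcomb n G b (of_mpol p)"
  unfolding of_mpol_scal by (rule qcomb_cmult)

text \<open>The conditions on the two operators force their difference to vanish on all Macdonald polynomials in the
rectangle, hence on the products of elementary symmetric polynomials that generate the kernel.\<close>

lemma raising_op_unique: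
  assumes B: "is_raising_op n m B" and B': "is_raising_op n m B'"
  shows "B = B'"
proof -
  let ?G = "shifts_upto n m"
  obtain b c where b: "B = qcomb n ?G b" and c: "B' = qcomb n ?G c"
    using B B' by (auto simp: is_raising_op_def qdiff_op_iff)
  define d where "d = (\<lambda>\<gamma>. b \<gamma> - c \<gamma>)"
  have D: "qcomb n ?G d f = B f - B' f" for f unfolding b c d_def by (rule qcomb_diff)
  have P0: "qcomb n ?G d (of_mpol (monicP n m \<rho>)) = 0" if r: "\<rho> \<in> parts n m" for \<rho>
  proof -
    let ?\<nu> = "lookup \<rho>"
    note p = parts_is_partition[OF r]
    have "B (macdonald_J n ?\<nu>) = B' (macdonald_J n ?\<nu>)"
      using B B' p by (simp add: is_raising_op_def)
    then have "qcomb n ?G d (of_K (c_normK ?\<nu>) * of_mpol (monicP n m \<rho>)) = 0"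
      unfolding D macdonald_J_def macdonald_P_eq[OF r] c_norm_eq by simp
    then show ?thesis unfolding qcomb_cmult using c_normK_nonzero[OF p(1)] by simp
  qed
  have "qcomb n ?G d (of_mpol (elem_prod n m \<kappa>)) = 0" if k: "\<kappa> \<in> box n m" for \<kappa>
  proof -
    have e: "elem_prod n m \<kappa> = (\<Sum>\<mu>\<in>parts n m. scal (elem_coeff n m \<kappa> \<mu>) (monicP n m \<mu>))" using elem_coeff[OF k] by blast
    show ?thesis unfolding e of_mpol_sum qcomb_sum qcomb_scal using P0 by simp
  qed
  from qcomb_zero[OF finite_multi_msize_le _ this] have "d \<gamma> = 0" if "\<gamma> \<in> ?G" for \<gamma>
    using that by simp
  then have "qcomb n ?G d f = 0" for f unfolding qcomb_def by simp
  then show ?thesis using D by (auto simp: fun_eq_iff)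
qed

lemma ratV_powi: "f \<in> ratV A \<Longrightarrow> f powi k \<in> ratV A"
  unfolding power_int_def by (auto intro: ratV_power ratV_inverse)

lemma ratV_qpoch: "f \<in> ratV A \<Longrightarrow> qpoch f k \<in> ratV A"
  unfolding qpoch_def qF_def by (intro ratV_prod ratV_diff ratV_1 ratV_mult ratV_power ratV_of_K)

lemma ratV_C_coef: "C_coef n \<alpha> \<beta> \<in> ratV {..<n}"
  unfolding C_coef_def qF_def
  by (intro ratV_prod ratV_divide ratV_qpoch ratV_mult ratV_powi ratV_of_K ratV_xvar)

lemma ratV_neg1: "(- 1) \<in> ratV A" by (intro ratV_uminus ratV_1)

lemma ratV_b_tilde: "b_tilde n \<alpha> \<in> ratV {..<n}"
  unfolding b_tilde_def qF_def tF_def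
  by (intro ratV_mult ratV_sum ratV_power ratV_neg1 ratV_of_K ratV_prod ratV_divide ratV_qpoch ratV_powi ratV_C_coef ratV_xvar)

text \<open>Collect the terms with the same shift.\<close>

lemma explicit_op_qcomb:
  "\<exists>b. (\<forall>\<gamma>. b \<gamma> \<in> ratV {..<n}) \<and> explicit_op n m = qcomb n (shifts_upto n m) b"
proof -
  let ?A = "{\<alpha>. \<alpha> \<in> multi n \<and> msize n \<alpha> = m}" and ?G = "shifts_upto n m"
  define w where "w \<alpha> \<beta> = b_tilde n \<alpha> * ((-1) ^ (msize n \<alpha> - msize n \<beta>) *
        qF ^ ((msize n \<alpha> - msize n \<beta> + 1) choose 2) * C_coef n \<alpha> \<beta>)" for \<alpha> \<beta>
  define b where "b \<gamma> = (\<Sum>\<alpha>\<in>?A. if \<gamma> \<le> \<alpha> then w \<alpha> \<gamma> else 0)" for \<gamma>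
  have wV: "w \<alpha> \<beta> \<in> ratV {..<n}" for \<alpha> \<beta>
    unfolding w_def qF_def by (intro ratV_mult ratV_b_tilde ratV_power ratV_neg1 ratV_of_K ratV_C_coef)
  have "b \<gamma> \<in> ratV {..<n}" for \<gamma>
    unfolding b_def by (rule ratV_sum) (auto intro: wV)
  moreover have "explicit_op n m f = qcomb n ?G b f" for f
  proof -
    have "explicit_op n m f = (\<Sum>\<alpha>\<in>?A. \<Sum>\<gamma>\<in>?G. if \<gamma> \<le> \<alpha> then w \<alpha> \<gamma> * qshifts n \<gamma> f else 0)"
      unfolding explicit_op_def
    proof (rule sum.cong[OF refl])
      fix \<alpha> assume a: "\<alpha> \<in> ?A"
      have "b_tilde n \<alpha> * phi n \<alpha> f = (\<Sum>\<beta> | \<beta> \<in> multi n \<and> \<beta> \<le> \<alpha>. w \<alpha> \<beta> * qshifts n \<beta> f)"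
        unfolding phi_def w_def sum_distrib_left by (simp only: mult.assoc)
      also have "\<dots> = (\<Sum>\<gamma>\<in>?G. if \<gamma> \<le> \<alpha> then w \<alpha> \<gamma> * qshifts n \<gamma> f else 0)"
        by (rule sum.mono_neutral_cong_left[OF finite_multi_msize_le]) (use a msize_mono in auto)
      finally show "b_tilde n \<alpha> * phi n \<alpha> f = (\<Sum>\<gamma>\<in>?G. if \<gamma> \<le> \<alpha> then w \<alpha> \<gamma> * qshifts n \<gamma> f else 0)" .
    qed
    also have "\<dots> = (\<Sum>\<gamma>\<in>?G. \<Sum>\<alpha>\<in>?A. if \<gamma> \<le> \<alpha> then w \<alpha> \<gamma> * qshifts n \<gamma> f else 0)" by (rule sum.swap)
    also have "\<dots> = qcomb n ?G b f"
      unfolding qcomb_def b_def sum_distrib_right by (rule sum.cong[OF refl], rule sum.cong[OF refl]) simp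
    finally show ?thesis .
  qed
  ultimately show ?thesis by (intro exI[of _ b]) (auto simp: fun_eq_iff)
qed

lemma explicit_op_is_raising:
  assumes n: "n \<ge> 1"
  shows "is_raising_op n m (explicit_op n m)"
proof -
  obtain b where b: "\<And>\<gamma>. b \<gamma> \<in> ratV {..<n}" "explicit_op n m = qcomb n (shifts_upto n m) b"
    using explicit_op_qcomb by blast
  have "explicit_op n m (macdonald_J n \<nu>) = (if len \<nu> < n then macdonald_J n (case_nat m \<nu>) else 0)"
    if nu: "is_partition \<nu>" "len \<nu> \<le> n" "\<nu> 0 \<le> m" for \<nu>
  proof -
    define \<rho> where "\<rho> = Abs_poly_mapping \<nu>"
    have l: "lookup \<rho> = \<nu>" and r: "\<rho> \<in> parts n m"
      unfolding \<rho>_def by (rule partition_in_parts[OF nu])+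
    have sh: "\<rho> \<in> short_parts n m \<longleftrightarrow> len \<nu> < n" unfolding \<rho>_def by (rule short_iff[OF nu n])
    have J: "macdonald_J n \<nu> = of_K (c_normK \<nu>) * of_mpol (monicP n m \<rho>)"
      unfolding macdonald_J_def c_norm_eq using macdonald_P_eq[OF r] l by simp
    have "explicit_op n m (of_mpol (monicP n m \<rho>)) =
      (if \<rho> \<in> short_parts n m then of_K (raise_norm n m (part_cons m \<rho>)) * of_mpol (monicP n m (part_cons m \<rho>)) else 0)"
      unfolding b(2) by (rule raising_from_kernel[OF n b(1) _ r]) (use explicit_op_kernel[OF n, of m] b(2) in simp)
    then have e: "explicit_op n m (macdonald_J n \<nu>) = of_K (c_normK \<nu>) *
      (if \<rho> \<in> short_parts n m then of_K (raise_norm n m (part_cons m \<rho>)) * of_mpol (monicP n m (part_cons m \<rho>)) else 0)"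
      unfolding J b(2) qcomb_cmult by simp
    show ?thesis
    proof (cases "\<rho> \<in> short_parts n m")
      case True
      have "macdonald_J n (case_nat m \<nu>) = of_K (c_normK \<nu>) * (of_K (raise_norm n m (part_cons m \<rho>)) * of_mpol (monicP n m (part_cons m \<rho>)))"
        using macdonald_P_eq[OF part_cons_in_parts[OF n True]] raise_norm_part_cons[OF n True]
        unfolding macdonald_J_def c_norm_eq lookup_part_cons l by (simp add: of_K_mult)
      then show ?thesis using e True sh by simp
    next
      case False
      then show ?thesis using e sh by simp
    qed
  qed
  moreover have "qdiff_op n m (explicit_op n m)" unfolding qdiff_op_iff using explicit_op_qcomb by blast
  ultimately show ?thesis unfolding is_raising_op_def by blast
qed

theorem theorem1p2:
  fixes n m :: nat
  assumes "n \<ge> 1"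
  shows "(\<exists>!B. is_raising_op n m B) \<and>
    raising_op n m =
      (\<lambda>f. \<Sum>\<alpha> | \<alpha> \<in> multi n \<and> msize n \<alpha> = m. b_tilde n \<alpha> * phi n \<alpha> f)"
proof -
  note raising = explicit_op_is_raising[OF assms, of m]
  have ex: "\<exists>!B. is_raising_op n m B"
    by (rule ex1I[of "is_raising_op n m", OF raising]) (rule raising_op_unique[OF _ raising])
  have "raising_op n m = explicit_op n m"
    unfolding raising_op_def by (rule the_equality[of "is_raising_op n m", OF raising]) (rule raising_op_unique[OF _ raising])
  then show ?thesis using ex by (simp add: fun_eq_iff explicit_op_def)
qed

end
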